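(* Let $X$ be an irreducible non-singular projective curve over an algebraically closed field $F$, and let $G$ be a finite group acting faithfully on $X$ by $F$-automorphisms. Let $\phi:\mathrm{Div}_0(X)^G\to\mathrm{Pic}_0(X)^G$ be the map sending a divisor to its class. Then there is an isomorphism $$\mathrm{Pic}_0(X)^G/\phi(\mathrm{Div}_0(X)^G)\;\cong\;\ker\{H^1(G,\mathrm{Prin}(X))\to H^1(G,\mathrm{Div}_0(X))\},$$ where the map on the right is induced by the inclusion $\mathrm{Prin}(X)\subset\mathrm{Div}_0(X)$. In particular, if $H^2(G,F^\times)$ is trivial, then every $G$-invariant divisor class $[D]$ of degree $0$ contains a $G$-invariant degree $0$ divisor $D'\in[D]$.
   Context: $\mathrm{Div}_0(X)$ is the group of divisors of degree $0$ on $X$, $\mathrm{Prin}(X)$ the subgroup of principal divisors, $\mathrm{Pic}_0(X)=\mathrm{Div}_0(X)/\mathrm{Prin}(X)$; all are $G$-modules. $G$ acts trivially on $F^\times$. $M^G$ denotes $G$-invariants and $H^i(G,M)$ group cohomology. *)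

theory Defs
  imports
    "HOL-Analysis.Analysis"
    "HOL-Computational_Algebra.Polynomial"
    "HOL-Algebra.Algebra"
    "HOL-Algebra.Free_Abelian_Groups"
    "HOL-Algebra.Elementary_Groups"
begin

section \<open>Projective space and its Zariski topology\<close>

text \<open>
  A point of projective space is the punctured line of its homogeneous coordinate vectors, which
  are indexed by a finite type \<open>'n\<close>; so the dimension of the ambient space is
  \<open>CARD('n) - 1\<close>.
\<close>

type_synonym ('k, 'n) pt = "('k^'n) set"

type_synonym ('k, 'n) mpoly = "('n \<Rightarrow>\<^sub>0 nat) \<Rightarrow>\<^sub>0 'k"

definition projective_space :: "('k::field, 'n::finite) pt set" where
  "projective_space = {{c *s v | c. c \<noteq> 0} | v. v \<noteq> 0}"

definition mono_eval :: "('n::finite \<Rightarrow>\<^sub>0 nat) \<Rightarrow> 'k::field^'n \<Rightarrow> 'k" where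
  "mono_eval m v = (\<Prod>i\<in>UNIV. (v $ i) ^ Poly_Mapping.lookup m i)"

definition poly_eval :: "('k::field, 'n::finite) mpoly \<Rightarrow> 'k^'n \<Rightarrow> 'k" where
  "poly_eval p v = (\<Sum>m\<in>Poly_Mapping.keys p. Poly_Mapping.lookup p m * mono_eval m v)"

definition homogeneous :: "nat \<Rightarrow> ('k::field, 'n::finite) mpoly \<Rightarrow> bool" where
  "homogeneous d p \<longleftrightarrow>
     (\<forall>m\<in>Poly_Mapping.keys p. (\<Sum>i\<in>UNIV. Poly_Mapping.lookup m i) = d)"

definition zero_locus :: "('k::field, 'n::finite) mpoly set \<Rightarrow> ('k, 'n) pt set" where
  "zero_locus T = {P \<in> projective_space. \<forall>p\<in>T. \<forall>v\<in>P. poly_eval p v = 0}"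

definition zariski_open :: "('k::field, 'n::finite) pt set \<Rightarrow> bool" where
  "zariski_open U \<longleftrightarrow>
     (\<exists>T. (\<forall>p\<in>T. \<exists>d. homogeneous d p) \<and> U = projective_space - zero_locus T)"

definition zariski :: "('k::field, 'n::finite) pt topology" where
  "zariski = topology zariski_open"

lemma poly_eval_superset:
  assumes "finite A" "Poly_Mapping.keys p \<subseteq> A"
  shows "poly_eval p v = (\<Sum>m\<in>A. Poly_Mapping.lookup p m * mono_eval m v)"
  unfolding poly_eval_def
  by (rule sum.mono_neutral_left) (use assms in \<open>auto simp: in_keys_iff\<close>)

lemma poly_eval_zero [simp]: "poly_eval 0 v = 0"
  by (simp add: poly_eval_def)

lemma poly_eval_add: "poly_eval (p + q) v = poly_eval p v + poly_eval q v"
proof -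
  let ?A = "Poly_Mapping.keys p \<union> Poly_Mapping.keys q"
  have "finite ?A" "Poly_Mapping.keys (p + q) \<subseteq> ?A"
    using Poly_Mapping.keys_add[of p q] by auto
  then show ?thesis
    by (simp add: poly_eval_superset[of ?A] lookup_add algebra_simps sum.distrib)
qed

lemma poly_eval_sum:
  "poly_eval (\<Sum>a\<in>A. f a) v = (\<Sum>a\<in>A. poly_eval (f a) v)"
  by (induction A rule: infinite_finite_induct) (auto simp: poly_eval_add)

lemma poly_eval_single: "poly_eval (Poly_Mapping.single m c) v = c * mono_eval m v"
  by (subst poly_eval_superset[of "{m}"]) auto

lemma mono_eval_add: "mono_eval (m + m') v = mono_eval m v * mono_eval m' v"
  by (simp add: mono_eval_def lookup_add power_add prod.distrib)

lemma poly_eval_mult: "poly_eval (p * q) v = poly_eval p v * poly_eval q v"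
proof -
  have decomp: "r = (\<Sum>m\<in>Poly_Mapping.keys r. Poly_Mapping.single m (Poly_Mapping.lookup r m))"
    for r :: "('a, 'b) mpoly"
    by (rule poly_mapping_eqI) (auto simp: lookup_sum lookup_single when_def in_keys_iff)
  have "p * q = (\<Sum>m\<in>Poly_Mapping.keys p. \<Sum>m'\<in>Poly_Mapping.keys q.
      Poly_Mapping.single (m + m') (Poly_Mapping.lookup p m * Poly_Mapping.lookup q m'))"
    by (subst decomp[of p], subst decomp[of q]) (simp add: sum_product mult_single)
  then show ?thesis
    by (simp add: poly_eval_sum poly_eval_single mono_eval_add poly_eval_def[of p]
        poly_eval_def[of q] sum_product mult_ac)
qed

lemma homogeneous_mult:
  assumes "homogeneous d p" "homogeneous e q"
  shows "homogeneous (d + e) (p * q)"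
  unfolding homogeneous_def
proof
  fix m assume "m \<in> Poly_Mapping.keys (p * q)"
  then obtain a b where "m = a + b" "a \<in> Poly_Mapping.keys p" "b \<in> Poly_Mapping.keys q"
    using keys_mult[of p q] by auto
  then show "(\<Sum>i\<in>UNIV. Poly_Mapping.lookup m i) = d + e"
    using assms by (auto simp: homogeneous_def lookup_add sum.distrib)
qed

lemma poly_eval_scale:
  assumes "homogeneous d p"
  shows "poly_eval p (c *s v) = c ^ d * poly_eval p v"
proof -
  have "mono_eval m (c *s v) = c ^ d * mono_eval m v" if "m \<in> Poly_Mapping.keys p" for m
    using assms that
    by (auto simp: mono_eval_def homogeneous_def power_mult_distrib prod.distrib power_sum)
  then show ?thesis
    by (simp add: poly_eval_def sum_distrib_left mult_ac)
qed

lemma istopology_zariski_open: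
  "istopology (zariski_open :: ('k::field, 'n::finite) pt set \<Rightarrow> bool)"
  unfolding istopology_def
proof (intro conjI allI impI)
  fix U V :: "('k, 'n) pt set"
  assume "zariski_open U" "zariski_open V"
  then obtain S T where S: "\<forall>p\<in>S. \<exists>d. homogeneous d p" "U = projective_space - zero_locus S"
    and T: "\<forall>p\<in>T. \<exists>d. homogeneous d p" "V = projective_space - zero_locus T"
    by (auto simp: zariski_open_def)
  define R where "R = (\<lambda>(p, q). p * q) ` (S \<times> T)"
  have "\<forall>p\<in>R. \<exists>d. homogeneous d p"
    using S(1) T(1) by (force simp: R_def dest: homogeneous_mult)
  moreover have "U \<inter> V = projective_space - zero_locus R"
  proof
    show "projective_space - zero_locus R \<subseteq> U \<inter> V"
      using S T by (auto simp: R_def zero_locus_def poly_eval_mult)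
    show "U \<inter> V \<subseteq> projective_space - zero_locus R"
    proof
      fix P assume "P \<in> U \<inter> V"
      then obtain p q v w where P: "P \<in> projective_space"
        and p: "p \<in> S" "v \<in> P" "poly_eval p v \<noteq> 0" and q: "q \<in> T" "w \<in> P" "poly_eval q w \<noteq> 0"
        using S T by (auto simp: zero_locus_def)
      from P obtain u where u: "P = {c *s u | c. c \<noteq> 0}"
        by (auto simp: projective_space_def)
      from u p q S(1) T(1) have "poly_eval p u \<noteq> 0" "poly_eval q u \<noteq> 0"
        by (auto simp: poly_eval_scale)
      moreover have "u \<in> P"
        unfolding u by (rule CollectI, rule exI[of _ 1]) simp
      moreover have "p * q \<in> R"
        using p q by (auto simp: R_def)
      ultimately have "P \<notin> zero_locus R"
        by (force simp: zero_locus_def poly_eval_mult)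
      with P show "P \<in> projective_space - zero_locus R" by simp
    qed
  qed
  ultimately show "zariski_open (U \<inter> V)"
    by (auto simp: zariski_open_def)
next
  fix \<U> :: "('k, 'n) pt set set"
  assume "\<forall>U\<in>\<U>. zariski_open U"
  then obtain T where T: "\<And>U. U \<in> \<U> \<Longrightarrow>
      (\<forall>p\<in>T U. \<exists>d. homogeneous d p) \<and> U = projective_space - zero_locus (T U)"
    unfolding zariski_open_def by metis
  have "\<Union>\<U> = (\<Union>U\<in>\<U>. projective_space - zero_locus (T U))"
    using T by auto
  also have "\<dots> = projective_space - zero_locus (\<Union>U\<in>\<U>. T U)"
    by (auto simp: zero_locus_def)
  finally show "zariski_open (\<Union>\<U>)"
    using T by (auto simp: zariski_open_def intro!: exI[of _ "\<Union>U\<in>\<U>. T U"])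
qed

lemma openin_zariski [simp]: "openin zariski U \<longleftrightarrow> zariski_open U"
  by (simp add: zariski_def topology_inverse'[OF istopology_zariski_open])

lemma topspace_zariski [simp]: "topspace zariski = projective_space"
proof -
  have "zero_locus {1} = ({} :: ('a::field, 'b::finite) pt set)"
    by (auto simp: zero_locus_def projective_space_def poly_eval_def mono_eval_def)
      (use one_neq_zero in blast)
  moreover have "\<exists>d. homogeneous d (1 :: ('a, 'b) mpoly)"
    by (auto simp: homogeneous_def)
  ultimately have "zariski_open (projective_space :: ('a, 'b) pt set)"
    by (auto simp: zariski_open_def intro!: exI[of _ "{1}"])
  then have "projective_space \<subseteq> topspace (zariski :: ('a, 'b) pt topology)"
    by (simp add: openin_subset)
  moreover have "topspace (zariski :: ('a, 'b) pt topology) \<subseteq> projective_space"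
    using openin_topspace[of "zariski :: ('a, 'b) pt topology", unfolded openin_zariski]
    unfolding zariski_open_def by blast
  ultimately show ?thesis by blast
qed

section \<open>Projective varieties, regular functions and morphisms\<close>

definition irreducible_space :: "'a topology \<Rightarrow> bool" where
  "irreducible_space S \<longleftrightarrow> topspace S \<noteq> {} \<and>
     (\<forall>A B. closedin S A \<and> closedin S B \<and> A \<union> B = topspace S \<longrightarrow>
        A = topspace S \<or> B = topspace S)"

definition projective_variety :: "('k::field, 'n::finite) pt set \<Rightarrow> bool" where
  "projective_variety C \<longleftrightarrow> closedin zariski C \<and> irreducible_space (subtopology zariski C)"

text \<open>
  Functions are only relevant on \<open>U\<close>, a Zariski open subset of a variety.
\<close>

definition regular_on :: "('k::field, 'n::finite) pt set \<Rightarrow> (('k, 'n) pt \<Rightarrow> 'k) \<Rightarrow> bool" where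
  "regular_on U f \<longleftrightarrow>
     (\<forall>P\<in>U. \<exists>V d p q. openin (subtopology zariski U) V \<and> P \<in> V \<and>
        homogeneous d p \<and> homogeneous d q \<and>
        (\<forall>Q\<in>V. \<forall>v\<in>Q. poly_eval q v \<noteq> 0 \<and> f Q = poly_eval p v / poly_eval q v))"

definition variety_morphism ::
  "('k::field, 'm::finite) pt set \<Rightarrow> ('k, 'n::finite) pt set \<Rightarrow>
     (('k, 'm) pt \<Rightarrow> ('k, 'n) pt) \<Rightarrow> bool" where
  "variety_morphism C Y s \<longleftrightarrow>
     continuous_map (subtopology zariski C) (subtopology zariski Y) s \<and>
     (\<forall>V f. openin (subtopology zariski Y) V \<and> regular_on V f \<longrightarrow>
        regular_on {P \<in> C. s P \<in> V} (f \<circ> s))"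

definition variety_automorphism ::
  "('k::field, 'n::finite) pt set \<Rightarrow> (('k, 'n) pt \<Rightarrow> ('k, 'n) pt) \<Rightarrow> bool" where
  "variety_automorphism C s \<longleftrightarrow>
     bij_betw s C C \<and> variety_morphism C C s \<and> variety_morphism C C (inv_into C s)"

section \<open>Function field, local rings and non-singular curves\<close>

type_synonym ('k, 'n) germ = "(('k, 'n) pt set \<times> (('k, 'n) pt \<Rightarrow> 'k)) set"

definition rational_pairs :: "('k::field, 'n::finite) pt set \<Rightarrow> ('k, 'n) germ" where
  "rational_pairs C =
     {(U, f). openin (subtopology zariski C) U \<and> U \<noteq> {} \<and> regular_on U f}"

definition rational_class ::
  "('k::field, 'n::finite) pt set \<Rightarrow> ('k, 'n) pt set \<Rightarrow> (('k, 'n) pt \<Rightarrow> 'k) \<Rightarrow> ('k, 'n) germ" where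
  "rational_class C U f = {(V, g) \<in> rational_pairs C. \<forall>P\<in>U \<inter> V. f P = g P}"

text \<open>
  On a variety, two regular functions that agree on a non-empty open set agree wherever both are
  defined, so the unions below are over representatives of one and the same class.
\<close>

definition function_field :: "('k::field, 'n::finite) pt set \<Rightarrow> ('k, 'n) germ ring" where
  "function_field C =
     \<lparr>carrier = {rational_class C U f | U f. (U, f) \<in> rational_pairs C},
      monoid.mult = (\<lambda>a b. \<Union>(U, f)\<in>a. \<Union>(V, g)\<in>b. rational_class C (U \<inter> V) (\<lambda>P. f P * g P)),
      monoid.one = rational_class C C (\<lambda>_. 1),
      ring.zero = rational_class C C (\<lambda>_. 0),
      ring.add = (\<lambda>a b. \<Union>(U, f)\<in>a. \<Union>(V, g)\<in>b. rational_class C (U \<inter> V) (\<lambda>P. f P + g P))\<rparr>"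

definition constant_functions :: "('k::field, 'n::finite) pt set \<Rightarrow> ('k, 'n) germ set" where
  "constant_functions C = range (\<lambda>c. rational_class C C (\<lambda>_. c))"

text \<open>
  The dimension of a variety is the transcendence degree of its function field over the
  constants. For a curve it is one: a single element forms a transcendence basis.
\<close>

definition projective_curve :: "('k::field, 'n::finite) pt set \<Rightarrow> bool" where
  "projective_curve C \<longleftrightarrow> projective_variety C \<and>
     (\<exists>t\<in>carrier (function_field C).
        ring.transcendental (function_field C) (constant_functions C) t \<and>
        (\<forall>y\<in>carrier (function_field C).
           \<not> ring.transcendental (function_field C)
               (generate_field (function_field C) (insert t (constant_functions C))) y))"

definition local_ring ::
  "('k::field, 'n::finite) pt set \<Rightarrow> ('k, 'n) pt \<Rightarrow> ('k, 'n) germ ring" where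
  "local_ring C P = (function_field C)
     \<lparr>carrier := {a \<in> carrier (function_field C). \<exists>(U, f)\<in>a. P \<in> U}\<rparr>"

definition local_maximal_ideal ::
  "('k::field, 'n::finite) pt set \<Rightarrow> ('k, 'n) pt \<Rightarrow> ('k, 'n) germ set" where
  "local_maximal_ideal C P = {a \<in> carrier (function_field C). \<exists>(U, f)\<in>a. P \<in> U \<and> f P = 0}"

definition uniformizer ::
  "('k::field, 'n::finite) pt set \<Rightarrow> ('k, 'n) pt \<Rightarrow> ('k, 'n) germ \<Rightarrow> bool" where
  "uniformizer C P t \<longleftrightarrow> t \<in> carrier (local_ring C P) \<and>
     local_maximal_ideal C P = PIdl\<^bsub>local_ring C P\<^esub> t"

text \<open>
  A point is non-singular when its local ring is regular, that is, when the maximal ideal can be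
  generated by as many elements as the dimension, which is one for a curve.
\<close>

definition nonsingular_projective_curve :: "('k::field, 'n::finite) pt set \<Rightarrow> bool" where
  "nonsingular_projective_curve C \<longleftrightarrow>
     projective_curve C \<and> (\<forall>P\<in>C. \<exists>t. uniformizer C P t)"

definition vanishing_order ::
  "('k::field, 'n::finite) pt set \<Rightarrow> ('k, 'n) pt \<Rightarrow> ('k, 'n) germ \<Rightarrow> int" where
  "vanishing_order C P a = (THE n. \<exists>t u. uniformizer C P t \<and> u \<in> Units (local_ring C P) \<and>
     a = u \<otimes>\<^bsub>function_field C\<^esub> (t [^]\<^bsub>function_field C\<^esub> n))"

section \<open>Divisors\<close>

text \<open>
  The group of all divisors is \<open>free_Abelian_group C\<close>. As this is a HOL-Algebra group, the groups
  below are multiplicative records even though their operation is the addition of divisors.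
\<close>

definition divisor_degree :: "(('k, 'n) pt \<Rightarrow>\<^sub>0 int) \<Rightarrow> int" where
  "divisor_degree D = (\<Sum>P\<in>Poly_Mapping.keys D. Poly_Mapping.lookup D P)"

definition Div0 :: "('k::field, 'n::finite) pt set \<Rightarrow> (('k, 'n) pt \<Rightarrow>\<^sub>0 int) monoid" where
  "Div0 C = (free_Abelian_group C)
     \<lparr>carrier := {D \<in> carrier (free_Abelian_group C). divisor_degree D = 0}\<rparr>"

definition Prin :: "('k::field, 'n::finite) pt set \<Rightarrow> (('k, 'n) pt \<Rightarrow>\<^sub>0 int) monoid" where
  "Prin C = (free_Abelian_group C)
     \<lparr>carrier := {D \<in> carrier (free_Abelian_group C).
        \<exists>a\<in>carrier (function_field C) - {\<zero>\<^bsub>function_field C\<^esub>}.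
          \<forall>P\<in>C. Poly_Mapping.lookup D P = vanishing_order C P a}\<rparr>"

definition Pic0 :: "('k::field, 'n::finite) pt set \<Rightarrow> (('k, 'n) pt \<Rightarrow>\<^sub>0 int) set monoid" where
  "Pic0 C = Div0 C Mod carrier (Prin C)"

definition divisor_class ::
  "('k::field, 'n::finite) pt set \<Rightarrow> (('k, 'n) pt \<Rightarrow>\<^sub>0 int) \<Rightarrow> (('k, 'n) pt \<Rightarrow>\<^sub>0 int) set" where
  "divisor_class C D = carrier (Prin C) #>\<^bsub>Div0 C\<^esub> D"

definition divisor_action ::
  "('g \<Rightarrow> ('k, 'n) pt \<Rightarrow> ('k, 'n) pt) \<Rightarrow> 'g \<Rightarrow> (('k, 'n) pt \<Rightarrow>\<^sub>0 int) \<Rightarrow> (('k, 'n) pt \<Rightarrow>\<^sub>0 int)"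
  where "divisor_action \<phi> g D = frag_extend (\<lambda>P. frag_of (\<phi> g P)) D"

definition class_action ::
  "('g \<Rightarrow> ('k, 'n) pt \<Rightarrow> ('k, 'n) pt) \<Rightarrow> 'g \<Rightarrow> (('k, 'n) pt \<Rightarrow>\<^sub>0 int) set \<Rightarrow>
     (('k, 'n) pt \<Rightarrow>\<^sub>0 int) set"
  where "class_action \<phi> g c = divisor_action \<phi> g ` c"

section \<open>Group cohomology\<close>

text \<open>
  A \<open>G\<close>-module is given by an abelian group \<open>M\<close>, written multiplicatively, and an action
  \<open>\<alpha>\<close>. Cohomology is that of the complex of inhomogeneous cochains; an \<open>n\<close>-cochain is a function
  on the lists of length \<open>n\<close> over \<open>G\<close>.
\<close>

definition invariants ::
  "('g, 'a) monoid_scheme \<Rightarrow> 'm monoid \<Rightarrow> ('g \<Rightarrow> 'm \<Rightarrow> 'm) \<Rightarrow> 'm monoid" where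
  "invariants G M \<alpha> = M\<lparr>carrier := {m \<in> carrier M. \<forall>g\<in>carrier G. \<alpha> g m = m}\<rparr>"

definition tuples :: "('g, 'a) monoid_scheme \<Rightarrow> nat \<Rightarrow> 'g list set" where
  "tuples G n = {xs. length xs = n \<and> set xs \<subseteq> carrier G}"

definition cochains ::
  "('g, 'a) monoid_scheme \<Rightarrow> 'm monoid \<Rightarrow> nat \<Rightarrow> ('g list \<Rightarrow> 'm) monoid" where
  "cochains G M n =
     \<lparr>carrier = tuples G n \<rightarrow>\<^sub>E carrier M,
      monoid.mult = (\<lambda>f f'. \<lambda>xs\<in>tuples G n. f xs \<otimes>\<^bsub>M\<^esub> f' xs),
      one = (\<lambda>xs\<in>tuples G n. \<one>\<^bsub>M\<^esub>)\<rparr>"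

text \<open>For \<open>xs = [g\<^sub>1, \<dots>, g\<^sub>k]\<close> and \<open>1 \<le> i < k\<close> this is \<open>[g\<^sub>1, \<dots>, g\<^sub>i g\<^sub>i\<^sub>+\<^sub>1, \<dots>, g\<^sub>k]\<close>.\<close>

definition merge_at :: "('g, 'a) monoid_scheme \<Rightarrow> nat \<Rightarrow> 'g list \<Rightarrow> 'g list" where
  "merge_at G i xs = take (i - 1) xs @ (xs ! (i - 1) \<otimes>\<^bsub>G\<^esub> xs ! i) # drop (i + 1) xs"

definition coboundary_map ::
  "('g, 'a) monoid_scheme \<Rightarrow> 'm monoid \<Rightarrow> ('g \<Rightarrow> 'm \<Rightarrow> 'm) \<Rightarrow> nat \<Rightarrow>
     ('g list \<Rightarrow> 'm) \<Rightarrow> 'g list \<Rightarrow> 'm" where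
  "coboundary_map G M \<alpha> n f = (\<lambda>xs\<in>tuples G (Suc n).
     \<alpha> (hd xs) (f (tl xs)) \<otimes>\<^bsub>M\<^esub>
     (\<Otimes>\<^bsub>M\<^esub>i\<in>{1..n}. f (merge_at G i xs) [^]\<^bsub>M\<^esub> ((- 1) ^ i :: int)) \<otimes>\<^bsub>M\<^esub>
     f (butlast xs) [^]\<^bsub>M\<^esub> ((- 1) ^ (n + 1) :: int))"

definition cocycles ::
  "('g, 'a) monoid_scheme \<Rightarrow> 'm monoid \<Rightarrow> ('g \<Rightarrow> 'm \<Rightarrow> 'm) \<Rightarrow> nat \<Rightarrow> ('g list \<Rightarrow> 'm) monoid" where
  "cocycles G M \<alpha> n = (cochains G M n)
     \<lparr>carrier := kernel (cochains G M n) (cochains G M (Suc n)) (coboundary_map G M \<alpha> n)\<rparr>"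

definition coboundaries ::
  "('g, 'a) monoid_scheme \<Rightarrow> 'm monoid \<Rightarrow> ('g \<Rightarrow> 'm \<Rightarrow> 'm) \<Rightarrow> nat \<Rightarrow> ('g list \<Rightarrow> 'm) set" where
  "coboundaries G M \<alpha> n = (case n of
       0 \<Rightarrow> {\<one>\<^bsub>cochains G M 0\<^esub>}
     | Suc k \<Rightarrow> coboundary_map G M \<alpha> k ` carrier (cochains G M k))"

definition cohomology ::
  "('g, 'a) monoid_scheme \<Rightarrow> 'm monoid \<Rightarrow> ('g \<Rightarrow> 'm \<Rightarrow> 'm) \<Rightarrow> nat \<Rightarrow> ('g list \<Rightarrow> 'm) set monoid"
  where "cohomology G M \<alpha> n = cocycles G M \<alpha> n Mod coboundaries G M \<alpha> n"

text \<open>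
  The map induced in degree \<open>n\<close> by an equivariant homomorphism \<open>h\<close> into the module
  \<open>(N, \<beta>)\<close>: all cocycles in the class \<open>A\<close> yield the same coset on the right-hand side.
\<close>

definition cohomology_map ::
  "('g, 'a) monoid_scheme \<Rightarrow> 'b monoid \<Rightarrow> ('g \<Rightarrow> 'b \<Rightarrow> 'b) \<Rightarrow> nat \<Rightarrow> ('m \<Rightarrow> 'b) \<Rightarrow>
     ('g list \<Rightarrow> 'm) set \<Rightarrow> ('g list \<Rightarrow> 'b) set" where
  "cohomology_map G N \<beta> n h A =
     (\<Union>c\<in>A. coboundaries G N \<beta> n #>\<^bsub>cocycles G N \<beta> n\<^esub> (\<lambda>xs\<in>tuples G n. h (c xs)))"

definition multiplicative_group :: "'k::field monoid" where
  "multiplicative_group = \<lparr>carrier = UNIV - {0}, monoid.mult = (*), one = 1\<rparr>"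

end

(*
Consider the degree 0 divisors D such that gD - D is principal for all g. Sending D to its class
maps them onto the invariant classes, and sending D to the cocycle g |-> gD - D maps them onto
the kernel of H^1(G, Prin) -> H^1(G, Div_0). In both quotients D becomes trivial if and only if
D is the sum of a principal and an invariant divisor, so the quotients are isomorphic.

If gD - D = div(a_g), then a_g g(a_h) / a_gh has trivial divisor, hence is a 2-cocycle of constants.
When it is a coboundary, the a_g can be rescaled to a 1-cocycle, Hilbert 90 gives w with
a_g = w / g(w), and D + div(w) is invariant.

This needs that principal divisors have degree 0. The zeros of x, counted with multiplicity, give
deg(x)_0 functions u_j that are linearly independent over k(x). If B is the polar divisor of x and A
bounds the poles of the u_j, then the functions x^a u_j with a <= r lie in L(rB + A), so
(r + 1) deg(x)_0 <= r deg B + deg A + 1 for all r, whence deg(x)_0 <= deg B; then replace x by 1/x.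
That a function without poles is constant is shown by extending a place of k(1/x) to the function
field (Chevalley), which is centered at a point because the curve is projective.
*)
theory Submission
  imports Defs "HOL-Library.Function_Algebras"
begin

section \<open>Fields of functions and abstract curves\<close>

text \<open>The order of vanishing is defined by a description operator over factorizations by
  uniformizers, and a curve is only known to have transcendence degree one and principal maximal
  ideals. Unique factorization in the local rings and the finite degree of the function field over
  k(x) have to be extracted from this. The finite degree comes from the projective coordinates:
  forms of degree d, divided by the d-th power of a coordinate, span a space whose dimension grows
  at most linearly in d. It yields that a regular function and a uniformizer are algebraically
  dependent, which bounds orders, and that a nonzero function has finitely many zeros. The degree
  over k(x) is never formed as a dimension: only independence over the constants of all products x^a
  u_i is used, so linear algebra over k suffices. The isomorphism needs no connecting homomorphism,
  because both quotients are images of one group and the same kernel is found twice. Principal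
  divisors must have degree 0 for Prin to lie inside Div_0 at all. Hilbert 90 is proved with a trace
  of a function that is concentrated at one point of a free orbit.\<close>

definition lin_indep :: "'p filter \<Rightarrow> 'i set \<Rightarrow> ('i \<Rightarrow> 'p \<Rightarrow> 'k::field) \<Rightarrow> bool" where
  "lin_indep F I u \<longleftrightarrow>
     (\<forall>c. (\<forall>\<^sub>F x in F. (\<Sum>i\<in>I. c i * u i x) = 0) \<longrightarrow> (\<forall>i\<in>I. c i = 0))"

lemma lin_indepD:
  assumes "lin_indep F I u" "\<forall>\<^sub>F x in F. (\<Sum>i\<in>I. c i * u i x) = 0" "i \<in> I"
  shows "c i = 0"
  using assms unfolding lin_indep_def by blast

text \<open>A relation among the \<open>u i - a i * u k\<close> is a relation among the
  \<open>u i\<close> in which \<open>u k\<close> receives minus the sum of the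
  \<open>c j * a j\<close> as its coefficient. The scalars \<open>a\<close> are arbitrary.\<close>

lemma lin_indep_eliminate:
  assumes I: "finite I" "k \<in> I" and ind: "lin_indep F I u"
  shows "lin_indep F (I - {k}) (\<lambda>i x. u i x - a i * u k x)"
  unfolding lin_indep_def
proof (intro allI impI)
  fix c assume ev: "\<forall>\<^sub>F x in F. (\<Sum>i\<in>I - {k}. c i * (u i x - a i * u k x)) = 0"
  define c' where "c' = (\<lambda>i. if i = k then - (\<Sum>j\<in>I - {k}. c j * a j) else c i)"
  have "(\<Sum>i\<in>I. c' i * u i x) = (\<Sum>i\<in>I - {k}. c i * (u i x - a i * u k x))" for x
  proof -
    have "(\<Sum>i\<in>I. c' i * u i x) = c' k * u k x + (\<Sum>i\<in>I - {k}. c' i * u i x)"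
      using I by (simp add: sum.remove)
    also have "(\<Sum>i\<in>I - {k}. c' i * u i x) = (\<Sum>i\<in>I - {k}. c i * u i x)"
      by (rule sum.cong) (auto simp: c'_def)
    finally show ?thesis
      by (simp add: c'_def algebra_simps sum_subtractf sum_distrib_left)
  qed
  with ev have "\<forall>\<^sub>F x in F. (\<Sum>i\<in>I. c' i * u i x) = 0" by simp
  then have "c' i = 0" if "i \<in> I" for i
    using lin_indepD[OF ind] that by blast
  then show "\<forall>i\<in>I - {k}. c i = 0" by (metis DiffE c'_def singletonI)
qed

text \<open>The Steinitz inequality by Gaussian elimination on the spanning family: removing one
  \<open>b k\<close> costs at most one member of \<open>I\<close>.\<close>

lemma lin_indep_card_le_span:
  assumes "finite J" "finite I" "lin_indep F I u"
    and "\<And>i. i \<in> I \<Longrightarrow> \<forall>\<^sub>F x in F. u i x = (\<Sum>j\<in>J. a i j * b j x)"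
  shows "card I \<le> card J"
  using assms
proof (induction J arbitrary: I u a rule: finite_induct)
  case empty
  have "I = {}"
  proof (rule ccontr)
    assume "I \<noteq> {}"
    then obtain k where k: "k \<in> I" by auto
    have "\<forall>\<^sub>F x in F. (\<Sum>i\<in>I. of_bool (i = k) * u i x) = 0"
      using empty.prems(3)[OF k]
      by eventually_elim (use k empty.prems(1) in \<open>simp add: of_bool_def if_distrib[of "\<lambda>x. x * _"] sum.delta cong: if_cong\<close>)
    from lin_indepD[OF empty.prems(2) this k] show False by simp
  qed
  then show ?case by simp
next
  case (insert k J)
  show ?case
  proof (cases "\<forall>i\<in>I. a i k = 0")
    case True
    have "card I \<le> card J"
      by (rule insert.IH[OF insert.prems(1,2), of a])
        (use insert.prems(3) insert.hyps True in \<open>simp\<close>)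
    then show ?thesis using insert.hyps by simp
  next
    case False
    then obtain l where l: "l \<in> I" "a l k \<noteq> 0" by auto
    \<comment> \<open>The multiple of \<open>u l\<close> that cancels the
      \<open>b k\<close>-component of \<open>u i\<close>.\<close>
    define r where "r = (\<lambda>i. a i k / a l k)"
    have "card (I - {l}) \<le> card J"
    proof (rule insert.IH[of _ "\<lambda>i x. u i x - r i * u l x" "\<lambda>i j. a i j - r i * a l j"])
      show "lin_indep F (I - {l}) (\<lambda>i x. u i x - r i * u l x)"
        by (rule lin_indep_eliminate) (use insert.prems l in auto)
      fix i assume i: "i \<in> I - {l}"
      then have "i \<in> I" by simp
      from insert.prems(3)[OF this] insert.prems(3)[OF l(1)]
      show "\<forall>\<^sub>F x in F. u i x - r i * u l x = (\<Sum>j\<in>J. (a i j - r i * a l j) * b j x)"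
      proof eventually_elim
        case (elim x)
        have "a i k = r i * a l k" using l by (simp add: r_def)
        then show ?case
          unfolding elim using insert.hyps
          by (simp add: algebra_simps sum_subtractf sum_distrib_left)
      qed
    qed (use insert.prems in auto)
    then show ?thesis
      using insert.hyps insert.prems l by (simp add: card_Diff_singleton)
  qed
qed

lemma lin_indep_mult:
  assumes "lin_indep F I u" "\<forall>\<^sub>F x in F. g x \<noteq> 0"
  shows "lin_indep F I (\<lambda>i x. g x * u i x)"
  unfolding lin_indep_def
proof (intro allI impI)
  fix c assume "\<forall>\<^sub>F x in F. (\<Sum>i\<in>I. c i * (g x * u i x)) = 0"
  with assms(2) have "\<forall>\<^sub>F x in F. (\<Sum>i\<in>I. c i * u i x) = 0"
  proof eventually_elim
    case (elim x)
    have "g x * (\<Sum>i\<in>I. c i * u i x) = (\<Sum>i\<in>I. c i * (g x * u i x))"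
      by (simp add: sum_distrib_left mult_ac)
    with elim show ?case by simp
  qed
  then show "\<forall>i\<in>I. c i = 0"
    using lin_indepD[OF assms(1)] by blast
qed

lemma lin_indep_reindex:
  assumes "bij_betw h J I" "lin_indep F I u"
  shows "lin_indep F J (\<lambda>j. u (h j))"
  unfolding lin_indep_def
proof (intro allI impI)
  fix c assume "\<forall>\<^sub>F x in F. (\<Sum>j\<in>J. c j * u (h j) x) = 0"
  moreover have "(\<Sum>i\<in>I. c (inv_into J h i) * u i x) = (\<Sum>j\<in>J. c j * u (h j) x)" for x
    by (subst sum.reindex_bij_betw[OF assms(1), symmetric])
       (use assms(1) in \<open>auto intro!: sum.cong simp: bij_betw_def inv_into_f_f\<close>)
  ultimately have "\<forall>\<^sub>F x in F. (\<Sum>i\<in>I. c (inv_into J h i) * u i x) = 0" by simp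
  then have "c (inv_into J h i) = 0" if "i \<in> I" for i
    using lin_indepD[OF assms(2), where c = "\<lambda>i. c (inv_into J h i)"] that by simp
  then show "\<forall>j\<in>J. c j = 0"
    using bij_betw_apply[OF assms(1)] inv_into_f_f[OF bij_betw_imp_inj_on[OF assms(1)]] by fastforce
qed

text \<open>
  A rational function is represented by a function on the points, up to generic equality: \<open>gen\<close> is
  the filter of the nonempty open sets. So field identities become pointwise identities, with
  \<open>1 / 0 = 0\<close> at the exceptional points.
\<close>

locale function_model =
  fixes gen :: "'p filter" and K :: "('p \<Rightarrow> 'k::field) set"
  assumes gen_ne: "gen \<noteq> bot"
    and K_const [intro]: "(\<lambda>_. c) \<in> K"
    and K_add [intro]: "f \<in> K \<Longrightarrow> g \<in> K \<Longrightarrow> (\<lambda>Q. f Q + g Q) \<in> K"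
    and K_mult [intro]: "f \<in> K \<Longrightarrow> g \<in> K \<Longrightarrow> (\<lambda>Q. f Q * g Q) \<in> K"
    and K_inverse [intro]: "f \<in> K \<Longrightarrow> (\<lambda>Q. inverse (f Q)) \<in> K"
    and K_cong: "f \<in> K \<Longrightarrow> \<forall>\<^sub>F Q in gen. f Q = g Q \<Longrightarrow> g \<in> K"
    and K_zero: "f \<in> K \<Longrightarrow> (\<forall>\<^sub>F Q in gen. f Q = 0) \<or> (\<forall>\<^sub>F Q in gen. f Q \<noteq> 0)"
begin

definition Kx :: "('p \<Rightarrow> 'k) set" where
  "Kx = {f \<in> K. \<forall>\<^sub>F Q in gen. f Q \<noteq> 0}"

lemma ev_contr: "\<not> ((\<forall>\<^sub>F Q in gen. f Q = 0) \<and> (\<forall>\<^sub>F Q in gen. f Q \<noteq> 0))"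
proof (rule notI, erule conjE)
  assume "\<forall>\<^sub>F Q in gen. f Q = 0" "\<forall>\<^sub>F Q in gen. f Q \<noteq> 0"
  then have "\<forall>\<^sub>F Q in gen. False" by eventually_elim simp
  with gen_ne show False by (simp add: trivial_limit_def)
qed

lemma K_nonzero: "f \<in> K \<Longrightarrow> \<not> (\<forall>\<^sub>F Q in gen. f Q = 0) \<Longrightarrow> f \<in> Kx"
  using K_zero by (auto simp: Kx_def)

lemma KxK: "f \<in> Kx \<Longrightarrow> f \<in> K" and Kx_ev: "f \<in> Kx \<Longrightarrow> \<forall>\<^sub>F Q in gen. f Q \<noteq> 0"
  by (auto simp: Kx_def)

lemma Kx_iff: "f \<in> K \<Longrightarrow> f \<in> Kx \<longleftrightarrow> \<not> (\<forall>\<^sub>F Q in gen. f Q = 0)"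
  using K_nonzero Kx_ev ev_contr by blast

lemma K_uminus [intro]: "f \<in> K \<Longrightarrow> (\<lambda>Q. - f Q) \<in> K"
  using K_mult[OF K_const[of "- 1"]] by fastforce

lemma K_diff [intro]: "f \<in> K \<Longrightarrow> g \<in> K \<Longrightarrow> (\<lambda>Q. f Q - g Q) \<in> K"
  using K_add[OF _ K_uminus] by fastforce

lemma K_divide [intro]: "f \<in> K \<Longrightarrow> g \<in> K \<Longrightarrow> (\<lambda>Q. f Q / g Q) \<in> K"
  using K_mult[OF _ K_inverse] by (fastforce simp: divide_inverse)

lemma K_power [intro]: "f \<in> K \<Longrightarrow> (\<lambda>Q. f Q ^ n) \<in> K"
  by (induction n) (auto intro: K_const K_mult)

lemma K_powi [intro]: "f \<in> K \<Longrightarrow> (\<lambda>Q. f Q powi n) \<in> K"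
  by (cases "n \<ge> 0") (simp_all add: power_int_def K_power K_inverse)

lemma K_sum: "(\<And>i. i \<in> I \<Longrightarrow> f i \<in> K) \<Longrightarrow> (\<lambda>Q. \<Sum>i\<in>I. f i Q) \<in> K"
  by (induction I rule: infinite_finite_induct) (auto intro: K_const K_add)

lemma Kx_mult [intro]: "f \<in> Kx \<Longrightarrow> g \<in> Kx \<Longrightarrow> (\<lambda>Q. f Q * g Q) \<in> Kx"
  by (auto simp: Kx_def eventually_conj_iff)

lemma Kx_inverse [intro]: "f \<in> Kx \<Longrightarrow> (\<lambda>Q. inverse (f Q)) \<in> Kx"
  by (auto simp: Kx_def)

lemma Kx_const: "c \<noteq> 0 \<Longrightarrow> (\<lambda>_. c) \<in> Kx"
  by (auto simp: Kx_def K_const)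

lemma Kx_power: "f \<in> Kx \<Longrightarrow> (\<lambda>Q. f Q ^ n) \<in> Kx"
  by (induction n) (simp_all add: Kx_const Kx_mult)

end

text \<open>
  The relation \<open>val P f c\<close> says that \<open>f\<close> is regular at \<open>P\<close> with value \<open>c\<close>. The assumption
  \<open>finite_type_nat\<close> is finiteness of the degree over the rational functions of \<open>x\<close>, where
  independence over these is expressed by independence of all \<open>x ^ a * u i\<close> over the constants.
\<close>

locale curve = function_model gen K
  for gen :: "'p filter" and K :: "('p \<Rightarrow> 'k::field) set" +
  fixes pts :: "'p set" and val :: "'p \<Rightarrow> ('p \<Rightarrow> 'k) \<Rightarrow> 'k \<Rightarrow> bool"
  assumes val_K: "val P f c \<Longrightarrow> f \<in> K"
    and val_const: "P \<in> pts \<Longrightarrow> val P (\<lambda>_. c) c"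
    and val_add: "val P f c \<Longrightarrow> val P g d \<Longrightarrow> val P (\<lambda>Q. f Q + g Q) (c + d)"
    and val_mult: "val P f c \<Longrightarrow> val P g d \<Longrightarrow> val P (\<lambda>Q. f Q * g Q) (c * d)"
    and val_inverse: "val P f c \<Longrightarrow> c \<noteq> 0 \<Longrightarrow> val P (\<lambda>Q. inverse (f Q)) (inverse c)"
    and val_cong: "val P f c \<Longrightarrow> \<forall>\<^sub>F Q in gen. f Q = g Q \<Longrightarrow> val P g c"
    and val_unique: "val P f c \<Longrightarrow> val P f d \<Longrightarrow> c = d"
    and fraction: "P \<in> pts \<Longrightarrow> f \<in> K \<Longrightarrow> \<exists>g h c d. val P g c \<and> val P h d \<and>
           (\<forall>\<^sub>F Q in gen. h Q \<noteq> 0 \<and> f Q = g Q / h Q)"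
    and uniformizer_exists: "P \<in> pts \<Longrightarrow> \<exists>t. val P t 0 \<and>
           (\<forall>f. val P f 0 \<longrightarrow> (\<exists>g c. val P g c \<and> (\<forall>\<^sub>F Q in gen. f Q = g Q * t Q)))"
    and finite_type_nat: "x \<in> K \<Longrightarrow> \<forall>c. \<not> (\<forall>\<^sub>F Q in gen. x Q = c) \<Longrightarrow>
           \<exists>e. \<forall>I (u :: nat \<Rightarrow> 'p \<Rightarrow> 'k). finite I \<longrightarrow> u ` I \<subseteq> K \<longrightarrow>
           (\<forall>r. lin_indep gen ({..r::nat} \<times> I) (\<lambda>(a, i) Q. x Q ^ a * u i Q)) \<longrightarrow> card I \<le> e"
    and proper: "f \<in> K \<Longrightarrow> (\<And>P. P \<in> pts \<Longrightarrow> \<exists>c. val P f c) \<Longrightarrow> \<exists>c. \<forall>\<^sub>F Q in gen. f Q = c"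
    and separate: "P \<in> pts \<Longrightarrow> Q \<in> pts \<Longrightarrow> P \<noteq> Q \<Longrightarrow> finite S \<Longrightarrow> S \<subseteq> pts \<Longrightarrow>
           \<exists>f c. (\<forall>A\<in>S. \<exists>d. val A f d) \<and> val P f c \<and> c \<noteq> 0 \<and> val Q f 0"
    and nonconstant: "\<exists>x\<in>K. \<forall>c. \<not> (\<forall>\<^sub>F Q in gen. x Q = c)"
begin

section \<open>Local rings, uniformizers and orders at a point\<close>

definition reg :: "'p \<Rightarrow> ('p \<Rightarrow> 'k) \<Rightarrow> bool" where
  "reg P f \<longleftrightarrow> (\<exists>c. val P f c)"

definition nonvan :: "'p \<Rightarrow> ('p \<Rightarrow> 'k) \<Rightarrow> bool" where
  "nonvan P f \<longleftrightarrow> (\<exists>c. c \<noteq> 0 \<and> val P f c)"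

definition unif :: "'p \<Rightarrow> ('p \<Rightarrow> 'k) \<Rightarrow> bool" where
  "unif P t \<longleftrightarrow> val P t 0 \<and> (\<forall>f. val P f 0 \<longrightarrow> (\<exists>g. reg P g \<and> (\<forall>\<^sub>F Q in gen. f Q = g Q * t Q)))"

definition loc :: "'p \<Rightarrow> 'p \<Rightarrow> 'k" where
  "loc P = (SOME t. unif P t)"

text \<open>"Order at least n", stated without \<open>ord\<close>, so that a generically zero
  function satisfies it for every n and the ultrametric inequality is merely closure of
  \<open>reg\<close> under sums.\<close>

definition vge :: "'p \<Rightarrow> ('p \<Rightarrow> 'k) \<Rightarrow> int \<Rightarrow> bool" where
  "vge P f n \<longleftrightarrow> (\<exists>g. reg P g \<and> (\<forall>\<^sub>F Q in gen. f Q = g Q * loc P Q powi n))"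

definition has_ord :: "'p \<Rightarrow> ('p \<Rightarrow> 'k) \<Rightarrow> int \<Rightarrow> bool" where
  "has_ord P f n \<longleftrightarrow> (\<exists>t u. unif P t \<and> nonvan P u \<and> (\<forall>\<^sub>F Q in gen. f Q = u Q * t Q powi n))"

definition ord :: "'p \<Rightarrow> ('p \<Rightarrow> 'k) \<Rightarrow> int" where
  "ord P f = (THE n. has_ord P f n)"

lemma reg_K: "reg P f \<Longrightarrow> f \<in> K"
  by (auto simp: reg_def val_K)

lemma nonvan_reg: "nonvan P f \<Longrightarrow> reg P f"
  by (auto simp: nonvan_def reg_def)

lemma reg_const: "P \<in> pts \<Longrightarrow> reg P (\<lambda>_. c)"
  using val_const by (auto simp: reg_def)

lemma reg_add: "reg P f \<Longrightarrow> reg P g \<Longrightarrow> reg P (\<lambda>Q. f Q + g Q)"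
  using val_add by (fastforce simp: reg_def)

lemma reg_mult: "reg P f \<Longrightarrow> reg P g \<Longrightarrow> reg P (\<lambda>Q. f Q * g Q)"
  using val_mult by (fastforce simp: reg_def)

lemma reg_cong: "reg P f \<Longrightarrow> \<forall>\<^sub>F Q in gen. f Q = g Q \<Longrightarrow> reg P g"
  using val_cong by (fastforce simp: reg_def)

lemma reg_sum: "P \<in> pts \<Longrightarrow> (\<And>i. i \<in> I \<Longrightarrow> reg P (f i)) \<Longrightarrow> reg P (\<lambda>Q. \<Sum>i\<in>I. f i Q)"
  by (induction I rule: infinite_finite_induct) (auto intro: reg_const reg_add)

lemma val_sum:
  "P \<in> pts \<Longrightarrow> (\<And>i. i \<in> I \<Longrightarrow> val P (f i) (c i)) \<Longrightarrow> val P (\<lambda>Q. \<Sum>i\<in>I. f i Q) (\<Sum>i\<in>I. c i)"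
  by (induction I rule: infinite_finite_induct) (auto intro: val_const val_add)

lemma val_power: "P \<in> pts \<Longrightarrow> val P f c \<Longrightarrow> val P (\<lambda>Q. f Q ^ n) (c ^ n)"
  by (induction n) (auto intro: val_const val_mult)

lemma reg_power: "P \<in> pts \<Longrightarrow> reg P f \<Longrightarrow> reg P (\<lambda>Q. f Q ^ n)"
  using val_power by (fastforce simp: reg_def)

lemma val_zero_mult: "val P f 0 \<Longrightarrow> reg P g \<Longrightarrow> val P (\<lambda>Q. g Q * f Q) 0"
  using val_mult by (fastforce simp: reg_def)

lemma nonvan_mult: "nonvan P f \<Longrightarrow> nonvan P g \<Longrightarrow> nonvan P (\<lambda>Q. f Q * g Q)"
  unfolding nonvan_def using val_mult by (metis mult_eq_0_iff)

lemma nonvan_inverse: "nonvan P f \<Longrightarrow> nonvan P (\<lambda>Q. inverse (f Q))"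
  unfolding nonvan_def using val_inverse by (metis inverse_zero_imp_zero)

lemma val_zero_iff: "P \<in> pts \<Longrightarrow> \<forall>\<^sub>F Q in gen. f Q = 0 \<Longrightarrow> val P f 0"
  using val_cong[OF val_const, of P 0 f] by (auto elim: eventually_mono)

lemma nonvan_Kx: assumes "P \<in> pts" "nonvan P f" shows "f \<in> Kx"
proof (rule K_nonzero)
  show "f \<in> K" using assms by (auto simp: nonvan_def val_K)
  show "\<not> (\<forall>\<^sub>F Q in gen. f Q = 0)"
    using assms val_zero_iff val_unique by (auto simp: nonvan_def)
qed

lemma reg_cases: "reg P f \<Longrightarrow> nonvan P f \<or> val P f 0"
  by (metis reg_def nonvan_def)

lemma not_nonvan_val0: "nonvan P f \<Longrightarrow> \<not> val P f 0"
  using val_unique by (auto simp: nonvan_def)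

lemma unif_exists: "P \<in> pts \<Longrightarrow> \<exists>t. unif P t"
  using uniformizer_exists[of P] unfolding unif_def reg_def by meson

lemma unif_loc: "P \<in> pts \<Longrightarrow> unif P (loc P)"
  unfolding loc_def using unif_exists by (rule someI_ex)

text \<open>If t were zero, so would be every function vanishing at P. Subtracting its value, each
  regular function would then be constant, and so would each quotient of regular functions, against
  \<open>nonconstant\<close>.\<close>

lemma unif_Kx:
  assumes P: "P \<in> pts" and t: "unif P t"
  shows "t \<in> Kx"
proof (rule K_nonzero)
  show "t \<in> K" using t by (auto simp: unif_def val_K)
  show "\<not> (\<forall>\<^sub>F Q in gen. t Q = 0)"
  proof
    assume t0: "\<forall>\<^sub>F Q in gen. t Q = 0"
    have m: "\<forall>\<^sub>F Q in gen. f Q = 0" if f: "val P f 0" for f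
    proof -
      obtain g where "\<forall>\<^sub>F Q in gen. f Q = g Q * t Q"
        using t f by (auto simp: unif_def)
      with t0 show ?thesis by eventually_elim simp
    qed
    have const: "\<forall>\<^sub>F Q in gen. f Q = c" if f: "val P f c" for f c
    proof -
      have "val P (\<lambda>Q. f Q + (- c)) 0"
        using val_add[OF f val_const[OF P, of "- c"]] by simp
      from m[OF this] show ?thesis by simp
    qed
    obtain x where x: "x \<in> K" "\<And>c. \<not> (\<forall>\<^sub>F Q in gen. x Q = c)"
      using nonconstant by blast
    obtain g h c d where gh: "val P g c" "val P h d" "\<forall>\<^sub>F Q in gen. h Q \<noteq> 0 \<and> x Q = g Q / h Q"
      using fraction[OF P x(1)] by blast
    from const[OF gh(1)] const[OF gh(2)] gh(3)
    have "\<forall>\<^sub>F Q in gen. x Q = c / d" by eventually_elim auto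
    with x(2) show False by blast
  qed
qed

lemma loc_ne: "P \<in> pts \<Longrightarrow> \<forall>\<^sub>F Q in gen. loc P Q \<noteq> 0"
  using unif_loc unif_Kx Kx_ev by blast

lemma not_const_unif: "P \<in> pts \<Longrightarrow> unif P t \<Longrightarrow> \<not> (\<forall>\<^sub>F Q in gen. t Q = c)"
proof
  assume P: "P \<in> pts" and t: "unif P t" and c: "\<forall>\<^sub>F Q in gen. t Q = c"
  have "val P t 0" using t by (auto simp: unif_def)
  moreover have "val P t c"
    by (rule val_cong[OF val_const[OF P]]) (use c in \<open>auto elim: eventually_mono\<close>)
  ultimately have "c = 0" using val_unique by blast
  with c unif_Kx[OF P t] show False using Kx_ev ev_contr by blast
qed

text \<open>A locale assumption cannot quantify over index types, so \<open>finite_type_nat\<close>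
  speaks of families indexed by numbers; enumerating the finite index set carries the bound over to
  any index type.\<close>

lemma finite_type:
  assumes "x \<in> K" "\<And>c. \<not> (\<forall>\<^sub>F Q in gen. x Q = c)"
  shows "\<exists>e. \<forall>I (u :: 'i \<Rightarrow> 'p \<Rightarrow> 'k). finite I \<longrightarrow> u ` I \<subseteq> K \<longrightarrow>
    (\<forall>r. lin_indep gen ({..r::nat} \<times> I) (\<lambda>(a, i) Q. x Q ^ a * u i Q)) \<longrightarrow> card I \<le> e"
proof -
  obtain e where e: "\<And>I (u :: nat \<Rightarrow> 'p \<Rightarrow> 'k). finite I \<Longrightarrow> u ` I \<subseteq> K \<Longrightarrow>
    (\<forall>r. lin_indep gen ({..r::nat} \<times> I) (\<lambda>(a, i) Q. x Q ^ a * u i Q)) \<Longrightarrow> card I \<le> e"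
    using finite_type_nat[OF assms(1)] assms(2) by blast
  show ?thesis
  proof (intro exI[of _ e] allI impI)
    fix I and u :: "'i \<Rightarrow> 'p \<Rightarrow> 'k"
    assume I: "finite I" "u ` I \<subseteq> K"
      and ind: "\<forall>r. lin_indep gen ({..r::nat} \<times> I) (\<lambda>(a, i) Q. x Q ^ a * u i Q)"
    obtain h where h: "bij_betw h {0..<card I} I"
      using ex_bij_betw_nat_finite[OF I(1)] by blast
    have "card {0..<card I} \<le> e"
    proof (rule e)
      show "(\<lambda>j. u (h j)) ` {0..<card I} \<subseteq> K"
        using I h by (auto simp: bij_betw_def)
      show "\<forall>r. lin_indep gen ({..r} \<times> {0..<card I}) (\<lambda>(a, i) Q. x Q ^ a * u (h i) Q)"
      proof
        fix r :: nat
        have b: "bij_betw (map_prod id h) ({..r} \<times> {0..<card I}) ({..r} \<times> I)"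
          using h by (intro bij_betw_map_prod) auto
        show "lin_indep gen ({..r} \<times> {0..<card I}) (\<lambda>(a, i) Q. x Q ^ a * u (h i) Q)"
          using lin_indep_reindex[OF b spec[OF ind]] by (simp add: case_prod_unfold)
      qed
    qed simp
    then show "card I \<le> e" by simp
  qed
qed

end

text \<open>Serves to divide a polynomial relation by its lowest power and to read the rest modulo
  x. The exponent \<open>a - k - 1\<close> is an exact difference, as \<open>a > k\<close> in that
  sum.\<close>

lemma sum_powers_split:
  fixes x :: "'a::comm_ring_1"
  assumes "k \<le> r" "\<And>a. a < k \<Longrightarrow> T a = 0"
  shows "(\<Sum>a\<le>r. x ^ a * T a) = x ^ k * (T k + x * (\<Sum>a\<in>{k<..r}. x ^ (a - k - 1) * T a))"
proof -
  have "(\<Sum>a\<le>r. x ^ a * T a) = (\<Sum>a\<in>{k..r}. x ^ a * T a)"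
    by (rule sum.mono_neutral_right) (auto simp: assms)
  also have "{k..r} = insert k {k<..r}" using assms by auto
  also have "(\<Sum>a\<in>insert k {k<..r}. x ^ a * T a) = x ^ k * T k + (\<Sum>a\<in>{k<..r}. x ^ a * T a)"
    by (subst sum.insert) auto
  also have "(\<Sum>a\<in>{k<..r}. x ^ a * T a) = (\<Sum>a\<in>{k<..r}. x ^ k * (x * (x ^ (a - k - 1) * T a)))"
  proof (rule sum.cong)
    fix a assume "a \<in> {k<..r}"
    then have "a = k + (1 + (a - k - 1))" by auto
    then have "x ^ a = x ^ k * (x * x ^ (a - k - 1))"
      by (metis power_add power_one_right)
    then show "x ^ a * T a = x ^ k * (x * (x ^ (a - k - 1) * T a))" by (simp add: mult.assoc)
  qed simp
  finally show ?thesis by (simp add: algebra_simps sum_distrib_left)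
qed

context curve begin

lemma val_poly: "P \<in> pts \<Longrightarrow> val P f c \<Longrightarrow> val P (\<lambda>Q. poly A (f Q)) (poly A c)"
proof (induction A)
  case (pCons a A)
  have "val P (\<lambda>Q. a + f Q * poly A (f Q)) (a + c * poly A c)"
    by (rule val_add[OF val_const val_mult]) (use pCons in auto)
  then show ?case by simp
qed (auto intro: val_const)

lemma reg_poly: "P \<in> pts \<Longrightarrow> reg P f \<Longrightarrow> reg P (\<lambda>Q. poly A (f Q))"
  using val_poly by (fastforce simp: reg_def)

lemma reg_uminus: assumes "P \<in> pts" "reg P f" shows "reg P (\<lambda>Q. - f Q)"
  using reg_mult[OF reg_const[OF assms(1), of "- 1"] assms(2)] by simp

text \<open>Replaces Krull's intersection theorem: it makes \<open>f\<close> divide a power of \<open>t\<close>, because \<open>f\<close> and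
  \<open>t\<close> are algebraically dependent.\<close>
lemma divides_unif_power:
  assumes P: "P \<in> pts" and t: "unif P t" and f: "reg P f" "f \<in> Kx"
  shows "\<exists>m s. reg P s \<and> (\<forall>\<^sub>F Q in gen. t Q ^ m = f Q * s Q)"
proof -
  have tK: "t \<in> Kx" using P t by (rule unif_Kx)
  obtain e where e: "\<And>I (u :: nat \<Rightarrow> 'p \<Rightarrow> 'k). finite I \<Longrightarrow> u ` I \<subseteq> K \<Longrightarrow>
    (\<forall>r. lin_indep gen ({..r::nat} \<times> I) (\<lambda>(a, i) Q. t Q ^ a * u i Q)) \<Longrightarrow> card I \<le> e"
    using finite_type[OF KxK[OF tK] not_const_unif[OF P t]] by blast
  have "(\<lambda>j Q. f Q ^ j) ` {..e} \<subseteq> K" using f by (auto intro: KxK)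
  \<comment> \<open>The powers of \<open>f\<close> with exponents in \<open>{..e}\<close> are e + 1
    in number, one too many to be independent over k(t).\<close>
  then obtain r where "\<not> lin_indep gen ({..r} \<times> {..e}) (\<lambda>(a, j) Q. t Q ^ a * f Q ^ j)"
    using e[of "{..e}" "\<lambda>j Q. f Q ^ j"] by auto
  then obtain c a0 i0 where c: "\<forall>\<^sub>F Q in gen. (\<Sum>(a, j)\<in>{..r} \<times> {..e}. c (a, j) * (t Q ^ a * f Q ^ j)) = 0"
    and nz: "a0 \<le> r" "i0 \<le> e" "c (a0, i0) \<noteq> 0"
    unfolding lin_indep_def by (auto simp: case_prod_unfold)
  define A where "A = (\<lambda>j. \<Sum>a\<le>r. Polynomial.monom (c (a, j)) a)"
  have A: "poly (A j) x = (\<Sum>a\<le>r. c (a, j) * x ^ a)" for j x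
    by (simp add: A_def poly_sum poly_monom)
  have "Polynomial.coeff (A i0) a0 = c (a0, i0)"
    using nz by (simp add: A_def coeff_sum)
  then have "A i0 \<noteq> 0" using nz by auto
  \<comment> \<open>The lowest power of \<open>f\<close> with a nonzero coefficient. Since
    \<open>f\<close> is generically nonzero, \<open>f ^ k\<close> cancels, and \<open>A k\<close>
    evaluated at \<open>t\<close> becomes a multiple of \<open>f\<close>.\<close>
  define k where "k = (LEAST j. A j \<noteq> 0)"
  have k: "A k \<noteq> 0" unfolding k_def by (rule LeastI, rule \<open>A i0 \<noteq> 0\<close>)
  have "k \<le> i0" unfolding k_def by (rule Least_le, rule \<open>A i0 \<noteq> 0\<close>)
  with nz have "k \<le> e" by simp
  have below: "A j = 0" if "j < k" for j
    using not_less_Least[OF that[unfolded k_def]] by simp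
  define w where "w = (\<lambda>Q. \<Sum>j\<in>{k<..e}. poly (A j) (t Q) * f Q ^ (j - k - 1))"
  have val_t: "val P t 0" using t by (simp add: unif_def)
  then have reg_t: "reg P t" by (auto simp: reg_def)
  have w: "reg P w"
    unfolding w_def using P f reg_t by (intro reg_sum reg_mult reg_power reg_poly) auto
  from c Kx_ev[OF f(2)] have rel: "\<forall>\<^sub>F Q in gen. poly (A k) (t Q) = - (f Q * w Q)"
  proof eventually_elim
    case (elim Q)
    have "0 = (\<Sum>a\<le>r. \<Sum>j\<le>e. c (a, j) * (t Q ^ a * f Q ^ j))"
      using elim(1) by (simp add: sum.cartesian_product)
    also have "\<dots> = (\<Sum>j\<le>e. f Q ^ j * poly (A j) (t Q))"
      unfolding A sum_distrib_left by (subst sum.swap) (simp add: mult_ac)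
    also have "\<dots> = f Q ^ k * (poly (A k) (t Q) + f Q * w Q)"
      unfolding w_def using sum_powers_split[OF \<open>k \<le> e\<close>, of "\<lambda>j. poly (A j) (t Q)" "f Q"]
      by (simp add: below mult.commute)
    finally have "f Q ^ k * (poly (A k) (t Q) + f Q * w Q) = 0" by simp
    with elim(2) show ?case by (simp add: eq_neg_iff_add_eq_0)
  qed
  \<comment> \<open>After the zero of \<open>A k\<close> at 0 is split off, the remaining factor
    takes at \<open>t\<close> a value that is a unit at P, because \<open>t\<close> vanishes there.
    Hence \<open>t ^ m\<close> itself is a multiple of \<open>f\<close>.\<close>
  obtain B where B: "A k = [:- 0, 1:] ^ Polynomial.order 0 (A k) * B" "\<not> [:- 0, 1:] dvd B"
    using order_decomp[OF k, of 0] by blast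
  have B0: "poly B 0 \<noteq> 0" using B(2) by (simp add: poly_eq_0_iff_dvd)
  define m where "m = Polynomial.order 0 (A k)"
  have Ak: "poly (A k) x = x ^ m * poly B x" for x
    by (subst B(1)) (simp add: m_def poly_power)
  have nvB: "nonvan P (\<lambda>Q. poly B (t Q))"
    using val_poly[OF P val_t, of B] B0 by (auto simp: nonvan_def)
  define s where "s = (\<lambda>Q. - w Q * inverse (poly B (t Q)))"
  have "reg P s" unfolding s_def
    by (intro reg_mult reg_uminus P w nonvan_reg nonvan_inverse nvB)
  moreover have "\<forall>\<^sub>F Q in gen. t Q ^ m = f Q * s Q"
    using rel Kx_ev[OF nonvan_Kx[OF P nvB]]
    by eventually_elim (simp add: s_def Ak field_simps)
  ultimately show ?thesis by blast
qed

text \<open>Induction on m with \<open>t ^ m = f * s\<close>: a nonunit f is g * t, and then g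
  divides \<open>t ^ (m - 1)\<close>; for m = 0 the function f is a unit. The initial m is supplied
  by \<open>divides_unif_power\<close>.\<close>

lemma reg_factor:
  assumes P: "P \<in> pts" and t: "unif P t" and f: "reg P f" "f \<in> Kx"
  shows "\<exists>n u. nonvan P u \<and> (\<forall>\<^sub>F Q in gen. f Q = u Q * t Q ^ n)"
proof -
  have val_t: "val P t 0" using t by (simp add: unif_def)
  have t0: "\<forall>\<^sub>F Q in gen. t Q \<noteq> 0" using unif_Kx[OF P t] by (rule Kx_ev)
  have "\<exists>n u. nonvan P u \<and> (\<forall>\<^sub>F Q in gen. f Q = u Q * t Q ^ n)"
    if "reg P s" "reg P f" "f \<in> Kx" "\<forall>\<^sub>F Q in gen. t Q ^ m = f Q * s Q" for m s f
    using that
  proof (induction m arbitrary: f)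
    case 0
    have "nonvan P f"
    proof (rule ccontr)
      assume "\<not> nonvan P f"
      then have "val P f 0" using reg_cases 0 by blast
      then have "val P (\<lambda>Q. s Q * f Q) 0" using 0 val_zero_mult by blast
      moreover have "val P (\<lambda>Q. s Q * f Q) 1"
        by (rule val_cong[OF val_const[OF P]]) (use 0(4) in \<open>auto elim!: eventually_mono simp: mult_ac\<close>)
      ultimately show False using val_unique zero_neq_one by metis
    qed
    then show ?case by (intro exI[of _ 0] exI[of _ f]) auto
  next
    case (Suc m)
    show ?case
    proof (cases "nonvan P f")
      case True
      then show ?thesis by (intro exI[of _ 0] exI[of _ f]) auto
    next
      case False
      then have "val P f 0" using reg_cases Suc.prems by blast
      then obtain g where g: "reg P g" "\<forall>\<^sub>F Q in gen. f Q = g Q * t Q"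
        using t by (auto simp: unif_def)
      have gK: "g \<in> Kx"
      proof (rule K_nonzero[OF reg_K[OF g(1)]])
        show "\<not> (\<forall>\<^sub>F Q in gen. g Q = 0)"
        proof
          assume "\<forall>\<^sub>F Q in gen. g Q = 0"
          with g(2) have "\<forall>\<^sub>F Q in gen. f Q = 0" by eventually_elim simp
          with Kx_ev[OF Suc.prems(3)] show False using ev_contr by blast
        qed
      qed
      from g(2) t0 Suc.prems(4) have "\<forall>\<^sub>F Q in gen. t Q ^ m = g Q * s Q"
        by eventually_elim (simp add: field_simps)
      from Suc.IH[OF Suc.prems(1) g(1) gK this]
      obtain n u where "nonvan P u" "\<forall>\<^sub>F Q in gen. g Q = u Q * t Q ^ n" by blast
      moreover from this(2) g(2) have "\<forall>\<^sub>F Q in gen. f Q = u Q * t Q ^ Suc n"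
        by eventually_elim simp
      ultimately show ?thesis by blast
    qed
  qed
  then show ?thesis using divides_unif_power[OF assms] f by blast
qed

lemma Kx_factor:
  assumes P: "P \<in> pts" and t: "unif P t" and f: "f \<in> Kx"
  shows "\<exists>n u. nonvan P u \<and> (\<forall>\<^sub>F Q in gen. f Q = u Q * t Q powi n)"
proof -
  obtain g h c d where gh: "val P g c" "val P h d" "\<forall>\<^sub>F Q in gen. h Q \<noteq> 0 \<and> f Q = g Q / h Q"
    using fraction[OF P KxK[OF f]] by blast
  have h: "reg P h" "h \<in> Kx" using gh by (auto simp: reg_def Kx_def val_K elim: eventually_mono)
  have "\<forall>\<^sub>F Q in gen. g Q \<noteq> 0"
    using gh(3) Kx_ev[OF f] by eventually_elim auto
  then have g: "reg P g" "g \<in> Kx" using gh by (auto simp: reg_def Kx_def val_K)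
  obtain n u where u: "nonvan P u" "\<forall>\<^sub>F Q in gen. g Q = u Q * t Q ^ n"
    using reg_factor[OF P t g] by blast
  obtain m v where v: "nonvan P v" "\<forall>\<^sub>F Q in gen. h Q = v Q * t Q ^ m"
    using reg_factor[OF P t h] by blast
  have "nonvan P (\<lambda>Q. u Q * inverse (v Q))"
    using u v by (intro nonvan_mult nonvan_inverse)
  moreover have "\<forall>\<^sub>F Q in gen. f Q = u Q * inverse (v Q) * t Q powi (int n - int m)"
    using gh(3) u(2) v(2) Kx_ev[OF unif_Kx[OF P t]]
    by eventually_elim (simp add: power_int_diff divide_inverse)
  ultimately show ?thesis by blast
qed

lemma nonvan_power: "P \<in> pts \<Longrightarrow> nonvan P f \<Longrightarrow> nonvan P (\<lambda>Q. f Q ^ n)"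
  unfolding nonvan_def using val_power by (metis power_not_zero)

lemma nonvan_powi: "P \<in> pts \<Longrightarrow> nonvan P f \<Longrightarrow> nonvan P (\<lambda>Q. f Q powi n)"
  by (cases "n \<ge> 0") (simp_all add: power_int_def nonvan_power nonvan_inverse)

text \<open>Each uniformizer divides the other, and the two regular quotients are inverse to each
  other, hence do not vanish at P.\<close>

lemma unif_associated:
  assumes P: "P \<in> pts" and t: "unif P t" "unif P t'"
  shows "\<exists>w. nonvan P w \<and> (\<forall>\<^sub>F Q in gen. t Q = w Q * t' Q)"
proof -
  obtain g where g: "reg P g" "\<forall>\<^sub>F Q in gen. t Q = g Q * t' Q" using t unfolding unif_def by blast
  obtain g' where g': "reg P g'" "\<forall>\<^sub>F Q in gen. t' Q = g' Q * t Q" using t unfolding unif_def by blast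
  have 1: "\<forall>\<^sub>F Q in gen. 1 = g' Q * g Q"
    using g(2) g'(2) Kx_ev[OF unif_Kx[OF P t(1)]]
    by eventually_elim (metis mult.assoc mult.commute mult_cancel_left mult_1)
  have "nonvan P g"
  proof (rule ccontr)
    assume "\<not> nonvan P g"
    then have "val P g 0" using reg_cases g by blast
    then have "val P (\<lambda>Q. g' Q * g Q) 0" using g' val_zero_mult by blast
    moreover have "val P (\<lambda>Q. g' Q * g Q) 1"
      by (rule val_cong[OF val_const[OF P] 1])
    ultimately show False using val_unique zero_neq_one by metis
  qed
  with g show ?thesis by blast
qed

lemma has_ord_iff:
  assumes P: "P \<in> pts"
  shows "has_ord P f n \<longleftrightarrow> (\<exists>u. nonvan P u \<and> (\<forall>\<^sub>F Q in gen. f Q = u Q * loc P Q powi n))"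
proof
  assume "has_ord P f n"
  then obtain t u where t: "unif P t" and u: "nonvan P u" "\<forall>\<^sub>F Q in gen. f Q = u Q * t Q powi n"
    by (auto simp: has_ord_def)
  obtain w where w: "nonvan P w" "\<forall>\<^sub>F Q in gen. t Q = w Q * loc P Q"
    using unif_associated[OF P t unif_loc[OF P]] by blast
  have "nonvan P (\<lambda>Q. u Q * w Q powi n)"
    by (intro nonvan_mult nonvan_powi u w P)
  moreover have "\<forall>\<^sub>F Q in gen. f Q = u Q * w Q powi n * loc P Q powi n"
    using u(2) w(2) by eventually_elim (simp add: power_int_mult_distrib)
  ultimately show "\<exists>u. nonvan P u \<and> (\<forall>\<^sub>F Q in gen. f Q = u Q * loc P Q powi n)" by blast
qed (use unif_loc[OF P] in \<open>auto simp: has_ord_def\<close>)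

text \<open>Cancelling the n-th power leaves \<open>u = v * loc P ^ (m - n)\<close>, which vanishes
  at P although u does not. As v need only be regular, this gives both the uniqueness of the order
  and the comparison of \<open>vge\<close> with \<open>ord\<close>.\<close>

lemma has_ord_less:
  assumes P: "P \<in> pts" and "n < m"
    and u: "nonvan P u" "\<forall>\<^sub>F Q in gen. f Q = u Q * loc P Q powi n"
    and v: "reg P v" "\<forall>\<^sub>F Q in gen. f Q = v Q * loc P Q powi m"
  shows False
proof -
  have "val P (loc P) 0" using unif_loc[OF P] by (simp add: unif_def)
  then have "val P (\<lambda>Q. loc P Q ^ nat (m - n)) 0"
    using val_power[OF P, of "loc P" 0 "nat (m - n)"] \<open>n < m\<close> by (simp add: zero_power)
  then have "val P (\<lambda>Q. v Q * loc P Q ^ nat (m - n)) 0" using v val_zero_mult by blast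
  moreover have "\<forall>\<^sub>F Q in gen. v Q * loc P Q ^ nat (m - n) = u Q"
    using u(2) v(2) loc_ne[OF P]
  proof eventually_elim
    case (elim Q)
    have "u Q * loc P Q powi n = v Q * loc P Q powi (m - n) * loc P Q powi n"
      using elim by (simp add: mult.assoc flip: power_int_add)
    then have "u Q = v Q * loc P Q powi (m - n)" using elim by simp
    then show ?case using \<open>n < m\<close> by (simp add: power_int_def)
  qed
  ultimately have "val P u 0" by (rule val_cong)
  with u(1) show False using not_nonvan_val0 by blast
qed

lemma has_ord_unique:
  assumes P: "P \<in> pts" and "has_ord P f n" "has_ord P f m"
  shows "n = m"
proof -
  obtain u v where u: "nonvan P u" "\<forall>\<^sub>F Q in gen. f Q = u Q * loc P Q powi n"
    and v: "nonvan P v" "\<forall>\<^sub>F Q in gen. f Q = v Q * loc P Q powi m"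
    using assms(2,3) unfolding has_ord_iff[OF P] by blast
  have "\<not> n < m" using has_ord_less[OF P _ u nonvan_reg[OF v(1)] v(2)] by blast
  moreover have "\<not> m < n" using has_ord_less[OF P _ v nonvan_reg[OF u(1)] u(2)] by blast
  ultimately show ?thesis by simp
qed

lemma ord_eqI: "P \<in> pts \<Longrightarrow> has_ord P f n \<Longrightarrow> ord P f = n"
  unfolding ord_def using has_ord_unique by blast

lemma ord_factor:
  assumes "P \<in> pts" "f \<in> Kx"
  shows "\<exists>u. nonvan P u \<and> (\<forall>\<^sub>F Q in gen. f Q = u Q * loc P Q powi ord P f)"
proof -
  obtain n u where u: "nonvan P u" "\<forall>\<^sub>F Q in gen. f Q = u Q * loc P Q powi n"
    using Kx_factor[OF assms(1) unif_loc[OF assms(1)] assms(2)] by blast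
  then have "ord P f = n" using ord_eqI has_ord_iff assms(1) by blast
  with u show ?thesis by blast
qed

lemma has_ord_ord: "P \<in> pts \<Longrightarrow> f \<in> Kx \<Longrightarrow> has_ord P f (ord P f)"
  using ord_factor has_ord_iff by blast

lemma ord_mult:
  assumes P: "P \<in> pts" and "f \<in> Kx" "g \<in> Kx"
  shows "ord P (\<lambda>Q. f Q * g Q) = ord P f + ord P g"
proof -
  obtain u where u: "nonvan P u" "\<forall>\<^sub>F Q in gen. f Q = u Q * loc P Q powi ord P f"
    using ord_factor[OF assms(1,2)] by blast
  obtain v where v: "nonvan P v" "\<forall>\<^sub>F Q in gen. g Q = v Q * loc P Q powi ord P g"
    using ord_factor[OF assms(1,3)] by blast
  have "\<forall>\<^sub>F Q in gen. f Q * g Q = (u Q * v Q) * loc P Q powi (ord P f + ord P g)"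
    using u(2) v(2) loc_ne[OF P] by eventually_elim (simp add: power_int_add)
  then show ?thesis
    using nonvan_mult[OF u(1) v(1)] by (intro ord_eqI[OF P]) (auto simp: has_ord_iff[OF P])
qed

lemma ord_cong: "\<forall>\<^sub>F Q in gen. f Q = g Q \<Longrightarrow> ord P f = ord P g"
proof -
  assume ev: "\<forall>\<^sub>F Q in gen. f Q = g Q"
  have "has_ord P f n \<longleftrightarrow> has_ord P g n" for n
  proof -
    have "(\<forall>\<^sub>F Q in gen. f Q = u Q * t Q powi n) \<longleftrightarrow> (\<forall>\<^sub>F Q in gen. g Q = u Q * t Q powi n)" for u t
      using ev by (auto elim: eventually_elim2)
    then show ?thesis by (simp add: has_ord_def)
  qed
  then show ?thesis by (simp add: ord_def)
qed

lemma ord_nonvan: "P \<in> pts \<Longrightarrow> nonvan P f \<Longrightarrow> ord P f = 0"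
  by (rule ord_eqI) (auto simp: has_ord_iff)

lemma nonvan_const: "P \<in> pts \<Longrightarrow> c \<noteq> 0 \<Longrightarrow> nonvan P (\<lambda>_. c)"
  using val_const by (auto simp: nonvan_def)

lemma ord_inverse:
  assumes P: "P \<in> pts" and "f \<in> Kx"
  shows "ord P (\<lambda>Q. inverse (f Q)) = - ord P f"
proof -
  have "0 = ord P (\<lambda>Q. f Q * inverse (f Q))"
  proof -
    have "\<forall>\<^sub>F Q in gen. f Q * inverse (f Q) = 1"
      using Kx_ev[OF assms(2)] by eventually_elim simp
    from ord_cong[OF this] show ?thesis
      using ord_nonvan[OF P nonvan_const[OF P one_neq_zero]] by (simp only:)
  qed
  then show ?thesis using ord_mult[OF P assms(2) Kx_inverse[OF assms(2)]] by simp
qed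

lemma vge_cong: "vge P f n \<Longrightarrow> \<forall>\<^sub>F Q in gen. f Q = g Q \<Longrightarrow> vge P g n"
proof -
  assume ev: "\<forall>\<^sub>F Q in gen. f Q = g Q" and "vge P f n"
  then obtain h where h: "reg P h" "\<forall>\<^sub>F Q in gen. f Q = h Q * loc P Q powi n"
    by (auto simp: vge_def)
  from h(2) ev have "\<forall>\<^sub>F Q in gen. g Q = h Q * loc P Q powi n" by eventually_elim simp
  with h(1) show ?thesis unfolding vge_def by blast
qed

lemma vge_0_iff: "P \<in> pts \<Longrightarrow> vge P f 0 \<longleftrightarrow> reg P f"
  unfolding vge_def using reg_cong[where g = f] by (auto simp: eq_commute)

lemma vge_add:
  assumes "vge P f n" "vge P g n" shows "vge P (\<lambda>Q. f Q + g Q) n"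
proof -
  obtain a b where "reg P a" "\<forall>\<^sub>F Q in gen. f Q = a Q * loc P Q powi n"
    "reg P b" "\<forall>\<^sub>F Q in gen. g Q = b Q * loc P Q powi n"
    using assms by (auto simp: vge_def)
  moreover from this(2,4) have "\<forall>\<^sub>F Q in gen. f Q + g Q = (a Q + b Q) * loc P Q powi n"
    by eventually_elim (simp add: algebra_simps)
  ultimately show ?thesis unfolding vge_def using reg_add by blast
qed

lemma vge_mult:
  assumes P: "P \<in> pts" and "vge P f n" "vge P g m" shows "vge P (\<lambda>Q. f Q * g Q) (n + m)"
proof -
  obtain a b where "reg P a" "\<forall>\<^sub>F Q in gen. f Q = a Q * loc P Q powi n"
    "reg P b" "\<forall>\<^sub>F Q in gen. g Q = b Q * loc P Q powi m"
    using assms by (auto simp: vge_def)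
  moreover from this(2,4) loc_ne[OF P]
  have "\<forall>\<^sub>F Q in gen. f Q * g Q = (a Q * b Q) * loc P Q powi (n + m)"
    by eventually_elim (simp add: power_int_add)
  ultimately show ?thesis unfolding vge_def using reg_mult by blast
qed

lemma vge_iff:
  assumes P: "P \<in> pts" and f: "f \<in> Kx"
  shows "vge P f n \<longleftrightarrow> n \<le> ord P f"
proof -
  obtain u where u: "nonvan P u" "\<forall>\<^sub>F Q in gen. f Q = u Q * loc P Q powi ord P f"
    using ord_factor[OF assms] by blast
  show ?thesis
  proof
    assume "vge P f n"
    then show "n \<le> ord P f"
      using has_ord_less[OF P _ u] by (metis not_le vge_def)
  next
    assume le: "n \<le> ord P f"
    have "val P (loc P) 0" using unif_loc[OF P] by (simp add: unif_def)
    then have "reg P (\<lambda>Q. u Q * loc P Q ^ nat (ord P f - n))"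
      using reg_mult[OF nonvan_reg[OF u(1)] reg_power[OF P]] by (metis reg_def)
    moreover have "\<forall>\<^sub>F Q in gen. f Q = u Q * loc P Q ^ nat (ord P f - n) * loc P Q powi n"
      using u(2) loc_ne[OF P]
    proof eventually_elim
      case (elim Q)
      have "loc P Q powi ord P f = loc P Q powi (ord P f - n) * loc P Q powi n"
        using elim by (simp flip: power_int_add)
      then show ?case using elim le by (simp add: power_int_def)
    qed
    ultimately show "vge P f n" unfolding vge_def by blast
  qed
qed

lemma vge_zero: "P \<in> pts \<Longrightarrow> \<forall>\<^sub>F Q in gen. f Q = 0 \<Longrightarrow> vge P f n"
  unfolding vge_def by (intro exI[of _ "\<lambda>_. 0"]) (auto simp: reg_const)

lemma vge_const_mult: assumes "P \<in> pts" "vge P f n" shows "vge P (\<lambda>Q. c * f Q) n"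
  using vge_mult[OF assms(1) _ assms(2), of "\<lambda>_. c" 0] assms(1) by (simp add: vge_0_iff reg_const)

lemma vge_sum: "P \<in> pts \<Longrightarrow> (\<And>i. i \<in> I \<Longrightarrow> vge P (f i) n) \<Longrightarrow> vge P (\<lambda>Q. \<Sum>i\<in>I. f i Q) n"
  by (induction I rule: infinite_finite_induct) (auto intro: vge_zero vge_add)

lemma vge_K: assumes "P \<in> pts" "vge P f n" shows "f \<in> K"
proof -
  obtain g where g: "reg P g" "\<forall>\<^sub>F Q in gen. f Q = g Q * loc P Q powi n"
    using assms by (auto simp: vge_def)
  have "(\<lambda>Q. g Q * loc P Q powi n) \<in> K"
    by (intro K_mult K_powi reg_K[OF g(1)] KxK[OF unif_Kx[OF assms(1) unif_loc[OF assms(1)]]])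
  then show ?thesis by (rule K_cong) (use g(2) in \<open>auto elim: eventually_mono\<close>)
qed

lemma vge_mono:
  assumes P: "P \<in> pts" and f: "vge P f m" and le: "n \<le> m"
  shows "vge P f n"
proof (cases "f \<in> Kx")
  case True
  then show ?thesis using assms vge_iff by auto
next
  case False
  then show ?thesis using vge_zero[OF P] K_zero[OF vge_K[OF P f]] vge_K[OF P f] by (auto simp: Kx_def)
qed

lemma vge_1_iff: "P \<in> pts \<Longrightarrow> vge P f 1 \<longleftrightarrow> val P f 0"
proof
  assume P: "P \<in> pts"
  have t: "unif P (loc P)" using unif_loc P by blast
  { assume "vge P f 1"
    then obtain g where g: "reg P g" "\<forall>\<^sub>F Q in gen. f Q = g Q * loc P Q"
      by (auto simp: vge_def)
    have "val P (\<lambda>Q. g Q * loc P Q) 0" using t val_zero_mult[OF _ g(1)] by (auto simp: unif_def)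
    then show "val P f 0" by (rule val_cong) (use g(2) in \<open>auto elim: eventually_mono\<close>) }
  { assume "val P f 0"
    then show "vge P f 1" using t by (auto simp: unif_def vge_def) }
qed

lemma nonvan_iff: "P \<in> pts \<Longrightarrow> nonvan P f \<longleftrightarrow> f \<in> Kx \<and> ord P f = 0"
proof
  assume P: "P \<in> pts"
  show "f \<in> Kx \<and> ord P f = 0" if "nonvan P f" using that P nonvan_Kx ord_nonvan by blast
  assume f: "f \<in> Kx \<and> ord P f = 0"
  then have "reg P f" "\<not> val P f 0"
    using P by (simp_all add: vge_iff flip: vge_0_iff vge_1_iff)
  then show "nonvan P f" using reg_cases by blast
qed

end

section \<open>Functions with prescribed zeros, and the degree of a principal divisor\<close>

context curve begin

lemma vge_power:
  assumes P: "P \<in> pts" and "vge P f n"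
  shows "vge P (\<lambda>Q. f Q ^ m) (int m * n)"
proof (induction m)
  case 0
  then show ?case using P by (simp add: vge_0_iff reg_const)
next
  case (Suc m)
  from vge_mult[OF P assms(2) this] show ?case by (simp add: algebra_simps)
qed

lemma reg_prod: "P \<in> pts \<Longrightarrow> (\<And>i. i \<in> I \<Longrightarrow> reg P (f i)) \<Longrightarrow> reg P (\<lambda>Q. \<Prod>i\<in>I. f i Q)"
  by (induction I rule: infinite_finite_induct) (auto intro: reg_const reg_mult)

lemma nonvan_prod: "P \<in> pts \<Longrightarrow> (\<And>i. i \<in> I \<Longrightarrow> nonvan P (f i)) \<Longrightarrow> nonvan P (\<lambda>Q. \<Prod>i\<in>I. f i Q)"
  by (induction I rule: infinite_finite_induct) (auto intro: nonvan_const nonvan_mult)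

text \<open>The product over Q in \<open>S - {P}\<close> of N-th powers of functions separating P
  from Q. Each factor is regular on all of \<open>S\<close>, so the other factors cannot lower the
  order N that is reached at Q.\<close>

lemma weak_approximation:
  assumes P: "P \<in> pts" and S: "finite S" "S \<subseteq> pts"
  shows "\<exists>h. nonvan P h \<and> (\<forall>A\<in>S. reg A h) \<and> (\<forall>A\<in>S - {P}. vge A h (int N))"
proof -
  have "\<exists>f. nonvan P f \<and> (\<forall>A\<in>S. reg A f) \<and> val Q f 0" if "Q \<in> S - {P}" for Q
  proof -
    have "Q \<in> pts" "P \<noteq> Q" using that S by auto
    then obtain f c where "\<forall>A\<in>S. \<exists>d. val A f d" "val P f c" "c \<noteq> 0" "val Q f 0"
      using separate[OF P _ _ S] by blast
    then show ?thesis unfolding reg_def nonvan_def by blast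
  qed
  then obtain f where f: "\<And>Q. Q \<in> S - {P} \<Longrightarrow> nonvan P (f Q)"
    "\<And>Q A. Q \<in> S - {P} \<Longrightarrow> A \<in> S \<Longrightarrow> reg A (f Q)" "\<And>Q. Q \<in> S - {P} \<Longrightarrow> val Q (f Q) 0"
    by metis
  define h where "h = (\<lambda>R. \<Prod>Q\<in>S - {P}. f Q R ^ N)"
  have "nonvan P h" unfolding h_def using f P by (intro nonvan_prod nonvan_power) auto
  moreover have "reg A h" if "A \<in> S" for A
    unfolding h_def using f that S by (intro reg_prod reg_power) auto
  moreover have "vge A h (int N)" if A: "A \<in> S - {P}" for A
  proof -
    have Ap: "A \<in> pts" using A S by auto
    have "vge A (f A) 1" using f(3)[OF A] Ap by (simp add: vge_1_iff)
    from vge_power[OF Ap this, of N] have 1: "vge A (\<lambda>R. f A R ^ N) (int N)" by simp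
    have "reg A (\<lambda>R. \<Prod>Q\<in>S - {P} - {A}. f Q R ^ N)"
      using f A Ap by (intro reg_prod reg_power) auto
    then have 2: "vge A (\<lambda>R. \<Prod>Q\<in>S - {P} - {A}. f Q R ^ N) 0" using Ap by (simp add: vge_0_iff)
    have "h = (\<lambda>R. f A R ^ N * (\<Prod>Q\<in>S - {P} - {A}. f Q R ^ N))"
      unfolding h_def using A S(1) by (intro ext prod.remove) auto
    then show ?thesis using vge_mult[OF Ap 1 2] by simp
  qed
  ultimately show ?thesis by blast
qed

lemma vge_bound:
  assumes "finite S" "S \<subseteq> pts" "finite I" "\<And>i. i \<in> I \<Longrightarrow> f i \<in> Kx"
  shows "\<exists>M::nat. \<forall>P\<in>S. \<forall>i\<in>I. vge P (f i) (- int M)"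
proof -
  define M where "M = (\<Sum>(P, i)\<in>S \<times> I. nat \<bar>ord P (f i)\<bar>)"
  have "vge P (f i) (- int M)" if "P \<in> S" "i \<in> I" for P i
  proof -
    have "nat \<bar>ord P (f i)\<bar> \<le> M"
      unfolding M_def using member_le_sum[of "(P, i)" "S \<times> I" "\<lambda>(P, i). nat \<bar>ord P (f i)\<bar>"] that assms by auto
    moreover have "P \<in> pts" using that assms by auto
    ultimately show ?thesis using vge_iff[of P "f i"] assms that by auto
  qed
  then show ?thesis by blast
qed

text \<open>At \<open>P \<in> S\<close> the functions \<open>u (P, j)\<close> have the orders \<open>j < n P\<close>, all other \<open>u (Q, j)\<close> and \<open>x\<close>
  have order at least \<open>n P\<close>; so a linear relation over the rational functions of \<open>x\<close>, reduced modulo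
  \<open>x\<close>, forces its coefficients to vanish.\<close>
lemma independent_family:
  assumes x: "x \<in> Kx" and S: "finite S" "S \<subseteq> pts"
    and n: "\<And>P. P \<in> S \<Longrightarrow> int (n P) \<le> ord P x"
  shows "\<exists>u. u ` Sigma S (\<lambda>P. {..<n P}) \<subseteq> K \<and>
     (\<forall>r. lin_indep gen ({..r::nat} \<times> Sigma S (\<lambda>P. {..<n P})) (\<lambda>(a, j) Q. x Q ^ a * u j Q))"
proof -
  define J where "J = Sigma S (\<lambda>P. {..<n P})"
  have J: "finite J" using S by (auto simp: J_def)
  have locK: "loc P \<in> Kx" if "P \<in> S" for P
    using that S unif_Kx unif_loc by blast
  have "(\<lambda>Q. loc P Q ^ j) \<in> Kx" if "P \<in> S" for P j
    using locK[OF that] by (rule Kx_power)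
  then have "(\<lambda>(P, j) R. loc P R ^ j) i \<in> Kx" if "i \<in> J" for i
    using that by (auto simp: J_def)
  then obtain M :: nat where "\<forall>Q\<in>S. \<forall>i\<in>J. vge Q ((\<lambda>(P, j) R. loc P R ^ j) i) (- int M)"
    using vge_bound[OF S J] by blast
  then have M: "vge Q (\<lambda>R. loc P R ^ j) (- int M)" if "Q \<in> S" "(P, j) \<in> J" for Q P j
    using that by fastforce
  \<comment> \<open>\<open>M\<close> compensates the poles that \<open>loc P ^ j\<close> may have at
    the other points of \<open>S\<close>; the sum dominates every single \<open>n A\<close>, so that
    order \<open>n A\<close> is left over.\<close>
  define N where "N = M + (\<Sum>P\<in>S. n P)"
  obtain h where h: "\<And>P. P \<in> S \<Longrightarrow> nonvan P (h P)" "\<And>P A. P \<in> S \<Longrightarrow> A \<in> S \<Longrightarrow> reg A (h P)"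
    "\<And>P A. P \<in> S \<Longrightarrow> A \<in> S - {P} \<Longrightarrow> vge A (h P) (int N)"
    using weak_approximation[OF _ S, of _ N] S(2) by (metis subsetD)
  define u where "u = (\<lambda>(P, j) R. loc P R ^ j * h P R)"
  have at_other: "vge A (u (P, j)) (int (n A))" if "(P, j) \<in> J" "A \<in> S" "A \<noteq> P" for A P j
  proof -
    have A: "A \<in> pts" using that S by auto
    have "n A \<le> (\<Sum>P\<in>S. n P)" using that S by (intro member_le_sum) auto
    then have "int (n A) \<le> - int M + int N" by (simp add: N_def del: of_nat_sum)
    moreover have "vge A (u (P, j)) (- int M + int N)"
      unfolding u_def prod.case using that h(3) M by (intro vge_mult A) (auto simp: J_def)
    ultimately show ?thesis using vge_mono[OF A] by blast
  qed
  have at_self: "u (P, j) \<in> Kx" "ord P (u (P, j)) = int j" if "P \<in> S" for P j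
  proof -
    have P: "P \<in> pts" using that S by auto
    have "has_ord P (u (P, j)) (int j)"
      unfolding has_ord_iff[OF P] u_def
      using h(1)[OF that] by (intro exI[of _ "h P"]) (simp add: mult.commute)
    then show "ord P (u (P, j)) = int j" by (rule ord_eqI[OF P])
    show "u (P, j) \<in> Kx"
      unfolding u_def prod.case
      by (intro Kx_mult Kx_power locK[OF that] nonvan_Kx[OF P h(1)[OF that]])
  qed
  have at_self_vge: "vge P (u (P, j)) (int m)" if "P \<in> S" "m \<le> j" for P j m
    using vge_iff[OF _ at_self(1)] at_self(2) that S by auto
  have regu: "reg A (u (P, j))" if "(P, j) \<in> J" "A \<in> S" for A P j
  proof -
    have A: "A \<in> pts" using that S by auto
    have "vge A (u (P, j)) 0"
    proof (cases "A = P")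
      case True
      then show ?thesis using at_self_vge[of P 0 j] that by simp
    next
      case False
      then show ?thesis using at_other[OF that] vge_mono[OF A, of _ "int (n A)" 0] by simp
    qed
    then show ?thesis using A by (simp add: vge_0_iff)
  qed
  have "lin_indep gen ({..r} \<times> J) (\<lambda>(a, j) Q. x Q ^ a * u j Q)" for r
    unfolding lin_indep_def
  proof (intro allI impI, rule ccontr)
    fix c assume ev: "\<forall>\<^sub>F Q in gen. (\<Sum>i\<in>{..r} \<times> J. c i * (case i of (a, j) \<Rightarrow> \<lambda>Q. x Q ^ a * u j Q) Q) = 0"
      and "\<not> (\<forall>i\<in>{..r} \<times> J. c i = 0)"
    then obtain a' j' where a': "a' \<le> r" "j' \<in> J" "c (a', j') \<noteq> 0" by auto
    \<comment> \<open>The lowest power of \<open>x\<close> with a nonzero coefficient, and below it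
      P is a point where such a coefficient sits. After division by \<open>x ^ k\<close>, the terms
      with \<open>a > k\<close> are \<open>x\<close> times a function regular at P, hence of order
      at least \<open>n P\<close> there.\<close>
    define k where "k = (LEAST a. \<exists>j\<in>J. c (a, j) \<noteq> 0)"
    have "\<exists>j\<in>J. c (k, j) \<noteq> 0" unfolding k_def by (rule LeastI) (use a' in auto)
    then obtain P i where Pi: "(P, i) \<in> J" "c (k, (P, i)) \<noteq> 0" by auto
    have "k \<le> a'" unfolding k_def by (rule Least_le) (use a' in auto)
    with a' have kr: "k \<le> r" by simp
    have below_k: "c (a, j) = 0" if "a < k" "j \<in> J" for a j
      using not_less_Least[OF that(1)[unfolded k_def]] that by blast
    \<comment> \<open>The lowest index at P with a nonzero coefficient: \<open>u (P, l)\<close> has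
      order exactly l at P, while all other terms have order at least l + 1, as
      \<open>l < n P\<close>.\<close>
    define l where "l = (LEAST i. i < n P \<and> c (k, (P, i)) \<noteq> 0)"
    have "l < n P \<and> c (k, (P, l)) \<noteq> 0"
      unfolding l_def by (rule LeastI[of _ i]) (use Pi in \<open>auto simp: J_def\<close>)
    then have l: "(P, l) \<in> J" "c (k, (P, l)) \<noteq> 0" "l < n P" using Pi by (auto simp: J_def)
    have below_l: "c (k, (P, i)) = 0" if "i < l" for i
      using not_less_Least[OF that[unfolded l_def]] that l by auto
    have PS: "P \<in> S" using Pi by (auto simp: J_def)
    then have P: "P \<in> pts" using S by auto
    define T where "T = (\<lambda>a Q. \<Sum>j\<in>J. c (a, j) * u j Q)"
    define w where "w = (\<lambda>Q. \<Sum>a\<in>{k<..r}. x Q ^ (a - k - 1) * T a Q)"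
    have "int (n P) \<le> ord P x" using n PS by blast
    then have x_vge: "vge P x (int (n P))" using vge_iff[OF P x] by simp
    then have "vge P x 0" using vge_mono[OF P] by force
    then have reg_x: "reg P x" using P by (simp add: vge_0_iff)
    have "reg P (T a)" for a
      unfolding T_def using P regu PS by (intro reg_sum reg_mult reg_const) auto
    then have "reg P w"
      unfolding w_def using P reg_x by (intro reg_sum reg_mult reg_power) auto
    then have "vge P w 0" using P by (simp add: vge_0_iff)
    from vge_mult[OF P x_vge this] have xw: "vge P (\<lambda>Q. x Q * w Q) (int (n P))" by simp
    have eq: "\<forall>\<^sub>F Q in gen. c (k, (P, l)) * u (P, l) Q =
       (-1) * (x Q * w Q) + (-1) * (\<Sum>j\<in>J - {(P, l)}. c (k, j) * u j Q)"
      using ev Kx_ev[OF x]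
    proof eventually_elim
      case (elim Q)
      have "(\<Sum>a\<le>r. x Q ^ a * T a Q) = 0"
        using elim(1) by (simp add: T_def sum_distrib_left sum.cartesian_product case_prod_unfold mult_ac)
      moreover have "(\<Sum>a\<le>r. x Q ^ a * T a Q) = x Q ^ k * (T k Q + x Q * w Q)"
        unfolding w_def by (rule sum_powers_split[OF kr]) (simp add: T_def below_k)
      ultimately have "T k Q + x Q * w Q = 0" using elim(2) by simp
      moreover have "T k Q = c (k, (P, l)) * u (P, l) Q + (\<Sum>j\<in>J - {(P, l)}. c (k, j) * u j Q)"
        unfolding T_def using J l(1) by (rule sum.remove)
      ultimately show ?case by (simp add: eq_neg_iff_add_eq_0 algebra_simps)
    qed
    have "vge P (\<lambda>Q. \<Sum>j\<in>J - {(P, l)}. c (k, j) * u j Q) (int (Suc l))"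
    proof (rule vge_sum[OF P])
      fix j assume j: "j \<in> J - {(P, l)}"
      obtain A i where Ai: "j = (A, i)" by fastforce
      show "vge P (\<lambda>Q. c (k, j) * u j Q) (int (Suc l))"
      proof (cases "A = P")
        case False
        then have "vge P (u j) (int (n P))" using at_other[of A i P] j Ai PS by auto
        then have "vge P (u j) (int (Suc l))" by (rule vge_mono[OF P]) (use l in simp)
        then show ?thesis by (rule vge_const_mult[OF P])
      next
        case True
        show ?thesis
        proof (cases "i < l")
          case i: True
          then show ?thesis using below_l True Ai P by (intro vge_zero) auto
        next
          case False
          then have "Suc l \<le> i" using j Ai True by auto
          from at_self_vge[OF PS this] show ?thesis
            unfolding Ai True by (rule vge_const_mult[OF P])
        qed
      qed
    qed
    moreover have "vge P (\<lambda>Q. x Q * w Q) (int (Suc l))"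
      by (rule vge_mono[OF P xw]) (use l in simp)
    ultimately have "vge P (\<lambda>Q. (-1) * (x Q * w Q) + (-1) * (\<Sum>j\<in>J - {(P, l)}. c (k, j) * u j Q)) (int (Suc l))"
      by (intro vge_add vge_const_mult P)
    then have "vge P (\<lambda>Q. c (k, (P, l)) * u (P, l) Q) (int (Suc l))"
      by (rule vge_cong) (use eq in \<open>auto elim: eventually_mono\<close>)
    moreover have "ord P (\<lambda>Q. c (k, (P, l)) * u (P, l) Q) = int l"
      using ord_mult[OF P Kx_const[OF l(2)] at_self(1)[OF PS]] ord_nonvan[OF P nonvan_const[OF P l(2)]]
        at_self(2)[OF PS] by simp
    ultimately show False
      using vge_iff[OF P Kx_mult[OF Kx_const[OF l(2)] at_self(1)[OF PS]]] by simp
  qed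
  moreover have "u ` J \<subseteq> K" using at_self(1) KxK by (auto simp: J_def)
  ultimately show ?thesis unfolding J_def by blast
qed

lemma ord_const: "P \<in> pts \<Longrightarrow> f \<in> Kx \<Longrightarrow> \<forall>\<^sub>F Q in gen. f Q = c \<Longrightarrow> ord P f = 0"
proof -
  assume P: "P \<in> pts" and f: "f \<in> Kx" and c: "\<forall>\<^sub>F Q in gen. f Q = c"
  have "c \<noteq> 0" using c Kx_ev[OF f] ev_contr by blast
  then show ?thesis using ord_cong[OF c] ord_nonvan[OF P nonvan_const[OF P]] by simp
qed

text \<open>With \<open>n P = 1\<close>, every finite set of zeros of a nonconstant x gives equally
  many functions independent over k(x), and their number is bounded by \<open>finite_type\<close>. A
  nonzero constant has no zeros.\<close>

lemma finite_zeros: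
  assumes x: "x \<in> Kx"
  shows "finite {P \<in> pts. ord P x > 0}"
proof (cases "\<exists>c. \<forall>\<^sub>F Q in gen. x Q = c")
  case True
  then have "{P \<in> pts. ord P x > 0} = {}" using ord_const[OF _ x] by auto
  then show ?thesis by (simp only: finite.emptyI)
next
  case False
  then have nc: "\<And>c. \<not> (\<forall>\<^sub>F Q in gen. x Q = c)" by blast
  from finite_type[OF KxK[OF x] nc]
  obtain e where e: "\<forall>I (u :: 'p \<times> nat \<Rightarrow> 'p \<Rightarrow> 'k). finite I \<longrightarrow> u ` I \<subseteq> K \<longrightarrow>
    (\<forall>r. lin_indep gen ({..r::nat} \<times> I) (\<lambda>(a, i) Q. x Q ^ a * u i Q)) \<longrightarrow> card I \<le> e" ..
  show ?thesis
  proof (rule ccontr)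
    assume "infinite {P \<in> pts. ord P x > 0}"
    from infinite_arbitrarily_large[OF this, of "Suc e"]
    obtain S where S: "S \<subseteq> {P \<in> pts. ord P x > 0}" "finite S" "card S = Suc e"
      by (elim exE conjE)
    have Sp: "S \<subseteq> pts" using S(1) by (rule subset_trans) simp
    have ord1: "int 1 \<le> ord P x" if "P \<in> S" for P
    proof -
      have "P \<in> {P \<in> pts. ord P x > 0}" by (rule subsetD[OF S(1) that])
      then have "P \<in> pts \<and> ord P x > 0" by (rule CollectD)
      then show ?thesis by linarith
    qed
    have "\<exists>u. u ` Sigma S (\<lambda>P. {..<1::nat}) \<subseteq> K \<and>
      (\<forall>r. lin_indep gen ({..r::nat} \<times> Sigma S (\<lambda>P. {..<1::nat})) (\<lambda>(a, j) Q. x Q ^ a * u j Q))"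
      by (rule independent_family[OF x S(2) Sp]) (rule ord1)
    then obtain u where u: "u ` Sigma S (\<lambda>P. {..<1::nat}) \<subseteq> K"
      "\<forall>r. lin_indep gen ({..r::nat} \<times> Sigma S (\<lambda>P. {..<1::nat})) (\<lambda>(a, j) Q. x Q ^ a * u j Q)"
      by blast
    have "card (Sigma S (\<lambda>P. {..<1::nat})) \<le> e"
      by (rule e[rule_format, OF finite_SigmaI u(1) spec[OF u(2)]]) (simp_all only: S(2) finite_lessThan)
    then show False by (simp add: card_SigmaI[OF S(2)] S(3))
  qed
qed

lemma finite_support:
  assumes x: "x \<in> Kx"
  shows "finite {P \<in> pts. ord P x \<noteq> 0}"
proof -
  have "{P \<in> pts. ord P x \<noteq> 0} = {P \<in> pts. ord P x > 0} \<union> {P \<in> pts. ord P (\<lambda>Q. inverse (x Q)) > 0}"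
    using ord_inverse[OF _ x] by auto
  then show ?thesis using finite_zeros[OF x] finite_zeros[OF Kx_inverse[OF x]] by simp
qed

text \<open>This is \<open>l(A) \<le> deg A + 1\<close> for an effective divisor \<open>A\<close> supported in \<open>S\<close>.\<close>
lemma card_le_degree:
  assumes "finite S" "S \<subseteq> pts" "\<And>P. P \<in> pts - S \<Longrightarrow> A P = 0"
    and "finite I" "lin_indep gen I u"
    and "\<And>i P. i \<in> I \<Longrightarrow> P \<in> pts \<Longrightarrow> vge P (u i) (- int (A P))"
    and "\<And>i. i \<in> I \<Longrightarrow> u i \<in> K"
  shows "card I \<le> (\<Sum>P\<in>S. A P) + 1"
  using assms(3-)
proof (induction "\<Sum>P\<in>S. A P" arbitrary: A I u)
  case 0
  then have A: "A P = 0" if "P \<in> pts" for P using that assms(1) by (cases "P \<in> S") auto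
  have "\<exists>c. \<forall>\<^sub>F Q in gen. u i Q = c" if "i \<in> I" for i
  proof (rule proper)
    show "u i \<in> K" using 0 that by blast
    show "\<exists>c. val P (u i) c" if P: "P \<in> pts" for P
      using 0(5)[OF \<open>i \<in> I\<close> P] A[OF P] P by (simp add: vge_0_iff reg_def)
  qed
  then obtain c where "\<And>i. i \<in> I \<Longrightarrow> \<forall>\<^sub>F Q in gen. u i Q = c i" by metis
  \<comment> \<open>Functions without poles are constants, so the function 1 spans all of them; this
    is the + 1 of the bound.\<close>
  then have "card I \<le> card {()}"
    using 0 by (intro lin_indep_card_le_span[where a = "\<lambda>i _. c i" and b = "\<lambda>_ _. 1" and F = gen and u = u]) auto
  then show ?case by simp
next
  case (Suc m)
  then have "(\<Sum>P\<in>S. A P) \<noteq> 0" by simp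
  then obtain P where PS: "P \<in> S" and AP: "A P \<noteq> 0" by (metis sum.neutral)
  have P: "P \<in> pts" using PS assms by auto
  define A' where "A' = A(P := A P - 1)"
  have sumA': "(\<Sum>P\<in>S. A' P) = m"
  proof -
    have "(\<Sum>P\<in>S. A P) = A P + (\<Sum>Q\<in>S - {P}. A Q)" using PS assms by (simp add: sum.remove)
    moreover have "(\<Sum>P\<in>S. A' P) = A' P + (\<Sum>Q\<in>S - {P}. A' Q)" using PS assms by (simp add: sum.remove)
    moreover have "(\<Sum>Q\<in>S - {P}. A' Q) = (\<Sum>Q\<in>S - {P}. A Q)"
      by (rule sum.cong) (auto simp: A'_def)
    ultimately show ?thesis using AP Suc(2) by (simp add: A'_def)
  qed
  have A'0: "A' Q = 0" if "Q \<in> pts - S" for Q using Suc.prems(1)[OF that] that PS by (auto simp: A'_def)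
  have "\<exists>l g. val P g l \<and> (\<forall>\<^sub>F Q in gen. u i Q = g Q * loc P Q powi (- int (A P)))" if "i \<in> I" for i
    using Suc.prems(4)[OF that P] unfolding vge_def reg_def by blast
  \<comment> \<open>\<open>l i\<close> is the leading coefficient of \<open>u i\<close> at P
    relative to the largest pole order \<open>A P\<close> allowed there.\<close>
  then obtain l g where g: "\<And>i. i \<in> I \<Longrightarrow> val P (g i) (l i)"
    "\<And>i. i \<in> I \<Longrightarrow> \<forall>\<^sub>F Q in gen. u i Q = g i Q * loc P Q powi (- int (A P))"
    by metis
  have A'vge: "vge Q f (- int (A' Q))" if "val P h 0"
    "\<forall>\<^sub>F Q in gen. f Q = h Q * loc P Q powi (- int (A P))"
    "\<And>Q. Q \<in> pts \<Longrightarrow> vge Q f (- int (A Q))" "Q \<in> pts" for f h Q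
  proof (cases "Q = P")
    case True
    have "vge P (\<lambda>Q. loc P Q powi (- int (A P))) (- int (A P))"
      unfolding vge_def using reg_const[OF P, of 1] by (intro exI[of _ "\<lambda>_. 1"]) auto
    moreover have "vge P h 1" using that P by (simp add: vge_1_iff)
    ultimately have "vge P (\<lambda>Q. h Q * loc P Q powi (- int (A P))) (1 + (- int (A P)))"
      by (intro vge_mult P)
    then have "vge P f (1 + (- int (A P)))"
      by (rule vge_cong) (use that in \<open>auto elim: eventually_mono\<close>)
    moreover have "1 + (- int (A P)) = - int (A' P)" using AP by (simp add: A'_def)
    ultimately show ?thesis using True by simp
  next
    case False
    then show ?thesis using that by (simp add: A'_def)
  qed
  show ?case
  \<comment> \<open>If all leading coefficients vanish, the bound at P drops by one and all of
    \<open>I\<close> is kept. Otherwise multiples of \<open>u k\<close> cancel the leading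
    coefficients of the others, and only \<open>u k\<close> is lost.\<close>
  proof (cases "\<forall>i\<in>I. l i = 0")
    case True
    have "card I \<le> (\<Sum>P\<in>S. A' P) + 1"
    proof (rule Suc.hyps(1))
      fix i Q assume i: "i \<in> I" "Q \<in> pts"
      show "vge Q (u i) (- int (A' Q))"
        by (rule A'vge[OF _ g(2)[OF i(1)]]) (use Suc.prems i g(1)[OF i(1)] True in auto)
    qed (use Suc.prems sumA' A'0 in auto)
    then show ?thesis using sumA' Suc(2) by simp
  next
    case False
    then obtain k where k: "k \<in> I" "l k \<noteq> 0" by auto
    define r where "r = (\<lambda>i. l i / l k)"
    have "card (I - {k}) \<le> (\<Sum>P\<in>S. A' P) + 1"
    proof (rule Suc.hyps(1)[of _ "I - {k}" "\<lambda>i Q. u i Q - r i * u k Q"])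
      show "lin_indep gen (I - {k}) (\<lambda>i Q. u i Q - r i * u k Q)"
        by (rule lin_indep_eliminate) (use k Suc.prems in auto)
      fix i assume i: "i \<in> I - {k}"
      then have iI: "i \<in> I" by auto
      show "(\<lambda>Q. u i Q - r i * u k Q) \<in> K"
        using Suc.prems(5)[OF iI] Suc.prems(5)[OF k(1)] by (intro K_diff K_mult K_const)
      fix Q assume Q: "Q \<in> pts"
      show "vge Q (\<lambda>Q. u i Q - r i * u k Q) (- int (A' Q))"
      proof (rule A'vge[OF _ _ _ Q])
        have "val P (\<lambda>Q. g i Q + (- r i) * g k Q) (l i + (- r i) * l k)"
          by (intro val_add val_mult val_const g iI k P)
        then show "val P (\<lambda>Q. g i Q + (- r i) * g k Q) 0" using k by (simp add: r_def)
        from g(2)[OF iI] g(2)[OF k(1)]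
        show "\<forall>\<^sub>F Q in gen. u i Q - r i * u k Q = (g i Q + (- r i) * g k Q) * loc P Q powi (- int (A P))"
          by eventually_elim (simp add: algebra_simps)
        fix Q assume Q: "Q \<in> pts"
        have "vge Q (\<lambda>Q. u i Q + (- r i) * u k Q) (- int (A Q))"
          by (intro vge_add vge_const_mult Suc.prems iI k Q)
        then show "vge Q (\<lambda>Q. u i Q - r i * u k Q) (- int (A Q))" by simp
      qed
    qed (use Suc.prems sumA' A'0 in auto)
    then show ?thesis using sumA' Suc(2) k Suc.prems(2) by (simp add: card_Diff_singleton)
  qed
qed

lemma zeros_le_poles:
  assumes x: "x \<in> Kx"
  shows "(\<Sum>P\<in>{P \<in> pts. ord P x \<noteq> 0}. nat (ord P x)) \<le> (\<Sum>P\<in>{P \<in> pts. ord P x \<noteq> 0}. nat (- ord P x))"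
proof -
  define S where "S = {P \<in> pts. ord P x \<noteq> 0}"
  define n where "n = (\<lambda>P. nat (ord P x))"
  define b where "b = (\<lambda>P. nat (- ord P x))"
  define Z where "Z = {P \<in> pts. ord P x > 0}"
  have S: "finite S" unfolding S_def using finite_support[OF x] .
  have Z: "finite Z" "Z \<subseteq> pts" unfolding Z_def using finite_zeros[OF x] by auto
  define J where "J = Sigma Z (\<lambda>P. {..<n P})"
  have J: "finite J" using Z by (auto simp: J_def)
  obtain u where u: "u ` J \<subseteq> K" "\<And>r. lin_indep gen ({..r::nat} \<times> J) (\<lambda>(a, j) Q. x Q ^ a * u j Q)"
    using independent_family[OF x Z, of n] unfolding J_def n_def Z_def by auto
  \<comment> \<open>\<open>ord\<close> has no meaning for a generically zero function, so the pole
    bound \<open>A\<close> is summed over the nonzero members.\<close>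
  define J' where "J' = {j \<in> J. u j \<in> Kx}"
  define A where "A = (\<lambda>P. \<Sum>j\<in>J'. nat (- ord P (u j)))"
  define S' where "S' = S \<union> (\<Union>j\<in>J'. {P \<in> pts. ord P (u j) \<noteq> 0})"
  have S': "finite S'" "S' \<subseteq> pts" unfolding S'_def using S J finite_support by (auto simp: J'_def S_def)
  have vgeA: "vge P (u j) (- int (A P))" if j: "j \<in> J" and P: "P \<in> pts" for j P
  proof (cases "u j \<in> Kx")
    case True
    have "finite J'" using J by (simp add: J'_def)
    then have "nat (- ord P (u j)) \<le> A P"
      unfolding A_def using True j member_le_sum[of j J' "\<lambda>j. nat (- ord P (u j))"] by (auto simp: J'_def)
    then show ?thesis using vge_iff[OF P True] by auto
  next
    case False
    then show ?thesis using u(1) j K_zero Kx_iff vge_zero[OF P] by blast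
  qed
  have bound: "Suc r * card J \<le> r * (\<Sum>P\<in>S. b P) + (\<Sum>P\<in>S'. A P) + 1" for r
  proof -
    have "card ({..r} \<times> J) \<le> (\<Sum>P\<in>S'. r * b P + A P) + 1"
    proof (rule card_le_degree[OF S' _ _ u(2)])
      show "r * b P + A P = 0" if "P \<in> pts - S'" for P
        using that by (auto simp: S'_def S_def b_def A_def)
      fix i P assume i: "i \<in> {..r} \<times> J" and P: "P \<in> pts"
      obtain a j where aj: "i = (a, j)" "a \<le> r" "j \<in> J" using i by auto
      have "vge P x (- int (b P))" using vge_iff[OF P x] by (simp add: b_def)
      from vge_power[OF P this, of a] have "vge P (\<lambda>Q. x Q ^ a) (int a * (- int (b P)))" .
      from vge_mult[OF P this vgeA[OF aj(3) P]]
      have "vge P (\<lambda>Q. x Q ^ a * u j Q) (int a * (- int (b P)) + (- int (A P)))" .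
      then have "vge P (\<lambda>Q. x Q ^ a * u j Q) (- int (r * b P + A P))"
        by (rule vge_mono[OF P]) (use aj(2) in \<open>simp add: mult_right_mono\<close>)
      then show "vge P (case i of (a, j) \<Rightarrow> \<lambda>Q. x Q ^ a * u j Q) (- int (r * b P + A P))"
        by (simp add: aj)
    next
      fix i assume "i \<in> {..r} \<times> J"
      then show "(case i of (a, j) \<Rightarrow> \<lambda>Q. x Q ^ a * u j Q) \<in> K"
        using u(1) by (cases i) (simp add: image_subset_iff K_mult K_power KxK[OF x])
    qed (use J in auto)
    moreover have "(\<Sum>P\<in>S'. b P) = (\<Sum>P\<in>S. b P)"
      by (rule sum.mono_neutral_right) (use S' in \<open>auto simp: S'_def S_def b_def\<close>)
    ultimately show ?thesis by (simp add: sum.distrib card_cartesian_product flip: sum_distrib_left)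
  qed
  have "card J \<le> (\<Sum>P\<in>S. b P)"
  proof (rule ccontr)
    assume "\<not> card J \<le> (\<Sum>P\<in>S. b P)"
    then have "Suc (\<Sum>P\<in>S. b P) \<le> card J" by simp
    \<comment> \<open>The bound is used with r one larger than the degree a of \<open>A\<close>. If
      \<open>card J\<close> exceeded the degree b of the polar divisor, then (r + 1)(b + 1) would be
      at most r b + a + 1, that is, r + b at most a.\<close>
    then have "Suc (Suc (\<Sum>P\<in>S'. A P)) * Suc (\<Sum>P\<in>S. b P) \<le> Suc (Suc (\<Sum>P\<in>S'. A P)) * card J"
      by (rule mult_le_mono2)
    also note bound[of "Suc (\<Sum>P\<in>S'. A P)"]
    finally show False by (simp add: algebra_simps)
  qed
  moreover have "card J = (\<Sum>P\<in>S. n P)"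
  proof -
    have "card J = (\<Sum>P\<in>Z. n P)" using Z by (simp add: J_def card_SigmaI)
    also have "\<dots> = (\<Sum>P\<in>S. n P)"
    proof (rule sum.mono_neutral_left[OF S])
      show "Z \<subseteq> S" unfolding Z_def S_def by force
      show "\<forall>P\<in>S - Z. n P = 0" by (simp add: Z_def S_def n_def not_less)
    qed
    finally show ?thesis .
  qed
  ultimately show ?thesis by (simp add: S_def n_def b_def)
qed

theorem degree_zero:
  assumes x: "x \<in> Kx"
  shows "(\<Sum>P\<in>{P \<in> pts. ord P x \<noteq> 0}. ord P x) = 0"
proof -
  define S where "S = {P \<in> pts. ord P x \<noteq> 0}"
  have le1: "(\<Sum>P\<in>S. nat (ord P x)) \<le> (\<Sum>P\<in>S. nat (- ord P x))"
    using zeros_le_poles[OF x] by (simp add: S_def)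
  have "{P \<in> pts. ord P (\<lambda>Q. inverse (x Q)) \<noteq> 0} = S"
    using ord_inverse[OF _ x] by (auto simp: S_def)
  then have le2: "(\<Sum>P\<in>S. nat (- ord P x)) \<le> (\<Sum>P\<in>S. nat (ord P x))"
    using zeros_le_poles[OF Kx_inverse[OF x]] ord_inverse[OF _ x] by (simp add: S_def)
  have "(\<Sum>P\<in>S. ord P x) = (\<Sum>P\<in>S. int (nat (ord P x)) - int (nat (- ord P x)))"
    by (rule sum.cong) auto
  also have "\<dots> = int (\<Sum>P\<in>S. nat (ord P x)) - int (\<Sum>P\<in>S. nat (- ord P x))"
    by (simp add: sum_subtractf)
  also have "\<dots> = 0" using le1 le2 by simp
  finally show ?thesis by (simp add: S_def)
qed

theorem constant_if_ord_zero:
  assumes x: "x \<in> Kx" and "\<And>P. P \<in> pts \<Longrightarrow> ord P x = 0"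
  shows "\<exists>c. c \<noteq> 0 \<and> (\<forall>\<^sub>F Q in gen. x Q = c)"
proof -
  have "\<exists>c. \<forall>\<^sub>F Q in gen. x Q = c"
  proof (rule proper[OF KxK[OF x]])
    fix P assume "P \<in> pts"
    then have "nonvan P x" using assms nonvan_iff by simp
    then show "\<exists>c. val P x c" by (auto simp: nonvan_def)
  qed
  then obtain c where c: "\<forall>\<^sub>F Q in gen. x Q = c" by blast
  moreover have "c \<noteq> 0" using c Kx_ev[OF x] ev_contr by blast
  ultimately show ?thesis by blast
qed

end

section \<open>Places\<close>

lemma power_fun_apply: "(f ^ n) x = (f x :: 'b::comm_semiring_1) ^ n"
  by (induction n) simp_all

lemma sum_fun_apply: "(\<Sum>i\<in>I. f i) x = (\<Sum>i\<in>I. f i x :: 'b::comm_monoid_add)"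
  by (induction I rule: infinite_finite_induct) simp_all

text \<open>Coefficients are functions here, with pointwise ring operations. The sum runs up to the
  degree over the ring of functions; at a given s the top coefficients may vanish.\<close>

lemma poly_fun_apply:
  "poly A Y s = (\<Sum>i\<le>Polynomial.degree A. Polynomial.coeff A i s * (Y s :: 'b::comm_ring_1) ^ i)"
  by (simp add: poly_altdef sum_fun_apply power_fun_apply)

locale alg_closed_function_model = function_model gen K
  for gen :: "'p filter" and K :: "('p \<Rightarrow> 'k::alg_closed_field) set"
begin

text \<open>
  A subring of the field together with a homomorphism to the constants is encoded as a ring of
  functions on one more point, \<open>None\<close>, at which the homomorphism is evaluated.
\<close>

definition ext_gen :: "'p option filter" where
  "ext_gen = sup (filtermap Some gen) (principal {None})"

lemma eventually_ext_gen:
  "eventually R ext_gen \<longleftrightarrow> (\<forall>\<^sub>F Q in gen. R (Some Q)) \<and> R None"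
  by (simp add: ext_gen_def eventually_sup eventually_filtermap eventually_principal)

text \<open>The last clause makes the homomorphism well defined on germs: with additivity, the value
  at \<open>None\<close> is determined by the values at the generic points.\<close>

definition hom_ring :: "('p option \<Rightarrow> 'k) set \<Rightarrow> bool" where
  "hom_ring \<Gamma> \<longleftrightarrow> (\<forall>f\<in>\<Gamma>. f \<circ> Some \<in> K) \<and> (\<forall>c. (\<lambda>_. c) \<in> \<Gamma>) \<and>
     (\<forall>f\<in>\<Gamma>. \<forall>g\<in>\<Gamma>. f + g \<in> \<Gamma> \<and> f * g \<in> \<Gamma>) \<and>
     (\<forall>f\<in>\<Gamma>. \<forall>g. (\<forall>\<^sub>F s in ext_gen. f s = g s) \<longrightarrow> g \<in> \<Gamma>) \<and>
     (\<forall>f\<in>\<Gamma>. (\<forall>\<^sub>F Q in gen. f (Some Q) = 0) \<longrightarrow> f None = 0)"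

context
  fixes \<Gamma> assumes \<Gamma>: "hom_ring \<Gamma>"
begin

lemma hom_ring_K: "f \<in> \<Gamma> \<Longrightarrow> (\<lambda>Q. f (Some Q)) \<in> K"
  and hom_ring_const: "(\<lambda>_. c) \<in> \<Gamma>"
  and hom_ring_add: "f \<in> \<Gamma> \<Longrightarrow> g \<in> \<Gamma> \<Longrightarrow> f + g \<in> \<Gamma>"
  and hom_ring_mult: "f \<in> \<Gamma> \<Longrightarrow> g \<in> \<Gamma> \<Longrightarrow> f * g \<in> \<Gamma>"
  and hom_ring_cong: "f \<in> \<Gamma> \<Longrightarrow> \<forall>\<^sub>F s in ext_gen. f s = g s \<Longrightarrow> g \<in> \<Gamma>"
  and hom_ring_zero: "f \<in> \<Gamma> \<Longrightarrow> \<forall>\<^sub>F Q in gen. f (Some Q) = 0 \<Longrightarrow> f None = 0"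
  using \<Gamma> unfolding hom_ring_def o_def by blast+

lemma hom_ring_0: "0 \<in> \<Gamma>" and hom_ring_1: "1 \<in> \<Gamma>"
  using hom_ring_const[of 0] hom_ring_const[of 1] by (simp_all add: zero_fun_def one_fun_def)

lemma hom_ring_uminus: "f \<in> \<Gamma> \<Longrightarrow> - f \<in> \<Gamma>"
  using hom_ring_mult[OF hom_ring_const[of "- 1"], of f] by (simp add: times_fun_def fun_Compl_def)

lemma hom_ring_diff: "f \<in> \<Gamma> \<Longrightarrow> g \<in> \<Gamma> \<Longrightarrow> f - g \<in> \<Gamma>"
  using hom_ring_add[OF _ hom_ring_uminus, of f g] by simp

lemma hom_ring_power: "f \<in> \<Gamma> \<Longrightarrow> f ^ n \<in> \<Gamma>"
  by (induction n) (simp_all add: hom_ring_1 hom_ring_mult)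

lemma hom_ring_sum: "(\<And>i. i \<in> I \<Longrightarrow> f i \<in> \<Gamma>) \<Longrightarrow> (\<Sum>i\<in>I. f i) \<in> \<Gamma>"
  by (induction I rule: infinite_finite_induct) (simp_all add: hom_ring_0 hom_ring_add)

end

text \<open>Localization: a fraction b / a^n receives the value of b divided by the n-th power of
  the value of a. In a maximal pair, therefore, everything outside the kernel is invertible.\<close>

lemma hom_ring_extend_inverse:
  assumes \<Gamma>: "hom_ring \<Gamma>" and a: "a \<in> \<Gamma>" "a None \<noteq> 0"
  shows "\<exists>\<Gamma>'. hom_ring \<Gamma>' \<and> \<Gamma> \<subseteq> \<Gamma>' \<and> (\<lambda>s. inverse (a s)) \<in> \<Gamma>'"
proof -
  define \<Gamma>' where "\<Gamma>' = {g. \<exists>b\<in>\<Gamma>. \<exists>n. \<forall>\<^sub>F s in ext_gen. g s * a s ^ n = b s}"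
  have "\<not> (\<forall>\<^sub>F Q in gen. a (Some Q) = 0)" using hom_ring_zero[OF \<Gamma> a(1)] a(2) by blast
  then have a_ev: "\<forall>\<^sub>F Q in gen. a (Some Q) \<noteq> 0" using K_zero[OF hom_ring_K[OF \<Gamma> a(1)]] by blast
  then have a_ne: "\<forall>\<^sub>F s in ext_gen. a s \<noteq> 0" using a by (simp add: eventually_ext_gen)
  have aK: "(\<lambda>Q. inverse (a (Some Q)) ^ n) \<in> K" for n
    by (intro K_power K_inverse hom_ring_K[OF \<Gamma> a(1)])
  have "hom_ring \<Gamma>'"
    unfolding hom_ring_def
  proof (intro conjI ballI allI impI)
    show "(\<lambda>_. c) \<in> \<Gamma>'" for c
      unfolding \<Gamma>'_def using hom_ring_const[OF \<Gamma>, of c]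
      by (intro CollectI bexI[of _ "\<lambda>_. c"] exI[of _ 0]) simp_all
  next
    fix f assume "f \<in> \<Gamma>'"
    then obtain b n where b: "b \<in> \<Gamma>" "\<forall>\<^sub>F s in ext_gen. f s * a s ^ n = b s" by (auto simp: \<Gamma>'_def)
    have ev: "\<forall>\<^sub>F Q in gen. f (Some Q) * a (Some Q) ^ n = b (Some Q)" "f None * a None ^ n = b None"
      using b(2) by (simp_all add: eventually_ext_gen)
    have bK: "(\<lambda>Q. b (Some Q) * inverse (a (Some Q)) ^ n) \<in> K"
      by (intro K_mult aK hom_ring_K[OF \<Gamma> b(1)])
    have "\<forall>\<^sub>F Q in gen. b (Some Q) * inverse (a (Some Q)) ^ n = f (Some Q)"
      using ev(1) a_ev by eventually_elim (simp add: field_simps)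
    from K_cong[OF bK this] show "f \<circ> Some \<in> K" by (simp add: o_def)
    { assume "\<forall>\<^sub>F Q in gen. f (Some Q) = 0"
      with ev(1) have "\<forall>\<^sub>F Q in gen. b (Some Q) = 0" by eventually_elim simp
      then have "b None = 0" using hom_ring_zero[OF \<Gamma> b(1)] by blast
      then show "f None = 0" using ev(2) a by auto }
    { fix g assume "\<forall>\<^sub>F s in ext_gen. f s = g s"
      with b(2) have "\<forall>\<^sub>F s in ext_gen. g s * a s ^ n = b s" by eventually_elim simp
      then show "g \<in> \<Gamma>'" using b(1) unfolding \<Gamma>'_def by blast }
    fix g assume "g \<in> \<Gamma>'"
    then obtain c m where c: "c \<in> \<Gamma>" "\<forall>\<^sub>F s in ext_gen. g s * a s ^ m = c s" by (auto simp: \<Gamma>'_def)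
    have "\<forall>\<^sub>F s in ext_gen. (f + g) s * a s ^ (n + m) = (b * a ^ m + c * a ^ n) s"
      using b(2) c(2) a_ne by eventually_elim (simp add: power_fun_apply field_simps power_add)
    moreover have "b * a ^ m + c * a ^ n \<in> \<Gamma>"
      by (intro hom_ring_add[OF \<Gamma>] hom_ring_mult[OF \<Gamma>] hom_ring_power[OF \<Gamma>] a b c)
    ultimately show "f + g \<in> \<Gamma>'" unfolding \<Gamma>'_def by blast
    have "\<forall>\<^sub>F s in ext_gen. (f * g) s * a s ^ (n + m) = (b * c) s"
      using b(2) c(2)
    proof eventually_elim
      case (elim s)
      have "(f * g) s * a s ^ (n + m) = (f s * a s ^ n) * (g s * a s ^ m)"
        by (simp add: power_add mult_ac)
      then show ?case by (simp add: elim)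
    qed
    moreover have "b * c \<in> \<Gamma>" by (intro hom_ring_mult[OF \<Gamma>] b c)
    ultimately show "f * g \<in> \<Gamma>'" unfolding \<Gamma>'_def by blast
  qed
  moreover have "\<Gamma> \<subseteq> \<Gamma>'"
  proof
    fix f assume "f \<in> \<Gamma>"
    then show "f \<in> \<Gamma>'" unfolding \<Gamma>'_def by (intro CollectI bexI[of _ f] exI[of _ 0]) simp_all
  qed
  moreover have "(\<lambda>s. inverse (a s)) \<in> \<Gamma>'"
  proof -
    have "\<forall>\<^sub>F s in ext_gen. inverse (a s) * a s ^ 1 = 1 s"
      using a_ne by eventually_elim simp
    then show ?thesis unfolding \<Gamma>'_def using hom_ring_1[OF \<Gamma>] by blast
  qed
  ultimately show ?thesis by blast
qed

section \<open>Adjoining one element to the domain of a homomorphism\<close>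

definition extend :: "'k \<Rightarrow> ('p \<Rightarrow> 'k) \<Rightarrow> 'p option \<Rightarrow> 'k" where
  "extend c y = case_option c y"

lemma extend_simps [simp]: "extend c y None = c" "extend c y (Some Q) = y Q"
  by (simp_all add: extend_def)

definition polys_over :: "('p option \<Rightarrow> 'k) set \<Rightarrow> ('p option \<Rightarrow> 'k) poly set" where
  "polys_over \<Gamma> = {A. \<forall>i. Polynomial.coeff A i \<in> \<Gamma>}"

definition residue_poly :: "('p option \<Rightarrow> 'k) poly \<Rightarrow> 'k poly" where
  "residue_poly A = map_poly (\<lambda>g. g None) A"

lemma coeff_residue_poly: "Polynomial.coeff (residue_poly A) i = Polynomial.coeff A i None"
  by (simp add: residue_poly_def coeff_map_poly)

lemma residue_poly_add: "residue_poly (A + B) = residue_poly A + residue_poly B"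
  by (rule poly_eqI) (simp add: coeff_residue_poly)

lemma residue_poly_mult: "residue_poly (A * B) = residue_poly A * residue_poly B"
  by (rule poly_eqI) (simp add: coeff_residue_poly coeff_mult sum_fun_apply)

lemma poly_residue_poly: "poly (residue_poly A) c = poly A (extend c y) None"
proof -
  have "poly (residue_poly A) c = (\<Sum>i\<le>Polynomial.degree A. Polynomial.coeff (residue_poly A) i * c ^ i)"
  proof (subst poly_altdef, rule sum.mono_neutral_left)
    show "{..Polynomial.degree (residue_poly A)} \<subseteq> {..Polynomial.degree A}"
      using degree_le[of "Polynomial.degree A" "residue_poly A"] by (auto simp: coeff_residue_poly coeff_eq_0)
    show "\<forall>i\<in>{..Polynomial.degree A} - {..Polynomial.degree (residue_poly A)}.
      Polynomial.coeff (residue_poly A) i * c ^ i = 0"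
      by (auto simp: coeff_eq_0)
  qed simp
  then show ?thesis by (simp add: poly_fun_apply coeff_residue_poly)
qed

lemma polys_over_closed:
  assumes \<Gamma>: "hom_ring \<Gamma>" and "A \<in> polys_over \<Gamma>" "B \<in> polys_over \<Gamma>"
  shows "A + B \<in> polys_over \<Gamma>" "A * B \<in> polys_over \<Gamma>"
  using assms(2,3) unfolding polys_over_def
  by (auto simp: coeff_mult intro!: hom_ring_add[OF \<Gamma>] hom_ring_sum[OF \<Gamma>] hom_ring_mult[OF \<Gamma>])

text \<open>An element y can be sent to c if c is a root of the reductions of all polynomial
  relations of y over \<Gamma>. These reductions form an ideal of k[X]; if it is proper, a common
  root exists because k is algebraically closed.\<close>

lemma hom_ring_extend_element:
  assumes \<Gamma>: "hom_ring \<Gamma>" and y: "y \<in> K"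
    and proper: "\<And>A. A \<in> polys_over \<Gamma> \<Longrightarrow> \<forall>\<^sub>F Q in gen. poly A (extend 0 y) (Some Q) = 0 \<Longrightarrow>
       residue_poly A \<noteq> 1"
  shows "\<exists>\<Gamma>' c. hom_ring \<Gamma>' \<and> \<Gamma> \<subseteq> \<Gamma>' \<and> extend c y \<in> \<Gamma>'"
proof -
  have indep: "poly A (extend c y) (Some Q) = poly A (extend 0 y) (Some Q)" for A c Q
    by (simp add: poly_fun_apply)
  \<comment> \<open>The ideal of the reduced relations of \<open>y\<close>. Whether a relation holds
    is tested at the points \<open>Some Q\<close>, where the value proposed for \<open>y\<close> at
    \<open>None\<close> is invisible.\<close>
  define J where "J = {residue_poly A | A. A \<in> polys_over \<Gamma> \<and>
    (\<forall>\<^sub>F Q in gen. poly A (extend 0 y) (Some Q) = 0)}"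
  have const_poly: "map_poly (\<lambda>c _. c) B \<in> polys_over \<Gamma>" "residue_poly (map_poly (\<lambda>c _. c) B) = B" for B
    using hom_ring_const[OF \<Gamma>]
    by (auto simp: polys_over_def coeff_map_poly zero_fun_def coeff_residue_poly intro!: poly_eqI)
  have J_add: "A + B \<in> J" if AB: "A \<in> J" "B \<in> J" for A B
  proof -
    obtain A' where A': "A = residue_poly A'" "A' \<in> polys_over \<Gamma>" "\<forall>\<^sub>F Q in gen. poly A' (extend 0 y) (Some Q) = 0"
      using AB(1) unfolding J_def by blast
    obtain B' where B': "B = residue_poly B'" "B' \<in> polys_over \<Gamma>" "\<forall>\<^sub>F Q in gen. poly B' (extend 0 y) (Some Q) = 0"
      using AB(2) unfolding J_def by blast
    have "\<forall>\<^sub>F Q in gen. poly (A' + B') (extend 0 y) (Some Q) = 0"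
      using A'(3) B'(3) by eventually_elim simp
    moreover have "A + B = residue_poly (A' + B')" using A' B' by (simp add: residue_poly_add)
    moreover have "A' + B' \<in> polys_over \<Gamma>" using A' B' polys_over_closed[OF \<Gamma>] by blast
    ultimately show ?thesis unfolding J_def by blast
  qed
  have J_mult: "B * A \<in> J" if A: "A \<in> J" for A B
  proof -
    obtain A' where A': "A = residue_poly A'" "A' \<in> polys_over \<Gamma>" "\<forall>\<^sub>F Q in gen. poly A' (extend 0 y) (Some Q) = 0"
      using A unfolding J_def by blast
    let ?B = "map_poly (\<lambda>c _. c) B :: ('p option \<Rightarrow> 'k) poly"
    have "\<forall>\<^sub>F Q in gen. poly (?B * A') (extend 0 y) (Some Q) = 0"
      using A'(3) by eventually_elim simp
    moreover have "B * A = residue_poly (?B * A')"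
      using A' by (simp add: residue_poly_mult const_poly(2))
    moreover have "?B * A' \<in> polys_over \<Gamma>"
      using polys_over_closed(2)[OF \<Gamma> const_poly(1) A'(2)] .
    ultimately show ?thesis unfolding J_def by blast
  qed
  have one: "1 \<notin> J" using proper by (auto simp: J_def)
  have "\<exists>c. \<forall>B\<in>J. poly B c = 0"
  proof (cases "J \<subseteq> {0}")
    case False
    then obtain B0 where B0: "B0 \<in> J" "B0 \<noteq> 0" by auto
    \<comment> \<open>An element of least degree generates the ideal, by division with remainder. It
      is not constant, since otherwise the ideal would contain 1.\<close>
    define g where "g = (ARG_MIN Polynomial.degree B. B \<in> J \<and> B \<noteq> 0)"
    have g: "g \<in> J" "g \<noteq> 0" and g_min: "\<And>B. B \<in> J \<Longrightarrow> B \<noteq> 0 \<Longrightarrow> Polynomial.degree g \<le> Polynomial.degree B"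
      using arg_min_nat_lemma[of "\<lambda>B. B \<in> J \<and> B \<noteq> 0" B0 Polynomial.degree] B0 unfolding g_def by auto
    have "Polynomial.degree g > 0"
    proof (rule ccontr)
      assume "\<not> 0 < Polynomial.degree g"
      then obtain c where c: "g = [:c:]" using degree_eq_zeroE by blast
      then have "[:inverse c:] * g = 1" using g(2) by (simp add: one_poly_eq_simps)
      with J_mult[OF g(1), of "[:inverse c:]"] one show False by simp
    qed
    then obtain c where c: "poly g c = 0" using alg_closed_imp_poly_has_root by blast
    have "poly B c = 0" if B: "B \<in> J" for B
    proof -
      have "B mod g = B + (- (B div g)) * g"
        by (simp add: minus_div_mult_eq_mod[symmetric])
      then have "B mod g \<in> J" using J_add[OF B J_mult[OF g(1), of "- (B div g)"]] by simp
      moreover have "B mod g = 0 \<or> Polynomial.degree (B mod g) < Polynomial.degree g"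
        using degree_mod_less[OF g(2)] by blast
      ultimately have "B mod g = 0" using g_min by fastforce
      then have "g dvd B" by (simp add: dvd_eq_mod_eq_0)
      then show ?thesis using c by (auto elim: dvdE)
    qed
    then show ?thesis by blast
  next
    case True
    have "poly B 0 = 0" if "B \<in> J" for B using subsetD[OF True that] by simp
    then show ?thesis by blast
  qed
  then obtain c where c: "\<And>B. B \<in> J \<Longrightarrow> poly B c = 0" by blast
  define \<Gamma>' where "\<Gamma>' = {g. \<exists>A\<in>polys_over \<Gamma>. \<forall>\<^sub>F s in ext_gen. g s = poly A (extend c y) s}"
  have "hom_ring \<Gamma>'"
    unfolding hom_ring_def
  proof (intro conjI ballI allI impI)
    fix d
    have "\<forall>\<^sub>F s in ext_gen. d = poly [:\<lambda>_. d:] (extend c y) s" by simp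
    moreover have "[:\<lambda>_. d:] \<in> polys_over \<Gamma>"
      using hom_ring_const[OF \<Gamma>] hom_ring_0[OF \<Gamma>] by (auto simp: polys_over_def coeff_pCons split: nat.splits)
    ultimately show "(\<lambda>_. d) \<in> \<Gamma>'" unfolding \<Gamma>'_def by blast
  next
    fix f assume "f \<in> \<Gamma>'"
    then obtain A where A: "A \<in> polys_over \<Gamma>" "\<forall>\<^sub>F s in ext_gen. f s = poly A (extend c y) s"
      by (auto simp: \<Gamma>'_def)
    have ev: "\<forall>\<^sub>F Q in gen. f (Some Q) = poly A (extend c y) (Some Q)" "f None = poly A (extend c y) None"
      using A(2) by (simp_all add: eventually_ext_gen)
    have "(\<lambda>Q. \<Sum>i\<le>Polynomial.degree A. Polynomial.coeff A i (Some Q) * y Q ^ i) \<in> K"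
      using A(1) by (intro K_sum K_mult K_power y hom_ring_K[OF \<Gamma>]) (simp add: polys_over_def)
    then have "(\<lambda>Q. poly A (extend c y) (Some Q)) \<in> K" by (simp add: poly_fun_apply)
    then show "f \<circ> Some \<in> K" unfolding o_def
      by (rule K_cong) (use ev(1) in \<open>simp add: eq_commute\<close>)
    { assume "\<forall>\<^sub>F Q in gen. f (Some Q) = 0"
      with ev(1) have "\<forall>\<^sub>F Q in gen. poly A (extend 0 y) (Some Q) = 0"
        by eventually_elim (simp add: indep[of _ c])
      then have "residue_poly A \<in> J" using A(1) by (auto simp: J_def)
      then show "f None = 0" using c ev(2) poly_residue_poly by metis }
    { fix g assume "\<forall>\<^sub>F s in ext_gen. f s = g s"
      with A(2) have "\<forall>\<^sub>F s in ext_gen. g s = poly A (extend c y) s" by eventually_elim simp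
      then show "g \<in> \<Gamma>'" using A(1) unfolding \<Gamma>'_def by blast }
    fix g assume "g \<in> \<Gamma>'"
    then obtain B where B: "B \<in> polys_over \<Gamma>" "\<forall>\<^sub>F s in ext_gen. g s = poly B (extend c y) s"
      by (auto simp: \<Gamma>'_def)
    have "\<forall>\<^sub>F s in ext_gen. (f + g) s = poly (A + B) (extend c y) s"
      using A(2) B(2) by eventually_elim simp
    then show "f + g \<in> \<Gamma>'" unfolding \<Gamma>'_def using polys_over_closed[OF \<Gamma> A(1) B(1)] by blast
    have "\<forall>\<^sub>F s in ext_gen. (f * g) s = poly (A * B) (extend c y) s"
      using A(2) B(2) by eventually_elim simp
    then show "f * g \<in> \<Gamma>'" unfolding \<Gamma>'_def using polys_over_closed[OF \<Gamma> A(1) B(1)] by blast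
  qed
  moreover have "\<Gamma> \<subseteq> \<Gamma>'"
  proof
    fix f assume "f \<in> \<Gamma>"
    then have "[:f:] \<in> polys_over \<Gamma>"
      using hom_ring_0[OF \<Gamma>] by (auto simp: polys_over_def coeff_pCons split: nat.splits)
    then show "f \<in> \<Gamma>'" unfolding \<Gamma>'_def by (intro CollectI bexI[of _ "[:f:]"]) simp_all
  qed
  moreover have "extend c y \<in> \<Gamma>'"
  proof -
    have "[:0, 1:] \<in> polys_over \<Gamma>"
      using hom_ring_0[OF \<Gamma>] hom_ring_1[OF \<Gamma>] by (auto simp: polys_over_def coeff_pCons split: nat.splits)
    then show ?thesis unfolding \<Gamma>'_def by (intro CollectI bexI[of _ "[:0, 1:]"]) simp_all
  qed
  ultimately show ?thesis by blast
qed


text \<open>A nonconstant function is transcendental: over an algebraically closed field the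
  polynomial splits, and each factor z - c is generically nonzero.\<close>

lemma poly_eventually_zero:
  assumes z: "z \<in> K" "\<And>c. \<not> (\<forall>\<^sub>F Q in gen. z Q = c)" and "\<forall>\<^sub>F Q in gen. poly A (z Q) = 0"
  shows "A = 0"
  using assms(3)
proof (induction "Polynomial.degree A" arbitrary: A)
  case 0
  then obtain c where c: "A = [:c:]" using degree_eq_zeroE by metis
  with 0 have "\<forall>\<^sub>F Q in gen. c = 0" by simp
  then have "c = 0" using gen_ne eventually_const_iff by blast
  with c show ?case by simp
next
  case (Suc n)
  then obtain c where "poly A c = 0" using alg_closed_imp_poly_has_root[of A] by auto
  then obtain B where B: "A = [:- c, 1:] * B" by (auto simp: poly_eq_0_iff_dvd elim: dvdE)
  have "\<not> (\<forall>\<^sub>F Q in gen. z Q - c = 0)" using z(2)[of c] by simp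
  then have "\<forall>\<^sub>F Q in gen. z Q - c \<noteq> 0" using K_zero[OF K_diff[OF z(1) K_const]] by blast
  with Suc.prems have ev: "\<forall>\<^sub>F Q in gen. poly B (z Q) = 0"
    by eventually_elim (simp add: B)
  have "A \<noteq> 0" using Suc.hyps(2) by auto
  then have "B \<noteq> 0" using B by auto
  then have "Polynomial.degree A = Suc (Polynomial.degree B)"
    unfolding B by (subst degree_mult_eq) auto
  then have "B = 0" using Suc.hyps ev by auto
  with B show ?case by simp
qed

section \<open>Chevalley's extension theorem\<close>

text \<open>A relation of y over \<Gamma> whose reduction is the constant polynomial 1: the
  obstruction to giving y a finite value.\<close>

definition reciprocal_rel :: "('p option \<Rightarrow> 'k) set \<Rightarrow> nat \<Rightarrow> ('p \<Rightarrow> 'k) \<Rightarrow> bool" where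
  "reciprocal_rel \<Gamma> n y \<longleftrightarrow> (\<exists>a. (\<forall>i\<le>n. a i \<in> \<Gamma>) \<and> a 0 None = 1 \<and> (\<forall>i\<in>{1..n}. a i None = 0) \<and>
     (\<forall>\<^sub>F Q in gen. (\<Sum>i\<le>n. a i (Some Q) * y Q ^ i) = 0))"

text \<open>The relation of 1 / y, multiplied by \<open>y ^ Suc n\<close>, has the leading
  coefficient \<open>b 0\<close>, which is a unit of \<Gamma> as its residue is 1; so it can be
  solved for \<open>y ^ Suc n\<close>. Substituting this into the relation of y preserves the
  residues, because \<open>a (Suc n)\<close> has residue 0.\<close>

lemma reciprocal_rel_decrease:
  assumes \<Gamma>: "hom_ring \<Gamma>"
    and inv: "\<And>a. a \<in> \<Gamma> \<Longrightarrow> a None \<noteq> 0 \<Longrightarrow> (\<lambda>s. inverse (a s)) \<in> \<Gamma>"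
    and y: "\<forall>\<^sub>F Q in gen. y Q \<noteq> 0"
    and rel: "reciprocal_rel \<Gamma> (Suc n) y" "reciprocal_rel \<Gamma> m (\<lambda>Q. inverse (y Q))" and le: "m \<le> Suc n"
  shows "reciprocal_rel \<Gamma> n y"
proof -
  obtain a where a: "\<And>i. i \<le> Suc n \<Longrightarrow> a i \<in> \<Gamma>" "a 0 None = 1" "\<And>i. i \<in> {1..Suc n} \<Longrightarrow> a i None = 0"
    "\<forall>\<^sub>F Q in gen. (\<Sum>i\<le>Suc n. a i (Some Q) * y Q ^ i) = 0"
    using rel(1) unfolding reciprocal_rel_def by blast
  obtain b where b: "\<And>i. i \<le> m \<Longrightarrow> b i \<in> \<Gamma>" "b 0 None = 1" "\<And>i. i \<in> {1..m} \<Longrightarrow> b i None = 0"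
    "\<forall>\<^sub>F Q in gen. (\<Sum>i\<le>m. b i (Some Q) * inverse (y Q) ^ i) = 0"
    using rel(2) unfolding reciprocal_rel_def by blast
  define g where "g = (\<lambda>s. inverse (b 0 s))"
  have g: "g \<in> \<Gamma>" unfolding g_def using inv b by simp
  have "\<not> (\<forall>\<^sub>F Q in gen. b 0 (Some Q) = 0)" using hom_ring_zero[OF \<Gamma> b(1)[of 0]] b(2) by auto
  then have b0: "\<forall>\<^sub>F Q in gen. b 0 (Some Q) \<noteq> 0" using K_zero[OF hom_ring_K[OF \<Gamma> b(1)[of 0]]] by blast
  \<comment> \<open>The coefficient of \<open>y ^ i\<close> in the relation of 1 / y after
    multiplication by \<open>y ^ Suc n\<close>, for \<open>i \<le> n\<close>; it is 0 where the
    reversed index exceeds \<open>m\<close>.\<close>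
  define e where "e = (\<lambda>i. if Suc n - i \<le> m then b (Suc n - i) else 0)"
  define a' where "a' = (\<lambda>i. a i - a (Suc n) * e i * g)"
  have e: "e i \<in> \<Gamma>" for i unfolding e_def using b(1) hom_ring_0[OF \<Gamma>] by auto
  have "a' i \<in> \<Gamma>" if "i \<le> n" for i
    unfolding a'_def using that by (intro hom_ring_diff[OF \<Gamma>] hom_ring_mult[OF \<Gamma>] a e g) auto
  moreover have "a' i None = a i None" for i
    using a(3)[of "Suc n"] by (simp add: a'_def)
  then have "a' 0 None = 1" "\<forall>i\<in>{1..n}. a' i None = 0" using a by auto
  moreover have "\<forall>\<^sub>F Q in gen. (\<Sum>i\<le>n. a' i (Some Q) * y Q ^ i) = 0"
    using a(4) b(4) b0 y
  proof eventually_elim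
    case (elim Q)
    define E where "E = (\<Sum>i\<le>n. e i (Some Q) * y Q ^ i)"
    have "0 = y Q ^ Suc n * (\<Sum>i\<le>m. b i (Some Q) * inverse (y Q) ^ i)" using elim by simp
    also have "\<dots> = (\<Sum>i\<le>m. b i (Some Q) * y Q ^ (Suc n - i))"
      unfolding sum_distrib_left
    proof (rule sum.cong)
      fix i assume "i \<in> {..m}"
      then have "Suc n = i + (Suc n - i)" using le by simp
      then have "y Q ^ Suc n = y Q ^ i * y Q ^ (Suc n - i)" by (metis power_add)
      then show "y Q ^ Suc n * (b i (Some Q) * inverse (y Q) ^ i) = b i (Some Q) * y Q ^ (Suc n - i)"
        using elim(4) by (simp add: field_simps)
    qed simp
    also have "\<dots> = b 0 (Some Q) * y Q ^ Suc n + (\<Sum>i\<in>{1..m}. b i (Some Q) * y Q ^ (Suc n - i))"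
    proof -
      have "{..m} = insert 0 {1..m}" by auto
      then show ?thesis by simp
    qed
    also have "(\<Sum>i\<in>{1..m}. b i (Some Q) * y Q ^ (Suc n - i)) = (\<Sum>i\<in>{Suc n - m..n}. b (Suc n - i) (Some Q) * y Q ^ i)"
      by (rule sum.reindex_bij_witness[of _ "\<lambda>i. Suc n - i" "\<lambda>i. Suc n - i"]) (use le in auto)
    also have "\<dots> = E"
      unfolding E_def by (rule sum.mono_neutral_cong_left) (auto simp: e_def)
    finally have "y Q ^ Suc n = - E * g (Some Q)"
      using elim(3) by (simp add: g_def field_simps eq_neg_iff_add_eq_0)
    then have "(\<Sum>i\<le>n. a i (Some Q) * y Q ^ i) + a (Suc n) (Some Q) * (- E * g (Some Q)) = 0"
      using elim(1) by simp
    moreover have "(\<Sum>i\<le>n. a' i (Some Q) * y Q ^ i)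
        = (\<Sum>i\<le>n. a i (Some Q) * y Q ^ i) - a (Suc n) (Some Q) * g (Some Q) * E"
      by (simp add: a'_def E_def algebra_simps sum_subtractf sum_distrib_left)
    ultimately show ?case by (simp add: algebra_simps)
  qed
  ultimately show ?thesis unfolding reciprocal_rel_def by blast
qed

text \<open>The longer of the two relations can always be shortened by means of the other one. A
  relation of degree 0 would be an element with residue 1 that is generically zero.\<close>

lemma reciprocal_rel_contradiction:
  assumes \<Gamma>: "hom_ring \<Gamma>"
    and inv: "\<And>a. a \<in> \<Gamma> \<Longrightarrow> a None \<noteq> 0 \<Longrightarrow> (\<lambda>s. inverse (a s)) \<in> \<Gamma>"
    and "\<forall>\<^sub>F Q in gen. y Q \<noteq> 0"
    and "reciprocal_rel \<Gamma> n y" "reciprocal_rel \<Gamma> m (\<lambda>Q. inverse (y Q))"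
  shows False
  using assms(3-)
proof (induction "n + m" arbitrary: n m y rule: less_induct)
  case less
  have zero: "\<not> reciprocal_rel \<Gamma> 0 y" for y
    using hom_ring_zero[OF \<Gamma>] by (fastforce simp: reciprocal_rel_def)
  obtain n' m' where nm: "n = Suc n'" "m = Suc m'"
    using less.prems zero by (metis not0_implies_Suc)
  have y': "\<forall>\<^sub>F Q in gen. inverse (y Q) \<noteq> 0" using less.prems(1) by eventually_elim simp
  show False
  proof (cases "m \<le> n")
    case True
    have "reciprocal_rel \<Gamma> n' y"
      using reciprocal_rel_decrease[OF \<Gamma> inv less.prems(1)] less.prems(2,3) True nm by blast
    then show False using less.hyps[of n' m y] less.prems nm by auto
  next
    case False
    have "reciprocal_rel \<Gamma> m' (\<lambda>Q. inverse (y Q))"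
      by (rule reciprocal_rel_decrease[OF \<Gamma> inv y', of m' n]) (use less.prems False nm in auto)
    then show False using less.hyps[of n m' y] less.prems nm by auto
  qed
qed

text \<open>Zorn's lemma above the homomorphism from k[z] to k with z mapped to 0, which is well
  defined because z is transcendental.\<close>

lemma maximal_hom_ring:
  assumes z: "z \<in> K" "\<And>c. \<not> (\<forall>\<^sub>F Q in gen. z Q = c)"
  shows "\<exists>\<Gamma>. hom_ring \<Gamma> \<and> extend 0 z \<in> \<Gamma> \<and> (\<forall>\<Gamma>'. hom_ring \<Gamma>' \<longrightarrow> \<Gamma> \<subseteq> \<Gamma>' \<longrightarrow> \<Gamma>' = \<Gamma>)"
proof -
  define \<Gamma>0 where "\<Gamma>0 = {f. \<exists>A. \<forall>\<^sub>F s in ext_gen. f s = poly A (extend 0 z s)}"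
  have "hom_ring \<Gamma>0"
    unfolding hom_ring_def
  proof (intro conjI ballI allI impI)
    show "(\<lambda>_. d) \<in> \<Gamma>0" for d
      unfolding \<Gamma>0_def by (intro CollectI exI[of _ "[:d:]"]) simp
    fix f assume "f \<in> \<Gamma>0"
    then obtain A where A: "\<forall>\<^sub>F s in ext_gen. f s = poly A (extend 0 z s)" by (auto simp: \<Gamma>0_def)
    then have ev: "\<forall>\<^sub>F Q in gen. f (Some Q) = poly A (z Q)" "f None = poly A 0"
      by (simp_all add: eventually_ext_gen)
    have "(\<lambda>Q. poly A (z Q)) \<in> K"
      unfolding poly_altdef by (intro K_sum K_mult K_power K_const z)
    then show "f \<circ> Some \<in> K" unfolding o_def by (rule K_cong) (use ev in \<open>simp add: eq_commute\<close>)
    { assume "\<forall>\<^sub>F Q in gen. f (Some Q) = 0"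
      with ev(1) have "\<forall>\<^sub>F Q in gen. poly A (z Q) = 0" by eventually_elim simp
      then have "A = 0" using poly_eventually_zero[OF z] by blast
      then show "f None = 0" using ev(2) by simp }
    { fix g assume "\<forall>\<^sub>F s in ext_gen. f s = g s"
      with A have "\<forall>\<^sub>F s in ext_gen. g s = poly A (extend 0 z s)" by eventually_elim simp
      then show "g \<in> \<Gamma>0" unfolding \<Gamma>0_def by blast }
    fix g assume "g \<in> \<Gamma>0"
    then obtain B where B: "\<forall>\<^sub>F s in ext_gen. g s = poly B (extend 0 z s)" by (auto simp: \<Gamma>0_def)
    from A B have "\<forall>\<^sub>F s in ext_gen. (f + g) s = poly (A + B) (extend 0 z s)" by eventually_elim simp
    then show "f + g \<in> \<Gamma>0" unfolding \<Gamma>0_def by blast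
    from A B have "\<forall>\<^sub>F s in ext_gen. (f * g) s = poly (A * B) (extend 0 z s)" by eventually_elim simp
    then show "f * g \<in> \<Gamma>0" unfolding \<Gamma>0_def by blast
  qed
  moreover have "extend 0 z \<in> \<Gamma>0" unfolding \<Gamma>0_def by (intro CollectI exI[of _ "[:0, 1:]"]) simp
  ultimately have ne: "\<Gamma>0 \<in> {\<Gamma>. hom_ring \<Gamma> \<and> extend 0 z \<in> \<Gamma>}" by simp
  have "\<exists>\<Gamma>\<in>{\<Gamma>. hom_ring \<Gamma> \<and> extend 0 z \<in> \<Gamma>}. \<forall>\<Gamma>'\<in>{\<Gamma>. hom_ring \<Gamma> \<and> extend 0 z \<in> \<Gamma>}. \<Gamma> \<subseteq> \<Gamma>' \<longrightarrow> \<Gamma>' = \<Gamma>"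
  proof (rule subset_Zorn_nonempty)
    show "{\<Gamma>. hom_ring \<Gamma> \<and> extend 0 z \<in> \<Gamma>} \<noteq> {}" using ne by blast
    fix \<C> assume \<C>: "\<C> \<noteq> {}" "subset.chain {\<Gamma>. hom_ring \<Gamma> \<and> extend 0 z \<in> \<Gamma>} \<C>"
    then have chain: "\<And>A B. A \<in> \<C> \<Longrightarrow> B \<in> \<C> \<Longrightarrow> A \<subseteq> B \<or> B \<subseteq> A"
      and mem: "\<And>A. A \<in> \<C> \<Longrightarrow> hom_ring A" "\<And>A. A \<in> \<C> \<Longrightarrow> extend 0 z \<in> A"
      by (auto simp: subset_chain_def)
    have "hom_ring (\<Union>\<C>)"
      unfolding hom_ring_def
    proof (intro conjI ballI allI impI)
      show "(\<lambda>_. c) \<in> \<Union>\<C>" for c using \<C>(1) mem(1) hom_ring_const by blast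
      fix f assume "f \<in> \<Union>\<C>"
      then obtain A where A: "A \<in> \<C>" "f \<in> A" by blast
      show "f \<circ> Some \<in> K" using hom_ring_K[OF mem(1)[OF A(1)] A(2)] by (simp add: o_def)
      show "f None = 0" if "\<forall>\<^sub>F Q in gen. f (Some Q) = 0"
        using hom_ring_zero[OF mem(1)[OF A(1)] A(2) that] .
      show "g \<in> \<Union>\<C>" if "\<forall>\<^sub>F s in ext_gen. f s = g s" for g
        using hom_ring_cong[OF mem(1)[OF A(1)] A(2) that] A(1) by blast
      fix g assume "g \<in> \<Union>\<C>"
      then obtain B where B: "B \<in> \<C>" "g \<in> B" by blast
      obtain D where D: "D \<in> \<C>" "f \<in> D" "g \<in> D" using chain[OF A(1) B(1)] A B by blast
      show "f + g \<in> \<Union>\<C>" using hom_ring_add[OF mem(1)[OF D(1)] D(2,3)] D(1) by blast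
      show "f * g \<in> \<Union>\<C>" using hom_ring_mult[OF mem(1)[OF D(1)] D(2,3)] D(1) by blast
    qed
    then show "\<Union>\<C> \<in> {\<Gamma>. hom_ring \<Gamma> \<and> extend 0 z \<in> \<Gamma>}" using \<C>(1) mem(2) by blast
  qed
  then show ?thesis by blast
qed

text \<open>\<open>pl f c\<close> says that f is finite at the place, with residue c. The domain of
  a maximal homomorphism is a valuation ring: if neither f nor 1 / f had a residue, both would
  satisfy reciprocal relations.\<close>

theorem place_exists:
  assumes z: "z \<in> K" "\<And>c. \<not> (\<forall>\<^sub>F Q in gen. z Q = c)"
  obtains pl where "\<And>f c. pl f c \<Longrightarrow> f \<in> K" "\<And>c. pl (\<lambda>_. c) c"
    "\<And>f c g d. pl f c \<Longrightarrow> pl g d \<Longrightarrow> pl (\<lambda>Q. f Q + g Q) (c + d)"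
    "\<And>f c g d. pl f c \<Longrightarrow> pl g d \<Longrightarrow> pl (\<lambda>Q. f Q * g Q) (c * d)"
    "\<And>f c. pl f c \<Longrightarrow> c \<noteq> 0 \<Longrightarrow> pl (\<lambda>Q. inverse (f Q)) (inverse c)"
    "\<And>f c g. pl f c \<Longrightarrow> \<forall>\<^sub>F Q in gen. f Q = g Q \<Longrightarrow> pl g c"
    "\<And>f c d. pl f c \<Longrightarrow> pl f d \<Longrightarrow> c = d"
    "\<And>f. f \<in> K \<Longrightarrow> \<exists>c. pl f c \<or> pl (\<lambda>Q. inverse (f Q)) c"
    "pl z 0"
proof -
  obtain \<Gamma> where \<Gamma>: "hom_ring \<Gamma>" and z\<Gamma>: "extend 0 z \<in> \<Gamma>"
    and max: "\<And>\<Gamma>'. hom_ring \<Gamma>' \<Longrightarrow> \<Gamma> \<subseteq> \<Gamma>' \<Longrightarrow> \<Gamma>' = \<Gamma>"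
    using maximal_hom_ring[OF z] by blast
  have inv: "(\<lambda>s. inverse (a s)) \<in> \<Gamma>" if "a \<in> \<Gamma>" "a None \<noteq> 0" for a
    using hom_ring_extend_inverse[OF \<Gamma> that] max by blast
  have rel: "\<exists>n. reciprocal_rel \<Gamma> n y" if y: "y \<in> K" and no: "\<And>c. extend c y \<notin> \<Gamma>" for y
  proof -
    \<comment> \<open>By maximality a \<open>y\<close> without a value cannot be adjoined, so the
      criterion for adjunction fails, and a relation reducing to 1 exists.\<close>
    obtain A where A: "A \<in> polys_over \<Gamma>" "\<forall>\<^sub>F Q in gen. poly A (extend 0 y) (Some Q) = 0" "residue_poly A = 1"
      using hom_ring_extend_element[OF \<Gamma> y] max no by blast
    have "Polynomial.coeff A 0 None = 1" "\<forall>i\<in>{1..Polynomial.degree A}. Polynomial.coeff A i None = 0"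
      using A(3) by (auto simp flip: coeff_residue_poly)
    moreover have "\<forall>\<^sub>F Q in gen. (\<Sum>i\<le>Polynomial.degree A. Polynomial.coeff A i (Some Q) * y Q ^ i) = 0"
      using A(2) by (simp add: poly_fun_apply)
    ultimately show ?thesis
      using A(1) unfolding reciprocal_rel_def polys_over_def by blast
  qed
  define pl where "pl = (\<lambda>f c. extend c f \<in> \<Gamma>)"
  show ?thesis
  proof (rule that[of pl])
    show "f \<in> K" if "pl f c" for f c using hom_ring_K[OF \<Gamma> that[unfolded pl_def]] by simp
    have "extend c (\<lambda>_. c) = (\<lambda>_. c)" for c by (auto simp: fun_eq_iff extend_def split: option.splits)
    then show "pl (\<lambda>_. c) c" for c using hom_ring_const[OF \<Gamma>] by (simp add: pl_def)
    show "pl (\<lambda>Q. f Q + g Q) (c + d)" if "pl f c" "pl g d" for f c g d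
    proof -
      have "extend c f + extend d g = extend (c + d) (\<lambda>Q. f Q + g Q)"
        by (auto simp: fun_eq_iff extend_def split: option.splits)
      then show ?thesis using hom_ring_add[OF \<Gamma>] that unfolding pl_def by metis
    qed
    show "pl (\<lambda>Q. f Q * g Q) (c * d)" if "pl f c" "pl g d" for f c g d
    proof -
      have "extend c f * extend d g = extend (c * d) (\<lambda>Q. f Q * g Q)"
        by (auto simp: fun_eq_iff extend_def split: option.splits)
      then show ?thesis using hom_ring_mult[OF \<Gamma>] that unfolding pl_def by metis
    qed
    show "pl (\<lambda>Q. inverse (f Q)) (inverse c)" if "pl f c" "c \<noteq> 0" for f c
    proof -
      have "(\<lambda>s. inverse (extend c f s)) = extend (inverse c) (\<lambda>Q. inverse (f Q))"
        by (auto simp: fun_eq_iff extend_def split: option.splits)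
      then show ?thesis using inv[of "extend c f"] that unfolding pl_def by simp
    qed
    show "pl g c" if "pl f c" "\<forall>\<^sub>F Q in gen. f Q = g Q" for f c g
      using hom_ring_cong[OF \<Gamma>, of "extend c f" "extend c g"] that
      by (simp add: pl_def eventually_ext_gen)
    show "c = d" if "pl f c" "pl f d" for f c d
      using hom_ring_zero[OF \<Gamma> hom_ring_diff[OF \<Gamma>, of "extend c f" "extend d f"]] that
      by (simp add: pl_def)
    show "\<exists>c. pl f c \<or> pl (\<lambda>Q. inverse (f Q)) c" if f: "f \<in> K" for f
    proof (rule ccontr)
      assume no: "\<nexists>c. pl f c \<or> pl (\<lambda>Q. inverse (f Q)) c"
      have "\<not> (\<forall>\<^sub>F Q in gen. f Q = 0)"
      proof
        assume "\<forall>\<^sub>F Q in gen. f Q = 0"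
        then have "\<forall>\<^sub>F Q in gen. 0 = f Q" by eventually_elim simp
        then have "\<forall>\<^sub>F s in ext_gen. 0 s = extend 0 f s" by (simp add: eventually_ext_gen)
        then have "pl f 0" unfolding pl_def by (rule hom_ring_cong[OF \<Gamma> hom_ring_0[OF \<Gamma>]])
        with no show False by blast
      qed
      then have ne: "\<forall>\<^sub>F Q in gen. f Q \<noteq> 0" using K_zero[OF f] by blast
      obtain n m where nm: "reciprocal_rel \<Gamma> n f" "reciprocal_rel \<Gamma> m (\<lambda>Q. inverse (f Q))"
        using rel[OF f] rel[OF K_inverse[OF f]] no by (auto simp: pl_def)
      show False by (rule reciprocal_rel_contradiction[OF \<Gamma> _ ne nm]) (rule inv)
    qed
    show "pl z 0" using z\<Gamma> by (simp add: pl_def)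
  qed
qed

end

section \<open>Rational functions on a projective variety\<close>

text \<open>The value of a form at an arbitrarily chosen coordinate vector. Only its vanishing, and
  quotients of values of forms of equal degree, are independent of the choice.\<close>

definition hval :: "('k::field, 'n::finite) mpoly \<Rightarrow> ('k, 'n) pt \<Rightarrow> 'k" where
  "hval p P = poly_eval p (SOME v. v \<in> P)"

lemma projective_space_rep:
  assumes "P \<in> projective_space"
  shows "(SOME v. v \<in> P) \<in> P" "(SOME v. v \<in> P) \<noteq> 0"
    "P = {c *s (SOME v. v \<in> P) | c. c \<noteq> 0}"
proof -
  obtain u where u: "u \<noteq> 0" "P = {c *s u | c. c \<noteq> 0}" using assms by (auto simp: projective_space_def)
  then have "1 *s u \<in> P" by (intro u(2)[THEN equalityD2, THEN subsetD] CollectI exI[of _ 1]) simp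
  then show mem: "(SOME v. v \<in> P) \<in> P" by (rule someI)
  then obtain a where a: "(SOME v. v \<in> P) = a *s u" "a \<noteq> 0" using u(2) by blast
  show "(SOME v. v \<in> P) \<noteq> 0" using a u(1) by simp
  show "P = {c *s (SOME v. v \<in> P) | c. c \<noteq> 0}"
    unfolding a(1)
  proof
    show "P \<subseteq> {c *s (a *s u) |c. c \<noteq> 0}"
    proof
      fix w assume "w \<in> P"
      then obtain b where b: "w = b *s u" "b \<noteq> 0" using u(2) by blast
      then have "w = (b / a) *s (a *s u)" using a by simp
      then show "w \<in> {c *s (a *s u) |c. c \<noteq> 0}" using a b by (intro CollectI exI[of _ "b / a"]) simp
    qed
    show "{c *s (a *s u) |c. c \<noteq> 0} \<subseteq> P"
      by (subst u(2)) (use a in \<open>auto simp: vector_smult_assoc\<close>)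
  qed
qed

text \<open>One scalar serves all forms at once, which is why it cancels in quotients of forms of
  the same degree.\<close>

lemma poly_eval_hval:
  assumes "P \<in> projective_space" "v \<in> P"
  obtains c where "c \<noteq> 0" "\<And>d p. homogeneous d p \<Longrightarrow> poly_eval p v = c ^ d * hval p P"
proof -
  obtain c where "c \<noteq> 0" "v = c *s (SOME v. v \<in> P)"
    using assms projective_space_rep(3)[OF assms(1)] by blast
  then show ?thesis using that[of c] by (simp add: poly_eval_scale hval_def)
qed

lemma hval_zero_iff:
  assumes "P \<in> projective_space" "v \<in> P" "homogeneous d p"
  shows "poly_eval p v = 0 \<longleftrightarrow> hval p P = 0"
  using poly_eval_hval[OF assms(1,2)] assms(3) by (metis mult_eq_0_iff power_not_zero)

lemma hval_ratio:
  assumes "P \<in> projective_space" "v \<in> P" "homogeneous d p" "homogeneous d q"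
  shows "poly_eval p v / poly_eval q v = hval p P / hval q P"
proof -
  obtain c where c: "c \<noteq> 0" "\<And>d p. homogeneous d p \<Longrightarrow> poly_eval p v = c ^ d * hval p P"
    using poly_eval_hval[OF assms(1,2)] by blast
  show ?thesis using c(1) by (simp add: c(2)[OF assms(3)] c(2)[OF assms(4)])
qed

lemma hval_add: "hval (p + q) P = hval p P + hval q P"
  and hval_mult: "hval (p * q) P = hval p P * hval q P"
  and hval_zero [simp]: "hval 0 P = 0"
  by (simp_all add: hval_def poly_eval_add poly_eval_mult)

definition const_mpoly :: "'k::field \<Rightarrow> ('k, 'n::finite) mpoly" where
  "const_mpoly c = Poly_Mapping.single 0 c"

definition var_mpoly :: "'n::finite \<Rightarrow> ('k::field, 'n) mpoly" where
  "var_mpoly i = Poly_Mapping.single (Poly_Mapping.single i 1) 1"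

lemma poly_eval_const: "poly_eval (const_mpoly c) v = c"
  by (simp add: const_mpoly_def poly_eval_single mono_eval_def)

lemma poly_eval_var: "poly_eval (var_mpoly i) v = v $ i"
proof -
  have "(\<Prod>j\<in>UNIV. v $ j ^ (Poly_Mapping.lookup (Poly_Mapping.single i (1::nat)) j)) = (\<Prod>j\<in>UNIV. if j = i then v $ j else 1)"
    by (rule prod.cong) (auto simp: lookup_single when_def)
  then show ?thesis by (simp add: var_mpoly_def poly_eval_single mono_eval_def)
qed

lemma homogeneous_const: "homogeneous 0 (const_mpoly c)"
  by (simp add: homogeneous_def const_mpoly_def)

lemma homogeneous_var: "homogeneous 1 (var_mpoly i)"
  by (simp add: homogeneous_def var_mpoly_def lookup_single when_def)

lemma homogeneous_add: "homogeneous d p \<Longrightarrow> homogeneous d q \<Longrightarrow> homogeneous d (p + q)"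
  unfolding homogeneous_def using Poly_Mapping.keys_add[of p q] by blast

lemma homogeneous_const_mult: "homogeneous d p \<Longrightarrow> homogeneous d (const_mpoly c * p)"
  using homogeneous_mult[OF homogeneous_const, of d p c] by simp

lemma hval_const: "hval (const_mpoly c) P = c"
  by (simp add: hval_def poly_eval_const)

lemma homogeneous_zero: "homogeneous d 0"
  by (simp add: homogeneous_def)

lemma homogeneous_power: "homogeneous d p \<Longrightarrow> homogeneous (n * d) (p ^ n)"
proof (induction n)
  case 0
  then show ?case by (simp add: homogeneous_def)
qed (simp add: homogeneous_mult)

lemma hval_one: "hval 1 P = 1"
  using hval_const[of 1] by (simp add: const_mpoly_def)

lemma hval_power: "hval (p ^ n) P = hval p P ^ n"
  by (induction n) (simp_all add: hval_mult hval_one)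

lemma projective_space_var:
  assumes "P \<in> projective_space"
  shows "\<exists>i. hval (var_mpoly i) P \<noteq> 0"
proof -
  obtain i where "(SOME v. v \<in> P) $ i \<noteq> 0"
    using projective_space_rep(2)[OF assms] by (metis vec_eq_iff zero_index)
  then show ?thesis by (auto simp: hval_def poly_eval_var)
qed

text \<open>Dehomogenization by the i-th coordinate. Thanks to 1 / 0 = 0 the identity holds also
  where this coordinate vanishes, for d = 0 as well as for d > 0.\<close>

lemma poly_eval_affine:
  assumes "homogeneous d p"
  shows "poly_eval p (\<chi> j. hval (var_mpoly j) Q / hval (var_mpoly i) Q) = hval p Q / hval (var_mpoly i) Q ^ d"
proof -
  have "(\<chi> j. hval (var_mpoly j) Q / hval (var_mpoly i) Q) = (1 / hval (var_mpoly i) Q) *s (SOME v. v \<in> Q)"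
    by (simp add: vec_eq_iff hval_def poly_eval_var)
  then show ?thesis using poly_eval_scale[OF assms] by (simp add: hval_def power_one_over divide_simps)
qed

text \<open>Meant for the relation "x_j / x_i is finite at the place", to find a coordinate by which
  all others can be divided.\<close>

lemma total_preorder_least:
  assumes "finite I" "I \<noteq> {}" and "\<And>i j. i \<in> I \<Longrightarrow> j \<in> I \<Longrightarrow> R i j \<or> R j i"
    and "\<And>i j l. i \<in> I \<Longrightarrow> j \<in> I \<Longrightarrow> l \<in> I \<Longrightarrow> R i j \<Longrightarrow> R j l \<Longrightarrow> R i l"
  shows "\<exists>i\<in>I. \<forall>j\<in>I. R i j"
  using assms
proof (induction I rule: finite_ne_induct)
  case (insert x I)
  have "\<exists>i\<in>I. \<forall>j\<in>I. R i j"
  proof (rule insert.IH)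
    show "R i j \<or> R j i" if "i \<in> I" "j \<in> I" for i j using insert.prems(1) that by simp
    show "R i l" if "i \<in> I" "j \<in> I" "l \<in> I" "R i j" "R j l" for i j l
      using insert.prems(2)[of i j l] that by simp
  qed
  then obtain i where i: "i \<in> I" "\<And>j. j \<in> I \<Longrightarrow> R i j" by blast
  show ?case
  proof (cases "R i x")
    case True
    then show ?thesis using i by blast
  next
    case False
    then have "R x i" using insert.prems(1)[of i x] i by blast
    then have "R x j" if "j \<in> I" for j using insert.prems(2)[of x i j] i that by blast
    moreover have "R x x" using insert.prems(1)[of x x] by blast
    ultimately show ?thesis by blast
  qed
qed blast

section \<open>Germs of rational functions on a projective variety\<close>

locale variety =
  fixes C :: "('k::alg_closed_field, 'n::finite) pt set"
  assumes variety: "projective_variety C"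
begin

definition forms :: "('k, 'n) mpoly set" where
  "forms = {s. (\<exists>d. homogeneous d s) \<and> (\<exists>P\<in>C. hval s P \<noteq> 0)}"

text \<open>The complements of hypersurfaces not containing \<open>C\<close> are a base of its
  nonempty open sets. By irreducibility (\<open>forms_mult\<close>) they are closed under
  intersection, so generic equality is agreement on one of them.\<close>

definition gen :: "('k, 'n) pt filter" where
  "gen = (INF s\<in>forms. principal {P \<in> C. hval s P \<noteq> 0})"

definition K :: "(('k, 'n) pt \<Rightarrow> 'k) set" where
  "K = {f. \<exists>d p q. homogeneous d p \<and> homogeneous d q \<and> q \<in> forms \<and>
     (\<forall>\<^sub>F P in gen. f P = hval p P / hval q P)}"

text \<open>Only the germ of f enters, so c may differ from \<open>f P\<close> when P is one of the
  exceptional points of the representative f.\<close>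

definition val :: "('k, 'n) pt \<Rightarrow> (('k, 'n) pt \<Rightarrow> 'k) \<Rightarrow> 'k \<Rightarrow> bool" where
  "val P f c \<longleftrightarrow> P \<in> C \<and> (\<exists>d p q. homogeneous d p \<and> homogeneous d q \<and> hval q P \<noteq> 0 \<and>
     (\<forall>\<^sub>F P in gen. f P = hval p P / hval q P) \<and> c = hval p P / hval q P)"

lemma C_zero_locus: obtains T where "\<And>p. p \<in> T \<Longrightarrow> \<exists>d. homogeneous d p" "C = zero_locus T"
proof -
  have C: "C \<subseteq> projective_space" "zariski_open (projective_space - C)"
    using variety by (auto simp: projective_variety_def closedin_def)
  then obtain T where T: "\<And>p. p \<in> T \<Longrightarrow> \<exists>d. homogeneous d p" "projective_space - C = projective_space - zero_locus T"
    by (auto simp: zariski_open_def)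
  have "zero_locus T \<subseteq> projective_space" by (auto simp: zero_locus_def)
  then have "C = zero_locus T" using T(2) C(1) by blast
  with T(1) show ?thesis by (rule that)
qed

lemma C_projective: "P \<in> C \<Longrightarrow> P \<in> projective_space"
  using C_zero_locus by (auto simp: zero_locus_def)

lemma C_nonempty: "C \<noteq> {}"
  using variety C_projective by (auto simp: projective_variety_def irreducible_space_def)

lemma openin_C: "openin (subtopology zariski C) U \<longleftrightarrow> (\<exists>W. zariski_open W \<and> U = W \<inter> C)"
  by (auto simp: openin_subtopology)

lemma zariski_open_nonzero:
  assumes "homogeneous d s"
  shows "zariski_open {P \<in> projective_space. hval s P \<noteq> 0}"
proof -
  have "{P \<in> projective_space. hval s P \<noteq> 0} = projective_space - zero_locus {s}"
    using hval_zero_iff[OF _ _ assms] projective_space_rep(1) by (fastforce simp: zero_locus_def)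
  then show ?thesis using assms unfolding zariski_open_def by blast
qed

lemma openin_nonzero:
  assumes "homogeneous d s"
  shows "openin (subtopology zariski C) {P \<in> C. hval s P \<noteq> 0}"
  unfolding openin_C using zariski_open_nonzero[OF assms] C_projective by blast

lemma openin_base:
  assumes "openin (subtopology zariski C) U" "P \<in> U"
  shows "\<exists>s\<in>forms. hval s P \<noteq> 0 \<and> (\<forall>Q\<in>C. hval s Q \<noteq> 0 \<longrightarrow> Q \<in> U)"
proof -
  obtain W where W: "zariski_open W" "U = W \<inter> C" using assms openin_C by blast
  obtain T where T: "\<And>p. p \<in> T \<Longrightarrow> \<exists>d. homogeneous d p" "W = projective_space - zero_locus T"
    using W(1) by (auto simp: zariski_open_def)
  have P: "P \<in> C" "P \<in> projective_space" "P \<notin> zero_locus T" using assms W T by auto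
  then obtain s v where s: "s \<in> T" "v \<in> P" "poly_eval s v \<noteq> 0" by (auto simp: zero_locus_def)
  obtain d where d: "homogeneous d s" using T s by blast
  have sP: "hval s P \<noteq> 0" using hval_zero_iff[OF P(2) s(2) d] s by simp
  have "Q \<in> U" if Q: "Q \<in> C" "hval s Q \<noteq> 0" for Q
  proof -
    have Qp: "Q \<in> projective_space" using Q C_projective by blast
    have "Q \<notin> zero_locus T"
      using hval_zero_iff[OF Qp projective_space_rep(1)[OF Qp] d] Q(2) s(1) projective_space_rep(1)[OF Qp]
      by (auto simp: zero_locus_def)
    then show ?thesis using W T Qp Q by blast
  qed
  then show ?thesis using sP d P unfolding forms_def by blast
qed

text \<open>Were the intersection empty, the complements would be closed sets covering
  \<open>C\<close>, and irreducibility would make one of the open sets empty.\<close>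

lemma open_Int_nonempty:
  assumes "openin (subtopology zariski C) U" "openin (subtopology zariski C) V" "U \<noteq> {}" "V \<noteq> {}"
  shows "U \<inter> V \<noteq> {}"
proof
  assume disj: "U \<inter> V = {}"
  have top: "topspace (subtopology zariski C) = C" using C_projective by auto
  have "U \<subseteq> C" "V \<subseteq> C" using assms openin_subset[of "subtopology zariski C"] top by blast+
  moreover have "closedin (subtopology zariski C) (C - U)" "closedin (subtopology zariski C) (C - V)"
    using assms(1,2) closedin_diff[OF closedin_topspace, of "subtopology zariski C"] unfolding top by blast+
  moreover have "(C - U) \<union> (C - V) = topspace (subtopology zariski C)" using disj top by auto
  ultimately have "C - U = C \<or> C - V = C"
    using variety unfolding projective_variety_def irreducible_space_def top by metis
  then show False using assms \<open>U \<subseteq> C\<close> \<open>V \<subseteq> C\<close> by blast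
qed

lemma forms_mult:
  assumes "s \<in> forms" "s' \<in> forms" shows "s * s' \<in> forms"
proof -
  obtain d d' where d: "homogeneous d s" "homogeneous d' s'" using assms by (auto simp: forms_def)
  have "{P \<in> C. hval s P \<noteq> 0} \<inter> {P \<in> C. hval s' P \<noteq> 0} \<noteq> {}"
    by (rule open_Int_nonempty[OF openin_nonzero openin_nonzero]) (use assms d in \<open>auto simp: forms_def\<close>)
  then show ?thesis using homogeneous_mult[OF d] by (auto simp: forms_def hval_mult)
qed

lemma const_forms: "c \<noteq> 0 \<Longrightarrow> const_mpoly c \<in> forms"
  using homogeneous_const[of c] C_nonempty by (auto simp: forms_def hval_const)

lemma eventually_gen:
  "eventually R gen \<longleftrightarrow> (\<exists>s\<in>forms. \<forall>P\<in>C. hval s P \<noteq> 0 \<longrightarrow> R P)"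
proof -
  have "eventually R gen \<longleftrightarrow> (\<exists>s\<in>forms. eventually R (principal {P \<in> C. hval s P \<noteq> 0}))"
    unfolding gen_def
  proof (rule eventually_INF_base)
    show "forms \<noteq> {}" using const_forms[of 1] by auto
    fix a b assume "a \<in> forms" "b \<in> forms"
    then show "\<exists>s\<in>forms. principal {P \<in> C. hval s P \<noteq> 0}
        \<le> inf (principal {P \<in> C. hval a P \<noteq> 0}) (principal {P \<in> C. hval b P \<noteq> 0})"
      using forms_mult by (intro bexI[of _ "a * b"]) (auto simp: hval_mult)
  qed
  then show ?thesis by (auto simp: eventually_principal)
qed

lemma gen_forms: "s \<in> forms \<Longrightarrow> \<forall>\<^sub>F P in gen. hval s P \<noteq> 0"
  unfolding eventually_gen by blast

lemma gen_C: "\<forall>\<^sub>F P in gen. P \<in> C"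
  unfolding eventually_gen using const_forms[of 1] by auto

lemma gen_openin:
  assumes "openin (subtopology zariski C) U" "U \<noteq> {}"
  shows "\<forall>\<^sub>F P in gen. P \<in> U"
  using assms openin_base unfolding eventually_gen by blast

lemma gen_not_bot: "gen \<noteq> bot"
  unfolding trivial_limit_def eventually_gen by (auto simp: forms_def)

lemma eventually_genE:
  assumes "eventually R gen"
  obtains U where "openin (subtopology zariski C) U" "U \<noteq> {}" "\<And>P. P \<in> U \<Longrightarrow> R P"
proof -
  obtain s where s: "s \<in> forms" "\<And>P. P \<in> C \<Longrightarrow> hval s P \<noteq> 0 \<Longrightarrow> R P"
    using assms unfolding eventually_gen by blast
  then obtain d where "homogeneous d s" by (auto simp: forms_def)
  from that[OF openin_nonzero[OF this]] s show ?thesis by (auto simp: forms_def)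
qed

lemma not_forms: "homogeneous d s \<Longrightarrow> s \<notin> forms \<Longrightarrow> P \<in> C \<Longrightarrow> hval s P = 0"
  by (auto simp: forms_def)

text \<open>A form that is nonzero at one point of \<open>C\<close> is itself one of the forms
  defining \<open>gen\<close>, hence generically nonzero. This density argument makes values of
  germs unique.\<close>

lemma eventually_zero_everywhere:
  assumes "homogeneous d s" "\<forall>\<^sub>F P in gen. hval s P = 0" "P \<in> C"
  shows "hval s P = 0"
proof (rule ccontr)
  assume "hval s P \<noteq> 0"
  then have "s \<in> forms" using assms by (auto simp: forms_def)
  from gen_forms[OF this] assms(2) have "\<forall>\<^sub>F P in gen. False" by eventually_elim simp
  then show False using gen_not_bot by (simp add: trivial_limit_def)
qed

lemma formsI: "homogeneous d s \<Longrightarrow> P \<in> C \<Longrightarrow> hval s P \<noteq> 0 \<Longrightarrow> s \<in> forms"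
  by (auto simp: forms_def)

lemma KI: "homogeneous d p \<Longrightarrow> homogeneous d q \<Longrightarrow> q \<in> forms \<Longrightarrow>
  \<forall>\<^sub>F P in gen. f P = hval p P / hval q P \<Longrightarrow> f \<in> K"
  unfolding K_def by blast

lemma KE: assumes "f \<in> K"
  obtains d p q where "homogeneous d p" "homogeneous d q" "q \<in> forms"
    "\<forall>\<^sub>F P in gen. f P = hval p P / hval q P"
  using assms unfolding K_def by blast

lemma valI: "P \<in> C \<Longrightarrow> homogeneous d p \<Longrightarrow> homogeneous d q \<Longrightarrow> hval q P \<noteq> 0 \<Longrightarrow>
  \<forall>\<^sub>F P in gen. f P = hval p P / hval q P \<Longrightarrow> c = hval p P / hval q P \<Longrightarrow> val P f c"
  unfolding val_def by blast

lemma valE: assumes "val P f c"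
  obtains d p q where "P \<in> C" "homogeneous d p" "homogeneous d q" "hval q P \<noteq> 0" "q \<in> forms"
    "\<forall>\<^sub>F P in gen. f P = hval p P / hval q P" "c = hval p P / hval q P"
  using assms formsI unfolding val_def by blast

lemma function_model: "function_model gen K"
proof
  show "gen \<noteq> bot" by (rule gen_not_bot)
  show "(\<lambda>_. c) \<in> K" for c
    by (rule KI[OF homogeneous_const[of c] homogeneous_const[of 1] const_forms]) (simp_all add: hval_const)
  fix f assume f: "f \<in> K"
  then obtain d p q where p: "homogeneous d p" "homogeneous d q" "q \<in> forms"
    "\<forall>\<^sub>F P in gen. f P = hval p P / hval q P" by (rule KE)
  note q = gen_forms[OF p(3)]
  { fix g assume "g \<in> K"
    then obtain d' p' q' where p': "homogeneous d' p'" "homogeneous d' q'" "q' \<in> forms"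
      "\<forall>\<^sub>F P in gen. g P = hval p' P / hval q' P" by (rule KE)
    note q' = gen_forms[OF p'(3)]
    have qq: "homogeneous (d + d') (q * q')" by (intro homogeneous_mult p p')
    have "homogeneous (d + d') (q * p')" "homogeneous (d + d') (q' * p)"
      using homogeneous_mult[OF p(2) p'(1)] homogeneous_mult[OF p'(2) p(1)] by (simp_all add: add.commute)
    then have pq: "homogeneous (d + d') (q * p' + q' * p)" by (rule homogeneous_add)
    show "(\<lambda>Q. f Q + g Q) \<in> K"
    proof (rule KI[OF pq qq forms_mult[OF p(3) p'(3)]])
      show "\<forall>\<^sub>F P in gen. f P + g P = hval (q * p' + q' * p) P / hval (q * q') P"
        using p(4) p'(4) q q' by eventually_elim (simp add: hval_add hval_mult field_simps)
    qed
    show "(\<lambda>Q. f Q * g Q) \<in> K"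
    proof (rule KI[OF homogeneous_mult[OF p(1) p'(1)] qq forms_mult[OF p(3) p'(3)]])
      show "\<forall>\<^sub>F P in gen. f P * g P = hval (p * p') P / hval (q * q') P"
        using p(4) p'(4) by eventually_elim (simp add: hval_mult)
    qed }
  show "g \<in> K" if "\<forall>\<^sub>F Q in gen. f Q = g Q" for g
  proof (rule KI[OF p(1-3)])
    show "\<forall>\<^sub>F P in gen. g P = hval p P / hval q P" using that p(4) by eventually_elim simp
  qed
  show "(\<lambda>Q. inverse (f Q)) \<in> K"
  proof (cases "p \<in> forms")
    case True
    show ?thesis
    proof (rule KI[OF p(2,1) True])
      show "\<forall>\<^sub>F P in gen. inverse (f P) = hval q P / hval p P"
        using p(4) by eventually_elim simp
    qed
  next
    \<comment> \<open>A numerator vanishing on \<open>C\<close> makes \<open>f\<close> generically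
      zero; by 1 / 0 = 0 its inverse is then zero too.\<close>
    case False
    show ?thesis
    proof (rule KI[OF homogeneous_zero p(2,3)])
      show "\<forall>\<^sub>F P in gen. inverse (f P) = hval 0 P / hval q P"
        using p(4) gen_C by eventually_elim (simp add: not_forms[OF p(1) False])
    qed
  qed
  show "(\<forall>\<^sub>F Q in gen. f Q = 0) \<or> (\<forall>\<^sub>F Q in gen. f Q \<noteq> 0)"
  proof (cases "p \<in> forms")
    case True
    have "\<forall>\<^sub>F Q in gen. f Q \<noteq> 0" using p(4) q gen_forms[OF True] by eventually_elim simp
    then show ?thesis by blast
  next
    case False
    have "\<forall>\<^sub>F Q in gen. f Q = 0" using p(4) gen_C by eventually_elim (simp add: not_forms[OF p(1) False])
    then show ?thesis by blast
  qed
qed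

sublocale alg_closed_function_model gen K
  using function_model by (simp add: alg_closed_function_model_def)

lemma val_in_K: "val P f c \<Longrightarrow> f \<in> K"
  by (elim valE) (rule KI)

lemma val_consts: "P \<in> C \<Longrightarrow> val P (\<lambda>_. c) c"
  by (rule valI[OF _ homogeneous_const[of c] homogeneous_const[of 1]]) (simp_all add: hval_const)

lemma val_plus: assumes "val P f c" "val P g c'" shows "val P (\<lambda>Q. f Q + g Q) (c + c')"
proof -
  obtain d p q where p: "P \<in> C" "homogeneous d p" "homogeneous d q" "hval q P \<noteq> 0" "q \<in> forms"
    "\<forall>\<^sub>F P in gen. f P = hval p P / hval q P" "c = hval p P / hval q P" using valE[OF assms(1)] .
  obtain d' p' q' where p': "homogeneous d' p'" "homogeneous d' q'" "hval q' P \<noteq> 0" "q' \<in> forms"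
    "\<forall>\<^sub>F P in gen. g P = hval p' P / hval q' P" "c' = hval p' P / hval q' P" using valE[OF assms(2)] .
  have qq: "homogeneous (d + d') (q * q')" by (intro homogeneous_mult p p')
  have "homogeneous (d + d') (q * p')" "homogeneous (d + d') (q' * p)"
    using homogeneous_mult[OF p(3) p'(1)] homogeneous_mult[OF p'(2) p(2)] by (simp_all add: add.commute)
  then have pq: "homogeneous (d + d') (q * p' + q' * p)" by (rule homogeneous_add)
  show ?thesis
  proof (rule valI[OF p(1) pq qq])
    show "\<forall>\<^sub>F P in gen. f P + g P = hval (q * p' + q' * p) P / hval (q * q') P"
      using p(6) p'(5) gen_forms[OF p(5)] gen_forms[OF p'(4)]
      by eventually_elim (simp add: hval_add hval_mult field_simps)
    show "hval (q * q') P \<noteq> 0" using p(4) p'(3) by (simp add: hval_mult)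
    show "c + c' = hval (q * p' + q' * p) P / hval (q * q') P"
      unfolding p(7) p'(6) hval_add hval_mult using p(4) p'(3) by (simp add: field_simps)
  qed
qed

lemma val_times: assumes "val P f c" "val P g c'" shows "val P (\<lambda>Q. f Q * g Q) (c * c')"
proof -
  obtain d p q where p: "P \<in> C" "homogeneous d p" "homogeneous d q" "hval q P \<noteq> 0" "q \<in> forms"
    "\<forall>\<^sub>F P in gen. f P = hval p P / hval q P" "c = hval p P / hval q P" using valE[OF assms(1)] .
  obtain d' p' q' where p': "homogeneous d' p'" "homogeneous d' q'" "hval q' P \<noteq> 0" "q' \<in> forms"
    "\<forall>\<^sub>F P in gen. g P = hval p' P / hval q' P" "c' = hval p' P / hval q' P" using valE[OF assms(2)] .
  show ?thesis
  proof (rule valI[OF p(1) homogeneous_mult[OF p(2) p'(1)] homogeneous_mult[OF p(3) p'(2)]])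
    show "\<forall>\<^sub>F P in gen. f P * g P = hval (p * p') P / hval (q * q') P"
      using p(6) p'(5) by eventually_elim (simp add: hval_mult)
  qed (use p p' in \<open>simp_all add: hval_mult\<close>)
qed

lemma val_inv: assumes "val P f c" "c \<noteq> 0" shows "val P (\<lambda>Q. inverse (f Q)) (inverse c)"
proof -
  obtain d p q where p: "P \<in> C" "homogeneous d p" "homogeneous d q" "hval q P \<noteq> 0" "q \<in> forms"
    "\<forall>\<^sub>F P in gen. f P = hval p P / hval q P" "c = hval p P / hval q P" using valE[OF assms(1)] .
  show ?thesis
  proof (rule valI[OF p(1,3,2)])
    show "\<forall>\<^sub>F P in gen. inverse (f P) = hval q P / hval p P"
      using p(6) by eventually_elim simp
  qed (use p assms in auto)
qed

lemma val_respects: assumes "val P f c" "\<forall>\<^sub>F Q in gen. f Q = g Q" shows "val P g c"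
proof -
  obtain d p q where p: "P \<in> C" "homogeneous d p" "homogeneous d q" "hval q P \<noteq> 0" "q \<in> forms"
    "\<forall>\<^sub>F P in gen. f P = hval p P / hval q P" "c = hval p P / hval q P" using valE[OF assms(1)] .
  show ?thesis
  proof (rule valI[OF p(1-4) _ p(7)])
    show "\<forall>\<^sub>F P in gen. g P = hval p P / hval q P" using p(6) assms(2) by eventually_elim simp
  qed
qed

text \<open>Two representations p / q and p' / q' of one germ have the cross difference q p' - q' p
  generically zero, hence zero at P, where neither denominator vanishes.\<close>

lemma val_eq: assumes "val P f c" "val P f c'" shows "c = c'"
proof -
  obtain d p q where p: "P \<in> C" "homogeneous d p" "homogeneous d q" "hval q P \<noteq> 0" "q \<in> forms"
    "\<forall>\<^sub>F P in gen. f P = hval p P / hval q P" "c = hval p P / hval q P" using valE[OF assms(1)] .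
  obtain d' p' q' where p': "homogeneous d' p'" "homogeneous d' q'" "hval q' P \<noteq> 0" "q' \<in> forms"
    "\<forall>\<^sub>F P in gen. f P = hval p' P / hval q' P" "c' = hval p' P / hval q' P" using valE[OF assms(2)] .
  define r where "r = q * p' + const_mpoly (- 1) * (q' * p)"
  have "homogeneous (d + d') (q * p')" "homogeneous (d + d') (q' * p)"
    using homogeneous_mult[OF p(3) p'(1)] homogeneous_mult[OF p'(2) p(2)] by (simp_all add: add.commute)
  then have r: "homogeneous (d + d') r" unfolding r_def by (intro homogeneous_add homogeneous_const_mult)
  have hr: "hval r Q = hval q Q * hval p' Q - hval q' Q * hval p Q" for Q
    by (simp add: r_def hval_add hval_mult hval_const)
  have "\<forall>\<^sub>F P in gen. hval r P = 0"
    using p(6) p'(5) gen_forms[OF p(5)] gen_forms[OF p'(4)] unfolding hr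
    by eventually_elim (simp add: field_simps)
  then have "hval r P = 0" using eventually_zero_everywhere[OF r] p(1) by blast
  then show ?thesis using p(4) p'(3) unfolding p(7) p'(6) hr by (simp add: field_simps)
qed

text \<open>Numerator and denominator are both divided by the d-th power of a coordinate that does
  not vanish at P.\<close>

lemma fractions:
  assumes P: "P \<in> C" and f: "f \<in> K"
  shows "\<exists>g h c d. val P g c \<and> val P h d \<and> (\<forall>\<^sub>F Q in gen. h Q \<noteq> 0 \<and> f Q = g Q / h Q)"
proof -
  obtain d p q where p: "homogeneous d p" "homogeneous d q" "q \<in> forms"
    "\<forall>\<^sub>F P in gen. f P = hval p P / hval q P" using f by (rule KE)
  obtain i where i: "hval (var_mpoly i :: ('k, 'n) mpoly) P \<noteq> 0"
    using projective_space_var[OF C_projective[OF P]] by blast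
  define x :: "('k, 'n) mpoly" where "x = var_mpoly i ^ d"
  have x: "homogeneous d x" using homogeneous_power[OF homogeneous_var, of d] by (simp add: x_def)
  have xP: "hval x P \<noteq> 0" using i by (simp add: x_def hval_power)
  have xf: "x \<in> forms" using formsI[OF x P xP] .
  have "val P (\<lambda>Q. hval p Q / hval x Q) (hval p P / hval x P)" "val P (\<lambda>Q. hval q Q / hval x Q) (hval q P / hval x P)"
    using valI[OF P p(1) x xP] valI[OF P p(2) x xP] by simp_all
  moreover have "\<forall>\<^sub>F Q in gen. hval q Q / hval x Q \<noteq> 0 \<and> f Q = (hval p Q / hval x Q) / (hval q Q / hval x Q)"
    using p(4) gen_forms[OF p(3)] gen_forms[OF xf] by eventually_elim simp
  ultimately show ?thesis by blast
qed

lemma regular_on_val: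
  assumes U: "openin (subtopology zariski C) U" and f: "regular_on U f" and P: "P \<in> U"
  shows "val P f (f P)"
proof -
  have UC: "U \<subseteq> C" using U by (auto simp: openin_C)
  obtain V d p q where V: "openin (subtopology zariski U) V" "P \<in> V" "homogeneous d p" "homogeneous d q"
    "\<And>Q v. Q \<in> V \<Longrightarrow> v \<in> Q \<Longrightarrow> poly_eval q v \<noteq> 0 \<and> f Q = poly_eval p v / poly_eval q v"
    using f P unfolding regular_on_def by meson
  have VU: "V \<subseteq> U" using V(1) by (auto simp: openin_subtopology)
  have VC: "openin (subtopology zariski C) V"
  proof -
    have "subtopology zariski U = subtopology (subtopology zariski C) U"
      using UC by (simp add: subtopology_subtopology Int_absorb1)
    then show ?thesis using V(1) U by (metis openin_trans_full)
  qed
  have at: "hval q Q \<noteq> 0 \<and> f Q = hval p Q / hval q Q" if Q: "Q \<in> V" for Q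
  proof -
    have "Q \<in> projective_space" using Q VU UC C_projective by blast
    from projective_space_rep(1)[OF this] show ?thesis using V(5)[OF Q] by (simp add: hval_def)
  qed
  show ?thesis
  proof (rule valI[OF _ V(3,4)])
    show "\<forall>\<^sub>F P in gen. f P = hval p P / hval q P"
    proof -
      have "\<forall>\<^sub>F P in gen. P \<in> V" using gen_openin[OF VC] V(2) by blast
      then show ?thesis by eventually_elim (simp add: at)
    qed
  qed (use at[OF V(2)] V(2) VU UC in auto)
qed

lemma regular_on_hval:
  assumes U: "U \<subseteq> C" and p: "homogeneous d p" "homogeneous d q" and "\<And>P. P \<in> U \<Longrightarrow> hval q P \<noteq> 0"
  shows "regular_on U (\<lambda>P. hval p P / hval q P)"
  unfolding regular_on_def
proof
  fix P assume P: "P \<in> U"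
  have top: "topspace (subtopology zariski U) = U" using C_projective U by auto
  have "openin (subtopology zariski U) U" using openin_topspace[of "subtopology zariski U"] unfolding top .
  moreover have "poly_eval q v \<noteq> 0 \<and> hval p Q / hval q Q = poly_eval p v / poly_eval q v"
    if "Q \<in> U" "v \<in> Q" for Q v
    using hval_zero_iff[OF _ that(2) p(2)] hval_ratio[OF _ that(2) p] assms(4)[OF that(1)] U that(1) C_projective
    by (metis subsetD)
  ultimately show "\<exists>V d r s. openin (subtopology zariski U) V \<and> P \<in> V \<and> homogeneous d r \<and> homogeneous d s \<and>
    (\<forall>Q\<in>V. \<forall>v\<in>Q. poly_eval s v \<noteq> 0 \<and> hval p Q / hval q Q = poly_eval r v / poly_eval s v)"
    using P p by blast
qed

lemma val_regular_on:
  assumes "val P f c"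
  shows "\<exists>U g. openin (subtopology zariski C) U \<and> P \<in> U \<and> regular_on U g \<and> (\<forall>\<^sub>F Q in gen. f Q = g Q) \<and> g P = c"
proof -
  obtain d p q where p: "P \<in> C" "homogeneous d p" "homogeneous d q" "hval q P \<noteq> 0" "q \<in> forms"
    "\<forall>\<^sub>F P in gen. f P = hval p P / hval q P" "c = hval p P / hval q P" using valE[OF assms] .
  let ?U = "{P \<in> C. hval q P \<noteq> 0}"
  have "regular_on ?U (\<lambda>P. hval p P / hval q P)" by (rule regular_on_hval[OF _ p(2,3)]) auto
  then show ?thesis using openin_nonzero[OF p(3)] p by (intro exI[of _ ?U]) auto
qed

lemma K_regular_on:
  assumes "f \<in> K"
  shows "\<exists>U g. openin (subtopology zariski C) U \<and> U \<noteq> {} \<and> regular_on U g \<and> (\<forall>\<^sub>F Q in gen. f Q = g Q)"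
proof -
  obtain d p q where p: "homogeneous d p" "homogeneous d q" "q \<in> forms"
    "\<forall>\<^sub>F P in gen. f P = hval p P / hval q P" using assms by (rule KE)
  then obtain P where "P \<in> C" "hval q P \<noteq> 0" by (auto simp: forms_def)
  then have "val P f (hval p P / hval q P)" by (intro valI[OF _ p(1,2) _ p(4)]) auto
  from val_regular_on[OF this] show ?thesis by blast
qed

text \<open>A nonconstant function without poles would be sent to infinity by a place, but that place is
  centered at a point of \<open>C\<close>, since \<open>C\<close> is projective.\<close>
lemma regular_constant:
  assumes f: "f \<in> K" and reg: "\<And>P. P \<in> C \<Longrightarrow> \<exists>c. val P f c"
  shows "\<exists>c. \<forall>\<^sub>F Q in gen. f Q = c"
proof (rule ccontr)
  assume nc: "\<nexists>c. \<forall>\<^sub>F Q in gen. f Q = c"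
  define z where "z = (\<lambda>Q. inverse (f Q))"
  have f_ne: "\<forall>\<^sub>F Q in gen. f Q \<noteq> 0" using K_zero[OF f] nc by blast
  have z: "z \<in> K" unfolding z_def by (rule K_inverse[OF f])
  have z_nc: "\<not> (\<forall>\<^sub>F Q in gen. z Q = c)" for c
  proof
    assume "\<forall>\<^sub>F Q in gen. z Q = c"
    with f_ne have "\<forall>\<^sub>F Q in gen. f Q = inverse c" by eventually_elim (auto simp: z_def)
    with nc show False by blast
  qed
  obtain pl where pl_K: "\<And>f c. pl f c \<Longrightarrow> f \<in> K" and pl_const: "\<And>c. pl (\<lambda>_. c) c"
    and pl_add: "\<And>f c g d. pl f c \<Longrightarrow> pl g d \<Longrightarrow> pl (\<lambda>Q. f Q + g Q) (c + d)"
    and pl_mult: "\<And>f c g d. pl f c \<Longrightarrow> pl g d \<Longrightarrow> pl (\<lambda>Q. f Q * g Q) (c * d)"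
    and pl_inverse: "\<And>f c. pl f c \<Longrightarrow> c \<noteq> 0 \<Longrightarrow> pl (\<lambda>Q. inverse (f Q)) (inverse c)"
    and pl_cong: "\<And>f c g. pl f c \<Longrightarrow> \<forall>\<^sub>F Q in gen. f Q = g Q \<Longrightarrow> pl g c"
    and pl_unique: "\<And>f c d. pl f c \<Longrightarrow> pl f d \<Longrightarrow> c = d"
    and pl_total: "\<And>f. f \<in> K \<Longrightarrow> \<exists>c. pl f c \<or> pl (\<lambda>Q. inverse (f Q)) c"
    and pl_z: "pl z 0"
    by (rule place_exists[OF z z_nc]) blast
  have pl_sum: "pl (\<lambda>Q. \<Sum>i\<in>I. g i Q) (\<Sum>i\<in>I. c i)" if "\<And>i. i \<in> I \<Longrightarrow> pl (g i) (c i)" for I :: "('n \<Rightarrow>\<^sub>0 nat) set" and g c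
    using that by (induction I rule: infinite_finite_induct) (simp_all add: pl_const pl_add)
  have pl_prod: "pl (\<lambda>Q. \<Prod>i\<in>I. g i Q) (\<Prod>i\<in>I. c i)" if "\<And>i. i \<in> I \<Longrightarrow> pl (g i) (c i)" for I :: "'n set" and g c
    using that by (induction I rule: infinite_finite_induct) (simp_all add: pl_const pl_mult)
  have pl_power: "pl (\<lambda>Q. g Q ^ n) (c ^ n)" if "pl g c" for g c and n :: nat
    using that by (induction n) (simp_all add: pl_const pl_mult)
  define x where "x = (\<lambda>i P. hval (var_mpoly i :: ('k, 'n) mpoly) P)"
  define I where "I = {i. (var_mpoly i :: ('k, 'n) mpoly) \<in> forms}"
  have x_ne: "\<forall>\<^sub>F Q in gen. x i Q \<noteq> 0" if "i \<in> I" for i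
    using gen_forms[of "var_mpoly i"] that by (simp add: x_def I_def)
  have x_zero: "\<forall>\<^sub>F Q in gen. x i Q = 0" if "i \<notin> I" for i
    using gen_C not_forms[OF homogeneous_var] that by (auto simp: x_def I_def elim!: eventually_mono)
  have xK: "(\<lambda>Q. x j Q / x i Q) \<in> K" if "i \<in> I" for i j
    by (rule KI[OF homogeneous_var[of j] homogeneous_var[of i]]) (use that in \<open>auto simp: x_def I_def\<close>)
  have "I \<noteq> {}"
  proof -
    obtain P where "P \<in> C" using C_nonempty by blast
    then obtain i where "hval (var_mpoly i :: ('k, 'n) mpoly) P \<noteq> 0"
      using projective_space_var C_projective by blast
    then have "i \<in> I" using formsI[OF homogeneous_var] \<open>P \<in> C\<close> by (auto simp: I_def)
    then show ?thesis by blast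
  qed
  \<comment> \<open>\<open>R i j\<close> says that x_j / x_i is finite at the place, so a least
    element is a coordinate of minimal valuation.\<close>
  define R where "R = (\<lambda>i j. \<exists>c. pl (\<lambda>Q. x j Q / x i Q) c)"
  have "\<exists>i\<in>I. \<forall>j\<in>I. R i j"
  proof (rule total_preorder_least[OF _ \<open>I \<noteq> {}\<close>])
    fix i j assume ij: "i \<in> I" "j \<in> I"
    show "R i j \<or> R j i"
      using pl_total[OF xK[OF ij(1), of j]] by (auto simp: R_def)
    fix l assume l: "l \<in> I" and "R i j" "R j l"
    then obtain c d where "pl (\<lambda>Q. x j Q / x i Q) c" "pl (\<lambda>Q. x l Q / x j Q) d" by (auto simp: R_def)
    from pl_mult[OF this] have cd: "pl (\<lambda>Q. x j Q / x i Q * (x l Q / x j Q)) (c * d)" .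
    have "\<forall>\<^sub>F Q in gen. x j Q / x i Q * (x l Q / x j Q) = x l Q / x i Q"
      using x_ne[OF ij(2)] by eventually_elim simp
    from pl_cong[OF cd this] show "R i l" by (auto simp: R_def)
  qed simp
  then obtain i where i: "i \<in> I" "\<And>j. j \<in> I \<Longrightarrow> R i j" by blast
  have "\<exists>c. pl (\<lambda>Q. x j Q / x i Q) c" for j
  proof (cases "j \<in> I")
    case True
    then show ?thesis using i(2) by (auto simp: R_def)
  next
    case False
    from x_zero[OF False] have "\<forall>\<^sub>F Q in gen. 0 = x j Q / x i Q" by eventually_elim simp
    from pl_cong[OF pl_const this] show ?thesis by blast
  qed
  then obtain c where c: "\<And>j. pl (\<lambda>Q. x j Q / x i Q) (c j)" by metis
  have "\<forall>\<^sub>F Q in gen. 1 = x i Q / x i Q" using x_ne[OF i(1)] by eventually_elim simp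
  from pl_cong[OF pl_const this] have ci: "c i = 1" using c pl_unique by blast
  define v where "v = (\<chi> j. c j)"
  have v0: "v \<noteq> 0" using ci by (auto simp: v_def vec_eq_iff intro!: exI[of _ i])
  \<comment> \<open>The center of the place: its coordinates are the residues of the x_j / x_i, and
    they are not all zero because the i-th one is 1.\<close>
  define P where "P = {a *s v | a. a \<noteq> 0}"
  have Pp: "P \<in> projective_space" unfolding P_def projective_space_def using v0 by blast
  have vP: "v \<in> P" unfolding P_def by (intro CollectI exI[of _ 1]) simp
  define y where "y = (\<lambda>Q. \<chi> j. x j Q / x i Q)"
  have pl_eval: "pl (\<lambda>Q. poly_eval p (y Q)) (poly_eval p v)" for p
    unfolding poly_eval_def mono_eval_def
    by (intro pl_sum pl_mult pl_prod pl_power pl_const) (simp add: y_def v_def c)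
  have eval_y: "poly_eval p (y Q) = hval p Q / x i Q ^ d" if "homogeneous d p" for p d Q
    unfolding y_def x_def by (rule poly_eval_affine[OF that])
  \<comment> \<open>Closedness of \<open>C\<close> enters here: an equation of \<open>C\<close> is
    generically zero in the affine coordinates, so its residue, which is its value at the center, is
    zero.\<close>
  have PC: "P \<in> C"
  proof -
    obtain T where T: "\<And>p. p \<in> T \<Longrightarrow> \<exists>d. homogeneous d p" "C = zero_locus T" using C_zero_locus by blast
    have "poly_eval p w = 0" if p: "p \<in> T" and w: "w \<in> P" for p w
    proof -
      obtain d where d: "homogeneous d p" using T p by blast
      have "hval p Q = 0" if "Q \<in> C" for Q
        using that p projective_space_rep(1)[OF C_projective[OF that]] unfolding T(2) zero_locus_def hval_def by blast
      then have "\<forall>\<^sub>F Q in gen. poly_eval p (y Q) = 0"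
        using gen_C by (auto simp: eval_y[OF d] elim!: eventually_mono)
      from pl_cong[OF pl_eval this] have "poly_eval p v = 0" using pl_const pl_unique by blast
      then show ?thesis using hval_zero_iff[OF Pp _ d] w vP by blast
    qed
    then show ?thesis using Pp unfolding T(2) zero_locus_def by blast
  qed
  then obtain e where "val P f e" using reg by blast
  then obtain d p q where p: "homogeneous d p" "homogeneous d q" "hval q P \<noteq> 0" "q \<in> forms"
    "\<forall>\<^sub>F P in gen. f P = hval p P / hval q P" by (rule valE)
  \<comment> \<open>Being regular at the center, \<open>f\<close> has a finite residue, namely that
    of p / q. Multiplied by \<open>z\<close>, of residue 0, it gives a function that is generically
    1 but has residue 0.\<close>
  have "poly_eval q v \<noteq> 0" using p hval_zero_iff[OF Pp vP p(2)] by simp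
  from pl_mult[OF pl_eval[of p] pl_inverse[OF pl_eval this]]
  have "pl (\<lambda>Q. poly_eval p (y Q) * inverse (poly_eval q (y Q))) (poly_eval p v * inverse (poly_eval q v))" .
  from pl_mult[OF this pl_z]
  have 0: "pl (\<lambda>Q. poly_eval p (y Q) * inverse (poly_eval q (y Q)) * z Q) 0" by simp
  have "\<forall>\<^sub>F Q in gen. poly_eval p (y Q) * inverse (poly_eval q (y Q)) * z Q = 1"
    using p(5) x_ne[OF i(1)] f_ne gen_forms[OF p(4)]
  proof eventually_elim
    case (elim Q)
    have "poly_eval p (y Q) * inverse (poly_eval q (y Q)) = f Q"
      using elim by (simp add: eval_y[OF p(1)] eval_y[OF p(2)])
    then show ?case using elim by (simp add: z_def)
  qed
  from pl_cong[OF 0 this] show False using pl_const pl_unique zero_neq_one by metis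
qed

end

section \<open>Linear forms in general position\<close>

text \<open>In a finite field, 1 plus the product of all X - a takes only the value 1 and so has no
  root.\<close>

lemma infinite_alg_closed_field: "infinite (UNIV :: 'k::alg_closed_field set)"
proof
  assume fin: "finite (UNIV :: 'k set)"
  define p :: "'k poly" where "p = (\<Prod>a\<in>UNIV. [:- a, 1:])"
  have "Polynomial.degree p = card (UNIV :: 'k set)"
    unfolding p_def by (subst degree_prod_eq_sum_degree) auto
  then have "Polynomial.degree p > 0" using fin by (simp add: card_gt_0_iff)
  then have "Polynomial.degree (p + 1) > 0" by (subst degree_add_eq_left) simp_all
  then obtain r where "poly (p + 1) r = 0" using alg_closed_imp_poly_has_root by blast
  moreover have "poly p r = 0"
    using fin by (auto simp: p_def poly_prod intro!: prod_zero bexI[of _ r])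
  ultimately show False by simp
qed

text \<open>A form that vanishes at the new point A is corrected by c times a coordinate that does
  not vanish there; only finitely many c are bad, and the field is infinite.\<close>

lemma linear_form_avoiding:
  fixes S :: "('k::alg_closed_field, 'n::finite) pt set"
  assumes "finite S" "S \<subseteq> projective_space"
  shows "\<exists>l. homogeneous 1 l \<and> (\<forall>A\<in>S. hval l A \<noteq> 0)"
  using assms
proof (induction S rule: finite_induct)
  case empty
  then show ?case using homogeneous_zero by blast
next
  case (insert A S)
  then obtain l where l: "homogeneous 1 l" "\<And>B. B \<in> S \<Longrightarrow> hval l B \<noteq> 0" by auto
  show ?case
  proof (cases "hval l A = 0")
    case False
    then show ?thesis using l by auto
  next
    case True
    obtain i where i: "hval (var_mpoly i :: ('k, 'n) mpoly) A \<noteq> 0"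
      using projective_space_var[of A] insert.prems by blast
    let ?x = "var_mpoly i :: ('k, 'n) mpoly"
    \<comment> \<open>The value c = 0 leaves the form zero at \<open>A\<close>; the others are the c
      that would make it vanish at some \<open>B\<close> in \<open>S\<close>.\<close>
    have "finite ({0} \<union> (\<lambda>B. - hval l B / hval ?x B) ` S)" using insert.hyps by simp
    then obtain c where c: "c \<notin> {0} \<union> (\<lambda>B. - hval l B / hval ?x B) ` S"
      using ex_new_if_finite[OF infinite_alg_closed_field] by metis
    have "hval (l + const_mpoly c * ?x) B \<noteq> 0" if B: "B \<in> insert A S" for B
    proof (cases "B = A")
      case True
      then show ?thesis using \<open>hval l A = 0\<close> i c by (simp add: hval_add hval_mult hval_const)
    next
      case False
      then have BS: "B \<in> S" using B by simp
      show ?thesis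
      proof
        assume "hval (l + const_mpoly c * ?x) B = 0"
        then have eq: "hval l B + c * hval ?x B = 0" by (simp add: hval_add hval_mult hval_const)
        then have "hval ?x B \<noteq> 0" using l(2)[OF BS] by auto
        with eq have "c = - hval l B / hval ?x B" by (simp add: field_simps eq_neg_iff_add_eq_0)
        then show False using c BS by blast
      qed
    qed
    moreover have "homogeneous 1 (l + const_mpoly c * ?x)"
      by (intro homogeneous_add homogeneous_const_mult l homogeneous_var)
    ultimately show ?thesis by blast
  qed
qed

text \<open>The form w_j X_i - w_i X_j vanishes at Q, and its value at P is a 2 x 2 minor of the two
  coordinate vectors. If all minors were zero, the vectors would be proportional.\<close>

lemma linear_form_separating:
  fixes P Q :: "('k::field, 'n::finite) pt"
  assumes "P \<in> projective_space" "Q \<in> projective_space" "P \<noteq> Q"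
  shows "\<exists>m. homogeneous 1 m \<and> hval m P \<noteq> 0 \<and> hval m Q = 0"
proof -
  define v where "v = (SOME v. v \<in> P)"
  define w where "w = (SOME v. v \<in> Q)"
  have P: "P = {c *s v | c. c \<noteq> 0}" "v \<noteq> 0" and Q: "Q = {c *s w | c. c \<noteq> 0}" "w \<noteq> 0"
    using projective_space_rep[OF assms(1)] projective_space_rep[OF assms(2)] by (auto simp: v_def w_def)
  have "\<exists>i j. w $ j * v $ i - w $ i * v $ j \<noteq> 0"
  proof (rule ccontr)
    assume "\<nexists>i j. w $ j * v $ i - w $ i * v $ j \<noteq> 0"
    then have eq: "w $ j * v $ i = w $ i * v $ j" for i j by auto
    obtain j where j: "w $ j \<noteq> 0" using Q(2) by (metis vec_eq_iff zero_index)
    define a where "a = v $ j / w $ j"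
    have va: "v = a *s w"
      using j eq[of j] by (auto simp: vec_eq_iff a_def field_simps)
    have "a \<noteq> 0" using va P(2) by auto
    have "v \<in> P" unfolding P(1) by (intro CollectI exI[of _ 1]) simp
    have "P = Q"
    proof
      show "P \<subseteq> Q" unfolding P(1) Q(1) va using \<open>a \<noteq> 0\<close> by (auto simp: vector_smult_assoc)
      show "Q \<subseteq> P"
      proof
        fix u assume "u \<in> Q"
        then obtain c where "u = c *s w" "c \<noteq> 0" unfolding Q(1) by blast
        then have "u = (c / a) *s v" "c / a \<noteq> 0" using \<open>a \<noteq> 0\<close> by (simp_all add: va vector_smult_assoc)
        then show "u \<in> P" unfolding P(1) by blast
      qed
    qed
    with assms(3) show False ..
  qed
  then obtain i j where ij: "w $ j * v $ i - w $ i * v $ j \<noteq> 0" by blast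
  define m where "m = const_mpoly (w $ j) * var_mpoly i + const_mpoly (- w $ i) * var_mpoly j"
  have "homogeneous 1 m" unfolding m_def by (intro homogeneous_add homogeneous_const_mult homogeneous_var)
  moreover have "hval m P \<noteq> 0" "hval m Q = 0"
    using ij by (simp_all add: hval_def m_def poly_eval_add poly_eval_mult poly_eval_const poly_eval_var
        flip: v_def w_def)
  ultimately show ?thesis by blast
qed

lemma homogeneous_prod:
  "(\<And>i. i \<in> I \<Longrightarrow> homogeneous (d i) (p i)) \<Longrightarrow> homogeneous (\<Sum>i\<in>I. d i) (\<Prod>i\<in>I. p i)"
  by (induction I rule: infinite_finite_induct) (simp_all add: homogeneous_mult, (simp add: homogeneous_def)+)

lemma hval_prod: "hval (\<Prod>i\<in>I. p i) P = (\<Prod>i\<in>I. hval (p i) P)"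
  by (induction I rule: infinite_finite_induct) (simp_all add: hval_mult hval_one)

section \<open>Finite degree over a field of rational functions\<close>

context function_model begin

lemma K_poly: "t \<in> K \<Longrightarrow> (\<lambda>Q. poly A (t Q)) \<in> K"
  unfolding poly_altdef by (intro K_sum K_mult K_power K_const)

definition algebraic_dependent :: "('p \<Rightarrow> 'k) \<Rightarrow> ('p \<Rightarrow> 'k) \<Rightarrow> bool" where
  "algebraic_dependent t y \<longleftrightarrow> (\<exists>n A. A n \<noteq> 0 \<and> (\<forall>\<^sub>F Q in gen. (\<Sum>j\<le>n. poly (A j) (t Q) * y Q ^ j) = 0))"

text \<open>The equation of each \<open>y i\<close> is multiplied by the leading coefficients of all
  the others and by a power of \<open>y i\<close>; so all acquire the same leading coefficient
  \<open>A\<close> and the same degree \<open>n\<close>.\<close>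

lemma common_integral_equation:
  fixes y :: "'n::finite \<Rightarrow> 'p \<Rightarrow> 'k"
  assumes "\<And>i. algebraic_dependent t (y i)"
  obtains n A B where "n > 0" "A \<noteq> 0"
    "\<And>i. \<forall>\<^sub>F Q in gen. poly A (t Q) * y i Q ^ n = (\<Sum>j<n. poly (B i j) (t Q) * y i Q ^ j)"
proof -
  have "\<forall>i. \<exists>n A. A n \<noteq> 0 \<and> (\<forall>\<^sub>F Q in gen. (\<Sum>j\<le>n. poly (A j) (t Q) * y i Q ^ j) = 0)"
    using assms unfolding algebraic_dependent_def by blast
  from choice[OF this] obtain n0 where
    "\<forall>i. \<exists>A. A (n0 i) \<noteq> 0 \<and> (\<forall>\<^sub>F Q in gen. (\<Sum>j\<le>n0 i. poly (A j) (t Q) * y i Q ^ j) = 0)" ..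
  from choice[OF this] obtain A0 where A0: "\<And>i. A0 i (n0 i) \<noteq> 0"
    "\<And>i. \<forall>\<^sub>F Q in gen. (\<Sum>j\<le>n0 i. poly (A0 i j) (t Q) * y i Q ^ j) = 0" by blast
  define n where "n = Suc (\<Sum>i\<in>UNIV. n0 i)"
  have n0: "n0 i < n" for i unfolding n_def by (simp add: less_Suc_eq_le member_le_sum)
  define A where "A = (\<Prod>i\<in>UNIV. A0 i (n0 i))"
  define L where "L = (\<lambda>i. \<Prod>l\<in>UNIV - {i}. A0 l (n0 l))"
  have AL: "A = A0 i (n0 i) * L i" for i unfolding A_def L_def by (rule prod.remove) auto
  \<comment> \<open>Coefficients of the lower powers, moved to the right-hand side and shifted by
    the exponent \<open>n - n0 i\<close> of the extra power of \<open>y i\<close>.\<close>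
  define B where "B = (\<lambda>i j. if n - n0 i \<le> j then - (L i * A0 i (j - (n - n0 i))) else 0)"
  show ?thesis
  proof (rule that[of n A B])
    show "n > 0" by (simp add: n_def)
    show "A \<noteq> 0" using A0(1) by (simp add: A_def)
    fix i
    show "\<forall>\<^sub>F Q in gen. poly A (t Q) * y i Q ^ n = (\<Sum>j<n. poly (B i j) (t Q) * y i Q ^ j)"
      using A0(2)[of i]
    proof eventually_elim
      case (elim Q)
      let ?Y = "y i Q" and ?m = "n - n0 i"
      have "(\<Sum>j<n. poly (B i j) (t Q) * ?Y ^ j) = (\<Sum>j\<in>{?m..<n}. poly (B i j) (t Q) * ?Y ^ j)"
        by (rule sum.mono_neutral_right) (auto simp: B_def)
      also have "\<dots> = (\<Sum>j<n0 i. poly (B i (j + ?m)) (t Q) * ?Y ^ (j + ?m))"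
        by (rule sum.reindex_bij_witness[of _ "\<lambda>j. j + ?m" "\<lambda>j. j - ?m"]) (use n0[of i] in auto)
      also have "\<dots> = - (poly (L i) (t Q) * ?Y ^ ?m * (\<Sum>j<n0 i. poly (A0 i j) (t Q) * ?Y ^ j))"
        by (simp add: B_def sum_distrib_left power_add mult_ac sum_negf)
      also have "(\<Sum>j<n0 i. poly (A0 i j) (t Q) * ?Y ^ j) = - (poly (A0 i (n0 i)) (t Q) * ?Y ^ n0 i)"
        using elim by (simp add: lessThan_Suc_atMost[symmetric] eq_neg_iff_add_eq_0 add.commute)
      finally show ?case
        using n0[of i] by (simp add: AL[of i] mult_ac flip: power_add)
    qed
  qed
qed

end

context variety begin

text \<open>A quotient of linear forms: the numerator vanishes at Q but not at P, the denominator
  nowhere on \<open>S\<close> and at neither P nor Q.\<close>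

lemma separating_function:
  assumes P: "P \<in> C" and Q: "Q \<in> C" "P \<noteq> Q" and S: "finite S" "S \<subseteq> C"
  shows "\<exists>f c. (\<forall>A\<in>S. \<exists>d. val A f d) \<and> val P f c \<and> c \<noteq> 0 \<and> val Q f 0"
proof -
  obtain m where m: "homogeneous 1 m" "hval m P \<noteq> 0" "hval m Q = 0"
    using linear_form_separating[OF C_projective C_projective] P Q by blast
  obtain l where l: "homogeneous 1 l" "\<And>A. A \<in> insert P (insert Q S) \<Longrightarrow> hval l A \<noteq> 0"
    using linear_form_avoiding[of "insert P (insert Q S)"] S P Q C_projective by blast
  have "val A (\<lambda>Q. hval m Q / hval l Q) (hval m A / hval l A)" if "A \<in> insert P (insert Q S)" for A
    by (rule valI[OF _ m(1) l(1)]) (use that l P Q S in auto)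
  then show ?thesis using m l by (intro exI[of _ "\<lambda>Q. hval m Q / hval l Q"] exI[of _ "hval m P / hval l P"]) force
qed

lemma forms_prod: "(\<And>i. i \<in> I \<Longrightarrow> p i \<in> forms) \<Longrightarrow> (\<Prod>i\<in>I. p i) \<in> forms"
proof (induction I rule: infinite_finite_induct)
  case (insert i I)
  then show ?case by (simp add: forms_mult)
qed (use const_forms[of 1] in \<open>simp_all add: const_mpoly_def\<close>)

text \<open>If all functions are algebraic over the rational functions of \<open>t\<close>, the space of forms of
  degree \<open>d\<close> has dimension \<open>O(d)\<close>; hence for every \<open>x\<close> the degree over the rational functions of
  \<open>x\<close> is bounded.\<close>
lemma finite_type_of_algebraic:
  assumes t: "t \<in> K" and trans: "\<And>A. \<forall>\<^sub>F Q in gen. poly A (t Q) = 0 \<Longrightarrow> A = 0"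
    and alg: "\<And>y. y \<in> K \<Longrightarrow> algebraic_dependent t y"
    and x: "x \<in> K"
  shows "\<exists>e. \<forall>I (u :: nat \<Rightarrow> _). finite I \<longrightarrow> u ` I \<subseteq> K \<longrightarrow>
    (\<forall>r. lin_indep gen ({..r::nat} \<times> I) (\<lambda>(a, i) Q. x Q ^ a * u i Q)) \<longrightarrow> card I \<le> e"
proof -
  obtain P where P: "P \<in> C" using C_nonempty by blast
  obtain o' where o': "hval (var_mpoly o' :: ('k, 'n) mpoly) P \<noteq> 0"
    using projective_space_var[OF C_projective[OF P]] by blast
  define x0 :: "('k, 'n) mpoly" where "x0 = var_mpoly o'"
  have x0: "x0 \<in> forms" using formsI[OF homogeneous_var P o'] by (simp add: x0_def)
  define y where "y = (\<lambda>i Q. hval (var_mpoly i) Q / hval x0 Q)"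
  have yK: "y i \<in> K" for i
    by (rule KI[OF homogeneous_var[of i] homogeneous_var[of o']]) (use x0 in \<open>auto simp: y_def x0_def\<close>)
  obtain n A B where n: "n > 0" "A \<noteq> 0"
    and rel: "\<And>i. \<forall>\<^sub>F Q in gen. poly A (t Q) * y i Q ^ n = (\<Sum>j<n. poly (B i j) (t Q) * y i Q ^ j)"
    using common_integral_equation[of t y] alg[OF yK] by blast
  \<comment> \<open>Bounds the t-degree gained in one multiplication by \<open>A\<close> and a
    coordinate, whether or not the equation for the n-th power has to be applied.\<close>
  define D where "D = Polynomial.degree A + (\<Sum>(i, j)\<in>UNIV \<times> {..<n}. Polynomial.degree (B i j))"
  have DA: "Polynomial.degree A \<le> D" by (simp add: D_def)
  have DB: "Polynomial.degree (B i j) \<le> D" if "j < n" for i j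
    using that member_le_sum[of "(i, j)" "UNIV \<times> {..<n}" "\<lambda>(i, j). Polynomial.degree (B i j)"]
    by (auto simp: D_def)
  define E where "E = (\<Pi>\<^sub>E i\<in>(UNIV :: 'n set). {..<n})"
  have E: "finite E" "\<And>b. b \<in> E \<longleftrightarrow> (\<forall>i. b i < n)" by (auto simp: E_def finite_PiE)
  define mon where "mon = (\<lambda>b Q. \<Prod>i\<in>UNIV. y i Q ^ b i)"
  have mon_upd: "mon (b(i := m)) Q = y i Q ^ m * (\<Prod>l\<in>UNIV - {i}. y l Q ^ b l)" for b :: "'n \<Rightarrow> nat" and i m Q
  proof -
    have "mon (b(i := m)) Q = y i Q ^ (b(i := m)) i * (\<Prod>l\<in>UNIV - {i}. y l Q ^ (b(i := m)) l)"
      unfolding mon_def by (rule prod.remove) auto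
    also have "(\<Prod>l\<in>UNIV - {i}. y l Q ^ (b(i := m)) l) = (\<Prod>l\<in>UNIV - {i}. y l Q ^ b l)"
      by (rule prod.cong) auto
    finally show ?thesis by (simp only: fun_upd_same)
  qed
  \<comment> \<open>The span of the \<open>t ^ a * mon b\<close> with \<open>a \<le> D * d\<close>
    and all exponents in \<open>b\<close> below \<open>n\<close>. It has (D d + 1)
    \<open>card E\<close> generators, a number linear in d.\<close>
  define W where "W = (\<lambda>d f. \<exists>c. \<forall>\<^sub>F Q in gen.
    f Q = (\<Sum>(a, b)\<in>{..D * d} \<times> E. c (a, b) * (t Q ^ a * mon b Q)))"
  have W_cong: "W d g" if f: "W d f" and eq: "\<forall>\<^sub>F Q in gen. g Q = f Q" for d f g
  proof -
    obtain c where c: "\<forall>\<^sub>F Q in gen. f Q = (\<Sum>(a, b)\<in>{..D * d} \<times> E. c (a, b) * (t Q ^ a * mon b Q))"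
      using f unfolding W_def by blast
    from c eq have "\<forall>\<^sub>F Q in gen. g Q = (\<Sum>(a, b)\<in>{..D * d} \<times> E. c (a, b) * (t Q ^ a * mon b Q))"
      by eventually_elim simp
    then show ?thesis unfolding W_def by blast
  qed
  have W_zero: "W d (\<lambda>_. 0)" for d
    unfolding W_def by (intro exI[of _ "\<lambda>_. 0"]) (simp add: case_prod_unfold)
  have W_add: "W d (\<lambda>Q. f Q + g Q)" if f: "W d f" and g: "W d g" for d f g
  proof -
    obtain c where c: "\<forall>\<^sub>F Q in gen. f Q = (\<Sum>(a, b)\<in>{..D * d} \<times> E. c (a, b) * (t Q ^ a * mon b Q))"
      using f unfolding W_def by blast
    obtain c' where c': "\<forall>\<^sub>F Q in gen. g Q = (\<Sum>(a, b)\<in>{..D * d} \<times> E. c' (a, b) * (t Q ^ a * mon b Q))"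
      using g unfolding W_def by blast
    from c c' have "\<forall>\<^sub>F Q in gen. f Q + g Q = (\<Sum>(a, b)\<in>{..D * d} \<times> E. (c (a, b) + c' (a, b)) * (t Q ^ a * mon b Q))"
      by eventually_elim (simp add: case_prod_unfold algebra_simps sum.distrib)
    then show ?thesis unfolding W_def by (intro exI[of _ "\<lambda>p. c p + c' p"])
  qed
  have W_scale: "W d (\<lambda>Q. k * f Q)" if f: "W d f" for d f k
  proof -
    obtain c where c: "\<forall>\<^sub>F Q in gen. f Q = (\<Sum>(a, b)\<in>{..D * d} \<times> E. c (a, b) * (t Q ^ a * mon b Q))"
      using f unfolding W_def by blast
    then have "\<forall>\<^sub>F Q in gen. k * f Q = (\<Sum>(a, b)\<in>{..D * d} \<times> E. (k * c (a, b)) * (t Q ^ a * mon b Q))"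
      by eventually_elim (simp add: case_prod_unfold sum_distrib_left mult_ac)
    then show ?thesis unfolding W_def by (intro exI[of _ "\<lambda>p. k * c p"])
  qed
  have W_sum: "W d (\<lambda>Q. \<Sum>i\<in>J. f i Q)" if "\<And>i. i \<in> J \<Longrightarrow> W d (f i)" for d J f
    using that by (induction J rule: infinite_finite_induct) (simp_all add: W_zero W_add)
  have W_basis: "W d (\<lambda>Q. t Q ^ a * mon b Q)" if "a \<le> D * d" "b \<in> E" for a b d
  proof -
    have "(\<Sum>(a', b')\<in>{..D * d} \<times> E. of_bool ((a', b') = (a, b)) * (t Q ^ a' * mon b' Q)) = t Q ^ a * mon b Q" for Q
    proof -
      have "(\<Sum>p\<in>{..D * d} \<times> E. of_bool (p = (a, b)) * (t Q ^ fst p * mon (snd p) Q))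
          = (\<Sum>p\<in>{(a, b)}. of_bool (p = (a, b)) * (t Q ^ fst p * mon (snd p) Q))"
        by (rule sum.mono_neutral_right) (use that E(1) in auto)
      then show ?thesis by (simp add: case_prod_unfold prod_eq_iff)
    qed
    then show ?thesis unfolding W_def by (intro exI[of _ "\<lambda>p. of_bool (p = (a, b))"]) simp
  qed
  have W_poly: "W d (\<lambda>Q. poly F (t Q) * mon b Q)" if "Polynomial.degree F \<le> D * d" "b \<in> E" for F b d
  proof -
    have "W d (\<lambda>Q. \<Sum>a\<le>Polynomial.degree F. Polynomial.coeff F a * (t Q ^ a * mon b Q))"
      by (intro W_sum W_scale W_basis) (use that in auto)
    then show ?thesis by (simp add: poly_altdef sum_distrib_right mult.assoc)
  qed
  \<comment> \<open>An exponent \<open>b i\<close> below n - 1 is simply raised. At n - 1, the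
    factor \<open>A\<close> is what allows \<open>y i ^ n\<close> to be replaced by lower powers. In
    both cases the t-degree grows by at most \<open>D\<close>.\<close>
  have W_step: "W (Suc d) (\<lambda>Q. poly A (t Q) * y i Q * f Q)" if f: "W d f" for d i f
  proof -
    obtain c where c: "\<forall>\<^sub>F Q in gen. f Q = (\<Sum>(a, b)\<in>{..D * d} \<times> E. c (a, b) * (t Q ^ a * mon b Q))"
      using f unfolding W_def by blast
    have "W (Suc d) (\<lambda>Q. poly A (t Q) * y i Q * (t Q ^ a * mon b Q))" if a: "a \<le> D * d" and b: "b \<in> E" for a b
    proof (cases "Suc (b i) < n")
      case True
      have "W (Suc d) (\<lambda>Q. poly (A * Polynomial.monom 1 a) (t Q) * mon (b(i := Suc (b i))) Q)"
      proof (rule W_poly)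
        have "Polynomial.degree (A * Polynomial.monom 1 a) \<le> Polynomial.degree A + a"
          using degree_mult_le degree_monom_le by (metis add_le_cancel_left le_trans)
        then show "Polynomial.degree (A * Polynomial.monom 1 a) \<le> D * Suc d" using DA a by simp
        show "b(i := Suc (b i)) \<in> E" using b True by (auto simp: E(2))
      qed
      moreover have "mon (b(i := Suc (b i))) Q = y i Q * mon b Q" for Q
        using mon_upd[of b i "Suc (b i)" Q] mon_upd[of b i "b i" Q] by simp
      ultimately show ?thesis by (simp add: poly_monom mult_ac)
    next
      case False
      then have bi: "Suc (b i) = n" using b E(2) by (metis Suc_lessI)
      have "W (Suc d) (\<lambda>Q. \<Sum>j<n. poly (B i j * Polynomial.monom 1 a) (t Q) * mon (b(i := j)) Q)"
      proof (intro W_sum W_poly)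
        fix j assume j: "j \<in> {..<n}"
        have "Polynomial.degree (B i j * Polynomial.monom 1 a) \<le> Polynomial.degree (B i j) + a"
          using degree_mult_le degree_monom_le by (metis add_le_cancel_left le_trans)
        then show "Polynomial.degree (B i j * Polynomial.monom 1 a) \<le> D * Suc d" using DB[of j i] a j by simp
        show "b(i := j) \<in> E" using b j by (auto simp: E(2))
      qed
      then show ?thesis
      proof (rule W_cong)
        show "\<forall>\<^sub>F Q in gen. poly A (t Q) * y i Q * (t Q ^ a * mon b Q)
          = (\<Sum>j<n. poly (B i j * Polynomial.monom 1 a) (t Q) * mon (b(i := j)) Q)"
          using rel[of i]
        proof eventually_elim
          case (elim Q)
          let ?R = "\<Prod>l\<in>UNIV - {i}. y l Q ^ b l"
          have "mon b Q = y i Q ^ b i * ?R" using mon_upd[of b i "b i" Q] by simp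
          then have "poly A (t Q) * y i Q * (t Q ^ a * mon b Q) = (poly A (t Q) * y i Q ^ n) * (t Q ^ a * ?R)"
            using bi by (auto simp: mult_ac)
          also have "\<dots> = (\<Sum>j<n. poly (B i j * Polynomial.monom 1 a) (t Q) * mon (b(i := j)) Q)"
            unfolding elim sum_distrib_right mon_upd by (simp add: poly_monom mult_ac)
          finally show ?case .
        qed
      qed
    qed
    then have "W (Suc d) (\<lambda>Q. \<Sum>p\<in>{..D * d} \<times> E. c p * (poly A (t Q) * y i Q * (t Q ^ fst p * mon (snd p) Q)))"
      by (intro W_sum W_scale) auto
    then show ?thesis
    proof (rule W_cong)
      show "\<forall>\<^sub>F Q in gen. poly A (t Q) * y i Q * f Q
        = (\<Sum>p\<in>{..D * d} \<times> E. c p * (poly A (t Q) * y i Q * (t Q ^ fst p * mon (snd p) Q)))"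
        using c by eventually_elim (simp add: case_prod_unfold sum_distrib_left mult_ac)
    qed
  qed
  have W_monomial: "W d (\<lambda>Q. poly A (t Q) ^ d * mon m Q)" if "(\<Sum>i\<in>UNIV. m i) = d" for d m
    using that
  proof (induction d arbitrary: m)
    case 0
    then have "m i = 0" for i by simp
    then have "mon m Q = t Q ^ 0 * mon (\<lambda>_. 0) Q" for Q by (simp add: mon_def)
    then show ?case using W_basis[of 0 0 "\<lambda>_. 0"] n E by simp
  next
    case (Suc d)
    then obtain i where i: "m i \<noteq> 0" by (metis sum.neutral nat.distinct(1))
    define m' where "m' = m(i := m i - 1)"
    have "(\<Sum>l\<in>UNIV. m l) = m i + (\<Sum>l\<in>UNIV - {i}. m l)" by (rule sum.remove) auto
    moreover have "(\<Sum>l\<in>UNIV. m' l) = m' i + (\<Sum>l\<in>UNIV - {i}. m' l)" by (rule sum.remove) auto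
    moreover have "(\<Sum>l\<in>UNIV - {i}. m' l) = (\<Sum>l\<in>UNIV - {i}. m l)" by (rule sum.cong) (auto simp: m'_def)
    ultimately have "(\<Sum>l\<in>UNIV. m' l) = d" using Suc.prems i by (simp add: m'_def)
    from W_step[OF Suc.IH[OF this], of i]
    have "W (Suc d) (\<lambda>Q. poly A (t Q) * y i Q * (poly A (t Q) ^ d * mon m' Q))" .
    moreover have "mon m Q = y i Q * mon m' Q" for Q
    proof -
      have "y i Q ^ m i = y i Q * y i Q ^ (m i - 1)" using i by (simp flip: power_Suc)
      then show ?thesis using mon_upd[of m i "m i" Q] mon_upd[of m i "m i - 1" Q] by (simp add: m'_def)
    qed
    ultimately show ?case by (simp add: mult_ac)
  qed
  \<comment> \<open>Each of the d coordinate factors of a monomial uses up one factor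
    \<open>A\<close>, whence the power \<open>A ^ d\<close> in front of the dehomogenized
    form.\<close>
  have W_form: "W d (\<lambda>Q. poly A (t Q) ^ d * (hval p Q / hval x0 Q ^ d))" if p: "homogeneous d p" for d p
  proof -
    have "hval p Q / hval x0 Q ^ d = (\<Sum>m\<in>Poly_Mapping.keys p. Poly_Mapping.lookup p m * mon (Poly_Mapping.lookup m) Q)" for Q
      unfolding x0_def poly_eval_affine[OF p, symmetric]
      by (simp add: poly_eval_def mono_eval_def mon_def y_def x0_def)
    moreover have "W d (\<lambda>Q. \<Sum>m\<in>Poly_Mapping.keys p. Poly_Mapping.lookup p m * (poly A (t Q) ^ d * mon (Poly_Mapping.lookup m) Q))"
      by (intro W_sum W_scale W_monomial) (use p in \<open>auto simp: homogeneous_def\<close>)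
    ultimately show ?thesis by (simp add: sum_distrib_left mult_ac)
  qed
  have A_ne: "\<forall>\<^sub>F Q in gen. poly A (t Q) \<noteq> 0"
    using K_zero[OF K_poly[OF t, of A]] trans n(2) by blast
  obtain e p q where p: "homogeneous e p" "homogeneous e q" "q \<in> forms"
    "\<forall>\<^sub>F P in gen. x P = hval p P / hval q P" using x by (rule KE)
  show ?thesis
  proof (intro exI[of _ "D * e * card E"] allI impI)
    fix I and u :: "nat \<Rightarrow> _"
    assume I: "finite I" "u ` I \<subseteq> K"
      and ind: "\<forall>r. lin_indep gen ({..r::nat} \<times> I) (\<lambda>(a, i) Q. x Q ^ a * u i Q)"
    have "\<forall>i\<in>I. \<exists>d p q. homogeneous d p \<and> homogeneous d q \<and> q \<in> forms \<and> (\<forall>\<^sub>F P in gen. u i P = hval p P / hval q P)"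
      using I(2) by (auto simp: K_def)
    from bchoice[OF this] obtain di where
      "\<forall>i\<in>I. \<exists>p q. homogeneous (di i) p \<and> homogeneous (di i) q \<and> q \<in> forms \<and> (\<forall>\<^sub>F P in gen. u i P = hval p P / hval q P)" ..
    from bchoice[OF this] obtain pi where
      "\<forall>i\<in>I. \<exists>q. homogeneous (di i) (pi i) \<and> homogeneous (di i) q \<and> q \<in> forms \<and> (\<forall>\<^sub>F P in gen. u i P = hval (pi i) P / hval q P)" ..
    from bchoice[OF this] obtain qi where pi: "\<And>i. i \<in> I \<Longrightarrow> homogeneous (di i) (pi i)"
      "\<And>i. i \<in> I \<Longrightarrow> homogeneous (di i) (qi i)" "\<And>i. i \<in> I \<Longrightarrow> qi i \<in> forms"
      "\<And>i. i \<in> I \<Longrightarrow> \<forall>\<^sub>F P in gen. u i P = hval (pi i) P / hval (qi i) P" by blast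
    define dI where "dI = (\<Sum>i\<in>I. di i)"
    define qI where "qI = (\<Prod>i\<in>I. qi i)"
    define pI where "pI = (\<lambda>i. pi i * (\<Prod>l\<in>I - {i}. qi l))"
    have qI: "homogeneous dI qI" "qI \<in> forms"
      unfolding dI_def qI_def using pi by (auto intro: homogeneous_prod forms_prod)
    have pI: "homogeneous dI (pI i)" if i: "i \<in> I" for i
    proof -
      have "homogeneous (di i + (\<Sum>l\<in>I - {i}. di l)) (pI i)"
        unfolding pI_def using pi i by (intro homogeneous_mult homogeneous_prod) auto
      then show ?thesis using sum.remove[OF I(1) i, of di] by (simp add: dI_def)
    qed
    have uI: "\<forall>\<^sub>F P in gen. u i P * hval qI P = hval (pI i) P" if i: "i \<in> I" for i
      using pi(4)[OF i] gen_forms[OF pi(3)[OF i]]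
    proof eventually_elim
      case (elim P)
      have "hval qI P = hval (qi i) P * (\<Prod>l\<in>I - {i}. hval (qi l) P)"
        unfolding qI_def hval_prod by (rule prod.remove[OF I(1) i])
      then show ?case using elim by (simp add: pI_def hval_mult hval_prod)
    qed
    have bound: "Suc r * card I \<le> Suc (D * (r * e + dI)) * card E" for r
    proof -
      define N where "N = r * e + dI"
      \<comment> \<open>A common multiplier for all \<open>x ^ a * u i\<close> with
        \<open>a \<le> r\<close>: it clears the denominators \<open>q\<close> and \<open>qI\<close>,
        divides the resulting form of degree \<open>N\<close> by \<open>x0 ^ N\<close>, and supplies
        the power of \<open>A\<close> needed to land in \<open>W N\<close>. It is generically
        nonzero, so independence survives.\<close>
      define \<Lambda> where "\<Lambda> = (\<lambda>Q. poly A (t Q) ^ N * (hval q Q ^ r * hval qI Q / hval x0 Q ^ N))"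
      have \<Lambda>_ne: "\<forall>\<^sub>F Q in gen. \<Lambda> Q \<noteq> 0"
        using A_ne gen_forms[OF p(3)] gen_forms[OF qI(2)] gen_forms[OF x0]
        by eventually_elim (simp add: \<Lambda>_def)
      have "W N (\<lambda>Q. \<Lambda> Q * (x Q ^ a * u i Q))" if a: "a \<le> r" and i: "i \<in> I" for a i
      proof -
        have "homogeneous (a * e + (r - a) * e + dI) (p ^ a * q ^ (r - a) * pI i)"
          by (intro homogeneous_mult homogeneous_power p pI i)
        moreover have "a * e + (r - a) * e + dI = N" using a by (simp add: N_def flip: add_mult_distrib)
        ultimately have "W N (\<lambda>Q. poly A (t Q) ^ N * (hval (p ^ a * q ^ (r - a) * pI i) Q / hval x0 Q ^ N))"
          using W_form by simp
        then show ?thesis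
        proof (rule W_cong)
          show "\<forall>\<^sub>F Q in gen. \<Lambda> Q * (x Q ^ a * u i Q)
            = poly A (t Q) ^ N * (hval (p ^ a * q ^ (r - a) * pI i) Q / hval x0 Q ^ N)"
            using p(4) uI[OF i] gen_forms[OF p(3)]
          proof eventually_elim
            case (elim Q)
            have "hval q Q ^ r = hval q Q ^ a * hval q Q ^ (r - a)" using a by (simp flip: power_add)
            then have "hval q Q ^ r * x Q ^ a = hval p Q ^ a * hval q Q ^ (r - a)"
              using elim by (simp add: power_divide)
            then have "\<Lambda> Q * (x Q ^ a * u i Q) = poly A (t Q) ^ N * ((hval p Q ^ a * hval q Q ^ (r - a)) * (u i Q * hval qI Q) / hval x0 Q ^ N)"
              by (simp add: \<Lambda>_def mult_ac)
            then show ?case by (simp add: elim hval_mult hval_power)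
          qed
        qed
      qed
      then have "\<forall>k\<in>{..r} \<times> I. \<exists>c. \<forall>\<^sub>F Q in gen. \<Lambda> Q * (case k of (a, i) \<Rightarrow> \<lambda>Q. x Q ^ a * u i Q) Q =
          (\<Sum>(a, b)\<in>{..D * N} \<times> E. c (a, b) * (t Q ^ a * mon b Q))"
        unfolding W_def by auto
      from bchoice[OF this] obtain c where c: "\<And>k. k \<in> {..r} \<times> I \<Longrightarrow> \<forall>\<^sub>F Q in gen. \<Lambda> Q * (case k of (a, i) \<Rightarrow> \<lambda>Q. x Q ^ a * u i Q) Q =
          (\<Sum>(a, b)\<in>{..D * N} \<times> E. c k (a, b) * (t Q ^ a * mon b Q))"
        by blast
      have "card ({..r} \<times> I) \<le> card ({..D * N} \<times> E)"
      proof (rule lin_indep_card_le_span[OF _ _ lin_indep_mult[OF spec[OF ind] \<Lambda>_ne]])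
        fix k assume "k \<in> {..r} \<times> I"
        from c[OF this] show "\<forall>\<^sub>F Q in gen. \<Lambda> Q * (case k of (a, i) \<Rightarrow> \<lambda>Q. x Q ^ a * u i Q) Q =
          (\<Sum>j\<in>{..D * N} \<times> E. c k j * (\<lambda>(a, b) Q. t Q ^ a * mon b Q) j Q)"
          by (simp add: case_prod_unfold)
      qed (use I E in auto)
      then show ?thesis by (simp add: card_cartesian_product N_def)
    qed
    show "card I \<le> D * e * card E"
    proof (rule ccontr)
      assume "\<not> card I \<le> D * e * card E"
      then have "Suc (D * e * card E) \<le> card I" by simp
      \<comment> \<open>With this r the right-hand side of the bound is exactly r times
        \<open>D * e * card E\<close>, plus r, which is less than Suc r times Suc
        (\<open>D * e * card E\<close>).\<close>
      define r where "r = Suc (D * dI) * card E"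
      have "Suc r * Suc (D * e * card E) \<le> Suc r * card I"
        using \<open>Suc (D * e * card E) \<le> card I\<close> by (rule mult_le_mono2)
      also note bound[of r]
      also have "Suc (D * (r * e + dI)) * card E = r * (D * e * card E) + r"
        by (simp add: r_def algebra_simps)
      finally show False by simp
    qed
  qed
qed

end

section \<open>The function field as a HOL-Algebra field\<close>

context variety begin

abbreviation "FF \<equiv> function_field C"

text \<open>The class of a germ, defined also from representatives that are regular nowhere in
  particular; pointwise formulas for field operations can then be used without tracking
  domains.\<close>

definition cls :: "(('k, 'n) pt \<Rightarrow> 'k) \<Rightarrow> ('k, 'n) germ" where
  "cls f = {(V, g) \<in> rational_pairs C. \<forall>\<^sub>F P in gen. f P = g P}"

lemma rational_pairs_val: "(U, f) \<in> rational_pairs C \<Longrightarrow> P \<in> U \<Longrightarrow> val P f (f P)"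
  using regular_on_val by (auto simp: rational_pairs_def)

lemma rational_pairs_K: "(U, f) \<in> rational_pairs C \<Longrightarrow> f \<in> K"
  using rational_pairs_val val_in_K by (fastforce simp: rational_pairs_def)

text \<open>Agreement on the overlap, which is a nonempty open set, is generic agreement.
  Conversely, generically equal functions have the same value wherever both are regular, by
  uniqueness of values.\<close>

lemma rational_class_eq:
  assumes "openin (subtopology zariski C) U" "U \<noteq> {}" and f: "\<And>P. P \<in> U \<Longrightarrow> val P f (f P)"
  shows "rational_class C U f = cls f"
proof -
  have "(\<forall>P\<in>U \<inter> V. f P = g P) \<longleftrightarrow> (\<forall>\<^sub>F P in gen. f P = g P)" if Vg: "(V, g) \<in> rational_pairs C" for V g
  proof
    have V: "openin (subtopology zariski C) V" "V \<noteq> {}" using Vg by (auto simp: rational_pairs_def)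
    assume "\<forall>P\<in>U \<inter> V. f P = g P"
    moreover have "\<forall>\<^sub>F P in gen. P \<in> U \<inter> V"
      using gen_openin[OF assms(1,2)] gen_openin[OF V] by eventually_elim simp
    ultimately show "\<forall>\<^sub>F P in gen. f P = g P" by (auto elim: eventually_mono)
  next
    assume ev: "\<forall>\<^sub>F P in gen. f P = g P"
    show "\<forall>P\<in>U \<inter> V. f P = g P"
    proof
      fix P assume P: "P \<in> U \<inter> V"
      then have "val P g (f P)" using val_respects[OF f ev] by blast
      moreover have "val P g (g P)" using P rational_pairs_val[OF Vg] by blast
      ultimately show "f P = g P" by (rule val_eq)
    qed
  qed
  then show ?thesis by (auto simp: rational_class_def cls_def)
qed

lemma rational_class_pair: "(U, f) \<in> rational_pairs C \<Longrightarrow> rational_class C U f = cls f"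
  using rational_class_eq[of U f] rational_pairs_val[of U f] by (auto simp: rational_pairs_def)

lemma openin_C_self: "openin (subtopology zariski C) C"
  using openin_nonzero[OF homogeneous_const[of 1]] by (simp add: hval_const)

lemma rational_class_const: "rational_class C C (\<lambda>_. c) = cls (\<lambda>_. c)"
  by (rule rational_class_eq) (use openin_C_self C_nonempty val_consts in auto)

lemma cls_memD: "(V, g) \<in> cls f \<Longrightarrow> (V, g) \<in> rational_pairs C \<and> g \<in> K \<and> (\<forall>\<^sub>F P in gen. f P = g P)"
  using rational_pairs_K by (auto simp: cls_def)

lemma cls_nonempty: "f \<in> K \<Longrightarrow> \<exists>V g. (V, g) \<in> cls f"
  using K_regular_on[of f] by (auto simp: cls_def rational_pairs_def)

lemma cls_cong: "\<forall>\<^sub>F P in gen. f P = g P \<Longrightarrow> cls f = cls g"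
proof -
  assume ev: "\<forall>\<^sub>F P in gen. f P = g P"
  have "(\<forall>\<^sub>F P in gen. f P = h P) \<longleftrightarrow> (\<forall>\<^sub>F P in gen. g P = h P)" for h
    using ev by (auto elim: eventually_elim2)
  then show ?thesis by (simp add: cls_def)
qed

lemma cls_eq_iff: "f \<in> K \<Longrightarrow> cls f = cls g \<longleftrightarrow> (\<forall>\<^sub>F P in gen. f P = g P)"
proof
  assume f: "f \<in> K" and eq: "cls f = cls g"
  obtain V h where h: "(V, h) \<in> cls f" using cls_nonempty[OF f] by blast
  have "\<forall>\<^sub>F P in gen. f P = h P" "\<forall>\<^sub>F P in gen. g P = h P"
    using cls_memD[OF h] cls_memD[OF h[unfolded eq]] by auto
  then show "\<forall>\<^sub>F P in gen. f P = g P" by eventually_elim simp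
qed (rule cls_cong)

lemma cls_eqD: "f \<in> K \<Longrightarrow> cls f = cls g \<Longrightarrow> \<forall>\<^sub>F P in gen. f P = g P"
  using cls_eq_iff by blast

lemma FF_carrier: "carrier FF = cls ` K"
proof
  show "carrier FF \<subseteq> cls ` K"
    using rational_class_pair rational_pairs_K by (auto simp: function_field_def)
  show "cls ` K \<subseteq> carrier FF"
  proof
    fix a assume "a \<in> cls ` K"
    then obtain f where f: "f \<in> K" "a = cls f" by blast
    obtain V g where g: "(V, g) \<in> cls f" using cls_nonempty[OF f(1)] by blast
    have "a = cls g" using cls_memD[OF g] f cls_cong by blast
    also have "cls g = rational_class C V g" using rational_class_pair cls_memD[OF g] by metis
    finally show "a \<in> carrier FF" using cls_memD[OF g] by (auto simp: function_field_def)
  qed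
qed

text \<open>All representatives produce the same class, so the unions in the definition of the field
  operations collapse. The operation \<open>h\<close> stands for sum and product alike.\<close>

lemma rational_class_op:
  assumes h: "\<And>P x y c d. val P x c \<Longrightarrow> val P y d \<Longrightarrow> val P (\<lambda>Q. h (x Q) (y Q)) (h c d)"
    and f: "f \<in> K" and g: "g \<in> K"
  shows "(\<Union>(U, f)\<in>cls f. \<Union>(V, g)\<in>cls g. rational_class C (U \<inter> V) (\<lambda>P. h (f P) (g P))) = cls (\<lambda>P. h (f P) (g P))"
proof -
  have "rational_class C (U \<inter> V) (\<lambda>P. h (f' P) (g' P)) = cls (\<lambda>P. h (f P) (g P))"
    if f': "(U, f') \<in> cls f" and g': "(V, g') \<in> cls g" for U V f' g'
  proof -
    have UV: "openin (subtopology zariski C) U" "U \<noteq> {}" "openin (subtopology zariski C) V" "V \<noteq> {}"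
      using cls_memD[OF f'] cls_memD[OF g'] by (auto simp: rational_pairs_def)
    have "rational_class C (U \<inter> V) (\<lambda>P. h (f' P) (g' P)) = cls (\<lambda>P. h (f' P) (g' P))"
    proof (rule rational_class_eq)
      show "openin (subtopology zariski C) (U \<inter> V)" using UV by (intro openin_Int)
      show "U \<inter> V \<noteq> {}" using UV by (intro open_Int_nonempty)
      show "val P (\<lambda>P. h (f' P) (g' P)) (h (f' P) (g' P))" if "P \<in> U \<inter> V" for P
        using that cls_memD[OF f'] cls_memD[OF g'] by (intro h rational_pairs_val) auto
    qed
    also have "\<dots> = cls (\<lambda>P. h (f P) (g P))"
    proof (rule cls_cong)
      have "\<forall>\<^sub>F P in gen. f P = f' P" "\<forall>\<^sub>F P in gen. g P = g' P" using cls_memD[OF f'] cls_memD[OF g'] by auto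
      then show "\<forall>\<^sub>F P in gen. h (f' P) (g' P) = h (f P) (g P)" by eventually_elim simp
    qed
    finally show ?thesis .
  qed
  moreover have "cls f \<noteq> {}" "cls g \<noteq> {}" using cls_nonempty f g by auto
  ultimately show ?thesis by fastforce
qed

lemma FF_mult: "f \<in> K \<Longrightarrow> g \<in> K \<Longrightarrow> cls f \<otimes>\<^bsub>FF\<^esub> cls g = cls (\<lambda>P. f P * g P)"
  using rational_class_op[of "(*)"] val_times by (simp add: function_field_def)

lemma FF_add: "f \<in> K \<Longrightarrow> g \<in> K \<Longrightarrow> cls f \<oplus>\<^bsub>FF\<^esub> cls g = cls (\<lambda>P. f P + g P)"
  using rational_class_op[of "(+)"] val_plus by (simp add: function_field_def)

lemma FF_one: "\<one>\<^bsub>FF\<^esub> = cls (\<lambda>_. 1)" and FF_zero: "\<zero>\<^bsub>FF\<^esub> = cls (\<lambda>_. 0)"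
  by (simp_all add: function_field_def rational_class_const)

lemma FF_constants: "constant_functions C = range (\<lambda>c. cls (\<lambda>_. c))"
  by (simp add: constant_functions_def rational_class_const)

lemma cls_zero_iff: "f \<in> K \<Longrightarrow> cls f = \<zero>\<^bsub>FF\<^esub> \<longleftrightarrow> (\<forall>\<^sub>F P in gen. f P = 0)"
  by (simp add: FF_zero cls_eq_iff)

lemma field_FF: "field FF"
proof -
  have "abelian_group FF"
  proof (rule abelian_groupI)
    fix a assume "a \<in> carrier FF"
    then obtain f where f: "f \<in> K" "a = cls f" by (auto simp: FF_carrier)
    show "\<zero>\<^bsub>FF\<^esub> \<oplus>\<^bsub>FF\<^esub> a = a" using f K_const by (simp add: FF_zero FF_add)
    show "\<exists>b\<in>carrier FF. b \<oplus>\<^bsub>FF\<^esub> a = \<zero>\<^bsub>FF\<^esub>"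
      using f K_uminus[OF f(1)] by (intro bexI[of _ "cls (\<lambda>P. - f P)"]) (simp_all add: FF_zero FF_add FF_carrier)
    fix b assume "b \<in> carrier FF"
    then obtain g where g: "g \<in> K" "b = cls g" by (auto simp: FF_carrier)
    show "a \<oplus>\<^bsub>FF\<^esub> b \<in> carrier FF" using f g K_add[OF f(1) g(1)] by (simp add: FF_add FF_carrier)
    show "a \<oplus>\<^bsub>FF\<^esub> b = b \<oplus>\<^bsub>FF\<^esub> a" using f g by (simp add: FF_add add.commute)
    fix c assume "c \<in> carrier FF"
    then obtain h where h: "h \<in> K" "c = cls h" by (auto simp: FF_carrier)
    show "a \<oplus>\<^bsub>FF\<^esub> b \<oplus>\<^bsub>FF\<^esub> c = a \<oplus>\<^bsub>FF\<^esub> (b \<oplus>\<^bsub>FF\<^esub> c)"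
      using f g h K_add[OF f(1) g(1)] K_add[OF g(1) h(1)] by (simp add: FF_add add.assoc)
  qed (use K_const[of 0] in \<open>simp add: FF_zero FF_carrier\<close>)
  moreover have "comm_monoid FF"
  proof (rule comm_monoidI)
    fix a assume "a \<in> carrier FF"
    then obtain f where f: "f \<in> K" "a = cls f" by (auto simp: FF_carrier)
    show "\<one>\<^bsub>FF\<^esub> \<otimes>\<^bsub>FF\<^esub> a = a" using f K_const by (simp add: FF_one FF_mult)
    fix b assume "b \<in> carrier FF"
    then obtain g where g: "g \<in> K" "b = cls g" by (auto simp: FF_carrier)
    show "a \<otimes>\<^bsub>FF\<^esub> b \<in> carrier FF" using f g K_mult[OF f(1) g(1)] by (simp add: FF_mult FF_carrier)
    show "a \<otimes>\<^bsub>FF\<^esub> b = b \<otimes>\<^bsub>FF\<^esub> a" using f g by (simp add: FF_mult mult.commute)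
    fix c assume "c \<in> carrier FF"
    then obtain h where h: "h \<in> K" "c = cls h" by (auto simp: FF_carrier)
    show "a \<otimes>\<^bsub>FF\<^esub> b \<otimes>\<^bsub>FF\<^esub> c = a \<otimes>\<^bsub>FF\<^esub> (b \<otimes>\<^bsub>FF\<^esub> c)"
      using f g h K_mult[OF f(1) g(1)] K_mult[OF g(1) h(1)] by (simp add: FF_mult mult.assoc)
  qed (use K_const[of 1] in \<open>simp add: FF_one FF_carrier\<close>)
  ultimately have "cring FF"
  proof (rule cringI)
    fix a b c assume "a \<in> carrier FF" "b \<in> carrier FF" "c \<in> carrier FF"
    then obtain f g h where f: "f \<in> K" "a = cls f" and g: "g \<in> K" "b = cls g" and h: "h \<in> K" "c = cls h"
      by (auto simp: FF_carrier)
    show "(a \<oplus>\<^bsub>FF\<^esub> b) \<otimes>\<^bsub>FF\<^esub> c = a \<otimes>\<^bsub>FF\<^esub> c \<oplus>\<^bsub>FF\<^esub> b \<otimes>\<^bsub>FF\<^esub> c"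
      using f g h K_add[OF f(1) g(1)] K_mult[OF f(1) h(1)] K_mult[OF g(1) h(1)]
      by (simp add: FF_add FF_mult distrib_right)
  qed
  then interpret cring FF .
  show ?thesis
  proof (rule cring_fieldI)
    show "Units FF = carrier FF - {\<zero>\<^bsub>FF\<^esub>}"
    proof
      have one_ne: "\<one>\<^bsub>FF\<^esub> \<noteq> \<zero>\<^bsub>FF\<^esub>"
        using gen_ne cls_zero_iff[OF K_const[of 1]] by (simp add: FF_one eventually_False)
      show "Units FF \<subseteq> carrier FF - {\<zero>\<^bsub>FF\<^esub>}"
        using one_ne Units_closed Units_r_inv l_null by (metis DiffI Units_inv_closed singletonD subsetI)
      show "carrier FF - {\<zero>\<^bsub>FF\<^esub>} \<subseteq> Units FF"
      proof
        fix a assume a: "a \<in> carrier FF - {\<zero>\<^bsub>FF\<^esub>}"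
        then obtain f where f: "f \<in> K" "a = cls f" by (auto simp: FF_carrier)
        then have "\<forall>\<^sub>F P in gen. f P \<noteq> 0" using a K_zero cls_zero_iff by blast
        then have ev: "\<forall>\<^sub>F P in gen. inverse (f P) * f P = 1" by eventually_elim simp
        have "cls (\<lambda>P. inverse (f P)) \<otimes>\<^bsub>FF\<^esub> a = \<one>\<^bsub>FF\<^esub>"
          using cls_cong[OF ev] by (simp add: f FF_mult K_inverse FF_one)
        moreover have "cls (\<lambda>P. inverse (f P)) \<in> carrier FF" using K_inverse[OF f(1)] by (simp add: FF_carrier)
        moreover have aF: "a \<in> carrier FF" using a by blast
        moreover have "a \<otimes>\<^bsub>FF\<^esub> cls (\<lambda>P. inverse (f P)) = \<one>\<^bsub>FF\<^esub>"
          using calculation(1) m_comm[OF aF calculation(2)] by simp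
        ultimately show "a \<in> Units FF" unfolding Units_def by blast
      qed
    qed
  qed
qed

end

sublocale variety \<subseteq> FF: field "function_field C"
  by (rule field_FF)

context variety begin

lemma cls_in_carrier [simp]: "f \<in> K \<Longrightarrow> cls f \<in> carrier FF"
  by (simp add: FF_carrier)

lemma FF_uminus: assumes "f \<in> K" shows "\<ominus>\<^bsub>FF\<^esub> cls f = cls (\<lambda>P. - f P)"
proof (rule FF.minus_equality)
  show "cls (\<lambda>P. - f P) \<oplus>\<^bsub>FF\<^esub> cls f = \<zero>\<^bsub>FF\<^esub>"
    by (simp add: FF_add assms K_uminus FF_zero)
qed (use assms K_uminus in simp_all)

lemma FF_inv: assumes "f \<in> Kx" shows "inv\<^bsub>FF\<^esub> (cls f) = cls (\<lambda>P. inverse (f P))"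
proof (rule FF.comm_inv_char)
  have ev: "\<forall>\<^sub>F P in gen. f P * inverse (f P) = 1" using Kx_ev[OF assms] by eventually_elim simp
  show "cls f \<otimes>\<^bsub>FF\<^esub> cls (\<lambda>P. inverse (f P)) = \<one>\<^bsub>FF\<^esub>"
    using cls_cong[OF ev] by (simp add: FF_mult KxK[OF assms] K_inverse FF_one)
qed (simp_all add: KxK[OF assms] K_inverse)

lemma FF_pow: "f \<in> K \<Longrightarrow> cls f [^]\<^bsub>FF\<^esub> (n::nat) = cls (\<lambda>P. f P ^ n)"
  by (induction n) (simp_all add: FF_one FF_mult K_power mult.commute)

lemma FF_int_pow: assumes "f \<in> Kx" shows "cls f [^]\<^bsub>FF\<^esub> (n::int) = cls (\<lambda>P. f P powi n)"
proof (cases "n \<ge> 0")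
  case True
  then show ?thesis using FF_pow[OF KxK[OF assms]] by (simp add: int_pow_def2 power_int_def)
next
  case False
  have "(\<lambda>P. f P ^ nat (- n)) \<in> Kx" by (rule Kx_power[OF assms])
  then show ?thesis
    using False FF_pow[OF KxK[OF assms]] FF_inv by (simp add: int_pow_def2 power_int_def power_inverse)
qed

lemma local_ring_carrier:
  assumes "P \<in> C" shows "carrier (local_ring C P) = cls ` {f. \<exists>c. val P f c}"
proof
  show "carrier (local_ring C P) \<subseteq> cls ` {f. \<exists>c. val P f c}"
  proof
    fix a assume "a \<in> carrier (local_ring C P)"
    then obtain f V g where f: "f \<in> K" "a = cls f" "(V, g) \<in> cls f" "P \<in> V"
      by (auto simp: local_ring_def FF_carrier)
    then have "a = cls g" "val P g (g P)"
      using cls_memD[OF f(3)] cls_cong rational_pairs_val by auto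
    then show "a \<in> cls ` {f. \<exists>c. val P f c}" by blast
  qed
  show "cls ` {f. \<exists>c. val P f c} \<subseteq> carrier (local_ring C P)"
  proof
    fix a assume "a \<in> cls ` {f. \<exists>c. val P f c}"
    then obtain f c where f: "a = cls f" "val P f c" by blast
    obtain U g where g: "openin (subtopology zariski C) U" "P \<in> U" "regular_on U g" "\<forall>\<^sub>F Q in gen. f Q = g Q"
      using val_regular_on[OF f(2)] by blast
    then have "(U, g) \<in> cls f" by (auto simp: cls_def rational_pairs_def)
    then show "a \<in> carrier (local_ring C P)"
      using f val_in_K[OF f(2)] g(2) by (auto simp: local_ring_def FF_carrier)
  qed
qed

lemma local_maximal_ideal_eq:
  assumes "P \<in> C" shows "local_maximal_ideal C P = cls ` {f. val P f 0}"
proof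
  show "local_maximal_ideal C P \<subseteq> cls ` {f. val P f 0}"
  proof
    fix a assume "a \<in> local_maximal_ideal C P"
    then obtain f V g where f: "f \<in> K" "a = cls f" "(V, g) \<in> cls f" "P \<in> V" "g P = 0"
      by (auto simp: local_maximal_ideal_def FF_carrier)
    have "val P g (g P)" using cls_memD[OF f(3)] f(4) rational_pairs_val by blast
    moreover have "a = cls g" using cls_memD[OF f(3)] cls_cong f(2) by blast
    ultimately show "a \<in> cls ` {f. val P f 0}" using f(5) by auto
  qed
  show "cls ` {f. val P f 0} \<subseteq> local_maximal_ideal C P"
  proof
    fix a assume "a \<in> cls ` {f. val P f 0}"
    then obtain f where f: "a = cls f" "val P f 0" by blast
    obtain U g where g: "openin (subtopology zariski C) U" "P \<in> U" "regular_on U g" "\<forall>\<^sub>F Q in gen. f Q = g Q" "g P = 0"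
      using val_regular_on[OF f(2)] by blast
    then have "(U, g) \<in> cls f" by (auto simp: cls_def rational_pairs_def)
    then show "a \<in> local_maximal_ideal C P"
      using f val_in_K[OF f(2)] g by (auto simp: local_maximal_ideal_def FF_carrier)
  qed
qed

lemma cls_val_iff: "f \<in> K \<Longrightarrow> cls f \<in> cls ` {f. val P f c} \<longleftrightarrow> val P f c"
proof
  assume f: "f \<in> K" and "cls f \<in> cls ` {f. val P f c}"
  then obtain g where g: "val P g c" "cls f = cls g" by blast
  from g(2) have "\<forall>\<^sub>F Q in gen. f Q = g Q" using cls_eq_iff[OF f] by blast
  then have "\<forall>\<^sub>F Q in gen. g Q = f Q" by eventually_elim simp
  with g(1) show "val P f c" by (rule val_respects)
qed blast

lemma local_ring_simps [simp]: "a \<otimes>\<^bsub>local_ring C P\<^esub> b = a \<otimes>\<^bsub>FF\<^esub> b" "\<one>\<^bsub>local_ring C P\<^esub> = \<one>\<^bsub>FF\<^esub>"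
  by (simp_all add: local_ring_def)

lemma uniformizer_cls:
  assumes P: "P \<in> C" and t: "t \<in> K"
  shows "uniformizer C P (cls t) \<longleftrightarrow>
     val P t 0 \<and> (\<forall>f. val P f 0 \<longrightarrow> (\<exists>g c. val P g c \<and> (\<forall>\<^sub>F Q in gen. f Q = g Q * t Q)))"
    (is "_ \<longleftrightarrow> ?R")
proof
  have ideal: "PIdl\<^bsub>local_ring C P\<^esub> (cls t) = {cls (\<lambda>Q. g Q * t Q) | g. \<exists>c. val P g c}"
    unfolding cgenideal_def local_ring_carrier[OF P] local_ring_simps
  proof (intro equalityI subsetI)
    fix a assume "a \<in> {x \<otimes>\<^bsub>FF\<^esub> cls t |x. x \<in> cls ` {f. \<exists>c. val P f c}}"
    then obtain g c where "a = cls g \<otimes>\<^bsub>FF\<^esub> cls t" "val P g c" by blast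
    then show "a \<in> {cls (\<lambda>Q. g Q * t Q) | g. \<exists>c. val P g c}" using FF_mult[OF val_in_K t] by blast
  next
    fix a assume "a \<in> {cls (\<lambda>Q. g Q * t Q) | g. \<exists>c. val P g c}"
    then obtain g c where g: "a = cls (\<lambda>Q. g Q * t Q)" "val P g c" by blast
    then have "a = cls g \<otimes>\<^bsub>FF\<^esub> cls t" using FF_mult[OF val_in_K t] by simp
    then show "a \<in> {x \<otimes>\<^bsub>FF\<^esub> cls t |x. x \<in> cls ` {f. \<exists>c. val P f c}}" using g(2) by blast
  qed
  { assume "uniformizer C P (cls t)"
    then have eq: "cls ` {f. val P f 0} = {cls (\<lambda>Q. g Q * t Q) | g. \<exists>c. val P g c}"
      unfolding uniformizer_def ideal local_maximal_ideal_eq[OF P] by blast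
    have "cls t = cls (\<lambda>Q. 1 * t Q) \<and> (\<exists>c. val P (\<lambda>_. 1) c)" using val_consts[OF P, of 1] by auto
    then have "cls t \<in> {cls (\<lambda>Q. g Q * t Q) | g. \<exists>c. val P g c}"
      unfolding mem_Collect_eq by (rule exI[of _ "\<lambda>_. 1"])
    then have "val P t 0" unfolding eq[symmetric] cls_val_iff[OF t] .
    moreover have "\<exists>g c. val P g c \<and> (\<forall>\<^sub>F Q in gen. f Q = g Q * t Q)" if f: "val P f 0" for f
    proof -
      have "cls f \<in> cls ` {f. val P f 0}" using f by blast
      then have "cls f \<in> {cls (\<lambda>Q. g Q * t Q) | g. \<exists>c. val P g c}" unfolding eq .
      then obtain g c where g: "val P g c" "cls f = cls (\<lambda>Q. g Q * t Q)" by blast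
      from g(1) cls_eqD[OF val_in_K[OF f] g(2)] show ?thesis by blast
    qed
    ultimately show ?R by blast }
  { assume R: ?R
    have "cls ` {f. val P f 0} = {cls (\<lambda>Q. g Q * t Q) | g. \<exists>c. val P g c}"
    proof
      show "cls ` {f. val P f 0} \<subseteq> {cls (\<lambda>Q. g Q * t Q) | g. \<exists>c. val P g c}"
      proof
        fix a assume "a \<in> cls ` {f. val P f 0}"
        then obtain f where f: "a = cls f" "val P f 0" by blast
        then obtain g c where g: "val P g c" "\<forall>\<^sub>F Q in gen. f Q = g Q * t Q" using R by blast
        from cls_cong[OF g(2)] f(1) have "a = cls (\<lambda>Q. g Q * t Q)" by simp
        with g(1) show "a \<in> {cls (\<lambda>Q. g Q * t Q) | g. \<exists>c. val P g c}" by blast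
      qed
      show "{cls (\<lambda>Q. g Q * t Q) | g. \<exists>c. val P g c} \<subseteq> cls ` {f. val P f 0}"
        using R val_times by fastforce
    qed
    then show "uniformizer C P (cls t)"
      unfolding uniformizer_def ideal local_maximal_ideal_eq[OF P] local_ring_carrier[OF P] using R by blast }
qed

lemma Units_local_ring:
  assumes P: "P \<in> C" and u: "u \<in> K"
  shows "cls u \<in> Units (local_ring C P) \<longleftrightarrow> (\<exists>c. c \<noteq> 0 \<and> val P u c)"
proof
  assume "cls u \<in> Units (local_ring C P)"
  then obtain v c where v: "cls u \<otimes>\<^bsub>FF\<^esub> cls v = \<one>\<^bsub>FF\<^esub>" "val P v c" and "cls u \<in> cls ` {f. \<exists>c. val P f c}"
    by (auto simp: Units_def local_ring_carrier[OF P])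
  then obtain u' d where u': "cls u = cls u'" "val P u' d" by blast
  have ud: "val P u d" using u' cls_val_iff[OF u] by blast
  have "cls (\<lambda>Q. u Q * v Q) = cls (\<lambda>_. 1)"
    using v(1) FF_mult[OF u val_in_K[OF v(2)]] by (simp add: FF_one)
  then have "\<forall>\<^sub>F Q in gen. u Q * v Q = 1"
    using cls_eq_iff[OF K_mult[OF u val_in_K[OF v(2)]], of "\<lambda>_. 1"] by blast
  from val_respects[OF val_times[OF ud v(2)] this] have "d * c = 1" using val_consts[OF P] val_eq by blast
  then have "d \<noteq> 0" by auto
  with ud show "\<exists>c. c \<noteq> 0 \<and> val P u c" by blast
next
  assume "\<exists>c. c \<noteq> 0 \<and> val P u c"
  then obtain c where c: "c \<noteq> 0" "val P u c" by blast
  let ?v = "\<lambda>Q. inverse (u Q)"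
  have v: "val P ?v (inverse c)" using val_inv c by blast
  have "\<not> (\<forall>\<^sub>F Q in gen. u Q = 0)"
    using val_respects[OF c(2), of "\<lambda>_. 0"] val_consts[OF P, of 0] val_eq c(1) by blast
  then have "\<forall>\<^sub>F Q in gen. u Q \<noteq> 0" using K_zero[OF u] by blast
  then have "\<forall>\<^sub>F Q in gen. u Q * ?v Q = 1" by eventually_elim simp
  then have "cls (\<lambda>Q. u Q * ?v Q) = cls (\<lambda>_. 1)" by (rule cls_cong)
  then have "cls u \<otimes>\<^bsub>FF\<^esub> cls ?v = \<one>\<^bsub>FF\<^esub>" by (simp only: FF_mult[OF u val_in_K[OF v]] FF_one)
  moreover have "cls ?v \<otimes>\<^bsub>FF\<^esub> cls u = \<one>\<^bsub>FF\<^esub>"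
    using calculation FF.m_comm[OF cls_in_carrier[OF u] cls_in_carrier[OF val_in_K[OF v]]] by simp
  moreover have "cls u \<in> carrier (local_ring C P)" "cls ?v \<in> carrier (local_ring C P)"
    using c v unfolding local_ring_carrier[OF P] by blast+
  ultimately show "cls u \<in> Units (local_ring C P)"
    unfolding Units_def local_ring_simps by blast
qed

text \<open>Quotients F(t) / G(t) are closed under the field operations. Transcendence of t is what
  keeps nonzero denominators generically nonzero.\<close>

lemma generated_field_fraction:
  assumes t: "t \<in> K" and trans: "\<And>A. \<forall>\<^sub>F Q in gen. poly A (t Q) = 0 \<Longrightarrow> A = 0"
    and "a \<in> generate_field FF (insert (cls t) (constant_functions C))"
  shows "\<exists>F G. G \<noteq> 0 \<and> a = cls (\<lambda>Q. poly F (t Q) / poly G (t Q))"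
  using assms(3)
proof (induction rule: generate_field.induct)
  have ne: "\<forall>\<^sub>F Q in gen. poly G (t Q) \<noteq> 0" if "G \<noteq> 0" for G
    using K_zero[OF K_poly[OF t, of G]] trans that by blast
  have KK: "(\<lambda>Q. poly F (t Q) / poly G (t Q)) \<in> K" for F G by (intro K_divide K_poly t)
  {
    case one
    show ?case by (rule exI[of _ 1], rule exI[of _ 1]) (simp add: FF_one)
  next
    case (incl h)
    then consider "h = cls t" | c where "h = cls (\<lambda>_. c)" by (auto simp: FF_constants)
    then show ?case
    proof cases
      case 1
      then show ?thesis by (intro exI[of _ "[:0, 1:]"] exI[of _ 1]) simp
    next
      case (2 c)
      then show ?thesis by (intro exI[of _ "[:c:]"] exI[of _ 1]) simp
    qed
  next
    case (a_inv h)
    then obtain F G where FG: "G \<noteq> 0" "h = cls (\<lambda>Q. poly F (t Q) / poly G (t Q))" by blast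
    then show ?case by (intro exI[of _ "- F"] exI[of _ G]) (simp add: FF_uminus[OF KK])
  next
    case (m_inv h)
    then obtain F G where FG: "G \<noteq> 0" "h = cls (\<lambda>Q. poly F (t Q) / poly G (t Q))" by blast
    have "F \<noteq> 0"
    proof
      assume "F = 0"
      then have "h = \<zero>\<^bsub>FF\<^esub>" by (simp add: FG FF_zero)
      with m_inv show False by simp
    qed
    have "\<forall>\<^sub>F Q in gen. poly F (t Q) / poly G (t Q) \<noteq> 0"
      using ne[OF FG(1)] ne[OF \<open>F \<noteq> 0\<close>] by eventually_elim simp
    then have "(\<lambda>Q. poly F (t Q) / poly G (t Q)) \<in> Kx" using KK by (simp add: Kx_def)
    then have "inv\<^bsub>FF\<^esub> h = cls (\<lambda>Q. poly G (t Q) / poly F (t Q))" by (simp add: FG FF_inv)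
    with \<open>F \<noteq> 0\<close> show ?case by blast
  next
    case (eng_add h1 h2)
    then obtain F G F' G' where FG: "G \<noteq> 0" "h1 = cls (\<lambda>Q. poly F (t Q) / poly G (t Q))"
      "G' \<noteq> 0" "h2 = cls (\<lambda>Q. poly F' (t Q) / poly G' (t Q))" by blast
    have "h1 \<oplus>\<^bsub>FF\<^esub> h2 = cls (\<lambda>Q. poly F (t Q) / poly G (t Q) + poly F' (t Q) / poly G' (t Q))"
      by (simp add: FG FF_add[OF KK KK])
    also have "\<dots> = cls (\<lambda>Q. poly (F * G' + F' * G) (t Q) / poly (G * G') (t Q))"
    proof (rule cls_cong)
      show "\<forall>\<^sub>F Q in gen. poly F (t Q) / poly G (t Q) + poly F' (t Q) / poly G' (t Q)
        = poly (F * G' + F' * G) (t Q) / poly (G * G') (t Q)"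
        using ne[OF FG(1)] ne[OF FG(3)] by eventually_elim (simp add: field_simps)
    qed
    finally show ?case using FG by (intro exI[of _ "F * G' + F' * G"] exI[of _ "G * G'"]) simp
  next
    case (eng_mult h1 h2)
    then obtain F G F' G' where FG: "G \<noteq> 0" "h1 = cls (\<lambda>Q. poly F (t Q) / poly G (t Q))"
      "G' \<noteq> 0" "h2 = cls (\<lambda>Q. poly F' (t Q) / poly G' (t Q))" by blast
    have "h1 \<otimes>\<^bsub>FF\<^esub> h2 = cls (\<lambda>Q. poly (F * F') (t Q) / poly (G * G') (t Q))"
      by (simp add: FG FF_mult[OF KK KK])
    then show ?case using FG by (intro exI[of _ "F * F'"] exI[of _ "G * G'"]) simp
  }
qed

text \<open>Coefficient lists start with the highest degree, so the head of \<open>ps\<close>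
  belongs to the exponent \<open>length ps - 1\<close>, and prepending a coefficient leaves the
  other exponents alone. \<open>H\<close> accumulates the denominators.\<close>

lemma eval_clear_denominators:
  assumes t: "t \<in> K" and trans: "\<And>A. \<forall>\<^sub>F Q in gen. poly A (t Q) = 0 \<Longrightarrow> A = 0" and y: "y \<in> K"
    and ps: "set ps \<subseteq> generate_field FF (insert (cls t) (constant_functions C))"
  shows "\<exists>H A h. H \<noteq> 0 \<and> h \<in> K \<and> FF.eval ps (cls y) = cls h \<and>
     (\<forall>\<^sub>F Q in gen. poly H (t Q) * h Q = (\<Sum>j<length ps. poly (A j) (t Q) * y Q ^ j)) \<and>
     (ps \<noteq> [] \<longrightarrow> hd ps \<noteq> \<zero>\<^bsub>FF\<^esub> \<longrightarrow> A (length ps - 1) \<noteq> 0)"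
  using ps
proof (induction ps)
  case Nil
  show ?case using K_const[of 0] by (intro exI[of _ 1] exI[of _ "\<lambda>_. 0"] exI[of _ "\<lambda>_. 0"]) (simp add: FF_zero)
next
  case (Cons a ps)
  then obtain H A h where IH: "H \<noteq> 0" "h \<in> K" "FF.eval ps (cls y) = cls h"
    "\<forall>\<^sub>F Q in gen. poly H (t Q) * h Q = (\<Sum>j<length ps. poly (A j) (t Q) * y Q ^ j)" by auto
  obtain F G where FG: "G \<noteq> 0" "a = cls (\<lambda>Q. poly F (t Q) / poly G (t Q))"
    using generated_field_fraction[OF t trans, of a] Cons.prems by auto
  have KK: "(\<lambda>Q. poly F (t Q) / poly G (t Q)) \<in> K" by (intro K_divide K_poly t)
  define h' where "h' = (\<lambda>Q. poly F (t Q) / poly G (t Q) * y Q ^ length ps + h Q)"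
  define A' where "A' = (\<lambda>j. if j < length ps then G * A j else H * F)"
  have h': "h' \<in> K" unfolding h'_def by (intro K_add K_mult KK K_power y IH)
  have "FF.eval (a # ps) (cls y) = cls h'"
  proof -
    have "FF.eval (a # ps) (cls y) = a \<otimes>\<^bsub>FF\<^esub> cls (\<lambda>Q. y Q ^ length ps) \<oplus>\<^bsub>FF\<^esub> cls h"
      by (simp add: IH FF_pow[OF y])
    then show ?thesis
      by (simp only: FG h'_def FF_mult[OF KK K_power[OF y]] FF_add[OF K_mult[OF KK K_power[OF y]] IH(2)])
  qed
  moreover have "\<forall>\<^sub>F Q in gen. poly (H * G) (t Q) * h' Q = (\<Sum>j<length (a # ps). poly (A' j) (t Q) * y Q ^ j)"
  proof -
    have "\<forall>\<^sub>F Q in gen. poly G (t Q) \<noteq> 0" using K_zero[OF K_poly[OF t, of G]] trans FG by blast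
    with IH(4) show ?thesis
    proof eventually_elim
      case (elim Q)
      have "(\<Sum>j<length (a # ps). poly (A' j) (t Q) * y Q ^ j)
          = (\<Sum>j<length ps. poly (A' j) (t Q) * y Q ^ j) + poly (H * F) (t Q) * y Q ^ length ps"
        by (simp add: A'_def)
      also have "(\<Sum>j<length ps. poly (A' j) (t Q) * y Q ^ j) = poly G (t Q) * (\<Sum>j<length ps. poly (A j) (t Q) * y Q ^ j)"
        unfolding sum_distrib_left by (rule sum.cong) (auto simp: A'_def mult_ac)
      finally show ?case using elim by (simp add: h'_def field_simps)
    qed
  qed
  moreover have "A' (length (a # ps) - 1) \<noteq> 0" if "hd (a # ps) \<noteq> \<zero>\<^bsub>FF\<^esub>"
  proof -
    have "F \<noteq> 0" using that by (auto simp: FG FF_zero)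
    then show ?thesis using IH(1) by (simp add: A'_def)
  qed
  ultimately show ?case using h' IH(1) FG(1) by (intro exI[of _ "H * G"] exI[of _ A'] exI[of _ h']) auto
qed

end

section \<open>Nonsingular projective curves as abstract curves\<close>

locale nonsingular_curve =
  fixes C :: "('k::alg_closed_field, 'n::finite) pt set"
  assumes nonsingular: "nonsingular_projective_curve C"

sublocale nonsingular_curve \<subseteq> variety C
  using nonsingular by unfold_locales (simp add: nonsingular_projective_curve_def projective_curve_def)

context nonsingular_curve begin

text \<open>Restates the dimension condition pointwise: an algebraic equation over the field
  generated by t and the constants becomes one over k[t] after clearing denominators, with nonzero
  leading coefficient.\<close>

lemma transcendence_basis:
  obtains t where "t \<in> K" "\<And>c. \<not> (\<forall>\<^sub>F Q in gen. t Q = c)" "\<And>y. y \<in> K \<Longrightarrow> algebraic_dependent t y"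
proof -
  obtain t0 where t0: "t0 \<in> carrier FF" "FF.transcendental (constant_functions C) t0"
    "\<And>y. y \<in> carrier FF \<Longrightarrow> \<not> FF.transcendental (generate_field FF (insert t0 (constant_functions C))) y"
    using nonsingular by (auto simp: nonsingular_projective_curve_def projective_curve_def)
  obtain t where t: "t \<in> K" "t0 = cls t" using t0(1) by (auto simp: FF_carrier)
  have nc: "\<not> (\<forall>\<^sub>F Q in gen. t Q = c)" for c
  proof
    assume ev: "\<forall>\<^sub>F Q in gen. t Q = c"
    have eq: "t0 = cls (\<lambda>_. c)" unfolding t(2) by (rule cls_cong[OF ev])
    \<comment> \<open>The polynomial X - c, leading coefficient first; it would kill a constant
      \<open>t0\<close>.\<close>
    let ?p = "[cls (\<lambda>_. 1), cls (\<lambda>_. - c)]"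
    have one_ne: "cls (\<lambda>_. 1) \<noteq> \<zero>\<^bsub>FF\<^esub>" using FF.one_not_zero by (simp add: FF_one)
    have "?p \<in> carrier ((constant_functions C) [X]\<^bsub>FF\<^esub>)" "[] \<in> carrier ((constant_functions C) [X]\<^bsub>FF\<^esub>)"
      using one_ne by (auto simp: univ_poly_def polynomial_def FF_constants)
    moreover have "FF.eval ?p t0 = FF.eval [] t0"
      by (simp add: eq FF_pow K_const FF_mult FF_add FF_zero K_mult)
    ultimately have "?p = []"
      using t0(2) unfolding FF.transcendental_def inj_on_def by blast
    then show False by simp
  qed
  note trans = poly_eventually_zero[OF t(1) nc]
  let ?L = "generate_field FF (insert (cls t) (constant_functions C))"
  have "algebraic_dependent t y" if y: "y \<in> K" for y
  proof -
    have "insert (cls t) (constant_functions C) \<subseteq> carrier FF" using t K_const by (auto simp: FF_constants)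
    then have "subring ?L FF" using FF.generate_field_is_subfield subfieldE(1) by blast
    then obtain p where p: "p \<in> carrier (?L [X]\<^bsub>FF\<^esub>)" "p \<noteq> []" "FF.eval p (cls y) = \<zero>\<^bsub>FF\<^esub>"
      using FF.algebraicE[of ?L "cls y"] t0(3)[of "cls y"] y t by (auto simp: over_def)
    then have L: "set p \<subseteq> ?L" "hd p \<noteq> \<zero>\<^bsub>FF\<^esub>" by (auto simp: univ_poly_def polynomial_def)
    obtain H A h where h: "H \<noteq> 0" "h \<in> K" "FF.eval p (cls y) = cls h"
      "\<forall>\<^sub>F Q in gen. poly H (t Q) * h Q = (\<Sum>j<length p. poly (A j) (t Q) * y Q ^ j)"
      "A (length p - 1) \<noteq> 0"
      using eval_clear_denominators[OF t(1) trans y L(1)] p(2) L(2) by blast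
    have "\<forall>\<^sub>F Q in gen. h Q = 0" using h(3) p(3) cls_zero_iff[OF h(2)] by metis
    with h(4) have "\<forall>\<^sub>F Q in gen. (\<Sum>j<length p. poly (A j) (t Q) * y Q ^ j) = 0"
      by eventually_elim simp
    moreover have "{..<length p} = {..length p - 1}" using p(2) by (cases p) auto
    ultimately show ?thesis unfolding algebraic_dependent_def using h(5) by (intro exI[of _ "length p - 1"] exI[of _ A]) simp
  qed
  with t(1) nc show ?thesis by (rule that)
qed

lemma curve: "curve gen K C val"
proof (unfold_locales)
  obtain t where t: "t \<in> K" "\<And>c. \<not> (\<forall>\<^sub>F Q in gen. t Q = c)" "\<And>y. y \<in> K \<Longrightarrow> algebraic_dependent t y"
    by (rule transcendence_basis) blast
  show "\<exists>x\<in>K. \<forall>c. \<not> (\<forall>\<^sub>F Q in gen. x Q = c)" using t by blast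
  show "\<exists>e. \<forall>I (u :: nat \<Rightarrow> ('k, 'n) pt \<Rightarrow> 'k). finite I \<longrightarrow> u ` I \<subseteq> K \<longrightarrow>
           (\<forall>r. lin_indep gen ({..r::nat} \<times> I) (\<lambda>(a, i) Q. x Q ^ a * u i Q)) \<longrightarrow> card I \<le> e"
    if "x \<in> K" for x
    by (rule finite_type_of_algebraic[OF t(1) poly_eventually_zero[OF t(1,2)] t(3) that])
  fix P
  show "val P f c \<Longrightarrow> f \<in> K" for f c by (rule val_in_K)
  show "P \<in> C \<Longrightarrow> val P (\<lambda>_. c) c" for c by (rule val_consts)
  show "val P f c \<Longrightarrow> val P g d \<Longrightarrow> val P (\<lambda>Q. f Q + g Q) (c + d)" for f c g d by (rule val_plus)
  show "val P f c \<Longrightarrow> val P g d \<Longrightarrow> val P (\<lambda>Q. f Q * g Q) (c * d)" for f c g d by (rule val_times)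
  show "val P f c \<Longrightarrow> c \<noteq> 0 \<Longrightarrow> val P (\<lambda>Q. inverse (f Q)) (inverse c)" for f c by (rule val_inv)
  show "val P f c \<Longrightarrow> \<forall>\<^sub>F Q in gen. f Q = g Q \<Longrightarrow> val P g c" for f c g by (rule val_respects)
  show "val P f c \<Longrightarrow> val P f d \<Longrightarrow> c = d" for f c d by (rule val_eq)
  show "P \<in> C \<Longrightarrow> f \<in> K \<Longrightarrow> \<exists>g h c d. val P g c \<and> val P h d \<and> (\<forall>\<^sub>F Q in gen. h Q \<noteq> 0 \<and> f Q = g Q / h Q)" for f
    by (rule fractions)
  show "f \<in> K \<Longrightarrow> (\<And>P. P \<in> C \<Longrightarrow> \<exists>c. val P f c) \<Longrightarrow> \<exists>c. \<forall>\<^sub>F Q in gen. f Q = c" for f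
    by (rule regular_constant)
  show "P \<in> C \<Longrightarrow> Q \<in> C \<Longrightarrow> P \<noteq> Q \<Longrightarrow> finite S \<Longrightarrow> S \<subseteq> C \<Longrightarrow>
           \<exists>f c. (\<forall>A\<in>S. \<exists>d. val A f d) \<and> val P f c \<and> c \<noteq> 0 \<and> val Q f 0" for Q S
    by (rule separating_function)
  show "\<exists>t. val P t 0 \<and> (\<forall>f. val P f 0 \<longrightarrow> (\<exists>g c. val P g c \<and> (\<forall>\<^sub>F Q in gen. f Q = g Q * t Q)))" if P: "P \<in> C"
  proof -
    obtain s where s: "uniformizer C P s" using nonsingular P by (auto simp: nonsingular_projective_curve_def)
    then have "s \<in> cls ` {f. \<exists>c. val P f c}" by (simp add: uniformizer_def local_ring_carrier[OF P])
    then obtain t where t: "t \<in> K" "s = cls t" using val_in_K by blast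
    then show ?thesis using s uniformizer_cls[OF P t(1)] by blast
  qed
qed

end

sublocale nonsingular_curve \<subseteq> curve gen K C val
  by (rule curve)

context nonsingular_curve begin

lemma uniformizer_iff: "P \<in> C \<Longrightarrow> t \<in> K \<Longrightarrow> uniformizer C P (cls t) \<longleftrightarrow> unif P t"
  using uniformizer_cls[of P t] unfolding unif_def reg_def by meson

text \<open>The predicates under the two definite descriptions are equivalent for each n, since all
  uniformizers and units of the local ring are classes of functions.\<close>

lemma vanishing_order_eq:
  assumes P: "P \<in> C" and f: "f \<in> Kx"
  shows "vanishing_order C P (cls f) = ord P f"
proof -
  have "(\<exists>t u. uniformizer C P t \<and> u \<in> Units (local_ring C P) \<and> cls f = u \<otimes>\<^bsub>FF\<^esub> (t [^]\<^bsub>FF\<^esub> n)) \<longleftrightarrow> has_ord P f n" for n :: int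
  proof
    assume "has_ord P f n"
    then obtain t u where t: "unif P t" and u: "nonvan P u" and eq: "\<forall>\<^sub>F Q in gen. f Q = u Q * t Q powi n"
      by (auto simp: has_ord_def)
    have tK: "t \<in> Kx" by (rule unif_Kx[OF P t])
    have uK: "u \<in> K" by (rule reg_K[OF nonvan_reg[OF u]])
    have "cls f = cls u \<otimes>\<^bsub>FF\<^esub> (cls t [^]\<^bsub>FF\<^esub> n)"
      using cls_cong[OF eq] by (simp add: FF_int_pow[OF tK] FF_mult[OF uK] K_powi KxK[OF tK])
    moreover have "uniformizer C P (cls t)" using uniformizer_iff[OF P KxK[OF tK]] t by blast
    moreover have "cls u \<in> Units (local_ring C P)" using Units_local_ring[OF P uK] u by (simp add: nonvan_def)
    ultimately show "\<exists>t u. uniformizer C P t \<and> u \<in> Units (local_ring C P) \<and> cls f = u \<otimes>\<^bsub>FF\<^esub> (t [^]\<^bsub>FF\<^esub> n)" by blast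
  next
    assume "\<exists>t u. uniformizer C P t \<and> u \<in> Units (local_ring C P) \<and> cls f = u \<otimes>\<^bsub>FF\<^esub> (t [^]\<^bsub>FF\<^esub> n)"
    then obtain t' u' where t': "uniformizer C P t'" "u' \<in> Units (local_ring C P)" "cls f = u' \<otimes>\<^bsub>FF\<^esub> (t' [^]\<^bsub>FF\<^esub> n)"
      by blast
    have "t' \<in> cls ` {f. \<exists>c. val P f c}" "u' \<in> cls ` {f. \<exists>c. val P f c}"
      using t' by (auto simp: uniformizer_def Units_def local_ring_carrier[OF P])
    then obtain t u where tu: "t' = cls t" "t \<in> K" "u' = cls u" "u \<in> K" using val_in_K by blast
    have t: "unif P t" using t'(1) tu uniformizer_iff[OF P tu(2)] by blast
    have tK: "t \<in> Kx" by (rule unif_Kx[OF P t])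
    have u: "nonvan P u" using t'(2) tu Units_local_ring[OF P tu(4)] by (simp add: nonvan_def)
    have "cls f = cls (\<lambda>Q. u Q * t Q powi n)"
      using t'(3) by (simp add: tu FF_int_pow[OF tK] FF_mult K_powi)
    then have "\<forall>\<^sub>F Q in gen. f Q = u Q * t Q powi n" by (rule cls_eqD[OF KxK[OF f]])
    with t u show "has_ord P f n" unfolding has_ord_def by blast
  qed
  then show ?thesis unfolding vanishing_order_def ord_def by simp
qed

end

section \<open>Cohomology in low degrees\<close>

lemma tuples_0: "tuples G 0 = {[]}"
  by (auto simp: tuples_def)

lemma tuples_1: "xs \<in> tuples G (Suc 0) \<longleftrightarrow> (\<exists>g\<in>carrier G. xs = [g])"
  by (auto simp: tuples_def length_Suc_conv)

lemma tuples_2: "xs \<in> tuples G (Suc (Suc 0)) \<longleftrightarrow> (\<exists>g\<in>carrier G. \<exists>h\<in>carrier G. xs = [g, h])"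
  by (auto simp: tuples_def length_Suc_conv)

lemma tuples_3:
  "xs \<in> tuples G (Suc (Suc (Suc 0))) \<longleftrightarrow> (\<exists>g\<in>carrier G. \<exists>h\<in>carrier G. \<exists>k\<in>carrier G. xs = [g, h, k])"
  by (auto simp: tuples_def length_Suc_conv)

context
  fixes G :: "('g, 'a) monoid_scheme" (structure) and M :: "'m monoid" and \<alpha> :: "'g \<Rightarrow> 'm \<Rightarrow> 'm"
  assumes G: "group G" and M: "comm_group M"
    and closed: "\<And>g x. g \<in> carrier G \<Longrightarrow> x \<in> carrier M \<Longrightarrow> \<alpha> g x \<in> carrier M"
begin

interpretation G: group G by (rule G)
interpretation M: comm_group M by (rule M)

lemma coboundary_map_0:
  assumes f: "f \<in> carrier (cochains G M 0)" and g: "g \<in> carrier G"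
  shows "coboundary_map G M \<alpha> 0 f [g] = \<alpha> g (f []) \<otimes>\<^bsub>M\<^esub> inv\<^bsub>M\<^esub> (f [])"
proof -
  have "f [] \<in> carrier M" using f by (auto simp: cochains_def tuples_0)
  then show ?thesis
    using g closed by (simp add: coboundary_map_def tuples_1 M.int_pow_neg[of _ 1])
qed

lemma coboundary_map_1:
  assumes f: "f \<in> carrier (cochains G M (Suc 0))" and g: "g \<in> carrier G" "h \<in> carrier G"
  shows "coboundary_map G M \<alpha> (Suc 0) f [g, h] =
    \<alpha> g (f [h]) \<otimes>\<^bsub>M\<^esub> inv\<^bsub>M\<^esub> (f [g \<otimes> h]) \<otimes>\<^bsub>M\<^esub> f [g]"
proof -
  have f: "f [k] \<in> carrier M" if "k \<in> carrier G" for k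
    using f that by (auto simp: cochains_def tuples_1)
  show ?thesis
    using g closed f by (simp add: coboundary_map_def tuples_2 merge_at_def M.int_pow_neg[of _ 1])
qed

lemma coboundary_map_2:
  assumes f: "f \<in> carrier (cochains G M 2)" and g: "g \<in> carrier G" "h \<in> carrier G" "k \<in> carrier G"
  shows "coboundary_map G M \<alpha> 2 f [g, h, k] =
    \<alpha> g (f [h, k]) \<otimes>\<^bsub>M\<^esub> (inv\<^bsub>M\<^esub> (f [g \<otimes> h, k]) \<otimes>\<^bsub>M\<^esub> f [g, h \<otimes> k]) \<otimes>\<^bsub>M\<^esub> inv\<^bsub>M\<^esub> (f [g, h])"
proof -
  have f: "f [x, y] \<in> carrier M" if "x \<in> carrier G" "y \<in> carrier G" for x y
    using f that by (auto simp: cochains_def tuples_2 numeral_2_eq_2)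
  have "{1..2::nat} = {1, 2}" by auto
  then have "(\<Otimes>\<^bsub>M\<^esub>i\<in>{1..2}. f (merge_at G i [g, h, k]) [^]\<^bsub>M\<^esub> ((- 1) ^ i :: int))
      = inv\<^bsub>M\<^esub> (f [g \<otimes> h, k]) \<otimes>\<^bsub>M\<^esub> f [g, h \<otimes> k]"
    using g f by (simp add: merge_at_def M.int_pow_neg[of _ 1])
  moreover have "[g, h, k] \<in> tuples G (Suc 2)" using g by (simp add: tuples_3 numeral_2_eq_2)
  ultimately show ?thesis
    using g closed f by (simp add: coboundary_map_def M.int_pow_neg[of _ 1])
qed

end

lemma normal_coset_one_iff:
  assumes "H \<lhd> K" "x \<in> carrier K" shows "H #>\<^bsub>K\<^esub> x = H \<longleftrightarrow> x \<in> H"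
proof -
  interpret normal H K by (rule assms)
  show ?thesis
    using rcos_const[OF is_group] rcos_self[OF assms(2) subgroup_axioms] by blast
qed

section \<open>Modules inside an additive type and their first cohomology\<close>

text \<open>Divisors already form an additive group type. Viewing a subset of it as a multiplicative
  record lets computations in a module and in its submodules use the same sum and
  difference.\<close>

definition add_module :: "'m::ab_group_add set \<Rightarrow> 'm monoid" where
  "add_module S = \<lparr>carrier = S, monoid.mult = (+), one = 0\<rparr>"

lemma add_module_simps [simp]:
  "carrier (add_module S) = S" "x \<otimes>\<^bsub>add_module S\<^esub> y = x + y" "\<one>\<^bsub>add_module S\<^esub> = 0"
  by (simp_all add: add_module_def)

locale add_G_module = group G for G :: "('g, 'a) monoid_scheme" (structure) +
  fixes S :: "'m::ab_group_add set" and act :: "'g \<Rightarrow> 'm \<Rightarrow> 'm"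
  assumes zero_mem: "0 \<in> S" and add_mem: "x \<in> S \<Longrightarrow> y \<in> S \<Longrightarrow> x + y \<in> S"
    and uminus_mem: "x \<in> S \<Longrightarrow> - x \<in> S"
    and act_mem: "g \<in> carrier G \<Longrightarrow> x \<in> S \<Longrightarrow> act g x \<in> S"
    and act_add: "g \<in> carrier G \<Longrightarrow> x \<in> S \<Longrightarrow> y \<in> S \<Longrightarrow> act g (x + y) = act g x + act g y"
    and act_mult: "g \<in> carrier G \<Longrightarrow> h \<in> carrier G \<Longrightarrow> x \<in> S \<Longrightarrow> act (g \<otimes> h) x = act g (act h x)"
    and act_one: "x \<in> S \<Longrightarrow> act \<one> x = x"
begin

lemma diff_mem: "x \<in> S \<Longrightarrow> y \<in> S \<Longrightarrow> x - y \<in> S"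
  using add_mem[OF _ uminus_mem, of x y] by simp

lemma act_diff: "g \<in> carrier G \<Longrightarrow> x \<in> S \<Longrightarrow> y \<in> S \<Longrightarrow> act g (x - y) = act g x - act g y"
  using act_add[of g "x - y" y] by (simp add: diff_mem)

lemma comm_group_add_module: "comm_group (add_module S)"
proof (rule comm_groupI)
  fix x assume "x \<in> carrier (add_module S)"
  then show "\<exists>y\<in>carrier (add_module S). y \<otimes>\<^bsub>add_module S\<^esub> x = \<one>\<^bsub>add_module S\<^esub>"
    using uminus_mem[of x] by (intro bexI[of _ "- x"]) simp_all
qed (simp_all add: zero_mem add_mem add_ac)

lemma inv_add_module: "x \<in> S \<Longrightarrow> inv\<^bsub>add_module S\<^esub> x = - x"
  using group.inv_equality[OF comm_group.axioms(2)[OF comm_group_add_module], of "- x" x]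
  by (simp add: uminus_mem)

text \<open>The coboundary of the 0-cochain m, written without reference to \<open>S\<close>. For a
  submodule B of A the maps \<open>A.bd\<close> and \<open>B.bd\<close> therefore coincide, and
  \<open>B.bd D\<close> makes sense for D in A: it is a cocycle of B exactly if all
  \<open>act g D - D\<close> lie in B.\<close>

definition bd :: "'m \<Rightarrow> 'g list \<Rightarrow> 'm" where
  "bd m = (\<lambda>xs\<in>tuples G (Suc 0). act (hd xs) m - m)"

lemma bd_apply: "g \<in> carrier G \<Longrightarrow> bd m [g] = act g m - m"
  by (simp add: bd_def tuples_1)

abbreviation "Z1 \<equiv> cocycles G (add_module S) act (Suc 0)"
abbreviation "B1 \<equiv> coboundaries G (add_module S) act (Suc 0)"
abbreviation "H1 \<equiv> cohomology G (add_module S) act (Suc 0)"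

lemma cocycle_iff: "f \<in> carrier Z1 \<longleftrightarrow> f \<in> tuples G (Suc 0) \<rightarrow>\<^sub>E S \<and>
  (\<forall>g\<in>carrier G. \<forall>h\<in>carrier G. f [g \<otimes> h] = f [g] + act g (f [h]))"
proof (cases "f \<in> tuples G (Suc 0) \<rightarrow>\<^sub>E S")
  case True
  then have f: "f \<in> carrier (cochains G (add_module S) (Suc 0))" by (simp add: cochains_def)
  have fS: "f [g] \<in> S" if "g \<in> carrier G" for g using True that by (auto simp: tuples_1)
  have "coboundary_map G (add_module S) act (Suc 0) f [g, h] = act g (f [h]) - f [g \<otimes> h] + f [g]"
    if "g \<in> carrier G" "h \<in> carrier G" for g h
    using coboundary_map_1[OF is_group comm_group_add_module, of act, OF _ f] that fS
    by (simp add: act_mem inv_add_module)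
  moreover have "coboundary_map G (add_module S) act (Suc 0) f xs = undefined" if "xs \<notin> tuples G (Suc (Suc 0))" for xs
    using that by (simp add: coboundary_map_def)
  ultimately have "coboundary_map G (add_module S) act (Suc 0) f = (\<lambda>xs\<in>tuples G (Suc (Suc 0)). 0) \<longleftrightarrow>
    (\<forall>g\<in>carrier G. \<forall>h\<in>carrier G. act g (f [h]) - f [g \<otimes> h] + f [g] = 0)"
    unfolding fun_eq_iff restrict_def by (metis tuples_2)
  moreover have "act g (f [h]) - f [g \<otimes> h] + f [g] = 0 \<longleftrightarrow> f [g \<otimes> h] = f [g] + act g (f [h])" for g h
    by (auto simp: algebra_simps)
  ultimately show ?thesis
    using True by (simp add: cocycles_def kernel_def cochains_def)
qed (simp add: cocycles_def kernel_def cochains_def)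

lemma cocycle_mult: "f \<otimes>\<^bsub>Z1\<^esub> f' = (\<lambda>xs\<in>tuples G (Suc 0). f xs + f' xs)"
  and cocycle_one: "\<one>\<^bsub>Z1\<^esub> = (\<lambda>xs\<in>tuples G (Suc 0). 0)"
  by (simp_all add: cocycles_def cochains_def)

lemma cocycle_mem: "f \<in> carrier Z1 \<Longrightarrow> g \<in> carrier G \<Longrightarrow> f [g] \<in> S"
  by (auto simp: cocycle_iff tuples_1)

lemma comm_group_cocycles: "comm_group Z1"
proof (rule comm_groupI)
  fix f assume f: "f \<in> carrier Z1"
  then have fE: "f \<in> tuples G (Suc 0) \<rightarrow>\<^sub>E S" and fc: "\<And>g h. g \<in> carrier G \<Longrightarrow> h \<in> carrier G \<Longrightarrow> f [g \<otimes> h] = f [g] + act g (f [h])"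
    by (auto simp: cocycle_iff)
  show "\<one>\<^bsub>Z1\<^esub> \<otimes>\<^bsub>Z1\<^esub> f = f"
    using fE by (auto simp: cocycle_mult cocycle_one fun_eq_iff PiE_def extensional_def)
  define f' where "f' = (\<lambda>xs\<in>tuples G (Suc 0). - f xs)"
  have "f' \<in> carrier Z1"
  proof -
    have "act g (- f [h]) = - act g (f [h])" if "g \<in> carrier G" "h \<in> carrier G" for g h
      using act_diff[OF that(1) zero_mem cocycle_mem[OF f that(2)]] act_diff[OF that(1) zero_mem zero_mem] by simp
    then show ?thesis
      using fE uminus_mem by (auto simp: cocycle_iff f'_def tuples_1 fc)
  qed
  moreover have "f' \<otimes>\<^bsub>Z1\<^esub> f = \<one>\<^bsub>Z1\<^esub>" by (auto simp: cocycle_mult cocycle_one f'_def fun_eq_iff)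
  ultimately show "\<exists>f'\<in>carrier Z1. f' \<otimes>\<^bsub>Z1\<^esub> f = \<one>\<^bsub>Z1\<^esub>" by blast
  fix h assume h: "h \<in> carrier Z1"
  show "f \<otimes>\<^bsub>Z1\<^esub> h = h \<otimes>\<^bsub>Z1\<^esub> f" by (simp add: cocycle_mult add.commute)
  show "f \<otimes>\<^bsub>Z1\<^esub> h \<in> carrier Z1"
  proof -
    have "act x (f [y] + h [y]) = act x (f [y]) + act x (h [y])" if "x \<in> carrier G" "y \<in> carrier G" for x y
      using act_add[OF that(1) cocycle_mem[OF f that(2)] cocycle_mem[OF h that(2)]] .
    then show ?thesis using f h add_mem
      by (auto simp: cocycle_iff cocycle_mult tuples_1 algebra_simps intro!: add_mem)
  qed
  fix k assume k: "k \<in> carrier Z1"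
  show "f \<otimes>\<^bsub>Z1\<^esub> h \<otimes>\<^bsub>Z1\<^esub> k = f \<otimes>\<^bsub>Z1\<^esub> (h \<otimes>\<^bsub>Z1\<^esub> k)"
    by (auto simp: cocycle_mult fun_eq_iff add.assoc)
next
  have "act x 0 = 0" if "x \<in> carrier G" for x using act_diff[OF that zero_mem zero_mem] by simp
  then show "\<one>\<^bsub>Z1\<^esub> \<in> carrier Z1" by (auto simp: cocycle_iff cocycle_one tuples_1 zero_mem)
qed

lemma bd_cocycle:
  assumes m: "m \<in> S" shows "bd m \<in> carrier Z1"
proof -
  have "act (g \<otimes> h) m - m = (act g m - m) + act g (act h m - m)" if "g \<in> carrier G" "h \<in> carrier G" for g h
    using that m by (simp add: act_mult act_diff act_mem)
  then show ?thesis using m by (auto simp: cocycle_iff bd_def tuples_1 intro!: diff_mem act_mem)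
qed

lemma bd_hom: "bd \<in> hom (add_module S) Z1"
proof (rule homI)
  show "bd (x \<otimes>\<^bsub>add_module S\<^esub> y) = bd x \<otimes>\<^bsub>Z1\<^esub> bd y"
    if "x \<in> carrier (add_module S)" "y \<in> carrier (add_module S)" for x y
    using that by (auto simp: cocycle_mult bd_def fun_eq_iff tuples_1 act_add)
qed (simp add: bd_cocycle)

lemma coboundaries_eq: "B1 = bd ` S"
proof -
  have eq: "coboundary_map G (add_module S) act 0 f = bd (f [])" if f: "f \<in> carrier (cochains G (add_module S) 0)" for f
  proof
    fix xs
    have fS: "f [] \<in> S" using f by (auto simp: cochains_def tuples_0)
    show "coboundary_map G (add_module S) act 0 f xs = bd (f []) xs"
    proof (cases "xs \<in> tuples G (Suc 0)")
      case True
      then obtain g where "g \<in> carrier G" "xs = [g]" by (auto simp: tuples_1)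
      then show ?thesis
        using coboundary_map_0[OF is_group comm_group_add_module, of act, OF _ f] fS
        by (simp add: act_mem inv_add_module bd_apply)
    next
      case False
      then show ?thesis by (simp add: coboundary_map_def bd_def)
    qed
  qed
  have "B1 = (\<lambda>f. bd (f [])) ` carrier (cochains G (add_module S) 0)"
  proof -
    have "B1 = coboundary_map G (add_module S) act 0 ` carrier (cochains G (add_module S) 0)"
      by (simp add: coboundaries_def)
    also have "\<dots> = (\<lambda>f. bd (f [])) ` carrier (cochains G (add_module S) 0)"
      by (rule image_cong[OF refl eq])
    finally show ?thesis .
  qed
  also have "\<dots> = bd ` ((\<lambda>f. f []) ` carrier (cochains G (add_module S) 0))" by (simp add: image_image)
  also have "(\<lambda>f. f []) ` carrier (cochains G (add_module S) 0) = S"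
  proof
    show "(\<lambda>f. f []) ` carrier (cochains G (add_module S) 0) \<subseteq> S" by (auto simp: cochains_def tuples_0)
    show "S \<subseteq> (\<lambda>f. f []) ` carrier (cochains G (add_module S) 0)"
    proof
      fix m assume "m \<in> S"
      then have "(\<lambda>xs\<in>tuples G 0. m) \<in> carrier (cochains G (add_module S) 0)" by (simp add: cochains_def)
      then show "m \<in> (\<lambda>f. f []) ` carrier (cochains G (add_module S) 0)"
        by (rule rev_image_eqI) (simp add: tuples_0)
    qed
  qed
  finally show ?thesis .
qed

lemma coboundaries_normal: "B1 \<lhd> Z1"
proof -
  interpret Z: comm_group Z1 by (rule comm_group_cocycles)
  interpret group_hom "add_module S" Z1 bd
    using comm_group_add_module bd_hom by (simp add: group_hom_def group_hom_axioms_def comm_group_def Z.is_group)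
  have "subgroup (bd ` carrier (add_module S)) Z1" by (rule img_is_subgroup)
  then show ?thesis using Z.subgroup_imp_normal by (simp add: coboundaries_eq)
qed

end

section \<open>Invariants of a quotient module compared with the kernel on first cohomology\<close>

locale G_submodule = A: add_G_module G A act + B: add_G_module G B act
  for G :: "('g, 'a) monoid_scheme" (structure) and A B :: "'m::ab_group_add set" and act +
  assumes sub: "B \<subseteq> A"
begin

abbreviation "QuotM \<equiv> add_module A Mod B"
abbreviation "Inv \<equiv> invariants G QuotM (\<lambda>g c. act g ` c)"
abbreviation "N \<equiv> (\<lambda>D. B #>\<^bsub>add_module A\<^esub> D) ` carrier (invariants G (add_module A) act)"
abbreviation "Ker \<equiv> kernel B.H1 A.H1 (cohomology_map G (add_module A) act (Suc 0) (\<lambda>D. D))"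

definition lifts :: "'m set" where
  "lifts = {D \<in> A. \<forall>g\<in>carrier G. act g D - D \<in> B}"

text \<open>This is B + A^G, the common kernel of the two maps out of \<open>lifts\<close>.\<close>

definition invariant_lifts :: "'m set" where
  "invariant_lifts = {D \<in> lifts. \<exists>D'\<in>A. (\<forall>g\<in>carrier G. act g D' = D') \<and> D - D' \<in> B}"

lemma liftsD: "D \<in> lifts \<Longrightarrow> D \<in> A" by (simp add: lifts_def)

lemma lifts_module: "add_G_module G lifts act"
proof unfold_locales
  have act0: "act g 0 = 0" if "g \<in> carrier G" for g using A.act_diff[OF that A.zero_mem A.zero_mem] by simp
  show "0 \<in> lifts" by (simp add: lifts_def A.zero_mem B.zero_mem act0)
  fix x y assume x: "x \<in> lifts" and y: "y \<in> lifts"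
  have "act g (x + y) - (x + y) \<in> B" if g: "g \<in> carrier G" for g
  proof -
    have "act g (x + y) - (x + y) = (act g x - x) + (act g y - y)"
      using x y g by (simp add: lifts_def A.act_add)
    moreover have "(act g x - x) + (act g y - y) \<in> B" using x y g by (intro B.add_mem) (auto simp: lifts_def)
    ultimately show ?thesis by (simp only:)
  qed
  then show "x + y \<in> lifts" using x y by (auto simp: lifts_def A.add_mem)
next
  fix x assume x: "x \<in> lifts"
  have "act g (- x) - (- x) \<in> B" if g: "g \<in> carrier G" for g
  proof -
    have "act g (- x) - (- x) = - (act g x - x)"
      using x A.act_diff[OF g A.zero_mem, of x] A.act_diff[OF g A.zero_mem A.zero_mem]
      by (simp add: lifts_def)
    moreover have "- (act g x - x) \<in> B" using x g by (intro B.uminus_mem) (auto simp: lifts_def)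
    ultimately show ?thesis by (simp only:)
  qed
  then show "- x \<in> lifts" using x by (simp add: lifts_def A.uminus_mem)
next
  fix g x assume g: "g \<in> carrier G" and x: "x \<in> lifts"
  have "act h (act g x) - act g x \<in> B" if h: "h \<in> carrier G" for h
  proof -
    \<comment> \<open>With x subtracted and added, hgx - gx becomes h(gx - x) + (hx - x) - (gx - x),
      in which every summand lies in B.\<close>
    have "act h (act g x) - act g x = (act h (act g x - x) + (act h x - x)) - (act g x - x)"
      using x g h by (simp add: lifts_def A.act_diff A.act_mem)
    moreover have "(act h (act g x - x) + (act h x - x)) - (act g x - x) \<in> B"
    proof -
      have d: "act k x - x \<in> B" if "k \<in> carrier G" for k using x that by (simp add: lifts_def)
      show ?thesis by (rule B.diff_mem[OF B.add_mem[OF B.act_mem[OF h d[OF g]] d[OF h]] d[OF g]])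
    qed
    ultimately show ?thesis by (simp only:)
  qed
  then show "act g x \<in> lifts" using x g by (auto simp: lifts_def A.act_mem)
next
  fix g x y assume "g \<in> carrier G" "x \<in> lifts" "y \<in> lifts"
  then show "act g (x + y) = act g x + act g y" by (simp add: lifts_def A.act_add)
next
  fix g h x assume "g \<in> carrier G" "h \<in> carrier G" "x \<in> lifts"
  then show "act (g \<otimes> h) x = act g (act h x)" by (simp add: lifts_def A.act_mult)
next
  fix x assume "x \<in> lifts"
  then show "act \<one> x = x" by (simp add: lifts_def A.act_one)
qed

lemma B_normal: "B \<lhd> add_module A"
proof -
  interpret MA: comm_group "add_module A" by (rule A.comm_group_add_module)
  have "subgroup B (add_module A)"
    using sub B.zero_mem B.add_mem B.uminus_mem A.inv_add_module by (intro subgroup.intro) auto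
  then show ?thesis by (rule MA.subgroup_imp_normal)
qed

lemma coset_eq: "B #>\<^bsub>add_module A\<^esub> D = {b + D | b. b \<in> B}"
  by (auto simp: r_coset_def)

lemma coset_mem: "D \<in> B #>\<^bsub>add_module A\<^esub> D"
  unfolding coset_eq using B.zero_mem by (intro CollectI exI[of _ 0]) simp

lemma coset_eq_iff: "B #>\<^bsub>add_module A\<^esub> D = B #>\<^bsub>add_module A\<^esub> D' \<longleftrightarrow> D - D' \<in> B"
proof
  assume "B #>\<^bsub>add_module A\<^esub> D = B #>\<^bsub>add_module A\<^esub> D'"
  then have "D \<in> B #>\<^bsub>add_module A\<^esub> D'" using coset_mem by blast
  then show "D - D' \<in> B" unfolding coset_eq by auto
next
  assume D: "D - D' \<in> B"
  have "b + D \<in> B #>\<^bsub>add_module A\<^esub> D'" if "b \<in> B" for b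
    unfolding coset_eq using B.add_mem[OF that D] by (intro CollectI exI[of _ "b + (D - D')"]) simp
  moreover have "b + D' \<in> B #>\<^bsub>add_module A\<^esub> D" if "b \<in> B" for b
    unfolding coset_eq using B.diff_mem[OF that D] by (intro CollectI exI[of _ "b - (D - D')"]) simp
  ultimately show "B #>\<^bsub>add_module A\<^esub> D = B #>\<^bsub>add_module A\<^esub> D'"
    unfolding coset_eq by blast
qed

lemma act_image_B: assumes g: "g \<in> carrier G" shows "act g ` B = B"
proof
  show "act g ` B \<subseteq> B" using B.act_mem[OF g] by blast
  show "B \<subseteq> act g ` B"
  proof
    fix b assume b: "b \<in> B"
    have "b = act g (act (inv g) b)"
      using B.act_mult[OF g A.inv_closed[OF g] b] B.act_one[OF b] A.r_inv[OF g] by simp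
    then show "b \<in> act g ` B" using B.act_mem[OF A.inv_closed[OF g] b] by blast
  qed
qed

lemma act_coset:
  assumes g: "g \<in> carrier G" and D: "D \<in> A"
  shows "act g ` (B #>\<^bsub>add_module A\<^esub> D) = B #>\<^bsub>add_module A\<^esub> act g D"
proof -
  have "act g ` (B #>\<^bsub>add_module A\<^esub> D) = (\<lambda>b. act g (b + D)) ` B" unfolding coset_eq by blast
  also have "\<dots> = (\<lambda>b. act g b + act g D) ` B"
    using A.act_add[OF g _ D] sub by (intro image_cong) auto
  also have "\<dots> = (\<lambda>b. b + act g D) ` (act g ` B)" by (simp add: image_image)
  also have "\<dots> = B #>\<^bsub>add_module A\<^esub> act g D" unfolding act_image_B[OF g] coset_eq by blast
  finally show ?thesis .
qed

lemma Inv_carrier: "carrier Inv = (\<lambda>D. B #>\<^bsub>add_module A\<^esub> D) ` lifts"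
proof -
  have "B #>\<^bsub>add_module A\<^esub> D \<in> carrier Inv \<longleftrightarrow> D \<in> lifts" if "D \<in> A" for D
    using that act_coset[OF _ that] coset_eq_iff
    by (auto simp: invariants_def FactGroup_def RCOSETS_def lifts_def B.zero_mem intro!: bexI[of _ D])
  moreover have "\<exists>D\<in>A. c = B #>\<^bsub>add_module A\<^esub> D" if "c \<in> carrier Inv" for c
    using that by (auto simp: invariants_def FactGroup_def RCOSETS_def)
  ultimately show ?thesis using liftsD by blast
qed

lemma quotient_hom: "(\<lambda>D. B #>\<^bsub>add_module A\<^esub> D) \<in> hom (add_module A) QuotM"
  using normal.r_coset_hom_Mod[OF B_normal] .

lemma subgroup_Inv: "subgroup (carrier Inv) QuotM"
proof -
  interpret L: add_G_module G lifts act by (rule lifts_module)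
  have "(\<lambda>D. B #>\<^bsub>add_module A\<^esub> D) \<in> hom (add_module lifts) QuotM"
    using quotient_hom liftsD by (auto simp: hom_def)
  then interpret group_hom "add_module lifts" QuotM "\<lambda>D. B #>\<^bsub>add_module A\<^esub> D"
    using L.comm_group_add_module normal.factorgroup_is_group[OF B_normal]
    by (simp add: group_hom_def group_hom_axioms_def comm_group_def)
  show ?thesis using img_is_subgroup by (simp add: Inv_carrier)
qed

lemma Inv_eq: "Inv = QuotM\<lparr>carrier := carrier Inv\<rparr>"
  by (simp add: invariants_def)

lemma comm_group_Inv: "comm_group Inv"
proof -
  interpret MA: comm_group "add_module A" by (rule A.comm_group_add_module)
  have "subgroup B (add_module A)" using B_normal normal_imp_subgroup by blast
  then interpret Q: comm_group QuotM by (rule MA.abelian_FactGroup)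
  have "group Inv" using subgroup.subgroup_is_group[OF subgroup_Inv Q.is_group] by (simp flip: Inv_eq)
  then show ?thesis
  proof (rule group.group_comm_groupI)
    fix x y assume "x \<in> carrier Inv" "y \<in> carrier Inv"
    then have "x \<otimes>\<^bsub>QuotM\<^esub> y = y \<otimes>\<^bsub>QuotM\<^esub> x" using subgroup.mem_carrier[OF subgroup_Inv] by (intro Q.m_comm) auto
    then show "x \<otimes>\<^bsub>Inv\<^esub> y = y \<otimes>\<^bsub>Inv\<^esub> x" by (simp add: invariants_def)
  qed
qed

lemma lift_hom: "(\<lambda>D. B #>\<^bsub>add_module A\<^esub> D) \<in> hom (add_module lifts) Inv"
proof (rule homI)
  fix x y assume "x \<in> carrier (add_module lifts)" "y \<in> carrier (add_module lifts)"
  then have "B #>\<^bsub>add_module A\<^esub> (x \<otimes>\<^bsub>add_module A\<^esub> y) = (B #>\<^bsub>add_module A\<^esub> x) \<otimes>\<^bsub>QuotM\<^esub> (B #>\<^bsub>add_module A\<^esub> y)"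
    using liftsD by (intro hom_mult[OF quotient_hom]) auto
  then show "B #>\<^bsub>add_module A\<^esub> (x \<otimes>\<^bsub>add_module lifts\<^esub> y) = (B #>\<^bsub>add_module A\<^esub> x) \<otimes>\<^bsub>Inv\<^esub> (B #>\<^bsub>add_module A\<^esub> y)"
    by (simp add: invariants_def)
qed (simp add: Inv_carrier)

lemma N_eq: "N = (\<lambda>D. B #>\<^bsub>add_module A\<^esub> D) ` {D \<in> A. \<forall>g\<in>carrier G. act g D = D}"
  by (simp add: invariants_def)

lemma N_normal: "N \<lhd> Inv"
proof -
  interpret I: comm_group Inv by (rule comm_group_Inv)
  let ?F = "{D \<in> A. \<forall>g\<in>carrier G. act g D = D}"
  have "add_G_module G ?F act"
    using A.act_add A.act_one A.act_mult A.add_mem A.zero_mem A.act_diff[OF _ A.zero_mem A.zero_mem] A.uminus_mem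
      A.act_diff[OF _ A.zero_mem]
    by unfold_locales auto
  then interpret F: add_G_module G ?F act .
  have "?F \<subseteq> lifts" by (auto simp: lifts_def B.zero_mem)
  then have "(\<lambda>D. B #>\<^bsub>add_module A\<^esub> D) \<in> hom (add_module ?F) Inv"
    using lift_hom unfolding hom_def add_module_simps by blast
  then interpret group_hom "add_module ?F" Inv "\<lambda>D. B #>\<^bsub>add_module A\<^esub> D"
    using F.comm_group_add_module by (simp add: group_hom_def group_hom_axioms_def comm_group_def I.is_group)
  have "subgroup N Inv" using img_is_subgroup unfolding N_eq by simp
  then show ?thesis by (rule I.subgroup_imp_normal)
qed

text \<open>The projection to classes, followed by the quotient by \<open>N\<close>, is onto and
  kills D if and only if the class of D contains an invariant element. Normality is stated along
  with it because inverting the isomorphism requires the quotient of \<open>lifts\<close> to be a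
  group.\<close>

lemma lifts_Mod_Inv:
  "invariant_lifts \<lhd> add_module lifts \<and> add_module lifts Mod invariant_lifts \<cong> Inv Mod N"
proof -
  interpret L: add_G_module G lifts act by (rule lifts_module)
  let ?h = "(\<lambda>c. N #>\<^bsub>Inv\<^esub> c) \<circ> (\<lambda>D. B #>\<^bsub>add_module A\<^esub> D)"
  have hom: "?h \<in> hom (add_module lifts) (Inv Mod N)"
    by (rule hom_compose[OF lift_hom normal.r_coset_hom_Mod[OF N_normal]])
  interpret group_hom "add_module lifts" "Inv Mod N" ?h
    using hom L.comm_group_add_module normal.factorgroup_is_group[OF N_normal]
    by (simp add: group_hom_def group_hom_axioms_def comm_group_def)
  have "?h ` carrier (add_module lifts) = carrier (Inv Mod N)"
    unfolding image_comp[symmetric] add_module_simps Inv_carrier[symmetric] carrier_FactGroup ..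
  moreover have "kernel (add_module lifts) (Inv Mod N) ?h = invariant_lifts"
  proof -
    have "?h D = \<one>\<^bsub>Inv Mod N\<^esub> \<longleftrightarrow> (\<exists>D'\<in>A. (\<forall>g\<in>carrier G. act g D' = D') \<and> D - D' \<in> B)" if D: "D \<in> lifts" for D
    proof -
      have "B #>\<^bsub>add_module A\<^esub> D \<in> carrier Inv" using D by (simp add: Inv_carrier)
      then have "?h D = \<one>\<^bsub>Inv Mod N\<^esub> \<longleftrightarrow> B #>\<^bsub>add_module A\<^esub> D \<in> N"
        using normal_coset_one_iff[OF N_normal] by simp
      also have "\<dots> \<longleftrightarrow> (\<exists>D'\<in>A. (\<forall>g\<in>carrier G. act g D' = D') \<and> D - D' \<in> B)"
        unfolding N_eq by (auto simp: coset_eq_iff)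
      finally show ?thesis .
    qed
    then show ?thesis by (auto simp: kernel_def invariant_lifts_def)
  qed
  ultimately show ?thesis using FactGroup_iso normal_kernel by simp
qed

lemma bd_lifts: "D \<in> lifts \<Longrightarrow> B.bd D \<in> carrier B.Z1"
  using A.bd_cocycle[OF liftsD, of D] unfolding A.cocycle_iff B.cocycle_iff
  by (auto simp: lifts_def B.bd_def tuples_1 PiE_def)

text \<open>Two cocycles in one class for B differ by some \<open>bd b\<close> with b in B, which is
  also a coboundary for A; so the union defining the induced map is a union of equal cosets.\<close>

lemma cohomology_map_coset:
  assumes f: "f \<in> carrier B.Z1"
  shows "cohomology_map G (add_module A) act (Suc 0) (\<lambda>D. D) (B.B1 #>\<^bsub>B.Z1\<^esub> f) = A.B1 #>\<^bsub>A.Z1\<^esub> f"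
proof -
  interpret ZA: comm_group A.Z1 by (rule A.comm_group_cocycles)
  interpret ZB: comm_group B.Z1 by (rule B.comm_group_cocycles)
  have ZZ: "x \<in> carrier A.Z1" if "x \<in> carrier B.Z1" for x
    using that sub by (auto simp: A.cocycle_iff B.cocycle_iff PiE_def)
  have subA: "subgroup A.B1 A.Z1" using A.coboundaries_normal normal_imp_subgroup by blast
  have subB: "subgroup B.B1 B.Z1" using B.coboundaries_normal normal_imp_subgroup by blast
  have "A.B1 #>\<^bsub>A.Z1\<^esub> (\<lambda>xs\<in>tuples G (Suc 0). c xs) = A.B1 #>\<^bsub>A.Z1\<^esub> f" if c: "c \<in> B.B1 #>\<^bsub>B.Z1\<^esub> f" for c
  proof -
    obtain b where b: "b \<in> B" "c = B.bd b \<otimes>\<^bsub>B.Z1\<^esub> f" using c by (auto simp: r_coset_def B.coboundaries_eq)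
    then have c_eq: "c = A.bd b \<otimes>\<^bsub>A.Z1\<^esub> f" by (simp add: A.cocycle_mult B.cocycle_mult)
    have bA: "A.bd b \<in> A.B1" using b sub by (auto simp: A.coboundaries_eq)
    have "(\<lambda>xs\<in>tuples G (Suc 0). c xs) = c" by (auto simp: c_eq A.cocycle_mult fun_eq_iff)
    moreover have "c \<in> A.B1 #>\<^bsub>A.Z1\<^esub> f" unfolding c_eq r_coset_def using bA by blast
    ultimately show ?thesis using ZA.repr_independence[OF _ ZZ[OF f] subA] by simp
  qed
  moreover have "f \<in> B.B1 #>\<^bsub>B.Z1\<^esub> f" by (rule ZB.rcos_self[OF f subB])
  ultimately show ?thesis unfolding cohomology_map_def by blast
qed

text \<open>A cocycle of B dies in the cohomology of A if and only if it is \<open>bd D\<close> with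
  D in A, and its having values in B then says that D is in \<open>lifts\<close>.\<close>

lemma Ker_eq: "Ker = (\<lambda>D. B.B1 #>\<^bsub>B.Z1\<^esub> B.bd D) ` lifts"
proof -
  have ZZ: "x \<in> carrier A.Z1" if "x \<in> carrier B.Z1" for x
    using that sub by (auto simp: A.cocycle_iff B.cocycle_iff PiE_def)
  have car: "carrier B.H1 = (\<lambda>f. B.B1 #>\<^bsub>B.Z1\<^esub> f) ` carrier B.Z1"
    by (auto simp: cohomology_def FactGroup_def RCOSETS_def)
  have one: "\<one>\<^bsub>A.H1\<^esub> = A.B1" by (simp add: cohomology_def)
  have iff: "cohomology_map G (add_module A) act (Suc 0) (\<lambda>D. D) (B.B1 #>\<^bsub>B.Z1\<^esub> f) = \<one>\<^bsub>A.H1\<^esub> \<longleftrightarrow> f \<in> A.bd ` A"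
    if f: "f \<in> carrier B.Z1" for f
    unfolding cohomology_map_coset[OF f] one
    using normal_coset_one_iff[OF A.coboundaries_normal ZZ[OF f]] by (simp add: A.coboundaries_eq)
  have lift: "D \<in> lifts" if D: "D \<in> A" "A.bd D \<in> carrier B.Z1" for D
  proof -
    have "act g D - D \<in> B" if "g \<in> carrier G" for g
      using B.cocycle_mem[OF D(2) that] A.bd_apply[OF that] by simp
    with D show ?thesis by (simp add: lifts_def)
  qed
  show ?thesis
  proof
    show "Ker \<subseteq> (\<lambda>D. B.B1 #>\<^bsub>B.Z1\<^esub> B.bd D) ` lifts"
    proof
      fix c assume "c \<in> Ker"
      then have c: "c \<in> carrier B.H1" "cohomology_map G (add_module A) act (Suc 0) (\<lambda>D. D) c = \<one>\<^bsub>A.H1\<^esub>"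
        by (simp_all add: kernel_def)
      then obtain f where f: "f \<in> carrier B.Z1" "c = B.B1 #>\<^bsub>B.Z1\<^esub> f" using car by blast
      then obtain D where D: "D \<in> A" "f = A.bd D" using iff c(2) by blast
      then show "c \<in> (\<lambda>D. B.B1 #>\<^bsub>B.Z1\<^esub> B.bd D) ` lifts" using lift f by auto
    qed
    show "(\<lambda>D. B.B1 #>\<^bsub>B.Z1\<^esub> B.bd D) ` lifts \<subseteq> Ker"
    proof
      fix c assume "c \<in> (\<lambda>D. B.B1 #>\<^bsub>B.Z1\<^esub> B.bd D) ` lifts"
      then obtain D where D: "D \<in> lifts" "c = B.B1 #>\<^bsub>B.Z1\<^esub> B.bd D" by blast
      have "B.bd D \<in> A.bd ` A" using liftsD[OF D(1)] by simp
      then show "c \<in> Ker" using iff[OF bd_lifts[OF D(1)]] bd_lifts[OF D(1)] D(2) car by (auto simp: kernel_def)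
    qed
  qed
qed

text \<open>The map sending D to the class of \<open>bd D\<close> is onto the kernel. It kills D if
  and only if \<open>bd D = bd E\<close> for some E in B, that is, if D - E is invariant.\<close>

lemma lifts_Mod_Ker:
  "group (B.H1\<lparr>carrier := Ker\<rparr>) \<and> add_module lifts Mod invariant_lifts \<cong> B.H1\<lparr>carrier := Ker\<rparr>"
proof -
  interpret L: add_G_module G lifts act by (rule lifts_module)
  let ?h = "(\<lambda>f. B.B1 #>\<^bsub>B.Z1\<^esub> f) \<circ> B.bd"
  have "B.bd \<in> hom (add_module lifts) B.Z1"
  proof (rule homI)
    show "B.bd (x \<otimes>\<^bsub>add_module lifts\<^esub> y) = B.bd x \<otimes>\<^bsub>B.Z1\<^esub> B.bd y"
      if "x \<in> carrier (add_module lifts)" "y \<in> carrier (add_module lifts)" for x y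
      using that by (auto simp: B.cocycle_mult B.bd_def fun_eq_iff tuples_1 A.act_add lifts_def)
  qed (simp add: bd_lifts)
  from hom_compose[OF this normal.r_coset_hom_Mod[OF B.coboundaries_normal]]
  have hom: "?h \<in> hom (add_module lifts) B.H1" by (simp add: cohomology_def)
  have grp: "group B.H1" using normal.factorgroup_is_group[OF B.coboundaries_normal] by (simp add: cohomology_def)
  interpret h: group_hom "add_module lifts" B.H1 ?h
    using hom L.comm_group_add_module grp by (simp add: group_hom_def group_hom_axioms_def comm_group_def)
  have img: "?h ` carrier (add_module lifts) = Ker" unfolding Ker_eq by (simp add: image_comp o_def)
  have "subgroup Ker B.H1" using h.img_is_subgroup img by simp
  then have grpK: "group (B.H1\<lparr>carrier := Ker\<rparr>)" using grp by (rule subgroup.subgroup_is_group)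
  have "?h \<in> hom (add_module lifts) (B.H1\<lparr>carrier := Ker\<rparr>)"
    using hom img by (auto simp: hom_def)
  then interpret k: group_hom "add_module lifts" "B.H1\<lparr>carrier := Ker\<rparr>" ?h
    using L.comm_group_add_module grpK by (simp add: group_hom_def group_hom_axioms_def comm_group_def)
  have "kernel (add_module lifts) (B.H1\<lparr>carrier := Ker\<rparr>) ?h = invariant_lifts"
  proof -
    have "?h D = \<one>\<^bsub>B.H1\<^esub> \<longleftrightarrow> (\<exists>D'\<in>A. (\<forall>g\<in>carrier G. act g D' = D') \<and> D - D' \<in> B)" if D: "D \<in> lifts" for D
    proof -
      have "?h D = \<one>\<^bsub>B.H1\<^esub> \<longleftrightarrow> B.bd D \<in> B.bd ` B"
        using normal_coset_one_iff[OF B.coboundaries_normal bd_lifts[OF D]]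
        by (simp add: cohomology_def B.coboundaries_eq)
      also have "\<dots> \<longleftrightarrow> (\<exists>D'\<in>A. (\<forall>g\<in>carrier G. act g D' = D') \<and> D - D' \<in> B)"
      proof
        assume "B.bd D \<in> B.bd ` B"
        then obtain E where E: "E \<in> B" "B.bd D = B.bd E" by blast
        have "act g (D - E) = D - E" if g: "g \<in> carrier G" for g
        proof -
          have "act g D - D = act g E - E" using E(2) B.bd_apply[OF g] by metis
          moreover have "act g (D - E) = (act g D - D) - (act g E - E) + (D - E)"
            using A.act_diff[OF g liftsD[OF D] subsetD[OF sub E(1)]] by simp
          ultimately show ?thesis by simp
        qed
        then show "\<exists>D'\<in>A. (\<forall>g\<in>carrier G. act g D' = D') \<and> D - D' \<in> B"
          using E(1) sub liftsD[OF D] A.diff_mem by (intro bexI[of _ "D - E"]) auto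
      next
        assume "\<exists>D'\<in>A. (\<forall>g\<in>carrier G. act g D' = D') \<and> D - D' \<in> B"
        then obtain D' where D': "D' \<in> A" "\<And>g. g \<in> carrier G \<Longrightarrow> act g D' = D'" "D - D' \<in> B" by blast
        have "B.bd D = B.bd (D - D')"
          using D' liftsD[OF D] by (auto simp: B.bd_def fun_eq_iff tuples_1 A.act_diff)
        then show "B.bd D \<in> B.bd ` B" using D'(3) by blast
      qed
      finally show ?thesis .
    qed
    then show ?thesis by (auto simp: kernel_def invariant_lifts_def)
  qed
  then show ?thesis using k.FactGroup_iso img grpK by simp
qed

theorem Inv_Mod_iso_Ker: "Inv Mod N \<cong> B.H1\<lparr>carrier := Ker\<rparr>"
proof -
  have "group (add_module lifts Mod invariant_lifts)"
    using lifts_Mod_Inv normal.factorgroup_is_group by blast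
  then show ?thesis
    using iso_trans[OF group.iso_sym[OF _ conjunct2[OF lifts_Mod_Inv]] conjunct2[OF lifts_Mod_Ker]] by blast
qed

end

section \<open>Divisors and the group action\<close>

lemma divisor_degree_superset:
  assumes "finite S" "Poly_Mapping.keys D \<subseteq> S"
  shows "divisor_degree D = (\<Sum>P\<in>S. Poly_Mapping.lookup D P)"
  unfolding divisor_degree_def
  by (rule sum.mono_neutral_left) (use assms in \<open>auto simp: in_keys_iff\<close>)

lemma divisor_degree_add: "divisor_degree (D + E) = divisor_degree D + divisor_degree E"
proof -
  let ?S = "Poly_Mapping.keys D \<union> Poly_Mapping.keys E"
  have "finite ?S" "Poly_Mapping.keys (D + E) \<subseteq> ?S" using Poly_Mapping.keys_add[of D E] by auto
  then show ?thesis by (simp add: divisor_degree_superset[of ?S] lookup_add sum.distrib)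
qed

lemma divisor_degree_uminus: "divisor_degree (- D) = - divisor_degree D"
  by (simp add: divisor_degree_def sum_negf)

section \<open>Pullback of germs along surjective endomorphisms\<close>

context variety begin

text \<open>A continuous surjection pulls nonempty open sets back to nonempty open sets, so generic
  statements can be composed with s.\<close>

lemma eventually_gen_pull:
  assumes cont: "continuous_map (subtopology zariski C) (subtopology zariski C) s" and surj: "s ` C = C"
    and ev: "\<forall>\<^sub>F Q in gen. R Q"
  shows "\<forall>\<^sub>F Q in gen. R (s Q)"
proof -
  obtain U where U: "openin (subtopology zariski C) U" "U \<noteq> {}" "\<And>P. P \<in> U \<Longrightarrow> R P"
    by (rule eventually_genE[OF ev]) blast
  have top: "topspace (subtopology zariski C) = C" using C_projective by auto
  have UC: "U \<subseteq> C" using U(1) by (auto simp: openin_C)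
  have "openin (subtopology zariski C) {P \<in> C. s P \<in> U}"
    using openin_continuous_map_preimage[OF cont U(1)] unfolding top .
  moreover have "{P \<in> C. s P \<in> U} \<noteq> {}"
  proof -
    obtain P where P: "P \<in> U" using U(2) by auto
    then have "P \<in> s ` C" using UC surj by auto
    then show ?thesis using P by auto
  qed
  ultimately have "\<forall>\<^sub>F Q in gen. Q \<in> {P \<in> C. s P \<in> U}" by (rule gen_openin)
  then show ?thesis by eventually_elim (simp add: U(3))
qed

lemma val_pull:
  assumes s: "variety_morphism C C s" "s ` C = C" and P: "P \<in> C" and f: "val (s P) f c"
  shows "val P (\<lambda>Q. f (s Q)) c"
proof -
  obtain U g where U: "openin (subtopology zariski C) U" "s P \<in> U" "regular_on U g"
    "\<forall>\<^sub>F Q in gen. f Q = g Q" "g (s P) = c"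
    using val_regular_on[OF f] by blast
  have top: "topspace (subtopology zariski C) = C" using C_projective by auto
  have cont: "continuous_map (subtopology zariski C) (subtopology zariski C) s"
    using s(1) by (simp add: variety_morphism_def)
  have "openin (subtopology zariski C) {P \<in> C. s P \<in> U}"
    using openin_continuous_map_preimage[OF cont U(1)] unfolding top .
  moreover have "regular_on {P \<in> C. s P \<in> U} (g \<circ> s)"
    using s(1) U(1,3) by (simp add: variety_morphism_def)
  moreover have "P \<in> {P \<in> C. s P \<in> U}" using P U(2) by simp
  ultimately have "val P (g \<circ> s) ((g \<circ> s) P)" by (rule regular_on_val)
  moreover have "\<forall>\<^sub>F Q in gen. (g \<circ> s) Q = f (s Q)"
    using eventually_gen_pull[OF cont s(2) U(4)] by eventually_elim simp
  ultimately have "val P (\<lambda>Q. f (s Q)) ((g \<circ> s) P)" by (rule val_respects)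
  then show ?thesis using U(5) by simp
qed

text \<open>Off the exceptional points the representative takes the value of its germ. This allows a
  germ to be evaluated at a sufficiently general point.\<close>

lemma K_generic_val: assumes "f \<in> K" shows "\<forall>\<^sub>F Q in gen. val Q f (f Q)"
proof -
  obtain U g where U: "openin (subtopology zariski C) U" "U \<noteq> {}" "regular_on U g" "\<forall>\<^sub>F Q in gen. f Q = g Q"
    using K_regular_on[OF assms] by blast
  have ev: "\<forall>\<^sub>F Q in gen. g Q = f Q" using U(4) by eventually_elim simp
  show ?thesis using gen_openin[OF U(1,2)] ev
  proof eventually_elim
    case (elim Q)
    have "val Q f (g Q)" by (rule val_respects[OF regular_on_val[OF U(1,3) elim(1)] ev])
    then show ?case by (simp add: elim(2))
  qed
qed

text \<open>It is enough to find one point at whose image f is regular: the pullback is then regular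
  at that point and so a rational function.\<close>

lemma K_pull:
  assumes s: "variety_morphism C C s" "s ` C = C" and f: "f \<in> K"
  shows "(\<lambda>Q. f (s Q)) \<in> K"
proof -
  have cont: "continuous_map (subtopology zariski C) (subtopology zariski C) s"
    using s(1) by (simp add: variety_morphism_def)
  have "\<forall>\<^sub>F Q in gen. Q \<in> C \<and> val (s Q) f (f (s Q))"
    using gen_C eventually_gen_pull[OF cont s(2) K_generic_val[OF f]] by eventually_elim simp
  from eventually_happens'[OF gen_not_bot this]
  obtain Q where "Q \<in> C" "val (s Q) f (f (s Q))" by blast
  then show ?thesis using val_pull[OF s] val_in_K by blast
qed

end

section \<open>The divisor of a function\<close>

context nonsingular_curve begin

definition dv :: "(('k, 'n) pt \<Rightarrow> 'k) \<Rightarrow> ('k, 'n) pt \<Rightarrow>\<^sub>0 int" where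
  "dv f = Abs_poly_mapping (\<lambda>P. if P \<in> C then ord P f else 0)"

lemma lookup_dv: "f \<in> Kx \<Longrightarrow> Poly_Mapping.lookup (dv f) P = (if P \<in> C then ord P f else 0)"
proof -
  assume f: "f \<in> Kx"
  have "{P. (if P \<in> C then ord P f else 0) \<noteq> 0} = {P \<in> C. ord P f \<noteq> 0}" by auto
  then have "finite {P. (if P \<in> C then ord P f else 0) \<noteq> 0}" using finite_support[OF f] by simp
  then show ?thesis unfolding dv_def by (simp add: Abs_poly_mapping_inverse)
qed

lemma keys_dv: "f \<in> Kx \<Longrightarrow> Poly_Mapping.keys (dv f) = {P \<in> C. ord P f \<noteq> 0}"
  by (auto simp: in_keys_iff lookup_dv split: if_splits)

lemma dv_mult: "f \<in> Kx \<Longrightarrow> g \<in> Kx \<Longrightarrow> dv (\<lambda>Q. f Q * g Q) = dv f + dv g"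
  by (rule poly_mapping_eqI) (simp add: lookup_dv lookup_add Kx_mult ord_mult)

lemma dv_inverse: "f \<in> Kx \<Longrightarrow> dv (\<lambda>Q. inverse (f Q)) = - dv f"
  by (rule poly_mapping_eqI) (simp add: lookup_dv Kx_inverse ord_inverse)

lemma dv_cong: "\<forall>\<^sub>F Q in gen. f Q = g Q \<Longrightarrow> dv f = dv g"
  using ord_cong[of f g] by (simp add: dv_def cong: if_cong)

lemma dv_const: "c \<noteq> 0 \<Longrightarrow> dv (\<lambda>_. c) = 0"
  by (rule poly_mapping_eqI) (simp add: lookup_dv Kx_const ord_nonvan nonvan_const)

lemma degree_dv: "f \<in> Kx \<Longrightarrow> divisor_degree (dv f) = 0"
  using degree_zero[of f] by (simp add: divisor_degree_def keys_dv lookup_dv)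

lemma dv_eq_0D: assumes "f \<in> Kx" "dv f = 0" shows "\<exists>c. c \<noteq> 0 \<and> (\<forall>\<^sub>F Q in gen. f Q = c)"
proof (rule constant_if_ord_zero[OF assms(1)])
  fix P assume "P \<in> C"
  then show "ord P f = 0" using lookup_dv[OF assms(1), of P] assms(2) by simp
qed

lemma Prin_carrier: "carrier (Prin C) = dv ` Kx"
proof
  show "carrier (Prin C) \<subseteq> dv ` Kx"
  proof
    fix D assume "D \<in> carrier (Prin C)"
    then obtain a where D: "Poly_Mapping.keys D \<subseteq> C" "a \<in> carrier FF" "a \<noteq> \<zero>\<^bsub>FF\<^esub>"
      "\<And>P. P \<in> C \<Longrightarrow> Poly_Mapping.lookup D P = vanishing_order C P a"
      by (auto simp: Prin_def free_Abelian_group_def)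
    then obtain f where f: "f \<in> K" "a = cls f" by (auto simp: FF_carrier)
    have fK: "f \<in> Kx" using K_nonzero[OF f(1)] cls_zero_iff[OF f(1)] D(3) f(2) by blast
    have "D = dv f"
    proof (rule poly_mapping_eqI)
      fix P
      show "Poly_Mapping.lookup D P = Poly_Mapping.lookup (dv f) P"
        using D(1) D(4)[of P] vanishing_order_eq[OF _ fK] f(2)
        by (auto simp: lookup_dv[OF fK] in_keys_iff)
    qed
    with fK show "D \<in> dv ` Kx" by blast
  qed
  show "dv ` Kx \<subseteq> carrier (Prin C)"
  proof
    fix D assume "D \<in> dv ` Kx"
    then obtain f where f: "f \<in> Kx" "D = dv f" by blast
    have "cls f \<noteq> \<zero>\<^bsub>FF\<^esub>" using cls_zero_iff[OF KxK[OF f(1)]] Kx_ev[OF f(1)] ev_contr by blast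
    moreover have "cls f \<in> carrier FF" using KxK[OF f(1)] by simp
    moreover have "Poly_Mapping.lookup D P = vanishing_order C P (cls f)" if "P \<in> C" for P
      using that f vanishing_order_eq[OF that f(1)] by (simp add: lookup_dv)
    ultimately show "D \<in> carrier (Prin C)"
      using keys_dv[OF f(1)] f(2) by (auto simp: Prin_def free_Abelian_group_def)
  qed
qed

definition degree_zero_divisors :: "(('k, 'n) pt \<Rightarrow>\<^sub>0 int) set" where
  "degree_zero_divisors = {D. Poly_Mapping.keys D \<subseteq> C \<and> divisor_degree D = 0}"

lemma Div0_eq: "Div0 C = add_module degree_zero_divisors"
  by (simp add: Div0_def free_Abelian_group_def add_module_def degree_zero_divisors_def)

lemma Prin_eq: "Prin C = add_module (dv ` Kx)"
proof -
  have "Prin C = (free_Abelian_group C)\<lparr>carrier := carrier (Prin C)\<rparr>" by (simp add: Prin_def)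
  then show ?thesis unfolding Prin_carrier by (simp add: free_Abelian_group_def add_module_def)
qed

end

section \<open>The group action on functions and divisors\<close>

locale curve_action = nonsingular_curve C + faithful_action G C \<phi>
  for C :: "('k::alg_closed_field, 'n::finite) pt set"
    and G :: "('g, 'a) monoid_scheme" (structure)
    and \<phi> :: "'g \<Rightarrow> ('k, 'n) pt \<Rightarrow> ('k, 'n) pt" +
  assumes finite_G: "finite (carrier G)"
    and automorphism: "\<And>g. g \<in> carrier G \<Longrightarrow> variety_automorphism C (\<phi> g)"
begin

lemma group_G: "group G"
  using group_hom group_hom.axioms(1) by blast

interpretation G: group G by (rule group_G)

lemma act_C: "g \<in> carrier G \<Longrightarrow> \<phi> g ` C = C"
  using surj_prop .

lemma act_in_C: "g \<in> carrier G \<Longrightarrow> P \<in> C \<Longrightarrow> \<phi> g P \<in> C"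
  using act_C by blast

lemma act_comp: "g \<in> carrier G \<Longrightarrow> h \<in> carrier G \<Longrightarrow> P \<in> C \<Longrightarrow> \<phi> (g \<otimes> h) P = \<phi> g (\<phi> h P)"
  using composition_rule by blast

lemma act_id: "P \<in> C \<Longrightarrow> \<phi> \<one> P = P"
  using id_eq_one by (metis restrict_apply')

lemma act_inv: "g \<in> carrier G \<Longrightarrow> P \<in> C \<Longrightarrow> \<phi> (inv g) (\<phi> g P) = P"
  using act_comp[of "inv g" g P] act_id by simp

lemma act_inv': "g \<in> carrier G \<Longrightarrow> P \<in> C \<Longrightarrow> \<phi> g (\<phi> (inv g) P) = P"
  using act_comp[of g "inv g" P] act_id by simp

lemma morphism: "g \<in> carrier G \<Longrightarrow> variety_morphism C C (\<phi> g)"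
  using automorphism by (simp add: variety_automorphism_def)

text \<open>The inverse makes this a left action, compatible with the push-forward of divisors: by
  \<open>divisor_action_dv\<close>, g applied to the divisor of f is the divisor of
  \<open>tw g f\<close>.\<close>

definition tw :: "'g \<Rightarrow> (('k, 'n) pt \<Rightarrow> 'k) \<Rightarrow> ('k, 'n) pt \<Rightarrow> 'k" where
  "tw g f = (\<lambda>Q. f (\<phi> (inv g) Q))"

lemma ev_act: "g \<in> carrier G \<Longrightarrow> \<forall>\<^sub>F Q in gen. R Q \<Longrightarrow> \<forall>\<^sub>F Q in gen. R (\<phi> g Q)"
  using eventually_gen_pull[OF _ act_C] morphism by (simp add: variety_morphism_def)

lemma ev_tw: "g \<in> carrier G \<Longrightarrow> \<forall>\<^sub>F Q in gen. R Q \<Longrightarrow> \<forall>\<^sub>F Q in gen. R (\<phi> (inv g) Q)"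
  by (rule ev_act) simp_all

lemma K_tw: "g \<in> carrier G \<Longrightarrow> f \<in> K \<Longrightarrow> tw g f \<in> K"
  unfolding tw_def by (rule K_pull[OF morphism act_C]) (rule G.inv_closed | assumption)+

lemma Kx_tw: assumes "g \<in> carrier G" "f \<in> Kx" shows "tw g f \<in> Kx"
  using K_tw[OF assms(1) KxK[OF assms(2)]] ev_tw[OF assms(1) Kx_ev[OF assms(2)]] by (simp add: Kx_def tw_def)

lemma val_act: "g \<in> carrier G \<Longrightarrow> P \<in> C \<Longrightarrow> val (\<phi> g P) f c \<Longrightarrow> val P (\<lambda>Q. f (\<phi> g Q)) c"
  by (rule val_pull[OF morphism act_C])

text \<open>The equality is generic because the composition rule of the action is available on
  \<open>C\<close> only.\<close>

lemma tw_mult: assumes "g \<in> carrier G" "h \<in> carrier G"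
  shows "\<forall>\<^sub>F Q in gen. tw (g \<otimes> h) f Q = tw g (tw h f) Q"
  using gen_C
proof eventually_elim
  case (elim Q)
  then show ?case using assms act_comp[of "inv h" "inv g" Q] by (simp add: tw_def G.inv_mult_group)
qed

text \<open>A function vanishing at P is carried to g P, divided there by t, and pulled
  back.\<close>

lemma unif_act:
  assumes g: "g \<in> carrier G" and P: "P \<in> C" and t: "unif (\<phi> g P) t"
  shows "unif P (\<lambda>Q. t (\<phi> g Q))"
  unfolding unif_def
proof (intro conjI allI impI)
  show "val P (\<lambda>Q. t (\<phi> g Q)) 0" using t by (intro val_act g P) (simp add: unif_def)
  fix f assume f: "val P f 0"
  have "val (\<phi> g P) (\<lambda>Q. f (\<phi> (inv g) Q)) 0"
    by (rule val_act) (use g P f act_in_C act_inv in simp_all)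
  then obtain u where u: "reg (\<phi> g P) u" "\<forall>\<^sub>F Q in gen. f (\<phi> (inv g) Q) = u Q * t Q"
    using t by (auto simp: unif_def)
  have "reg P (\<lambda>Q. u (\<phi> g Q))" using u(1) val_act[OF g P] by (auto simp: reg_def)
  moreover have "\<forall>\<^sub>F Q in gen. f Q = u (\<phi> g Q) * t (\<phi> g Q)"
    using ev_act[OF g u(2)] gen_C by eventually_elim (simp add: act_inv g)
  ultimately show "\<exists>w. reg P w \<and> (\<forall>\<^sub>F Q in gen. f Q = w Q * t (\<phi> g Q))" by blast
qed

lemma ord_act:
  assumes g: "g \<in> carrier G" and P: "P \<in> C" and f: "f \<in> Kx"
  shows "ord P (\<lambda>Q. f (\<phi> g Q)) = ord (\<phi> g P) f"
proof (rule ord_eqI[OF P])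
  have "has_ord (\<phi> g P) f (ord (\<phi> g P) f)" by (rule has_ord_ord[OF act_in_C[OF g P] f])
  then obtain t u where t: "unif (\<phi> g P) t" and u: "nonvan (\<phi> g P) u"
    and eq: "\<forall>\<^sub>F Q in gen. f Q = u Q * t Q powi ord (\<phi> g P) f"
    by (auto simp: has_ord_def)
  have "nonvan P (\<lambda>Q. u (\<phi> g Q))" using u val_act[OF g P] unfolding nonvan_def by blast
  with unif_act[OF g P t] ev_act[OF g eq]
  show "has_ord P (\<lambda>Q. f (\<phi> g Q)) (ord (\<phi> g P) f)" unfolding has_ord_def by blast
qed

lemma lookup_divisor_action:
  assumes g: "g \<in> carrier G" and D: "Poly_Mapping.keys D \<subseteq> C" and P: "P \<in> C"
  shows "Poly_Mapping.lookup (divisor_action \<phi> g D) (\<phi> g P) = Poly_Mapping.lookup D P"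
proof -
  have "\<phi> g i = \<phi> g P \<longleftrightarrow> i = P" if "i \<in> Poly_Mapping.keys D" for i
    using act_inv[OF g, of i] act_inv[OF g P] that D by (metis subsetD)
  then have "(\<Sum>i\<in>Poly_Mapping.keys D. Poly_Mapping.lookup D i * Poly_Mapping.lookup (frag_of (\<phi> g i)) (\<phi> g P))
      = (\<Sum>i\<in>Poly_Mapping.keys D. if i = P then Poly_Mapping.lookup D i else 0)"
    by (intro sum.cong) (auto simp: lookup_single when_def)
  then show ?thesis
    by (simp add: divisor_action_def frag_extend_def lookup_sum sum.delta in_keys_iff)
qed

lemma keys_divisor_action:
  assumes g: "g \<in> carrier G" and D: "Poly_Mapping.keys D \<subseteq> C"
  shows "Poly_Mapping.keys (divisor_action \<phi> g D) \<subseteq> \<phi> g ` Poly_Mapping.keys D"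
  using keys_frag_extend[of "\<lambda>P. frag_of (\<phi> g P)" D] by (auto simp: divisor_action_def keys_frag_of)

lemma keys_divisor_action_C:
  assumes g: "g \<in> carrier G" and D: "Poly_Mapping.keys D \<subseteq> C"
  shows "Poly_Mapping.keys (divisor_action \<phi> g D) \<subseteq> C"
  using keys_divisor_action[OF assms] act_in_C[OF g] D by blast

lemma lookup_divisor_action':
  assumes g: "g \<in> carrier G" and D: "Poly_Mapping.keys D \<subseteq> C"
  shows "Poly_Mapping.lookup (divisor_action \<phi> g D) Q = (if Q \<in> C then Poly_Mapping.lookup D (\<phi> (inv g) Q) else 0)"
proof (cases "Q \<in> C")
  case True
  then show ?thesis
    using lookup_divisor_action[OF g D, of "\<phi> (inv g) Q"] act_inv'[OF g True] act_in_C[of "inv g" Q] g by simp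
next
  case False
  then show ?thesis using keys_divisor_action_C[OF g D] by (auto simp: in_keys_iff)
qed

lemma degree_divisor_action:
  assumes g: "g \<in> carrier G" and D: "Poly_Mapping.keys D \<subseteq> C"
  shows "divisor_degree (divisor_action \<phi> g D) = divisor_degree D"
proof -
  have inj: "inj_on (\<phi> g) (Poly_Mapping.keys D)"
    using act_inv[OF g] D by (metis (no_types, lifting) inj_onI subsetD)
  have "divisor_degree (divisor_action \<phi> g D) = (\<Sum>Q\<in>\<phi> g ` Poly_Mapping.keys D. Poly_Mapping.lookup (divisor_action \<phi> g D) Q)"
    by (rule divisor_degree_superset) (simp_all add: keys_divisor_action[OF g D])
  also have "\<dots> = (\<Sum>P\<in>Poly_Mapping.keys D. Poly_Mapping.lookup (divisor_action \<phi> g D) (\<phi> g P))"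
    by (simp add: sum.reindex[OF inj])
  also have "\<dots> = divisor_degree D"
    unfolding divisor_degree_def using D by (intro sum.cong) (auto simp: lookup_divisor_action[OF g D])
  finally show ?thesis .
qed

lemma divisor_action_dv:
  assumes g: "g \<in> carrier G" and f: "f \<in> Kx"
  shows "divisor_action \<phi> g (dv f) = dv (tw g f)"
proof (rule poly_mapping_eqI)
  fix Q
  have k: "Poly_Mapping.keys (dv f) \<subseteq> C" using keys_dv[OF f] by blast
  show "Poly_Mapping.lookup (divisor_action \<phi> g (dv f)) Q = Poly_Mapping.lookup (dv (tw g f)) Q"
    unfolding lookup_divisor_action'[OF g k] lookup_dv[OF f] lookup_dv[OF Kx_tw[OF g f]]
    using ord_act[of "inv g" Q f] act_in_C[of "inv g" Q] g f by (simp add: tw_def)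
qed

lemma divisor_module: "add_G_module G degree_zero_divisors (divisor_action \<phi>)"
proof unfold_locales
  show "0 \<in> degree_zero_divisors" by (simp add: degree_zero_divisors_def divisor_degree_def)
  fix D assume D: "D \<in> degree_zero_divisors"
  then have Dk: "Poly_Mapping.keys D \<subseteq> C" by (simp add: degree_zero_divisors_def)
  show "- D \<in> degree_zero_divisors"
    using D by (simp add: degree_zero_divisors_def divisor_degree_uminus)
  show "divisor_action \<phi> \<one> D = D"
  proof (rule poly_mapping_eqI)
    show "Poly_Mapping.lookup (divisor_action \<phi> \<one> D) Q = Poly_Mapping.lookup D Q" for Q
      unfolding lookup_divisor_action'[OF G.one_closed Dk] using Dk act_id[of Q]
      by (auto simp: in_keys_iff)
  qed
  fix g assume g: "g \<in> carrier G"
  show "divisor_action \<phi> g D \<in> degree_zero_divisors"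
    using keys_divisor_action_C[OF g Dk] degree_divisor_action[OF g Dk] D by (simp add: degree_zero_divisors_def)
  show "divisor_action \<phi> (g \<otimes> h) D = divisor_action \<phi> g (divisor_action \<phi> h D)" if h: "h \<in> carrier G" for h
  proof (rule poly_mapping_eqI)
    fix Q
    show "Poly_Mapping.lookup (divisor_action \<phi> (g \<otimes> h) D) Q = Poly_Mapping.lookup (divisor_action \<phi> g (divisor_action \<phi> h D)) Q"
      unfolding lookup_divisor_action'[OF G.m_closed[OF g h] Dk] lookup_divisor_action'[OF g keys_divisor_action_C[OF h Dk]]
        lookup_divisor_action'[OF h Dk]
      using act_comp[of "inv h" "inv g" Q] act_in_C[of "inv g" Q] g h by (simp add: G.inv_mult_group)
  qed
  fix E assume E: "E \<in> degree_zero_divisors"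
  show "divisor_action \<phi> g (D + E) = divisor_action \<phi> g D + divisor_action \<phi> g E"
    by (simp add: divisor_action_def frag_extend_add)
next
  fix D E assume "D \<in> degree_zero_divisors" "E \<in> degree_zero_divisors"
  then show "D + E \<in> degree_zero_divisors"
    using Poly_Mapping.keys_add[of D E] by (auto simp: degree_zero_divisors_def divisor_degree_add)
qed

lemma dv_subset: "dv ` Kx \<subseteq> degree_zero_divisors"
  using keys_dv degree_dv by (auto simp: degree_zero_divisors_def)

lemma principal_module: "add_G_module G (dv ` Kx) (divisor_action \<phi>)"
proof -
  interpret A: add_G_module G degree_zero_divisors "divisor_action \<phi>" by (rule divisor_module)
  show ?thesis
  proof unfold_locales
    show "0 \<in> dv ` Kx" using dv_const[of 1] Kx_const[of 1] by force
    fix D assume "D \<in> dv ` Kx"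
    then obtain f where f: "f \<in> Kx" "D = dv f" by blast
    show "- D \<in> dv ` Kx" using dv_inverse[OF f(1)] Kx_inverse[OF f(1)] f(2) by force
    show "divisor_action \<phi> \<one> D = D" using A.act_one f dv_subset by blast
    { fix g assume g: "g \<in> carrier G"
      show "divisor_action \<phi> g D \<in> dv ` Kx" using divisor_action_dv[OF g f(1)] Kx_tw[OF g f(1)] f(2) by blast
      show "divisor_action \<phi> (g \<otimes> h) D = divisor_action \<phi> g (divisor_action \<phi> h D)" if "h \<in> carrier G" for h
        using A.act_mult[OF g that] f dv_subset by blast
      show "divisor_action \<phi> g (D + E) = divisor_action \<phi> g D + divisor_action \<phi> g E" for E
        by (simp add: divisor_action_def frag_extend_add) }
    fix E assume "E \<in> dv ` Kx"
    then obtain h where h: "h \<in> Kx" "E = dv h" by blast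
    show "D + E \<in> dv ` Kx" using dv_mult[OF f(1) h(1)] Kx_mult[OF f(1) h(1)] f(2) h(2) by force
  qed
qed

lemma module_pair: "G_submodule G degree_zero_divisors (dv ` Kx) (divisor_action \<phi>)"
  using divisor_module principal_module dv_subset by (simp add: G_submodule_def G_submodule_axioms_def)

text \<open>By faithfulness, g and the identity act by distinct maps; both are extensional on
  \<open>C\<close>, so g moves some P in \<open>C\<close>. If f separates g P from P, then the
  pullback of f minus f is nonzero at P, hence generically nonzero, whereas it vanishes at every
  fixed point of g.\<close>

lemma moves_generic_point:
  assumes g: "g \<in> carrier G" "g \<noteq> \<one>"
  shows "\<forall>\<^sub>F Q in gen. \<phi> g Q \<noteq> Q"
proof -
  have "\<phi> g \<noteq> \<phi> \<one>" using faithful g by (auto simp: inj_on_def)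
  moreover have "\<phi> g \<in> extensional C" "\<phi> \<one> \<in> extensional C"
    using group_hom.hom_closed[OF group_hom, of g] group_hom.hom_closed[OF group_hom, of \<one>] g
    by (simp_all add: BijGroup_def Bij_def)
  ultimately obtain P where P: "P \<in> C" "\<phi> g P \<noteq> P"
    using act_id by (metis extensionalityI)
  obtain f c where f: "val (\<phi> g P) f c" "c \<noteq> 0" "val P f 0"
    using separating_function[OF act_in_C[OF g(1) P(1)] P(1,2), of "{}"] by auto
  have "val P (\<lambda>Q. f (\<phi> g Q) + (- 1) * f Q) (c + (- 1) * 0)"
    by (intro val_plus val_times val_consts val_act g f P)
  then have "nonvan P (\<lambda>Q. f (\<phi> g Q) + (- 1) * f Q)" using f(2) by (auto simp: nonvan_def)
  from Kx_ev[OF nonvan_Kx[OF P(1) this]] show ?thesis by eventually_elim auto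
qed

text \<open>For \<open>x\<close> nonzero at a general point \<open>Q\<close> and zero at the other points of its orbit, the twisted
  trace of \<open>x\<close> does not vanish at \<open>Q\<close>.\<close>
lemma hilbert_90:
  assumes b: "\<And>g. g \<in> carrier G \<Longrightarrow> b g \<in> Kx"
    and cocycle: "\<And>g h. g \<in> carrier G \<Longrightarrow> h \<in> carrier G \<Longrightarrow> \<forall>\<^sub>F Q in gen. b g Q * tw g (b h) Q = b (g \<otimes> h) Q"
  shows "\<exists>w\<in>Kx. \<forall>g\<in>carrier G. \<forall>\<^sub>F Q in gen. b g Q * tw g w Q = w Q"
proof -
  have "\<forall>\<^sub>F Q in gen. \<forall>g\<in>carrier G. val Q (b g) (b g Q) \<and> (g \<noteq> \<one> \<longrightarrow> \<phi> (inv g) Q \<noteq> Q)"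
  proof (intro eventually_ball_finite finite_G ballI)
    fix g assume g: "g \<in> carrier G"
    have 1: "\<forall>\<^sub>F Q in gen. g \<noteq> \<one> \<longrightarrow> \<phi> (inv g) Q \<noteq> Q"
    proof (cases "g = \<one>")
      case False
      then have "inv g \<noteq> \<one>" using g by simp
      from moves_generic_point[OF G.inv_closed[OF g] this] show ?thesis by eventually_elim simp
    qed simp
    from K_generic_val[OF KxK[OF b[OF g]]] 1
    show "\<forall>\<^sub>F Q in gen. val Q (b g) (b g Q) \<and> (g \<noteq> \<one> \<longrightarrow> \<phi> (inv g) Q \<noteq> Q)" by eventually_elim blast
  qed
  then have "\<forall>\<^sub>F Q in gen. Q \<in> C \<and> b \<one> Q \<noteq> 0 \<and>
      (\<forall>g\<in>carrier G. val Q (b g) (b g Q) \<and> (g \<noteq> \<one> \<longrightarrow> \<phi> (inv g) Q \<noteq> Q))"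
    using gen_C Kx_ev[OF b[OF G.one_closed]] by eventually_elim blast
  \<comment> \<open>A general point: all \<open>b g\<close> are regular there with their actual
    values, \<open>b \<one>\<close> does not vanish, and the stabilizer is trivial. Finiteness of
    the group lets finitely many generic conditions be combined.\<close>
  from eventually_happens'[OF gen_not_bot this]
  obtain Q where Q: "Q \<in> C" "b \<one> Q \<noteq> 0" "\<And>g. g \<in> carrier G \<Longrightarrow> val Q (b g) (b g Q)"
    "\<And>g. g \<in> carrier G \<Longrightarrow> g \<noteq> \<one> \<Longrightarrow> \<phi> (inv g) Q \<noteq> Q"
    by blast
  let ?S = "(\<lambda>g. \<phi> (inv g) Q) ` carrier G"
  have S: "finite ?S" "?S \<subseteq> C" using finite_G act_in_C Q(1) by auto
  obtain x where x: "nonvan Q x" "\<forall>A\<in>?S - {Q}. vge A x (int 1)"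
    using weak_approximation[OF Q(1) S, of 1] by blast
  then obtain c where c: "c \<noteq> 0" "val Q x c" by (auto simp: nonvan_def)
  have xK: "x \<in> K" using c val_in_K by blast
  \<comment> \<open>The twisted trace of x. At Q only the summand for the identity survives, with
    the value of \<open>b \<one>\<close> times that of x.\<close>
  define w where "w = (\<lambda>R. \<Sum>h\<in>carrier G. b h R * tw h x R)"
  have tw_val: "val Q (tw h x) (if h = \<one> then c else 0)" if h: "h \<in> carrier G" for h
  proof -
    have "val (\<phi> (inv h) Q) x (if h = \<one> then c else 0)"
    proof (cases "h = \<one>")
      case True
      then show ?thesis using c act_id[OF Q(1)] by simp
    next
      case False
      then have "\<phi> (inv h) Q \<in> ?S - {Q}" using Q(4)[OF h] h by blast
      with x(2) have "vge (\<phi> (inv h) Q) x 1" by simp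
      then show ?thesis using False act_in_C[of "inv h" Q] h Q(1) by (simp add: vge_1_iff)
    qed
    then show ?thesis unfolding tw_def using h Q(1) by (intro val_act) simp_all
  qed
  have "val Q w (\<Sum>h\<in>carrier G. b h Q * (if h = \<one> then c else 0))"
    unfolding w_def by (intro val_sum Q(1) val_times Q(3) tw_val)
  also have "(\<Sum>h\<in>carrier G. b h Q * (if h = \<one> then c else 0)) = b \<one> Q * c"
    using finite_G by (simp add: if_distrib[of "\<lambda>y. _ * y"] sum.delta cong: if_cong)
  finally have "nonvan Q w" unfolding nonvan_def using Q(2) c(1) by (intro exI[of _ "b \<one> Q * c"]) simp
  then have wK: "w \<in> Kx" by (rule nonvan_Kx[OF Q(1)])
  moreover have "\<forall>\<^sub>F R in gen. b g R * tw g w R = w R" if g: "g \<in> carrier G" for g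
  proof -
    have "\<forall>\<^sub>F R in gen. \<forall>h\<in>carrier G. b g R * tw g (b h) R = b (g \<otimes> h) R \<and> tw (g \<otimes> h) x R = tw g (tw h x) R"
      using cocycle[OF g] tw_mult[OF g] by (intro eventually_ball_finite finite_G ballI eventually_conj) auto
    then show ?thesis
    proof eventually_elim
      case (elim R)
      \<comment> \<open>The twist is applied termwise; by the cocycle rule the h-th summand becomes
        the one for the product of g and h, and multiplication by g permutes the group.\<close>
      have "b g R * tw g w R = (\<Sum>h\<in>carrier G. b g R * (tw g (b h) R * tw g (tw h x) R))"
        by (simp add: tw_def w_def sum_distrib_left)
      also have "\<dots> = (\<Sum>h\<in>carrier G. b (g \<otimes> h) R * tw (g \<otimes> h) x R)"
        by (rule sum.cong) (use elim in \<open>auto simp flip: mult.assoc\<close>)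
      also have "\<dots> = (\<Sum>h\<in>carrier G. b h R * tw h x R)"
        by (rule sum.reindex_bij_witness[of _ "\<lambda>h. inv g \<otimes> h" "\<lambda>h. g \<otimes> h"])
           (use g in \<open>auto simp flip: G.m_assoc\<close>)
      finally show ?case by (simp add: w_def)
    qed
  qed
  ultimately show ?thesis by blast
qed

end

section \<open>Invariant divisor classes\<close>

lemma multiplicative_group_simps [simp]:
  "carrier (multiplicative_group :: 'k::field monoid) = UNIV - {0}"
  "x \<otimes>\<^bsub>multiplicative_group\<^esub> y = (x * y :: 'k)" "\<one>\<^bsub>multiplicative_group\<^esub> = (1 :: 'k)"
  by (simp_all add: multiplicative_group_def)

lemma comm_group_multiplicative_group: "comm_group (multiplicative_group :: 'k::field monoid)"
proof (rule comm_groupI)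
  fix x :: 'k assume "x \<in> carrier multiplicative_group"
  then show "\<exists>y\<in>carrier multiplicative_group. y \<otimes>\<^bsub>multiplicative_group\<^esub> x = \<one>\<^bsub>multiplicative_group\<^esub>"
    by (intro bexI[of _ "inverse x"]) auto
qed auto

lemma inv_multiplicative_group: "x \<noteq> 0 \<Longrightarrow> inv\<^bsub>multiplicative_group\<^esub> x = inverse (x :: 'k::field)"
  using group.inv_equality[OF comm_group.axioms(2)[OF comm_group_multiplicative_group], of "inverse x" x] by simp

section \<open>From a 2-cocycle of constants to an invariant divisor\<close>

text \<open>In a trivial cohomology group the only coset is the set of coboundaries. It is thus the
  coset of the cochain attached to \<zeta>, and contains this cochain because 1 is a coboundary. A
  1-cochain with that coboundary gives \<xi>; with constants acted on trivially, the equation is an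
  identity of products.\<close>

lemma trivial_H2_splits:
  fixes G :: "('g, 'a) monoid_scheme" (structure) and \<zeta> :: "'g \<Rightarrow> 'g \<Rightarrow> 'k::field"
  assumes G: "group G"
    and triv: "trivial_group (cohomology G (multiplicative_group :: 'k monoid) (\<lambda>g c. c) 2)"
    and nz: "\<And>g h. g \<in> carrier G \<Longrightarrow> h \<in> carrier G \<Longrightarrow> \<zeta> g h \<noteq> 0"
    and cocycle: "\<And>g h k. g \<in> carrier G \<Longrightarrow> h \<in> carrier G \<Longrightarrow> k \<in> carrier G \<Longrightarrow>
      \<zeta> g h * \<zeta> (g \<otimes> h) k = \<zeta> h k * \<zeta> g (h \<otimes> k)"
  obtains \<xi> where "\<And>g. g \<in> carrier G \<Longrightarrow> \<xi> g \<noteq> 0"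
    "\<And>g h. g \<in> carrier G \<Longrightarrow> h \<in> carrier G \<Longrightarrow> \<zeta> g h * \<xi> (g \<otimes> h) = \<xi> g * \<xi> h"
proof -
  interpret G: group G by (rule G)
  define M where "M = (multiplicative_group :: 'k monoid)"
  let ?t = "\<lambda>(g :: 'g) (c :: 'k). c"
  have M: "comm_group M" and closed: "\<And>g x. g \<in> carrier G \<Longrightarrow> x \<in> carrier M \<Longrightarrow> ?t g x \<in> carrier M"
    by (simp_all add: M_def comm_group_multiplicative_group)
  define z where "z = (\<lambda>xs\<in>tuples G 2. \<zeta> (xs ! 0) (xs ! 1))"
  have z_app: "z [g, h] = \<zeta> g h" if "g \<in> carrier G" "h \<in> carrier G" for g h
    using that by (simp add: z_def tuples_2 numeral_2_eq_2)
  have zC: "z \<in> carrier (cochains G M 2)"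
    using nz by (auto simp: cochains_def M_def z_def tuples_2 numeral_2_eq_2)
  have d2: "coboundary_map G M ?t 2 z xs = 1" if xs: "xs \<in> tuples G 3" for xs
  proof -
    obtain g h k where xs: "g \<in> carrier G" "h \<in> carrier G" "k \<in> carrier G" "xs = [g, h, k]"
      using xs by (auto simp: tuples_3 numeral_3_eq_3)
    have nz': "\<zeta> h k \<noteq> 0" "\<zeta> (g \<otimes> h) k \<noteq> 0" "\<zeta> g (h \<otimes> k) \<noteq> 0" "\<zeta> g h \<noteq> 0" using nz xs by auto
    have "coboundary_map G M ?t 2 z [g, h, k] =
        \<zeta> h k * (inverse (\<zeta> (g \<otimes> h) k) * \<zeta> g (h \<otimes> k)) * inverse (\<zeta> g h)"
      using coboundary_map_2[OF G M closed zC xs(1-3)] xs(1-3) nz'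
      by (simp add: z_app M_def inv_multiplicative_group)
    also have "\<dots> = (\<zeta> h k * \<zeta> g (h \<otimes> k)) * inverse (\<zeta> g h * \<zeta> (g \<otimes> h) k)"
      using nz' by (simp add: field_simps)
    also have "\<dots> = 1" unfolding cocycle[OF xs(1-3)] by (rule right_inverse) (use nz' in simp)
    finally show ?thesis using xs(4) by simp
  qed
  have z_ext: "coboundary_map G M ?t 2 z = \<one>\<^bsub>cochains G M (Suc 2)\<^esub>"
  proof
    fix xs
    show "coboundary_map G M ?t 2 z xs = \<one>\<^bsub>cochains G M (Suc 2)\<^esub> xs"
    proof (cases "xs \<in> tuples G (Suc 2)")
      case True
      then show ?thesis using d2[of xs] by (simp add: cochains_def M_def numeral_3_eq_3 numeral_2_eq_2)
    next
      case False
      then show ?thesis by (simp add: cochains_def coboundary_map_def)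
    qed
  qed
  let ?Z = "cocycles G M ?t 2" and ?B = "coboundaries G M ?t 2"
  have zZ: "z \<in> carrier ?Z" using zC z_ext by (simp add: cocycles_def kernel_def)
  have B_eq: "?B = coboundary_map G M ?t 1 ` carrier (cochains G M 1)"
    by (simp add: coboundaries_def numeral_2_eq_2)
  have "\<one>\<^bsub>?Z\<^esub> \<in> ?B"
  proof -
    have 1: "\<one>\<^bsub>cochains G M 1\<^esub> \<in> carrier (cochains G M 1)" by (simp add: cochains_def M_def)
    have "coboundary_map G M ?t 1 \<one>\<^bsub>cochains G M 1\<^esub> = \<one>\<^bsub>?Z\<^esub>"
    proof
      fix xs
      show "coboundary_map G M ?t 1 \<one>\<^bsub>cochains G M 1\<^esub> xs = \<one>\<^bsub>?Z\<^esub> xs"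
      proof (cases "xs \<in> tuples G (Suc (Suc 0))")
        case True
        then obtain g h where gh: "g \<in> carrier G" "h \<in> carrier G" "xs = [g, h]" by (auto simp: tuples_2)
        then show ?thesis
          using coboundary_map_1[OF G M closed 1[unfolded One_nat_def] gh(1,2)]
          by (simp add: cocycles_def cochains_def M_def tuples_1 tuples_2 numeral_2_eq_2 inv_multiplicative_group)
      next
        case False
        then show ?thesis by (simp add: cocycles_def cochains_def coboundary_map_def numeral_2_eq_2)
      qed
    qed
    with 1 show ?thesis unfolding B_eq by (metis imageI)
  qed
  moreover have "\<one>\<^bsub>?Z\<^esub> \<otimes>\<^bsub>?Z\<^esub> z = z"
    by (auto simp: cocycles_def cochains_def M_def z_def fun_eq_iff)
  ultimately have "z \<in> ?B #>\<^bsub>?Z\<^esub> z" unfolding r_coset_def by force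
  moreover have "?B #>\<^bsub>?Z\<^esub> z \<in> carrier (cohomology G M ?t 2)"
    using zZ by (auto simp: cohomology_def carrier_FactGroup)
  then have "?B #>\<^bsub>?Z\<^esub> z = ?B"
    using triv unfolding M_def[symmetric] by (simp add: trivial_group_def cohomology_def)
  ultimately have "z \<in> ?B" by simp
  then obtain f where f: "f \<in> carrier (cochains G M 1)" "z = coboundary_map G M ?t 1 f" unfolding B_eq by blast
  have f0: "f [g] \<noteq> 0" if "g \<in> carrier G" for g
    using f(1) that by (auto simp: cochains_def M_def tuples_1)
  show ?thesis
  proof (rule that[of "\<lambda>g. f [g]"])
    show "f [g] \<noteq> 0" if "g \<in> carrier G" for g using f0 that .
    fix g h assume g: "g \<in> carrier G" "h \<in> carrier G"
    have "\<zeta> g h = f [h] * inverse (f [g \<otimes> h]) * f [g]"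
      using coboundary_map_1[OF G M closed f(1)[unfolded One_nat_def] g] z_app[OF g] f(2) g f0[OF G.m_closed[OF g]]
      by (simp add: M_def inv_multiplicative_group)
    then show "\<zeta> g h * f [g \<otimes> h] = f [g] * f [h]" using f0[OF G.m_closed[OF g]] by simp
  qed
qed

context curve_action begin

interpretation G: group G by (rule group_G)
interpretation P: G_submodule G degree_zero_divisors "dv ` Kx" "divisor_action \<phi>" by (rule module_pair)

lemma Pic0_eq: "Pic0 C = P.QuotM"
  by (simp add: Pic0_def Div0_eq Prin_carrier)

lemma class_action_eq: "class_action \<phi> = (\<lambda>g c. divisor_action \<phi> g ` c)"
  by (simp add: fun_eq_iff class_action_def)

lemma divisor_class_eq: "divisor_class C = (\<lambda>D. dv ` Kx #>\<^bsub>add_module degree_zero_divisors\<^esub> D)"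
  by (simp add: fun_eq_iff divisor_class_def Div0_eq Prin_carrier)

lemma class_group_iso_kernel:
  "(invariants G (Pic0 C) (class_action \<phi>) Mod
      (divisor_class C ` carrier (invariants G (Div0 C) (divisor_action \<phi>))))
   \<cong> (cohomology G (Prin C) (divisor_action \<phi>) 1)
        \<lparr>carrier := kernel (cohomology G (Prin C) (divisor_action \<phi>) 1)
                     (cohomology G (Div0 C) (divisor_action \<phi>) 1)
                     (cohomology_map G (Div0 C) (divisor_action \<phi>) 1 (\<lambda>D. D))\<rparr>"
  using P.Inv_Mod_iso_Ker
  unfolding Pic0_eq class_action_eq divisor_class_eq Div0_eq Prin_eq One_nat_def .

lemma ev_const_eq: "\<forall>\<^sub>F Q in gen. (c :: 'k) = d \<Longrightarrow> c = d"
  using gen_not_bot by (simp add: eventually_const)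

lemma invariant_class_representative:
  assumes triv: "trivial_group (cohomology G (multiplicative_group :: 'k monoid) (\<lambda>g c. c) 2)"
    and c: "c \<in> carrier (invariants G (Pic0 C) (class_action \<phi>))"
  shows "\<exists>D\<in>carrier (invariants G (Div0 C) (divisor_action \<phi>)). D \<in> c"
proof -
  obtain D where D: "D \<in> P.lifts" "c = dv ` Kx #>\<^bsub>add_module degree_zero_divisors\<^esub> D"
    using c P.Inv_carrier unfolding Pic0_eq class_action_eq by blast
  have DA: "D \<in> degree_zero_divisors" using P.liftsD[OF D(1)] .
  have "\<forall>g\<in>carrier G. \<exists>a. a \<in> Kx \<and> divisor_action \<phi> g D - D = dv a"
  proof
    fix g assume "g \<in> carrier G"
    then have "divisor_action \<phi> g D - D \<in> dv ` Kx" using D(1) by (simp add: P.lifts_def)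
    then show "\<exists>a. a \<in> Kx \<and> divisor_action \<phi> g D - D = dv a" by blast
  qed
  from bchoice[OF this] obtain a where "\<forall>g\<in>carrier G. a g \<in> Kx \<and> divisor_action \<phi> g D - D = dv (a g)" ..
  then have a: "a g \<in> Kx" "divisor_action \<phi> g D - D = dv (a g)" if "g \<in> carrier G" for g
    using that by simp_all
  \<comment> \<open>The divisor of the quotient telescopes: (gD - D) + (ghD - gD) - (ghD - D) =
    0.\<close>
  have const: "\<exists>e. e \<noteq> 0 \<and> (\<forall>\<^sub>F Q in gen. a g Q * tw g (a h) Q = e * a (g \<otimes> h) Q)"
    if g: "g \<in> carrier G" and h: "h \<in> carrier G" for g h
  proof -
    let ?f = "\<lambda>Q. a g Q * tw g (a h) Q * inverse (a (g \<otimes> h) Q)"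
    have gh: "g \<otimes> h \<in> carrier G" using g h by simp
    have K1: "tw g (a h) \<in> Kx" by (rule Kx_tw[OF g a(1)[OF h]])
    have K2: "(\<lambda>Q. a g Q * tw g (a h) Q) \<in> Kx" by (rule Kx_mult[OF a(1)[OF g] K1])
    have K3: "(\<lambda>Q. inverse (a (g \<otimes> h) Q)) \<in> Kx" by (rule Kx_inverse[OF a(1)[OF gh]])
    have "dv ?f = dv (a g) + dv (tw g (a h)) - dv (a (g \<otimes> h))"
      by (simp add: dv_mult[OF K2 K3] dv_mult[OF a(1)[OF g] K1] dv_inverse[OF a(1)[OF gh]])
    also have "dv (tw g (a h)) = divisor_action \<phi> g (divisor_action \<phi> h D - D)"
      using divisor_action_dv[OF g a(1)[OF h]] a(2)[OF h] by simp
    also have "\<dots> = divisor_action \<phi> (g \<otimes> h) D - divisor_action \<phi> g D"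
      using P.A.act_diff[OF g P.A.act_mem[OF h DA] DA] P.A.act_mult[OF g h DA] by simp
    also have "dv (a g) + (divisor_action \<phi> (g \<otimes> h) D - divisor_action \<phi> g D) - dv (a (g \<otimes> h)) = 0"
      by (simp flip: a(2)[OF g] a(2)[OF gh])
    finally obtain e where e: "e \<noteq> 0" "\<forall>\<^sub>F Q in gen. ?f Q = e" using dv_eq_0D[OF Kx_mult[OF K2 K3]] by blast
    have "\<forall>\<^sub>F Q in gen. a g Q * tw g (a h) Q = e * a (g \<otimes> h) Q"
      using e(2) Kx_ev[OF a(1)[OF gh]] by eventually_elim (auto simp: field_simps)
    with e(1) show ?thesis by blast
  qed
  have "\<forall>p\<in>carrier G \<times> carrier G. \<exists>e. e \<noteq> 0 \<and>
      (\<forall>\<^sub>F Q in gen. a (fst p) Q * tw (fst p) (a (snd p)) Q = e * a (fst p \<otimes> snd p) Q)"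
  proof
    fix p assume "p \<in> carrier G \<times> carrier G"
    then have "fst p \<in> carrier G" "snd p \<in> carrier G" by (simp_all add: mem_Times_iff)
    then show "\<exists>e. e \<noteq> 0 \<and> (\<forall>\<^sub>F Q in gen. a (fst p) Q * tw (fst p) (a (snd p)) Q = e * a (fst p \<otimes> snd p) Q)"
      by (rule const)
  qed
  from bchoice[OF this] obtain \<zeta>' where \<zeta>': "\<forall>p\<in>carrier G \<times> carrier G. \<zeta>' p \<noteq> 0 \<and>
      (\<forall>\<^sub>F Q in gen. a (fst p) Q * tw (fst p) (a (snd p)) Q = \<zeta>' p * a (fst p \<otimes> snd p) Q)" ..
  define \<zeta> where "\<zeta> = (\<lambda>g h. \<zeta>' (g, h))"
  have \<zeta>0: "\<zeta> g h \<noteq> 0" if "g \<in> carrier G" "h \<in> carrier G" for g h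
    using bspec[OF \<zeta>', of "(g, h)"] that by (simp add: \<zeta>_def)
  have \<zeta>: "\<forall>\<^sub>F Q in gen. a g Q * tw g (a h) Q = \<zeta> g h * a (g \<otimes> h) Q" if "g \<in> carrier G" "h \<in> carrier G" for g h
    using bspec[OF \<zeta>', of "(g, h)"] that by (simp add: \<zeta>_def)
  \<comment> \<open>The triple product of \<open>a g\<close>, \<open>tw g (a h)\<close> and
    \<open>tw (g \<otimes> h) (a k)\<close> is grouped from the left and from the right; the two
    constants in front of the same nonzero function must agree.\<close>
  have cocycle: "\<zeta> g h * \<zeta> (g \<otimes> h) k = \<zeta> h k * \<zeta> g (h \<otimes> k)"
    if g: "g \<in> carrier G" and h: "h \<in> carrier G" and k: "k \<in> carrier G" for g h k
  proof (rule ev_const_eq)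
    have gh: "g \<otimes> h \<in> carrier G" and hk: "h \<otimes> k \<in> carrier G" and ghk: "g \<otimes> h \<otimes> k \<in> carrier G"
      using g h k by simp_all
    \<comment> \<open>The relation for h and k is composed with the inverse of g; the constant
      \<open>\<zeta> h k\<close> is unaffected by this.\<close>
    have tw_hk: "\<forall>\<^sub>F Q in gen. tw g (a h) Q * tw g (tw h (a k)) Q = \<zeta> h k * tw g (a (h \<otimes> k)) Q"
      using ev_tw[OF g \<zeta>[OF h k]] by (simp add: tw_def)
    show "\<forall>\<^sub>F Q in gen. \<zeta> g h * \<zeta> (g \<otimes> h) k = \<zeta> h k * \<zeta> g (h \<otimes> k)"
      using \<zeta>[OF g h] \<zeta>[OF gh k] \<zeta>[OF g hk] tw_hk tw_mult[OF g h, of "a k"] Kx_ev[OF a(1)[OF ghk]]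
    proof eventually_elim
      case (elim Q)
      have "\<zeta> g h * \<zeta> (g \<otimes> h) k * a (g \<otimes> h \<otimes> k) Q = \<zeta> g h * (a (g \<otimes> h) Q * tw (g \<otimes> h) (a k) Q)"
        using elim(2) by (simp add: mult_ac)
      also have "\<dots> = a g Q * tw g (a h) Q * tw (g \<otimes> h) (a k) Q" using elim(1) by (simp add: mult_ac)
      also have "\<dots> = a g Q * (tw g (a h) Q * tw g (tw h (a k)) Q)" using elim(5) by (simp add: mult_ac)
      also have "\<dots> = \<zeta> h k * (a g Q * tw g (a (h \<otimes> k)) Q)" unfolding elim(4) by (simp add: mult_ac)
      also have "\<dots> = \<zeta> h k * \<zeta> g (h \<otimes> k) * a (g \<otimes> h \<otimes> k) Q"
        unfolding elim(3) using g h k by (simp add: G.m_assoc)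
      finally show ?case using elim(6) by simp
    qed
  qed
  obtain \<xi> where \<xi>: "\<And>g. g \<in> carrier G \<Longrightarrow> \<xi> g \<noteq> 0"
    "\<And>g h. g \<in> carrier G \<Longrightarrow> h \<in> carrier G \<Longrightarrow> \<zeta> g h * \<xi> (g \<otimes> h) = \<xi> g * \<xi> h"
    using trivial_H2_splits[OF group_G triv \<zeta>0 cocycle] by blast
  \<comment> \<open>Dividing by \<xi> removes the factor \<zeta> and leaves the divisors
    unchanged.\<close>
  define b where "b = (\<lambda>g Q. inverse (\<xi> g) * a g Q)"
  have inv\<xi>: "(\<lambda>_. inverse (\<xi> g)) \<in> Kx" if "g \<in> carrier G" for g
    using \<xi>(1)[OF that] by (intro Kx_const) simp
  have bK: "b g \<in> Kx" if g: "g \<in> carrier G" for g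
    unfolding b_def by (rule Kx_mult[OF inv\<xi>[OF g] a(1)[OF g]])
  have dvb: "dv (b g) = divisor_action \<phi> g D - D" if g: "g \<in> carrier G" for g
    unfolding b_def using dv_mult[OF inv\<xi>[OF g] a(1)[OF g]] dv_const[of "inverse (\<xi> g)"] \<xi>(1)[OF g] a(2)[OF g] by simp
  have "\<exists>w\<in>Kx. \<forall>g\<in>carrier G. \<forall>\<^sub>F Q in gen. b g Q * tw g w Q = w Q"
  proof (rule hilbert_90[OF bK])
    fix g h assume g: "g \<in> carrier G" and h: "h \<in> carrier G"
    have nz: "\<xi> g \<noteq> 0" "\<xi> h \<noteq> 0" "\<xi> (g \<otimes> h) \<noteq> 0" using \<xi>(1) g h by simp_all
    show "\<forall>\<^sub>F Q in gen. b g Q * tw g (b h) Q = b (g \<otimes> h) Q"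
      using \<zeta>[OF g h]
    proof eventually_elim
      case (elim Q)
      have "b g Q * tw g (b h) Q = (a g Q * tw g (a h) Q) / (\<xi> g * \<xi> h)"
        by (simp add: b_def tw_def field_simps)
      also have "\<dots> = (\<zeta> g h * a (g \<otimes> h) Q) / (\<zeta> g h * \<xi> (g \<otimes> h))" by (simp only: elim \<xi>(2)[OF g h])
      also have "\<dots> = b (g \<otimes> h) Q" using \<zeta>0[OF g h] by (simp add: b_def field_simps)
      finally show ?case .
    qed
  qed
  then obtain w where w: "w \<in> Kx" "\<And>g. g \<in> carrier G \<Longrightarrow> \<forall>\<^sub>F Q in gen. b g Q * tw g w Q = w Q" by blast
  \<comment> \<open>By the choice of \<open>w\<close>, the group element g subtracts gD - D from the
    divisor of \<open>w\<close>, and this cancels what it adds to \<open>D\<close>.\<close>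
  have "divisor_action \<phi> g (dv w + D) = dv w + D" if g: "g \<in> carrier G" for g
  proof -
    have eq: "dv w = dv (b g) + dv (tw g w)"
      using dv_cong[OF w(2)[OF g]] dv_mult[OF bK[OF g] Kx_tw[OF g w(1)]] by simp
    have "divisor_action \<phi> g (dv w) = dv w - (divisor_action \<phi> g D - D)"
    proof -
      have "dv (tw g w) = dv w - dv (b g)" using eq by simp
      then show ?thesis unfolding divisor_action_dv[OF g w(1)] dvb[OF g] .
    qed
    moreover have "divisor_action \<phi> g (dv w + D) = divisor_action \<phi> g (dv w) + divisor_action \<phi> g D"
      by (simp add: divisor_action_def frag_extend_add)
    ultimately show ?thesis by simp
  qed
  moreover have "dv w + D \<in> degree_zero_divisors" using P.A.add_mem DA dv_subset w(1) by blast
  ultimately have "dv w + D \<in> carrier (invariants G (Div0 C) (divisor_action \<phi>))"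
    by (simp add: invariants_def Div0_eq)
  moreover have "dv w + D \<in> c" unfolding D(2) P.coset_eq using w(1) by blast
  ultimately show ?thesis by blast
qed

end

theorem theorem3p10:
  fixes C :: "('k::alg_closed_field, 'n::finite) pt set"
    and G :: "('g, 'a) monoid_scheme"
    and \<phi> :: "'g \<Rightarrow> ('k, 'n) pt \<Rightarrow> ('k, 'n) pt"
  assumes "nonsingular_projective_curve C"
    and "group G" and "finite (carrier G)"
    and "faithful_action G C \<phi>"
    and "\<forall>g\<in>carrier G. variety_automorphism C (\<phi> g)"
  shows "(invariants G (Pic0 C) (class_action \<phi>) Mod
            (divisor_class C ` carrier (invariants G (Div0 C) (divisor_action \<phi>))))
         \<cong> (cohomology G (Prin C) (divisor_action \<phi>) 1)
              \<lparr>carrier := kernel (cohomology G (Prin C) (divisor_action \<phi>) 1)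
                           (cohomology G (Div0 C) (divisor_action \<phi>) 1)
                           (cohomology_map G (Div0 C) (divisor_action \<phi>) 1 (\<lambda>D. D))\<rparr>
       \<and> (trivial_group (cohomology G (multiplicative_group :: 'k monoid) (\<lambda>g c. c) 2) \<longrightarrow>
            (\<forall>c\<in>carrier (invariants G (Pic0 C) (class_action \<phi>)).
               \<exists>D\<in>carrier (invariants G (Div0 C) (divisor_action \<phi>)). D \<in> c))"
proof -
  interpret curve_action C G \<phi>
    using assms by (simp add: curve_action_def curve_action_axioms_def nonsingular_curve_def)
  show ?thesis using class_group_iso_kernel invariant_class_representative by blast
qed

end
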